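(* Let $w$ be a word and let $u$ be a function defined on the cell $F_w(SG)$ (with all powers $\Delta^ju$ defined there) satisfying $$\|\Delta^ju\|_{L^\infty(F_w(SG))}=O(R^j)\ \text{for some } R<\lambda_2 .$$ Then $u$ has a unique extension to an entire analytic function on $SG$.
   Context: Let $q_0,q_1,q_2$ be the vertices of an equilateral triangle in the plane (indices mod 3), $F_i(x)=\frac12(x+q_i)$, and let $SG$ (Sierpinski gasket) be the unique nonempty compact set with $SG=\bigcup_{i=0}^2F_i(SG)$. For a word $w=(w_1,\dots,w_m)\in\{0,1,2\}^m$, $|w|=m$, put $F_w=F_{w_1}\circ\cdots\circ F_{w_m}$; $F_w(SG)$ is a cell of level $m$. $V_0=\{q_0,q_1,q_2\}$, $V_m=\bigcup_iF_i(V_{m-1})$, $V_*=\bigcup_mV_m$; for distinct $x,y\in V_m$, $x\sim_my$ means $x,y$ lie in a common cell of level $m$. Laplacian: $u\in\mathrm{dom}\,\Delta$ with $\Delta u=f$ means that $u,f$ are continuous on $SG$ and $\frac32 5^m\sum_{y\sim_mx}(u(y)-u(x))\to f(x)$ as $m\to\infty$, uniformly for $x\in V_*\setminus V_0$. Powers $\Delta^n$ and $\mathrm{dom}(\Delta^n)$ are defined iteratively. On a cell $F_w(SG)$, $\Delta u=f$ means $\Delta(u\circ F_w)=5^{-|w|}f\circ F_w$ on $SG$; powers are again iterated. Normal derivative: $\partial_nu(q_j)=\lim_{m\to\infty}(5/3)^m\big(2u(q_j)-u(F_j^mq_{j+1})-u(F_j^mq_{j-1})\big)$. Tangential derivative: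 $\partial_Tu(q_j)=\lim_{m\to\infty}5^m\big(u(F_j^mq_{j+1})-u(F_j^mq_{j-1})\big)$. $\mathcal H_j$ is the $(3j+3)$-dimensional space of solutions of $\Delta^{j+1}u=0$ on $SG$. The monomial $P^{(\ell)}_{jk}$ ($\ell=0,1,2$, $k=1,2,3$, $j\ge0$) is the unique function in $\mathcal H_j$ such that for all $0\le m\le j$: $\Delta^mP^{(\ell)}_{jk}(q_\ell)=\delta_{mj}\delta_{k1}$, $\partial_n\Delta^mP^{(\ell)}_{jk}(q_\ell)=\delta_{mj}\delta_{k2}$, $\partial_T\Delta^mP^{(\ell)}_{jk}(q_\ell)=\delta_{mj}\delta_{k3}$. A Neumann eigenvalue is a $\lambda$ for which there is a nonzero $u\in\mathrm{dom}\,\Delta$ with $-\Delta u=\lambda u$ and $\partial_nu(q_i)=0$ for $i=0,1,2$. $\lambda_2\approx135.572126995788$ denotes the second nonzero Neumann eigenvalue (distinct eigenvalues in increasing order, not counting multiplicity). An entire analytic function is a function on $SG$ given by a power series $\sum_{k=1}^3\sum_{j=0}^\infty c_{jk}P^{(\ell)}_{jk}(x)$ about a boundary point $q_\ell$ with $|c_{jk}|=O(R^j)$ for some $R<\lambda_2$, $k=1,2,3$. *)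

theory Defs
  imports "HOL-Analysis.Analysis" "HOL-Library.Landau_Symbols"
begin

text \<open>
  Vertices and letters are indexed by the three-element numeral type \<^typ>\<open>3\<close>, whose arithmetic is
  that of the integers modulo 3.  A real function on a set is represented by a function on the plane
  of which only the values on the set matter; where a function has to be singled out uniquely, the
  representative in \<^const>\<open>extensional\<close> is taken.
\<close>

type_synonym plane = "real ^ 2"

definition equilateral :: "(3 \<Rightarrow> plane) \<Rightarrow> bool" where
  "equilateral q \<longleftrightarrow> (\<exists>s>0. \<forall>i j. i \<noteq> j \<longrightarrow> dist (q i) (q j) = s)"

definition F :: "(3 \<Rightarrow> plane) \<Rightarrow> 3 \<Rightarrow> plane \<Rightarrow> plane" where
  "F q i x = (1 / 2) *\<^sub>R (x + q i)"

definition SG :: "(3 \<Rightarrow> plane) \<Rightarrow> plane set" where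
  "SG q = (THE K. compact K \<and> K \<noteq> {} \<and> K = (\<Union>i. F q i ` K))"

primrec Fw :: "(3 \<Rightarrow> plane) \<Rightarrow> 3 list \<Rightarrow> plane \<Rightarrow> plane" where
  "Fw q [] = id"
| "Fw q (i # w) = F q i \<circ> Fw q w"

definition cell :: "(3 \<Rightarrow> plane) \<Rightarrow> 3 list \<Rightarrow> plane set" where
  "cell q w = Fw q w ` SG q"

primrec V :: "(3 \<Rightarrow> plane) \<Rightarrow> nat \<Rightarrow> plane set" where
  "V q 0 = range q"
| "V q (Suc m) = (\<Union>i. F q i ` V q m)"

definition nbrs :: "(3 \<Rightarrow> plane) \<Rightarrow> nat \<Rightarrow> plane \<Rightarrow> plane set" where
  "nbrs q m x = {y \<in> V q m. y \<noteq> x \<and> (\<exists>w. length w = m \<and> x \<in> cell q w \<and> y \<in> cell q w)}"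

text \<open>
  \<open>\<Delta>u = f\<close> on the whole gasket.  The difference quotient of level \<open>m\<close> at \<open>x\<close> is meaningful only if
  \<open>x\<close> is a vertex of level \<open>m\<close>, so uniform convergence on the non-boundary vertices of all levels
  means that the threshold \<open>M\<close> does not depend on the vertex.
\<close>

definition has_laplacian_SG :: "(3 \<Rightarrow> plane) \<Rightarrow> (plane \<Rightarrow> real) \<Rightarrow> (plane \<Rightarrow> real) \<Rightarrow> bool" where
  "has_laplacian_SG q u f \<longleftrightarrow>
     continuous_on (SG q) u \<and> continuous_on (SG q) f \<and>
     (\<forall>\<epsilon>>0. \<exists>M. \<forall>m\<ge>M. \<forall>x \<in> V q m - V q 0.
        \<bar>3 / 2 * 5 ^ m * (\<Sum>y \<in> nbrs q m x. u y - u x) - f x\<bar> < \<epsilon>)"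

definition has_laplacian ::
  "(3 \<Rightarrow> plane) \<Rightarrow> 3 list \<Rightarrow> (plane \<Rightarrow> real) \<Rightarrow> (plane \<Rightarrow> real) \<Rightarrow> bool" where
  "has_laplacian q w u f \<longleftrightarrow>
     has_laplacian_SG q (u \<circ> Fw q w) (\<lambda>x. f (Fw q w x) / 5 ^ length w)"

text \<open>The word \<open>w\<close> is the cell on which the operator acts; the empty word gives the whole gasket.\<close>

definition laplacian :: "(3 \<Rightarrow> plane) \<Rightarrow> 3 list \<Rightarrow> (plane \<Rightarrow> real) \<Rightarrow> plane \<Rightarrow> real" where
  "laplacian q w u = (THE f. f \<in> extensional (cell q w) \<and> has_laplacian q w u f)"

abbreviation laplacian_pow ::
  "(3 \<Rightarrow> plane) \<Rightarrow> 3 list \<Rightarrow> nat \<Rightarrow> (plane \<Rightarrow> real) \<Rightarrow> plane \<Rightarrow> real" where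
  "laplacian_pow q w n u \<equiv> (laplacian q w ^^ n) u"

definition laplacian_dom :: "(3 \<Rightarrow> plane) \<Rightarrow> 3 list \<Rightarrow> nat \<Rightarrow> (plane \<Rightarrow> real) set" where
  "laplacian_dom q w n = {u. \<forall>m<n. \<exists>f. has_laplacian q w (laplacian_pow q w m u) f}"

definition has_normal_deriv ::
  "(3 \<Rightarrow> plane) \<Rightarrow> (plane \<Rightarrow> real) \<Rightarrow> 3 \<Rightarrow> real \<Rightarrow> bool" where
  "has_normal_deriv q u j d \<longleftrightarrow>
     (\<lambda>m. (5 / 3) ^ m *
        (2 * u (q j) - u ((F q j ^^ m) (q (j + 1))) - u ((F q j ^^ m) (q (j - 1)))))
     \<longlonglongrightarrow> d"

definition has_tangential_deriv ::
  "(3 \<Rightarrow> plane) \<Rightarrow> (plane \<Rightarrow> real) \<Rightarrow> 3 \<Rightarrow> real \<Rightarrow> bool" where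
  "has_tangential_deriv q u j d \<longleftrightarrow>
     (\<lambda>m. 5 ^ m * (u ((F q j ^^ m) (q (j + 1))) - u ((F q j ^^ m) (q (j - 1))))) \<longlonglongrightarrow> d"

definition polyharmonic :: "(3 \<Rightarrow> plane) \<Rightarrow> nat \<Rightarrow> (plane \<Rightarrow> real) set" where
  "polyharmonic q j = {u \<in> extensional (SG q) \<inter> laplacian_dom q [] (j + 1).
     \<forall>x \<in> SG q. laplacian_pow q [] (j + 1) u x = 0}"

definition monomial :: "(3 \<Rightarrow> plane) \<Rightarrow> 3 \<Rightarrow> nat \<Rightarrow> nat \<Rightarrow> plane \<Rightarrow> real" where
  "monomial q l j k = (THE P. P \<in> polyharmonic q j \<and> (\<forall>m\<le>j.
     laplacian_pow q [] m P (q l) = of_bool (m = j \<and> k = 1) \<and>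
     has_normal_deriv q (laplacian_pow q [] m P) l (of_bool (m = j \<and> k = 2)) \<and>
     has_tangential_deriv q (laplacian_pow q [] m P) l (of_bool (m = j \<and> k = 3))))"

definition neumann_eigenvalue :: "(3 \<Rightarrow> plane) \<Rightarrow> real \<Rightarrow> bool" where
  "neumann_eigenvalue q a \<longleftrightarrow>
     (\<exists>u. (\<exists>x \<in> SG q. u x \<noteq> 0) \<and> has_laplacian q [] u (\<lambda>x. - a * u x) \<and>
          (\<forall>i. has_normal_deriv q u i 0))"

text \<open>A cardinality of one forces exactly one smaller nonzero eigenvalue, since infinite sets have
  cardinality zero.\<close>

definition lambda2 :: "(3 \<Rightarrow> plane) \<Rightarrow> real" where
  "lambda2 q = (THE a. neumann_eigenvalue q a \<and> a \<noteq> 0 \<and>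
     card {b. neumann_eigenvalue q b \<and> b \<noteq> 0 \<and> b < a} = 1)"

text \<open>The condition \<open>0 \<le> R\<close> is needed because \<open>O(R\<^sup>j)\<close> only sees \<open>\<bar>R\<bar>\<close>.\<close>

definition entire_analytic :: "(3 \<Rightarrow> plane) \<Rightarrow> (plane \<Rightarrow> real) \<Rightarrow> bool" where
  "entire_analytic q v \<longleftrightarrow> v \<in> extensional (SG q) \<and>
     (\<exists>l c R. 0 \<le> R \<and> R < lambda2 q \<and>
        (\<forall>k \<in> {1..3}. (\<lambda>j. c j k) \<in> O(\<lambda>j. R ^ j)) \<and>
        (\<forall>x \<in> SG q.
           (\<forall>k \<in> {1..3}. summable (\<lambda>j. c j k * monomial q l j k x)) \<and>
           v x = (\<Sum>k = 1..3. \<Sum>j. c j k * monomial q l j k x)))"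

end

theory Submission
  imports Defs "HOL-Complex_Analysis.Complex_Analysis"
begin

text \<open>
  Multiply the Laplacian by \<open>-2/3\<close> and collect the values of all its powers at a point \<open>x\<close> into a bounded
  sequence \<open>G x\<close>, with the \<open>j\<close>-th entry divided by \<open>r\<^sup>j\<close>.  The Laplacian then acts on \<open>G\<close> as \<open>r\<close> times the shift, and spectral
  decimation for eigenfunctions becomes an operator identity: the graph Laplacian of level \<open>n\<close> maps \<open>G\<close> to \<open>K G\<close>, where \<open>K\<close> is the entire
  function \<open>decim\<close>, given by \<open>m (5 z) = m z (5 - m z)\<close> and \<open>m z = z + \<dots>\<close>, evaluated at \<open>r / 5\<^sup>n\<close> times the shift.  All steps of the
  argument are finite linear algebra over the operators \<open>K\<close>; they need that \<open>v - K\<close> is invertible for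
  \<open>v \<ge> 3\<close>, which holds while \<open>r / 5\<^sup>n\<close> is below the least positive \<open>z\<close> with \<open>m z = 3\<close>, and that \<open>2 - K\<close> is invertible
  one level deeper.  A solution on a cell of level one is
  extended to the gasket by solving the equations of level two, so \<open>r\<close> may be anything below 25 times that number, and this bound is
  exactly the second Neumann eigenvalue in the scale of \<open>z\<close>.  The same extension step, iterated from tiny cells
  at a corner, where the jet equations are solved by infinite products, gives a function for every bounded
  sequence of jets; this bounds the monomials and identifies entire analytic functions with the
  solutions \<open>G\<close>.
\<close>

text \<open>The identity behind everything compares \<open>6 - K\<close> on a residual of one level
  with \<open>(2 - K) (5 - K)\<close> on residuals of the next; 2, 5 and 6 are the exceptional
  values of decimation on the gasket. Equations pass to coarser levels when \<open>6 - K\<close> can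
  be inverted, and to finer ones when \<open>2 - K\<close> and \<open>5 - K\<close> can.
  Invertibility of \<open>v - K\<close> is decided by the complex zeros of \<open>v - m\<close>, and
  for v between 0 and 25/4 these are nonnegative reals, so only the behaviour of m on the half-line
  matters. There 5 and 6 lie beyond 3, but 2 is passed before 3. This is the obstacle: at level two,
  with r close to its bound, \<open>2 - K\<close> need not be invertible, so the unknown junction of
  an extension cannot be found by dividing by it. Its formula has to be rewritten until only
  \<open>3 - K\<close> is left. The number 3 is also the least nonzero Neumann eigenvalue of the
  graph of level one, which is why the resulting bound on r is an eigenvalue. The growth condition
  is used twice: it makes the sequences bounded, and its strictness makes their entries decay
  geometrically, so that the limits defining the powers of the Laplacian become uniform in the
  power.\<close>

definition dilate :: "'a::comm_ring_1 \<Rightarrow> 'a fps \<Rightarrow> 'a fps" where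
  "dilate c f = Abs_fps (\<lambda>k. c ^ k * fps_nth f k)"

lemma dilate_nth [simp]: "fps_nth (dilate c f) k = c ^ k * fps_nth f k"
  by (simp add: dilate_def)

lemma dilate_mult: "dilate c (f * g) = dilate c f * dilate c g"
proof (rule fps_ext)
  fix n
  have "c ^ i * c ^ (n - i) = c ^ n" if "i \<le> n" for i
    using that by (simp flip: power_add)
  then have "c ^ i * fps_nth f i * (c ^ (n - i) * fps_nth g (n - i)) = c ^ n * (fps_nth f i * fps_nth g (n - i))"
    if "i \<le> n" for i
    using that by (metis (no_types, lifting) mult.assoc mult.left_commute)
  then show "fps_nth (dilate c (f * g)) n = fps_nth (dilate c f * dilate c g) n"
    by (auto simp: fps_mult_nth sum_distrib_left intro!: sum.cong)
qed

lemma dilate_simps [simp]: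
  "dilate c (f + g) = dilate c f + dilate c g"
  "dilate c (f - g) = dilate c f - dilate c g"
  "dilate c (fps_const a) = fps_const a"
  by (auto simp: fps_eq_iff algebra_simps)

lemma conv_radius_dilate:
  fixes f :: "'a::{banach,real_normed_field} fps"
  assumes "c \<noteq> 0"
  shows "fps_conv_radius (dilate c f) = fps_conv_radius f / ereal (norm c)"
  using assms by (simp add: fps_conv_radius_def conv_radius_mult_power)

lemma conv_radius_bounded_coeffs:
  fixes f :: "'a::{banach,real_normed_field} fps"
  assumes "0 < C" "\<And>k. norm (fps_nth f k) \<le> C ^ k"
  shows "fps_conv_radius f \<ge> ereal (1 / C)"
  unfolding fps_conv_radius_def
proof (rule conv_radius_geI_ex)
  fix \<rho> :: real assume \<rho>: "0 < \<rho>" "ereal \<rho> < ereal (1 / C)"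
  have "summable (\<lambda>n. fps_nth f n * of_real \<rho> ^ n)"
  proof (rule summable_comparison_test')
    show "summable (\<lambda>n. (C * \<rho>) ^ n)"
      using \<rho> assms(1) by (intro summable_geometric) (auto simp: field_simps)
    show "norm (fps_nth f n * of_real \<rho> ^ n) \<le> (C * \<rho>) ^ n" if "n \<ge> 0" for n
      using assms(2)[of n] \<rho> by (auto simp: norm_mult norm_power power_mult_distrib mult_right_mono)
  qed
  then show "\<exists>z. norm z = \<rho> \<and> summable (\<lambda>n. fps_nth f n * z ^ n)"
    using \<rho> by (intro exI[of _ "of_real \<rho>"]) auto
qed

section \<open>The decimation function\<close>

text \<open>Comparing the coefficients of z^k in m (5 z) = 5 m z - (m z)^2 gives
  \<open>(5 ^ k - 5) * dcoeff k\<close> as minus the convolution sum. At k = 1 this equation is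
  void, so the linear coefficient is a normalization; the value 1 makes m agree with its argument to
  first order.\<close>

fun dcoeff :: "nat \<Rightarrow> real" where
  "dcoeff k = (if k = 0 then 0 else if k = 1 then 1
     else - (\<Sum>i\<in>{1..<k}. dcoeff i * dcoeff (k - i)) / (5 ^ k - 5))"

declare dcoeff.simps [simp del]

lemma dcoeff_0 [simp]: "dcoeff 0 = 0" and dcoeff_1 [simp]: "dcoeff 1 = 1" "dcoeff (Suc 0) = 1"
  by (simp_all add: dcoeff.simps)

definition decim :: "real fps" where "decim = Abs_fps dcoeff"

lemma decim_nth [simp]: "fps_nth decim k = dcoeff k"
  by (simp add: decim_def)

text \<open>Fewer than k products of size at most 1 are divided by \<open>5 ^ k - 5\<close>, which
  is at least k for k \<ge> 2. This only yields convergence in the unit disk; the functional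
  equation does the rest.\<close>

lemma abs_dcoeff_le: "\<bar>dcoeff k\<bar> \<le> 1"
proof (induction k rule: less_induct)
  case (less k)
  show ?case
  proof (cases "k < 2")
    case True
    then have "k = 0 \<or> k = 1" by auto
    then show ?thesis by auto
  next
    case False
    have pw: "real k + 5 \<le> 5 ^ k" if "k \<ge> 2" for k
      using that by (induction k rule: dec_induct) (auto simp: power2_eq_square)
    have "\<bar>\<Sum>i\<in>{1..<k}. dcoeff i * dcoeff (k - i)\<bar> \<le> (\<Sum>i\<in>{1..<k}. 1)"
    proof (rule order_trans[OF sum_abs sum_mono])
      fix i assume "i \<in> {1..<k}"
      then show "\<bar>dcoeff i * dcoeff (k - i)\<bar> \<le> 1"
        using less[of i] less[of "k - i"] by (auto simp: abs_mult intro: mult_le_one)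
    qed
    also have "\<dots> \<le> 5 ^ k - 5" using pw[of k] False by auto
    finally show ?thesis
      using False pw[of k] by (subst dcoeff.simps) (auto simp: abs_divide divide_le_eq)
  qed
qed

text \<open>The coefficients of \<open>decim\<close> are the only ones with linear coefficient 1 that satisfy this equation.\<close>

lemma decim_eq: "decim = 5 * dilate (1/5) decim - dilate (1/5) decim * dilate (1/5) decim"
proof (rule fps_ext)
  fix k
  have "(\<Sum>i=0..k. dcoeff i * dcoeff (k - i)) = (\<Sum>i\<in>{1..<k}. dcoeff i * dcoeff (k - i))"
  proof (rule sum.mono_neutral_right)
    show "\<forall>i\<in>{0..k} - {1..<k}. dcoeff i * dcoeff (k - i) = 0"
    proof
      fix i assume "i \<in> {0..k} - {1..<k}"
      then have "i = 0 \<or> i = k" by auto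
      then show "dcoeff i * dcoeff (k - i) = 0" by auto
    qed
  qed auto
  moreover have "fps_nth (dilate (1/5) decim * dilate (1/5) decim) k
      = (1/5) ^ k * (\<Sum>i=0..k. dcoeff i * dcoeff (k - i))"
    by (simp add: dilate_mult [symmetric] fps_mult_nth)
  moreover have "dcoeff k = 5 * ((1/5) ^ k * dcoeff k) - (1/5) ^ k * (\<Sum>i\<in>{1..<k}. dcoeff i * dcoeff (k - i))"
  proof -
    consider "k = 0" | "k = 1" | "k \<ge> 2" by linarith
    then show ?thesis
    proof cases
      case 3
      then have "(5::real) ^ 2 \<le> 5 ^ k" by (intro power_increasing) auto
      then have *: "(5::real) ^ k - 5 \<noteq> 0" "(5::real)^k \<noteq> 0" by auto
      define S where "S = (\<Sum>i\<in>{1..<k}. dcoeff i * dcoeff (k - i))"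
      have "dcoeff k = - S / (5 ^ k - 5)"
        unfolding S_def using 3 by (subst dcoeff.simps) auto
      then have "dcoeff k * (5 ^ k - 5) = - S" using * by (simp add: field_simps)
      then show ?thesis using * unfolding S_def[symmetric]
        by (simp add: field_simps power_divide)
    qed (auto)
  qed
  ultimately show "fps_nth decim k = fps_nth (5 * dilate (1/5) decim - dilate (1/5) decim * dilate (1/5) decim) k"
    by simp
qed

text \<open>All coefficients are real, but the radius of convergence of a reciprocal is governed by
  complex zeros, so the series have to be evaluated on the complex plane.\<close>

definition cfps :: "real fps \<Rightarrow> complex fps" where
  "cfps f = Abs_fps (\<lambda>k. complex_of_real (fps_nth f k))"

lemma cfps_nth [simp]: "fps_nth (cfps f) k = complex_of_real (fps_nth f k)"
  by (simp add: cfps_def)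

lemma cfps_simps: "cfps (f * g) = cfps f * cfps g" "cfps (f + g) = cfps f + cfps g"
  "cfps (f - g) = cfps f - cfps g" "cfps (fps_const a) = fps_const (complex_of_real a)"
  "cfps 1 = 1" "cfps 0 = 0"
  by (auto simp: fps_eq_iff fps_mult_nth)

lemma conv_radius_cfps: "fps_conv_radius (cfps f) = fps_conv_radius f"
proof -
  have "fps_conv_radius (cfps f) = conv_radius (\<lambda>n. norm (complex_of_real (fps_nth f n)))"
    unfolding fps_conv_radius_def by (subst conv_radius_norm) simp
  also have "\<dots> = conv_radius (\<lambda>n. norm (fps_nth f n))"
    by simp
  finally show ?thesis unfolding fps_conv_radius_def conv_radius_norm .
qed

lemma cfps_dilate: "cfps (dilate c f) = dilate (complex_of_real c) (cfps f)"
  by (rule fps_ext) simp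

text \<open>The functional equation writes \<open>decim\<close> as a polynomial in its dilation by
  1/5, whose radius is five times as large. A radius that is at least 1 and at least five times
  itself is infinite.\<close>

lemma conv_radius_decim: "fps_conv_radius decim = \<infinity>"
proof -
  have "fps_conv_radius decim \<ge> ereal (1 / 1)"
    by (rule conv_radius_bounded_coeffs) (auto simp: abs_dcoeff_le)
  moreover have "fps_conv_radius decim \<ge> fps_conv_radius (dilate (1/5) decim)"
  proof -
    let ?r = "fps_conv_radius (dilate (1/5) decim)"
    have "fps_conv_radius (5 * dilate (1/5) decim) \<ge> ?r"
      by (rule order_trans[OF _ fps_conv_radius_mult]) auto
    moreover have "fps_conv_radius (dilate (1/5) decim * dilate (1/5) decim) \<ge> ?r"
      by (rule order_trans[OF _ fps_conv_radius_mult]) auto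
    ultimately show ?thesis
      by (subst decim_eq) (rule order_trans[OF _ fps_conv_radius_diff], auto)
  qed
  ultimately show ?thesis
    by (cases "fps_conv_radius decim") (auto simp: conv_radius_dilate)
qed

section \<open>The decimation function on the complex plane and on the real line\<close>

definition dfun :: "complex \<Rightarrow> complex" where
  "dfun = eval_fps (cfps decim)"

lemma eval_dilate:
  fixes f :: "'a::{banach,real_normed_field} fps"
  shows "eval_fps (dilate c f) z = eval_fps f (c * z)"
  by (simp add: eval_fps_def power_mult_distrib mult_ac)

lemma conv_radius_cdecim: "fps_conv_radius (cfps decim) = \<infinity>"
  by (simp add: conv_radius_cfps conv_radius_decim)

lemma dfun_eq: "dfun z = dfun (z / 5) * (5 - dfun (z / 5))"
proof -
  let ?d = "dilate (1/5) (cfps decim)"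
  have r: "fps_conv_radius ?d = \<infinity>" by (simp add: conv_radius_dilate conv_radius_cdecim)
  have r5: "fps_conv_radius (5 * ?d) = \<infinity>" "fps_conv_radius (?d * ?d) = \<infinity>"
    using fps_conv_radius_mult[of 5 ?d] fps_conv_radius_mult[of ?d ?d] r by auto
  have "cfps decim = 5 * ?d - ?d * ?d"
    using arg_cong[OF decim_eq, of cfps] cfps_simps(4)[of 5]
    by (simp add: cfps_simps cfps_dilate numeral_fps_const)
  then have "dfun z = eval_fps (5 * ?d - ?d * ?d) z"
    unfolding dfun_def by simp
  also have "\<dots> = 5 * dfun (z/5) - dfun (z/5) * dfun (z/5)"
    by (simp add: eval_fps_diff eval_fps_mult r r5 eval_dilate dfun_def)
  finally show ?thesis by (simp add: algebra_simps)
qed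

lemma dfun_0 [simp]: "dfun 0 = 0"
  by (simp add: dfun_def eval_fps_at_0)

lemma dfun_holomorphic: "dfun holomorphic_on A"
  unfolding dfun_def by (intro holomorphic_on_eval_fps) (auto simp: conv_radius_cdecim)

lemma deriv_dfun_0: "deriv dfun 0 = 1"
  unfolding dfun_def
  by (simp add: eval_fps_deriv[symmetric] conv_radius_cdecim eval_fps_at_0)

lemma dfun_sums: "(\<lambda>n. complex_of_real (dcoeff n) * z ^ n) sums dfun z"
  using sums_eval_fps[of z "cfps decim"] by (simp add: dfun_def conv_radius_cdecim)

lemma cnj_dfun: "dfun (cnj z) = cnj (dfun z)"
proof -
  have "(\<lambda>n. cnj (complex_of_real (dcoeff n) * z ^ n)) sums cnj (dfun z)"
    by (subst sums_cnj) (rule dfun_sums)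
  then show ?thesis using sums_unique2[OF dfun_sums[of "cnj z"]] by simp
qed

definition rfun :: "real \<Rightarrow> real" where "rfun t = Re (dfun (of_real t))"

lemma dfun_of_real: "dfun (of_real t) = of_real (rfun t)"
proof -
  have "cnj (dfun (of_real t)) = dfun (of_real t)"
    using cnj_dfun[of "of_real t"] by simp
  then show ?thesis unfolding rfun_def
    by (metis Reals_cnj_iff of_real_Re)
qed

lemma rfun_eq: "rfun t = rfun (t / 5) * (5 - rfun (t / 5))"
proof -
  have "complex_of_real (rfun t) = of_real (rfun (t / 5) * (5 - rfun (t / 5)))"
    using dfun_eq[of "of_real t"] dfun_of_real[of "t/5"] by (simp add: dfun_of_real)
  then show ?thesis by (rule of_real_eq_iff[THEN iffD1])
qed

lemma rfun_0 [simp]: "rfun 0 = 0" by (simp add: rfun_def)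

lemma rfun_sums: "(\<lambda>n. dcoeff n * t ^ n) sums rfun t"
proof -
  have "(\<lambda>n. complex_of_real (dcoeff n * t ^ n)) sums of_real (rfun t)"
    using dfun_sums[of "of_real t"] by (simp add: dfun_of_real)
  then show ?thesis by (simp only: sums_of_real_iff)
qed

lemma continuous_rfun: "continuous_on A rfun"
proof -
  have "continuous_on A (\<lambda>t. dfun (complex_of_real t))"
    by (rule continuous_on_compose2[OF holomorphic_on_imp_continuous_on[OF dfun_holomorphic[of UNIV]]])
      (auto intro!: continuous_intros)
  then show ?thesis unfolding rfun_def by (intro continuous_intros)
qed

text \<open>The derivative at 0 is 1. Since the functional equation divides arguments by 5, every
  argument reaches this ball after finitely many steps, so the local statement decides global
  questions.\<close>

lemma local_injectivity:
  obtains d where "0 < d" "inj_on dfun (ball 0 d)" "\<And>t. 0 < t \<Longrightarrow> t < d \<Longrightarrow> 0 < rfun t"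
    "\<And>t. -d < t \<Longrightarrow> t < 0 \<Longrightarrow> rfun t < 0"
proof -
  obtain e where e: "0 < e" "inj_on dfun (ball 0 e)"
    using has_complex_derivative_locally_injective[OF dfun_holomorphic[of UNIV], of 0] deriv_dfun_0
    by auto
  have "(dfun has_field_derivative 1) (at 0)"
    using holomorphic_derivI[OF dfun_holomorphic[of UNIV], of 0] deriv_dfun_0 by simp
  then have "((\<lambda>t. dfun (of_real t)) has_vector_derivative 1 * 1) (at 0)"
    using field_vector_diff_chain_at[of complex_of_real 1 0 dfun 1]
    by (simp add: o_def has_vector_derivative_real_field)
  then have "((\<lambda>t. Re (dfun (of_real t))) has_vector_derivative Re 1) (at 0)"
    unfolding has_vector_derivative_def by (drule_tac bounded_linear.has_derivative[OF bounded_linear_Re]) simp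
  then have D: "(rfun has_real_derivative 1) (at 0)"
    by (simp add: rfun_def[abs_def] has_real_derivative_iff_has_vector_derivative)
  obtain d1 where d1: "0 < d1" "\<And>h. 0 < h \<Longrightarrow> h < d1 \<Longrightarrow> rfun 0 < rfun (0 + h)"
    using DERIV_pos_inc_right[OF D] by auto
  obtain d2 where d2: "0 < d2" "\<And>h. 0 < h \<Longrightarrow> h < d2 \<Longrightarrow> rfun (0 - h) < rfun 0"
    using DERIV_pos_inc_left[OF D] by auto
  show ?thesis
  proof (rule that[of "min e (min d1 d2)"])
    show "0 < min e (min d1 d2)" using e d1 d2 by auto
    show "inj_on dfun (ball 0 (min e (min d1 d2)))" by (rule inj_on_subset[OF e(2)]) auto
    show "0 < rfun t" if "0 < t" "t < min e (min d1 d2)" for t using d1(2)[of t] that by simp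
    show "rfun t < 0" if "- min e (min d1 d2) < t" "t < 0" for t using d2(2)[of "-t"] that by simp
  qed
qed

text \<open>The preimages of \<open>[0, 25/4]\<close> under \<open>x \<mapsto> x (5 - x)\<close> lie in \<open>[0, 5]\<close>; so a point with a value in
  that interval can be divided by 5 until it is in the domain of injectivity around 0.\<close>

lemma dfun_real_imp:
  assumes "dfun z = of_real v" "0 \<le> v" "v \<le> 25/4"
  shows "\<exists>t\<ge>0. z = of_real t"
proof -
  have step: "\<exists>v'. dfun (z / 5) = of_real v' \<and> 0 \<le> v' \<and> v' \<le> 25/4"
    if "dfun z = of_real v" "0 \<le> v" "v \<le> 25/4" for z v
  proof -
    define s where "s = sqrt (25/4 - v)"
    have s: "s\<^sup>2 = 25/4 - v" "0 \<le> s" using that by (auto simp: s_def)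
    have s5: "s \<le> 5/2" unfolding s_def by (rule real_le_lsqrt) (use that in \<open>auto simp: power2_eq_square\<close>)
    have "complex_of_real v = of_real (25/4 - s\<^sup>2)" using s by simp
    then have cs: "complex_of_real s * of_real s = 25/4 - of_real v"
      by (simp add: power2_eq_square)
    have cd: "dfun (z/5) * dfun (z/5) = 5 * dfun (z/5) - of_real v"
      using dfun_eq[of z] that(1) by (simp add: algebra_simps)
    have "(dfun (z/5) - of_real (5/2 + s)) * (dfun (z/5) - of_real (5/2 - s)) 
        = dfun (z/5) * dfun (z/5) - 5 * dfun (z/5) + 25/4 - of_real s * of_real s"
      by (simp add: algebra_simps)
    then have "(dfun (z/5) - of_real (5/2 + s)) * (dfun (z/5) - of_real (5/2 - s)) = 0"
      unfolding cs cd by simp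
    then have "dfun (z/5) = of_real (5/2 + s) \<or> dfun (z/5) = of_real (5/2 - s)" by auto
    then show ?thesis
    proof
      assume *: "dfun (z/5) = of_real (5/2 + s)"
      show ?thesis by (intro exI[of _ "5/2 + s"]) (use * s s5 in auto)
    next
      assume *: "dfun (z/5) = of_real (5/2 - s)"
      show ?thesis by (intro exI[of _ "5/2 - s"]) (use * s s5 in auto)
    qed
  qed
  have "\<exists>v'. dfun (z / 5 ^ n) = of_real v' \<and> 0 \<le> v' \<and> v' \<le> 25/4" for n
  proof (induction n)
    case 0 then show ?case using assms by auto
  next
    case (Suc n)
    then obtain v' where v': "dfun (z / 5 ^ n) = of_real v'" "0 \<le> v'" "v' \<le> 25/4" by blast
    show ?case using step[OF v'] by (simp add: mult.commute)
  qed
  obtain d where d: "0 < d" "inj_on dfun (ball 0 d)"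
    "\<And>t. -d < t \<Longrightarrow> t < 0 \<Longrightarrow> rfun t < 0"
    using local_injectivity by metis
  have "(\<lambda>n. norm z * (1/5) ^ n) \<longlonglongrightarrow> norm z * 0"
    by (intro tendsto_intros LIMSEQ_realpow_zero) auto
  then have "\<forall>\<^sub>F n in sequentially. norm z * (1/5) ^ n < d"
    using d(1) by (intro order_tendstoD(2)) auto
  then obtain n where n: "norm z * (1/5) ^ n < d" by (auto simp: eventually_sequentially)
  define y where "y = z / 5 ^ n"
  have y: "norm y < d" using n by (simp add: y_def norm_divide norm_power power_divide)
  obtain v' where v': "dfun y = of_real v'" "0 \<le> v'"
    using \<open>\<And>n. \<exists>v'. dfun (z / 5 ^ n) = of_real v' \<and> 0 \<le> v' \<and> v' \<le> 25/4\<close> y_def by blast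
  \<comment> \<open>The value at \<open>y\<close> is real, so \<open>cnj y\<close> has the same
    value and injectivity makes \<open>y\<close> real. It is nonnegative because m is negative at
    small negative reals.\<close>
  have "dfun (cnj y) = dfun y" using v' by (simp add: cnj_dfun)
  then have "cnj y = y" using d(2) y by (auto simp: inj_on_def)
  then obtain t where t: "y = of_real t" by (metis Reals_cases Reals_cnj_iff)
  have "rfun t = v'" using v' dfun_of_real[of t] t by simp
  then have "t \<ge> 0" using d(3)[of t] v' y t by force
  moreover have "z = of_real (5 ^ n * t)" using t by (simp add: y_def field_simps)
  ultimately show ?thesis by (intro exI[of _ "5 ^ n * t"]) auto
qed

text \<open>If m stayed below 3 on the positive half-line, each multiplication of the argument by 5
  would multiply the value by \<open>5 - m\<close>, hence by more than 2, and the values would be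
  unbounded.\<close>

lemma exists_rfun_ge_3: "\<exists>t>0. rfun t \<ge> 3"
proof (rule ccontr)
  assume "\<not> ?thesis"
  then have lt: "rfun t < 3" if "t > 0" for t using that by force
  obtain d where d: "0 < d" "\<And>t. 0 < t \<Longrightarrow> t < d \<Longrightarrow> 0 < rfun t" using local_injectivity by metis
  define t where "t = d / 2"
  have t: "0 < t" "0 < rfun t" using d by (auto simp: t_def)
  have "rfun (5 ^ n * t) \<ge> 2 ^ n * rfun t" for n
  proof (induction n)
    case (Suc n)
    let ?x = "rfun (5 ^ n * t)"
    have x: "0 < ?x" using Suc t by (meson less_le_trans mult_pos_pos zero_less_numeral zero_less_power)
    have "rfun (5 ^ Suc n * t) = ?x * (5 - ?x)" by (subst rfun_eq) simp
    also have "\<dots> \<ge> ?x * 2" using x lt[of "5^n*t"] t by (intro mult_left_mono) auto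
    finally show ?case using Suc by simp
  qed simp
  moreover obtain n where "3 / rfun t < 2 ^ n" using real_arch_pow[of 2] by auto
  then have "3 < 2 ^ n * rfun t" using t by (simp add: field_simps)
  ultimately have "3 < rfun (5 ^ n * t)" by (meson less_le_trans)
  then show False using lt[of "5^n*t"] t by auto
qed

section \<open>The ranges on which the decimation function stays below 3 and below 2\<close>

definition rad3 :: real where "rad3 = Inf {t. 0 \<le> t \<and> rfun t = 3}"

lemma rad3: "0 < rad3" "rfun rad3 = 3" "\<And>t. 0 \<le> t \<Longrightarrow> t < rad3 \<Longrightarrow> rfun t < 3"
proof -
  let ?A = "{t. 0 \<le> t \<and> rfun t = 3}"
  obtain t where t: "t > 0" "rfun t \<ge> 3" using exists_rfun_ge_3 by auto
  then obtain s where "0 \<le> s" "rfun s = 3"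
    using IVT'[of rfun 0 3 t] continuous_rfun by auto
  then have ne: "?A \<noteq> {}" by auto
  have bb: "bdd_below ?A" by (auto intro: bdd_belowI[of _ 0])
  have "closed (({0..}) \<inter> rfun -` {3})"
    by (intro continuous_closed_preimage continuous_rfun) auto
  then have "closed ?A" by (simp add: vimage_def Int_def)
  then have mem: "rad3 \<in> ?A" unfolding rad3_def by (rule closed_contains_Inf[OF ne bb])
  then show "rfun rad3 = 3" by auto
  then have "rad3 \<noteq> 0" using rfun_0 by auto
  then show "0 < rad3" using mem by auto
  fix t assume t: "0 \<le> t" "t < rad3"
  show "rfun t < 3"
  proof (rule ccontr)
    assume "\<not> ?thesis"
    then obtain s where "0 \<le> s" "s \<le> t" "rfun s = 3"
      using IVT'[of rfun 0 3 t] continuous_rfun t by auto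
    then have "rad3 \<le> s" unfolding rad3_def by (intro cInf_lower bb) auto
    then show False using \<open>s \<le> t\<close> t by auto
  qed
qed

text \<open>A point \<open>s\<close> with value 2 would give the value 2 (5 - 2) = 6 at
  \<open>5 * s\<close>, although values up to \<open>rad3\<close> do not exceed 3.\<close>

lemma rfun_lt_2: "0 \<le> t \<Longrightarrow> t \<le> rad3 / 5 \<Longrightarrow> rfun t < 2"
proof (rule ccontr)
  assume t: "0 \<le> t" "t \<le> rad3 / 5" and "\<not> rfun t < 2"
  then obtain s where s: "0 \<le> s" "s \<le> t" "rfun s = 2"
    using IVT'[of rfun 0 2 t] continuous_rfun by auto
  have "rfun (5 * s) = 6" using rfun_eq[of "5 * s"] s by simp
  moreover have "5 * s \<le> rad3" using s t by auto
  moreover have "rfun (5 * s) \<le> 3"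
    using rad3(2) rad3(3)[of "5 * s"] s \<open>5 * s \<le> rad3\<close>
    by (metis less_eq_real_def mult_nonneg_nonneg order_refl zero_le_numeral)
  ultimately show False by linarith
qed

text \<open>The inequality m < 2 holds up to and including \<open>rad3 / 5\<close>, so by continuity
  a little beyond. The slack matters for the Neumann eigenfunctions with graph eigenvalue 3, whose
  refinement starts with the parameter exactly equal to \<open>rad3 / 5\<close>.\<close>

lemma exists_rad2: "\<exists>c>rad3 / 5. c < rad3 \<and> (\<forall>t. 0 \<le> t \<longrightarrow> t < c \<longrightarrow> rfun t < 2)"
proof -
  have "isCont rfun (rad3/5)" using continuous_rfun[of UNIV] by (simp add: continuous_on_eq_continuous_at)
  then have "\<forall>\<^sub>F t in at (rad3/5). rfun t < 2"
    using rfun_lt_2[of "rad3/5"] rad3(1) by (intro order_tendstoD(2)[of rfun "rfun (rad3/5)"]) (auto simp: isCont_def)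
  then obtain d where d: "d > 0" "\<And>t. t \<noteq> rad3/5 \<Longrightarrow> dist t (rad3/5) < d \<Longrightarrow> rfun t < 2"
    by (auto simp: eventually_at)
  define c where "c = rad3/5 + min d (rad3/2)"
  have c: "c > rad3/5" "c < rad3" "c \<le> rad3/5 + d" using d(1) rad3(1) by (auto simp: c_def min_def)
  have "rfun t < 2" if "0 \<le> t" "t < c" for t
  proof (cases "t \<le> rad3/5")
    case True then show ?thesis using rfun_lt_2 that by auto
  next
    case False then show ?thesis using that c by (intro d(2)) (auto simp: dist_real_def)
  qed
  then show ?thesis using c(1,2) by (intro exI[of _ c] conjI allI impI)
qed

definition rad2 :: real where
  "rad2 = (SOME c. rad3 / 5 < c \<and> c < rad3 \<and> (\<forall>t. 0 \<le> t \<longrightarrow> t < c \<longrightarrow> rfun t < 2))"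

lemma rad2: "rad3 / 5 < rad2" "rad2 < rad3" "\<And>t. 0 \<le> t \<Longrightarrow> t < rad2 \<Longrightarrow> rfun t < 2" "0 < rad2"
proof -
  have *: "rad3 / 5 < rad2 \<and> rad2 < rad3 \<and> (\<forall>t. 0 \<le> t \<longrightarrow> t < rad2 \<longrightarrow> rfun t < 2)"
    unfolding rad2_def by (rule someI_ex[OF exists_rad2])
  then show "rad3 / 5 < rad2" "rad2 < rad3" "\<And>t. 0 \<le> t \<Longrightarrow> t < rad2 \<Longrightarrow> rfun t < 2" by auto
  then show "0 < rad2" using rad3(1) by auto
qed

section \<open>Resolvents of the decimation function and infinite products\<close>

definition resolvent :: "real \<Rightarrow> real fps" where
  "resolvent v = inverse (fps_const v - decim)"

lemma resolvent_mult: "v \<noteq> 0 \<Longrightarrow> (fps_const v - decim) * resolvent v = 1"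
  unfolding resolvent_def by (intro inverse_mult_eq_1') auto

lemma resolvent_nth_0: "fps_nth (resolvent v) 0 = 1 / v"
  by (simp add: resolvent_def inverse_eq_divide)

text \<open>The reciprocal of an entire function converges up to its nearest zero. For these v every
  zero of \<open>v - m\<close> is a nonnegative real, and the last assumption excludes such zeros
  below \<open>c\<close>.\<close>

lemma conv_radius_resolvent:
  assumes "0 < v" "v \<le> 25/4" and c: "\<And>t. 0 \<le> t \<Longrightarrow> t < c \<Longrightarrow> rfun t < v"
  shows "fps_conv_radius (resolvent v) \<ge> ereal c"
proof -
  let ?f = "fps_const (complex_of_real v) - cfps decim"
  have rad: "fps_conv_radius ?f = \<infinity>"
    using fps_conv_radius_diff[of "fps_const (complex_of_real v)" "cfps decim"] by (simp add: conv_radius_cdecim)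
  have ev: "eval_fps ?f z = of_real v - dfun z" for z
    by (simp add: eval_fps_diff conv_radius_cdecim dfun_def)
  have "fps_conv_radius (inverse ?f) \<ge> min (ereal c) (fps_conv_radius ?f)"
  proof (rule fps_conv_radius_inverse)
    show "eval_fps ?f z \<noteq> 0" if "ereal (norm z) < ereal c" for z
    proof
      assume "eval_fps ?f z = 0"
      then have v: "dfun z = of_real v" by (simp add: ev)
      then obtain t where t: "t \<ge> 0" "z = of_real t" using dfun_real_imp[of z v] assms by auto
      then have "rfun t = v" using v dfun_of_real[of t] by simp
      then show False using c[of t] t that by auto
    qed
  qed
  moreover have "inverse ?f = cfps (resolvent v)"
  proof (rule fps_inverse_unique)
    show "?f * cfps (resolvent v) = 1"
      using arg_cong[OF resolvent_mult[of v], of cfps] assms by (simp add: cfps_simps)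
  qed
  ultimately show ?thesis by (simp add: rad conv_radius_cfps)
qed

lemma conv_radius_resolvent_3: "3 \<le> v \<Longrightarrow> v \<le> 25/4 \<Longrightarrow> fps_conv_radius (resolvent v) \<ge> ereal rad3"
  by (intro conv_radius_resolvent less_le_trans[OF rad3(3)]) auto

lemma conv_radius_resolvent_2: "2 \<le> v \<Longrightarrow> v \<le> 25/4 \<Longrightarrow> fps_conv_radius (resolvent v) \<ge> ereal rad2"
  by (intro conv_radius_resolvent less_le_trans[OF rad2(3)]) auto

text \<open>The recursion obtained from B z = f z * B (z / 5) by comparing coefficients: the term
  with i = 0 contributes \<open>b n / 5 ^ n\<close>, which moves to the left and produces the
  divisor \<open>1 - 1 / 5 ^ n\<close>.\<close>

fun product_coeff :: "(nat \<Rightarrow> real) \<Rightarrow> nat \<Rightarrow> real" where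
  "product_coeff f n = (if n = 0 then 1 else
     (\<Sum>i\<in>{1..n}. f i * product_coeff f (n - i) / 5 ^ (n - i)) / (1 - 1 / 5 ^ n))"

declare product_coeff.simps [simp del]

text \<open>The infinite product \<open>\<Prod>\<^sub>k f (z / 5\<^sup>k)\<close>, obtained from the functional equation that it satisfies.\<close>

lemma infinite_product_fps:
  fixes f :: "real fps"
  assumes f0: "fps_nth f 0 = 1" and rad: "fps_conv_radius f > 0"
  shows "\<exists>B. fps_nth B 0 = 1 \<and> fps_conv_radius B > 0 \<and> B = f * dilate (1/5) B"
proof -
  define b where "b = product_coeff (fps_nth f)"
  have b0: "b 0 = 1" by (simp add: b_def product_coeff.simps)
  have bn: "b n = (\<Sum>i\<in>{1..n}. fps_nth f i * b (n - i) / 5 ^ (n - i)) / (1 - 1 / 5 ^ n)" if "n > 0" for n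
    unfolding b_def using that by (subst product_coeff.simps) simp
  obtain \<rho> :: real where "0 < ereal \<rho>" "ereal \<rho> < fps_conv_radius f"
    using ereal_dense2[OF rad] by metis
  then have \<rho>: "0 < \<rho>" "ereal \<rho> < fps_conv_radius f" by auto
  have sm: "summable (\<lambda>n. \<bar>fps_nth f n\<bar> * \<rho> ^ n)"
    using norm_summable_fps[of \<rho> f] \<rho> by (simp add: abs_mult)
  define S where "S = (\<Sum>n. \<bar>fps_nth f n\<bar> * \<rho> ^ n)"
  \<comment> \<open>The second entry of the maximum makes the numerator at most 4/5 of
    \<open>L ^ n\<close>, which compensates the divisor \<open>1 - 1 / 5 ^ n \<ge> 4/5\<close>; the
    first entry ensures that powers of \<open>L * \<rho>\<close> are at least
    \<open>L * \<rho>\<close>.\<close>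
  define L where "L = max (1/\<rho>) (5/4 * S / \<rho>)"
  have L: "L > 0" "1 \<le> L * \<rho>" "5/4 * S \<le> L * \<rho>"
  proof -
    have "L \<ge> 1/\<rho>" "L \<ge> 5/4 * S / \<rho>" by (auto simp: L_def)
    then show "1 \<le> L * \<rho>" "5/4 * S \<le> L * \<rho>" using \<rho> by (auto simp: divide_le_eq)
    show "L > 0" using \<open>L \<ge> 1/\<rho>\<close> \<rho> by (meson less_le_trans zero_less_divide_1_iff)
  qed
  have bL: "\<bar>b n\<bar> \<le> L ^ n" for n
  proof (induction n rule: less_induct)
    case (less n)
    show ?case
    proof (cases "n = 0")
      case False
      have q: "1 - 1 / 5 ^ n \<ge> (4/5 :: real)"
        using False self_le_power[of "5::real" n] by (auto simp: field_simps)
      have "\<bar>\<Sum>i\<in>{1..n}. fps_nth f i * b (n - i) / 5 ^ (n - i)\<bar>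
          \<le> (\<Sum>i\<in>{1..n}. L ^ n / (L * \<rho>) * (\<bar>fps_nth f i\<bar> * \<rho> ^ i))"
      proof (rule order_trans[OF sum_abs sum_mono])
        fix i assume i: "i \<in> {1..n}"
        have "\<bar>fps_nth f i * b (n - i) / 5 ^ (n - i)\<bar> = \<bar>fps_nth f i\<bar> * \<bar>b (n - i)\<bar> / 5 ^ (n - i)"
          by (simp add: abs_mult)
        also have "\<dots> \<le> \<bar>fps_nth f i\<bar> * L ^ (n - i) / 1"
          using i less[of "n - i"] L(1) by (intro frac_le mult_left_mono) auto
        also have "\<dots> \<le> \<bar>fps_nth f i\<bar> * (L ^ n / (L * \<rho>) * \<rho> ^ i)"
        proof -
          have "L ^ (n - i) = L ^ n / (L * \<rho>) ^ i * \<rho> ^ i"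
            using i L \<rho> by (simp add: power_diff power_mult_distrib)
          also have "L ^ n / (L * \<rho>) ^ i * \<rho> ^ i \<le> L ^ n / (L * \<rho>) * \<rho> ^ i"
            using L \<rho> i self_le_power[of "L * \<rho>" i] by (intro mult_right_mono divide_left_mono) auto
          finally have "L ^ (n - i) / 1 \<le> L ^ n / (L * \<rho>) * \<rho> ^ i" by simp
          from mult_left_mono[OF this abs_ge_zero[of "fps_nth f i"]] show ?thesis by simp
        qed
        finally show "\<bar>fps_nth f i * b (n - i) / 5 ^ (n - i)\<bar> \<le> L ^ n / (L * \<rho>) * (\<bar>fps_nth f i\<bar> * \<rho> ^ i)"
          by (simp add: mult_ac)
      qed
      also have "\<dots> = L ^ n / (L * \<rho>) * (\<Sum>i\<in>{1..n}. \<bar>fps_nth f i\<bar> * \<rho> ^ i)"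
        by (simp add: sum_distrib_left)
      also have "\<dots> \<le> L ^ n / (L * \<rho>) * S"
        unfolding S_def using L \<rho> by (intro mult_left_mono sum_le_suminf sm) auto
      also have "\<dots> \<le> L ^ n * (4/5)"
        using L \<rho> by (simp add: field_simps)
      finally have "\<bar>b n\<bar> \<le> L ^ n * (4/5) / (4/5)"
        unfolding bn[OF False[unfolded neq0_conv]] abs_divide using q L by (intro frac_le) auto
      then show ?thesis by simp
    qed (simp add: b0)
  qed
  define B where "B = Abs_fps b"
  have "fps_conv_radius B \<ge> ereal (1 / L)"
    by (rule conv_radius_bounded_coeffs) (use L bL in \<open>auto simp: B_def\<close>)
  then have "fps_conv_radius B > 0"
    using L by (meson ereal_less(2) less_le_trans zero_less_divide_1_iff)
  moreover have "B = f * dilate (1/5) B"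
  proof (rule fps_ext)
    fix n :: nat
    have "{0..n} = insert 0 {1..n}" by auto
    then have *: "fps_nth (f * dilate (1/5) B) n
        = b n / 5 ^ n + (\<Sum>i\<in>{1..n}. fps_nth f i * b (n - i) / 5 ^ (n - i))"
      by (simp add: fps_mult_nth B_def f0 power_divide mult_ac)
    show "fps_nth B n = fps_nth (f * dilate (1/5) B) n"
    proof (cases "n = 0")
      case False
      then have "(1::real) < 5 ^ n" by simp
      then have "(5::real) ^ n \<noteq> 1" by linarith
      then have "b n * (1 - 1 / 5 ^ n) = (\<Sum>i\<in>{1..n}. fps_nth f i * b (n - i) / 5 ^ (n - i))"
        by (subst bn) (use False in auto)
      then show ?thesis unfolding * by (simp add: B_def algebra_simps)
    qed (simp add: * B_def b0 f0)
  qed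
  ultimately show ?thesis using b0 by (intro exI[of _ B]) (simp add: B_def)
qed

section \<open>Power series of the shift on bounded sequences\<close>

text \<open>On the discrete space of natural numbers every function is continuous, so this is the
  Banach space of bounded sequences with the supremum norm.\<close>

type_synonym bseq = "nat \<Rightarrow>\<^sub>C real"

lemma bounded_in_bcontfun:
  fixes f :: "nat \<Rightarrow> real"
  assumes "\<And>j. \<bar>f j\<bar> \<le> C"
  shows "f \<in> bcontfun"
  using assms by (auto simp: bcontfun_def bounded_iff)

lemma apply_Bcontfun:
  fixes f :: "nat \<Rightarrow> real"
  assumes "\<And>j. \<bar>f j\<bar> \<le> C"
  shows "apply_bcontfun (Bcontfun f) j = f j"
  using bounded_in_bcontfun[OF assms] by (simp add: Bcontfun_inverse)

lemma abs_bseq_le: "\<bar>apply_bcontfun (s::bseq) j\<bar> \<le> norm s"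
  using norm_bounded[of s j] by simp

lemma norm_bseq_le: "(\<And>j. \<bar>apply_bcontfun (s::bseq) j\<bar> \<le> C) \<Longrightarrow> norm s \<le> C"
  using norm_bound[of s C] by simp

definition shift :: "bseq \<Rightarrow> bseq" where
  "shift s = Bcontfun (\<lambda>j. apply_bcontfun s (Suc j))"

lemma apply_shift [simp]: "apply_bcontfun (shift s) j = apply_bcontfun s (Suc j)"
  unfolding shift_def by (rule apply_Bcontfun) (rule abs_bseq_le)

lemma norm_shift: "norm (shift s) \<le> norm s"
  by (rule norm_bseq_le) (simp add: abs_bseq_le)

lemma shift_linear: "shift (s + t) = shift s + shift t" "shift (s - t) = shift s - shift t"
  "shift (c *\<^sub>R s) = c *\<^sub>R shift s" "shift 0 = 0" "shift (- s) = - shift s"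
  by (auto intro!: bcontfun_eqI)

section \<open>Functional calculus of the shift\<close>

definition convergent_at :: "real \<Rightarrow> real fps \<Rightarrow> bool" where
  "convergent_at \<rho> g \<longleftrightarrow> 0 \<le> \<rho> \<and> ereal \<rho> < fps_conv_radius g"

lemma convergent_at_nonneg: "convergent_at \<rho> g \<Longrightarrow> 0 \<le> \<rho>"
  by (simp add: convergent_at_def)

lemma convergent_at_decim [simp]: "0 \<le> \<rho> \<Longrightarrow> convergent_at \<rho> decim"
  by (simp add: convergent_at_def conv_radius_decim)

lemma convergent_at_const [simp]: "0 \<le> \<rho> \<Longrightarrow> convergent_at \<rho> (fps_const a)"
  "0 \<le> \<rho> \<Longrightarrow> convergent_at \<rho> (numeral n)" "0 \<le> \<rho> \<Longrightarrow> convergent_at \<rho> 1"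
  "0 \<le> \<rho> \<Longrightarrow> convergent_at \<rho> fps_X"
  by (simp_all add: convergent_at_def)

lemma convergent_at_combine:
  assumes "convergent_at \<rho> f" "convergent_at \<rho> g"
  shows "convergent_at \<rho> (f + g)" "convergent_at \<rho> (f - g)" "convergent_at \<rho> (f * g)"
proof -
  have "ereal \<rho> < min (fps_conv_radius f) (fps_conv_radius g)" "0 \<le> \<rho>"
    using assms by (auto simp: convergent_at_def)
  note this(2) less_le_trans[OF this(1)]
  then show "convergent_at \<rho> (f + g)" "convergent_at \<rho> (f - g)" "convergent_at \<rho> (f * g)"
    unfolding convergent_at_def
    by (blast intro: fps_conv_radius_add fps_conv_radius_diff fps_conv_radius_mult)+
qed

lemma convergent_at_mono: "convergent_at \<rho> g \<Longrightarrow> 0 \<le> \<rho>' \<Longrightarrow> \<rho>' \<le> \<rho> \<Longrightarrow> convergent_at \<rho>' g"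
  unfolding convergent_at_def by (meson ereal_less_eq(3) le_less_trans)

lemma convergent_at_resolvent_3: "0 \<le> \<rho> \<Longrightarrow> \<rho> < rad3 \<Longrightarrow> 3 \<le> v \<Longrightarrow> v \<le> 25/4 \<Longrightarrow> convergent_at \<rho> (resolvent v)"
  unfolding convergent_at_def using less_le_trans[OF _ conv_radius_resolvent_3[of v], of "ereal \<rho>"] by simp

lemma convergent_at_resolvent_2: "0 \<le> \<rho> \<Longrightarrow> \<rho> < rad2 \<Longrightarrow> 2 \<le> v \<Longrightarrow> v \<le> 25/4 \<Longrightarrow> convergent_at \<rho> (resolvent v)"
  unfolding convergent_at_def using less_le_trans[OF _ conv_radius_resolvent_2[of v], of "ereal \<rho>"] by simp

definition wnorm :: "real \<Rightarrow> real fps \<Rightarrow> real" where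
  "wnorm \<rho> g = (\<Sum>i. \<bar>fps_nth g i\<bar> * \<rho> ^ i)"

lemma summable_wnorm: "convergent_at \<rho> g \<Longrightarrow> summable (\<lambda>i. \<bar>fps_nth g i\<bar> * \<rho> ^ i)"
  using norm_summable_fps[of \<rho> g] by (simp add: convergent_at_def abs_mult)

lemma wnorm_nonneg: "convergent_at \<rho> g \<Longrightarrow> 0 \<le> wnorm \<rho> g"
  unfolding wnorm_def by (intro suminf_nonneg summable_wnorm) (auto simp: convergent_at_def)

text \<open>The operator g (\<rho> S) with S the shift. Since S has norm at most 1, the series
  converges in norm for \<rho> strictly inside the radius of g, and \<open>wnorm\<close> bounds its
  norm.\<close>

definition opr :: "real \<Rightarrow> real fps \<Rightarrow> bseq \<Rightarrow> bseq" where
  "opr \<rho> g s = Bcontfun (\<lambda>j. \<Sum>i. fps_nth g i * \<rho> ^ i * apply_bcontfun s (i + j))"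

context
  fixes \<rho> :: real and g :: "real fps"
  assumes conv: "convergent_at \<rho> g"
begin

lemma opr_term_le: "\<bar>fps_nth g i * \<rho> ^ i * apply_bcontfun s k\<bar> \<le> \<bar>fps_nth g i\<bar> * \<rho> ^ i * norm s"
  for s :: bseq
  using convergent_at_nonneg[OF conv] abs_bseq_le[of s k] by (simp add: abs_mult mult_left_mono)

lemma opr_abs_summable: "summable (\<lambda>i. \<bar>fps_nth g i * \<rho> ^ i * apply_bcontfun s (i + j)\<bar>)"
  for s :: bseq
  by (rule summable_comparison_test'[OF summable_mult2[OF summable_wnorm[OF conv], of "norm s"]])
    (use opr_term_le in auto)

lemma opr_summable: "summable (\<lambda>i. fps_nth g i * \<rho> ^ i * apply_bcontfun s (i + j))"
  for s :: bseq
  using opr_abs_summable by (rule summable_rabs_cancel)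

lemma opr_bound: "\<bar>\<Sum>i. fps_nth g i * \<rho> ^ i * apply_bcontfun s (i + j)\<bar> \<le> wnorm \<rho> g * norm s"
  for s :: bseq
proof -
  have "\<bar>\<Sum>i. fps_nth g i * \<rho> ^ i * apply_bcontfun s (i + j)\<bar>
      \<le> (\<Sum>i. \<bar>fps_nth g i * \<rho> ^ i * apply_bcontfun s (i + j)\<bar>)"
    by (rule summable_rabs[OF opr_abs_summable])
  also have "\<dots> \<le> (\<Sum>i. \<bar>fps_nth g i\<bar> * \<rho> ^ i * norm s)"
    by (intro suminf_le opr_abs_summable summable_mult2 summable_wnorm conv opr_term_le)
  also have "\<dots> = wnorm \<rho> g * norm s"
    unfolding wnorm_def by (rule suminf_mult2[symmetric]) (rule summable_wnorm[OF conv])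
  finally show ?thesis .
qed

lemma apply_opr: "apply_bcontfun (opr \<rho> g s) j = (\<Sum>i. fps_nth g i * \<rho> ^ i * apply_bcontfun s (i + j))"
  unfolding opr_def by (rule apply_Bcontfun[OF opr_bound])

lemma norm_opr: "norm (opr \<rho> g s) \<le> wnorm \<rho> g * norm s"
  by (rule norm_bseq_le) (simp add: apply_opr opr_bound)

lemma opr_linear: "opr \<rho> g (s + t) = opr \<rho> g s + opr \<rho> g t" "opr \<rho> g (s - t) = opr \<rho> g s - opr \<rho> g t"
  "opr \<rho> g (c *\<^sub>R s) = c *\<^sub>R opr \<rho> g s" "opr \<rho> g 0 = 0" "opr \<rho> g (- s) = - opr \<rho> g s"
proof -
  show add: "opr \<rho> g (s + t) = opr \<rho> g s + opr \<rho> g t" for s t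
    by (rule bcontfun_eqI) (simp add: apply_opr suminf_add[OF opr_summable opr_summable] distrib_left)
  show sc: "opr \<rho> g (c *\<^sub>R s) = c *\<^sub>R opr \<rho> g s" for c s
    by (rule bcontfun_eqI, simp add: apply_opr, subst suminf_mult[OF opr_summable, symmetric], simp add: mult_ac)
  show "opr \<rho> g 0 = 0" using sc[of 0 0] by simp
  show um: "opr \<rho> g (- s) = - opr \<rho> g s" for s using sc[of "-1" s] by simp
  show "opr \<rho> g (s - t) = opr \<rho> g s - opr \<rho> g t" using add[of s "-t"] um[of t] by simp
qed

lemma opr_shift: "opr \<rho> g (shift s) = shift (opr \<rho> g s)"
  by (rule bcontfun_eqI) (simp add: apply_opr)

end

lemma opr_diff_fps: "convergent_at \<rho> f \<Longrightarrow> convergent_at \<rho> g \<Longrightarrow> opr \<rho> (f - g) s = opr \<rho> f s - opr \<rho> g s"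
  by (rule bcontfun_eqI)
    (simp add: apply_opr convergent_at_combine suminf_diff[OF opr_summable opr_summable] left_diff_distrib)

lemma opr_const: "0 \<le> \<rho> \<Longrightarrow> opr \<rho> (fps_const a) s = a *\<^sub>R s"
proof (rule bcontfun_eqI)
  fix j assume \<rho>: "0 \<le> \<rho>"
  have "(\<lambda>i. fps_nth (fps_const a) i * \<rho> ^ i * apply_bcontfun s (i + j)) sums
      (\<Sum>i\<in>{0}. fps_nth (fps_const a) i * \<rho> ^ i * apply_bcontfun s (i + j))"
    by (rule sums_finite) auto
  then show "apply_bcontfun (opr \<rho> (fps_const a) s) j = apply_bcontfun (a *\<^sub>R s) j"
    using \<rho> by (simp add: apply_opr sums_iff)
qed

lemma opr_numeral: "0 \<le> \<rho> \<Longrightarrow> opr \<rho> (numeral n) s = numeral n *\<^sub>R s" "0 \<le> \<rho> \<Longrightarrow> opr \<rho> 1 s = s"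
  using opr_const[of \<rho> "numeral n" s] opr_const[of \<rho> 1 s] by (simp_all add: numeral_fps_const)

lemma opr_X: "0 \<le> \<rho> \<Longrightarrow> opr \<rho> fps_X s = \<rho> *\<^sub>R shift s"
proof (rule bcontfun_eqI)
  fix j assume \<rho>: "0 \<le> \<rho>"
  have "(\<lambda>i. fps_nth fps_X i * \<rho> ^ i * apply_bcontfun s (i + j)) sums
      (\<Sum>i\<in>{1}. fps_nth fps_X i * \<rho> ^ i * apply_bcontfun s (i + j))"
    by (rule sums_finite) auto
  then show "apply_bcontfun (opr \<rho> fps_X s) j = apply_bcontfun (\<rho> *\<^sub>R shift s) j"
    using \<rho> by (simp add: apply_opr sums_iff)
qed

text \<open>Both sides are sums of one absolutely summable double family \<open>h\<close>: iterated
  summation gives the composition, summation along the antidiagonals gives the Cauchy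
  product.\<close>

lemma opr_mult:
  assumes f: "convergent_at \<rho> f" and g: "convergent_at \<rho> g"
  shows "opr \<rho> (f * g) s = opr \<rho> f (opr \<rho> g s)"
proof (rule bcontfun_eqI)
  fix j
  have \<rho>: "0 \<le> \<rho>" using f by (simp add: convergent_at_def)
  let ?s = "apply_bcontfun s"
  define h where "h = (\<lambda>(i,k). fps_nth f i * \<rho> ^ i * (fps_nth g k * \<rho> ^ k * ?s (k + (i + j))))"
  have "(\<lambda>x. norm (h x)) summable_on UNIV \<times> UNIV"
  proof (rule Infinite_Sum.abs_summable_on_comparison_test)
    let ?b = "\<lambda>(i,k). (\<bar>fps_nth f i\<bar> * \<rho> ^ i) * (\<bar>fps_nth g k\<bar> * \<rho> ^ k * norm s)"
    have F: "((\<lambda>i. \<bar>fps_nth f i\<bar> * \<rho> ^ i) has_sum wnorm \<rho> f) UNIV"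
      using summable_wnorm[OF f] \<rho> by (intro norm_summable_imp_has_sum) (auto simp: wnorm_def)
    have G: "((\<lambda>i. \<bar>fps_nth g i\<bar> * \<rho> ^ i) has_sum wnorm \<rho> g) UNIV"
      using summable_wnorm[OF g] \<rho> by (intro norm_summable_imp_has_sum) (auto simp: wnorm_def)
    have "?b summable_on UNIV \<times> UNIV"
    proof (rule summable_on_SigmaI)
      show "((\<lambda>y. ?b (x, y)) has_sum (\<bar>fps_nth f x\<bar> * \<rho> ^ x) * (wnorm \<rho> g * norm s)) UNIV" for x
        using has_sum_cmult_right[OF has_sum_cmult_left[OF G, of "norm s"], of "\<bar>fps_nth f x\<bar> * \<rho> ^ x"]
        by (simp add: mult_ac)
      show "(\<lambda>x. \<bar>fps_nth f x\<bar> * \<rho> ^ x * (wnorm \<rho> g * norm s)) summable_on UNIV"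
        using F by (intro summable_on_cmult_left) (auto simp: summable_on_def)
    qed (use \<rho> in auto)
    then show "(\<lambda>x. norm (?b x)) summable_on UNIV \<times> UNIV"
      by (rule summable_on_iff_abs_summable_on_real[THEN iffD1])
    show "norm (h x) \<le> norm (?b x)" if "x \<in> UNIV \<times> UNIV" for x
      using opr_term_le[OF g] \<rho> by (auto simp: h_def split_beta abs_mult intro!: mult_left_mono abs_bseq_le)
  qed
  then have h: "h summable_on UNIV \<times> UNIV" by (rule abs_summable_summable)
  have inf: "infsum a UNIV = suminf a" if "summable (\<lambda>n. \<bar>a n\<bar>)" for a :: "nat \<Rightarrow> real"
    using norm_summable_imp_has_sum[of a "suminf a"] that
    by (auto intro: infsumI summable_rabs_cancel summable_sums)
  have "infsum h (UNIV \<times> UNIV) = infsum (\<lambda>i. infsum (\<lambda>k. h (i,k)) UNIV) UNIV"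
    by (rule infsum_Sigma_banach[symmetric, OF h])
  also have "\<dots> = infsum (\<lambda>i. fps_nth f i * \<rho> ^ i * apply_bcontfun (opr \<rho> g s) (i + j)) UNIV"
  proof (rule infsum_cong)
    fix i :: nat
    have "infsum (\<lambda>k. h (i,k)) UNIV = (\<Sum>k. fps_nth f i * \<rho> ^ i * (fps_nth g k * \<rho> ^ k * ?s (k + (i + j))))"
      unfolding h_def by (subst inf) (use summable_mult[OF opr_abs_summable[OF g, of s "i+j"], of "\<bar>fps_nth f i * \<rho> ^ i\<bar>"] in \<open>auto simp: abs_mult\<close>)
    also have "\<dots> = fps_nth f i * \<rho> ^ i * apply_bcontfun (opr \<rho> g s) (i + j)"
      by (simp add: apply_opr[OF g] suminf_mult[OF opr_summable[OF g]])
    finally show "infsum (\<lambda>k. h (i,k)) UNIV = fps_nth f i * \<rho> ^ i * apply_bcontfun (opr \<rho> g s) (i + j)" .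
  qed
  also have "\<dots> = apply_bcontfun (opr \<rho> f (opr \<rho> g s)) j"
    by (subst inf) (auto simp: apply_opr[OF f] intro: opr_abs_summable[OF f])
  finally have 1: "infsum h (UNIV \<times> UNIV) = apply_bcontfun (opr \<rho> f (opr \<rho> g s)) j" .
  have bij: "bij_betw (\<lambda>(n,i). (i, n - i)) (Sigma UNIV (\<lambda>n::nat. {..n})) (UNIV \<times> UNIV)"
    by (rule bij_betw_byWitness[where f' = "\<lambda>(i,k). (i + k, i)"]) auto
  have "infsum h (UNIV \<times> UNIV) = infsum (\<lambda>x. h ((\<lambda>(n,i). (i, n - i)) x)) (Sigma UNIV (\<lambda>n::nat. {..n}))"
    by (rule infsum_reindex_bij_betw[OF bij, symmetric])
  also have "\<dots> = infsum (\<lambda>n. infsum (\<lambda>i. h (i, n - i)) {..n}) UNIV"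
    using summable_on_reindex_bij_betw[OF bij, of h] h
    by (subst infsum_Sigma_banach[symmetric]) auto
  also have "\<dots> = infsum (\<lambda>n. fps_nth (f * g) n * \<rho> ^ n * ?s (n + j)) UNIV"
  proof (rule infsum_cong)
    fix n :: nat
    have "h (i, n - i) = fps_nth f i * fps_nth g (n - i) * \<rho> ^ n * ?s (n + j)" if "i \<le> n" for i
    proof -
      have "\<rho> ^ n = \<rho> ^ i * \<rho> ^ (n - i)" using that by (simp flip: power_add)
      then show ?thesis using that by (simp add: h_def)
    qed
    then show "infsum (\<lambda>i. h (i, n - i)) {..n} = fps_nth (f * g) n * \<rho> ^ n * ?s (n + j)"
      by (simp add: fps_mult_nth sum_distrib_right atLeast0AtMost)
  qed
  also have "\<dots> = apply_bcontfun (opr \<rho> (f * g) s) j"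
    using convergent_at_combine(3)[OF f g]
    by (subst inf) (auto simp: apply_opr intro: opr_abs_summable)
  finally show "apply_bcontfun (opr \<rho> (f * g) s) j = apply_bcontfun (opr \<rho> f (opr \<rho> g s)) j"
    using 1 by simp
qed

lemma opr_commute:
  "convergent_at \<rho> f \<Longrightarrow> convergent_at \<rho> g \<Longrightarrow> opr \<rho> f (opr \<rho> g s) = opr \<rho> g (opr \<rho> f s)"
  by (metis opr_mult mult.commute)

lemma opr_dilate: "opr \<rho> (dilate c g) s = opr (c * \<rho>) g s"
  unfolding opr_def by (simp add: power_mult_distrib mult_ac)

lemma convergent_at_dilate:
  assumes "0 < c" "0 \<le> \<rho>"
  shows "convergent_at \<rho> (dilate c g) \<longleftrightarrow> convergent_at (c * \<rho>) g"
  using assms by (cases "fps_conv_radius g")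
    (auto simp: convergent_at_def conv_radius_dilate field_simps)

text \<open>The functional equation of m, carried over by the functional calculus: it expresses the
  operator of a level as \<open>K (5 - K)\<close> with the operator \<open>K\<close> of the next
  level.\<close>

lemma opr_decim_step:
  assumes "0 \<le> \<rho>"
  shows "opr \<rho> decim s = 5 *\<^sub>R opr (\<rho>/5) decim s - opr (\<rho>/5) decim (opr (\<rho>/5) decim s)"
proof -
  let ?d = "dilate (1/5) decim"
  have c: "convergent_at \<rho> ?d" using assms by (simp add: convergent_at_dilate)
  have "opr \<rho> decim s = opr \<rho> (5 * ?d - ?d * ?d) s" by (simp flip: decim_eq)
  also have "\<dots> = 5 *\<^sub>R opr \<rho> ?d s - opr \<rho> ?d (opr \<rho> ?d s)"
    using c assms by (simp add: opr_diff_fps opr_mult opr_numeral convergent_at_combine)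
  finally show ?thesis by (simp add: opr_dilate)
qed

lemma opr_resolvent:
  assumes "convergent_at \<rho> (resolvent v)" "v \<noteq> 0"
  shows "opr \<rho> (resolvent v) (v *\<^sub>R s - opr \<rho> decim s) = s"
    and "v *\<^sub>R opr \<rho> (resolvent v) s - opr \<rho> decim (opr \<rho> (resolvent v) s) = s"
proof -
  have \<rho>: "0 \<le> \<rho>" using assms by (simp add: convergent_at_def)
  have "opr \<rho> ((fps_const v - decim) * resolvent v) s = s"
    using resolvent_mult[OF assms(2)] \<rho> by (simp add: opr_numeral)
  then show 2: "v *\<^sub>R opr \<rho> (resolvent v) s - opr \<rho> decim (opr \<rho> (resolvent v) s) = s"
    using assms \<rho> by (simp add: opr_mult opr_diff_fps opr_const convergent_at_combine)
  show "opr \<rho> (resolvent v) (v *\<^sub>R s - opr \<rho> decim s) = s"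
    using 2 assms \<rho> by (simp add: opr_linear opr_commute[of \<rho> decim])
qed

text \<open>Without the constant term every summand carries at least one factor \<rho>, so the
  weighted norm shrinks at least linearly between \<open>\<rho>0\<close> and \<rho>. This gives
  asymptotics as the level grows, uniformly in the sequence.\<close>

lemma opr_near_const:
  assumes "convergent_at \<rho>0 g" "0 < \<rho>0"
  shows "\<exists>C\<ge>0. \<forall>\<rho> s. 0 \<le> \<rho> \<longrightarrow> \<rho> \<le> \<rho>0 \<longrightarrow> norm (opr \<rho> g s - fps_nth g 0 *\<^sub>R s) \<le> C * \<rho> * norm s"
proof (intro exI[of _ "wnorm \<rho>0 g / \<rho>0"] conjI allI impI)
  show "0 \<le> wnorm \<rho>0 g / \<rho>0" using wnorm_nonneg assms by auto
  fix \<rho> s assume \<rho>: "0 \<le> \<rho>" "\<rho> \<le> \<rho>0"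
  let ?g = "g - fps_const (fps_nth g 0)"
  have c: "convergent_at \<rho> g" using convergent_at_mono[OF assms(1) \<rho>] .
  then have cg: "convergent_at \<rho> ?g" using \<rho> by (intro convergent_at_combine) auto
  have "wnorm \<rho> ?g \<le> (\<Sum>i. \<rho> / \<rho>0 * (\<bar>fps_nth g i\<bar> * \<rho>0 ^ i))"
    unfolding wnorm_def
  proof (intro suminf_le summable_wnorm cg summable_mult assms)
    fix i
    show "\<bar>fps_nth ?g i\<bar> * \<rho> ^ i \<le> \<rho> / \<rho>0 * (\<bar>fps_nth g i\<bar> * \<rho>0 ^ i)"
    proof (cases i)
      case (Suc k)
      have "\<rho> ^ k \<le> \<rho>0 ^ k" using \<rho> by (intro power_mono) auto
      then have "\<bar>fps_nth g (Suc k)\<bar> * (\<rho> * \<rho> ^ k) \<le> \<bar>fps_nth g (Suc k)\<bar> * (\<rho> * \<rho>0 ^ k)"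
        using \<rho> by (intro mult_left_mono) auto
      then show ?thesis using Suc assms(2) by (simp add: mult_ac)
    qed (use \<rho> assms in auto)
  qed
  also have "\<dots> = \<rho> / \<rho>0 * wnorm \<rho>0 g"
    unfolding wnorm_def by (rule suminf_mult[OF summable_wnorm[OF assms(1)]])
  finally have w: "wnorm \<rho> ?g \<le> wnorm \<rho>0 g / \<rho>0 * \<rho>" by (simp add: mult_ac)
  have "opr \<rho> g s - fps_nth g 0 *\<^sub>R s = opr \<rho> ?g s"
    using c \<rho> by (simp add: opr_diff_fps opr_const)
  also have "norm \<dots> \<le> wnorm \<rho> ?g * norm s" by (rule norm_opr[OF cg])
  also have "\<dots> \<le> wnorm \<rho>0 g / \<rho>0 * \<rho> * norm s" by (intro mult_right_mono w) auto
  finally show "norm (opr \<rho> g s - fps_nth g 0 *\<^sub>R s) \<le> wnorm \<rho>0 g / \<rho>0 * \<rho> * norm s" .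
qed

text \<open>As m z = z + ..., the operator is \<rho> times the shift up to second order. This
  estimate is the bridge between the exact equations of the levels and the Laplacian as a limit, in
  both directions.\<close>

lemma opr_decim_near_shift:
  assumes "0 < \<rho>0"
  shows "\<exists>C\<ge>0. \<forall>\<rho> s. 0 \<le> \<rho> \<longrightarrow> \<rho> \<le> \<rho>0 \<longrightarrow> norm (opr \<rho> decim s - \<rho> *\<^sub>R shift s) \<le> C * \<rho>\<^sup>2 * norm s"
proof -
  define h where "h = fps_shift 1 decim"
  have dh: "decim = fps_X * h"
    by (rule fps_ext) (auto simp: h_def)
  have ch: "convergent_at \<rho> h" if "0 \<le> \<rho>" for \<rho>
    using that by (simp add: convergent_at_def h_def conv_radius_decim)
  obtain C where C: "C \<ge> 0" "\<And>\<rho> s. 0 \<le> \<rho> \<Longrightarrow> \<rho> \<le> \<rho>0 \<Longrightarrow> norm (opr \<rho> h s - s) \<le> C * \<rho> * norm s"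
    using opr_near_const[OF ch assms] assms by (auto simp: h_def)
  show ?thesis
  proof (intro exI[of _ C] conjI allI impI C(1))
    fix \<rho> s assume \<rho>: "0 \<le> \<rho>" "\<rho> \<le> \<rho>0"
    have "opr \<rho> decim s - \<rho> *\<^sub>R shift s = \<rho> *\<^sub>R shift (opr \<rho> h s - s)"
      using \<rho> ch[of \<rho>] by (simp add: dh opr_mult opr_X shift_linear scaleR_diff_right)
    also have "norm \<dots> \<le> \<rho> * (C * \<rho> * norm s)"
      using \<rho> order_trans[OF norm_shift C(2)[OF \<rho>, of s]] by (simp add: mult_left_mono)
    finally show "norm (opr \<rho> decim s - \<rho> *\<^sub>R shift s) \<le> C * \<rho>\<^sup>2 * norm s"
      by (simp add: power2_eq_square mult_ac)
  qed
qed

text \<open>An eigenfunction of the Laplacian produces geometric sequences, which are eigenvectors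
  of the shift. On these the operator is a number, and the classical decimation of eigenvalues is
  recovered.\<close>

lemma opr_decim_eigen:
  assumes "0 \<le> \<rho>" "shift s = \<theta> *\<^sub>R s"
  shows "opr \<rho> decim s = rfun (\<rho> * \<theta>) *\<^sub>R s"
proof (rule bcontfun_eqI)
  fix j
  have *: "apply_bcontfun s (i + j) = \<theta> ^ i * apply_bcontfun s j" for i
  proof (induction i)
    case (Suc i)
    have "apply_bcontfun s (Suc i + j) = apply_bcontfun (shift s) (i + j)" by simp
    then show ?case using Suc assms(2) by simp
  qed simp
  have "(\<lambda>i. dcoeff i * (\<rho> * \<theta>) ^ i * apply_bcontfun s j) sums (rfun (\<rho> * \<theta>) * apply_bcontfun s j)"
    by (intro sums_mult2 rfun_sums)
  then show "apply_bcontfun (opr \<rho> decim s) j = apply_bcontfun (rfun (\<rho> * \<theta>) *\<^sub>R s) j"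
    using assms(1) by (simp add: apply_opr * sums_iff power_mult_distrib mult_ac)
qed

section \<open>Cells and vertices of the gasket\<close>

lemma three_eq_zero [simp]: "(3::3) = 0"
  by simp

lemma letter_neq [simp]: "(a::3) + 1 \<noteq> a" "a \<noteq> a + 1" "a + 2 \<noteq> a" "a \<noteq> a + 2" "a + 1 \<noteq> a + 2" "a + 2 \<noteq> a + 1"
  by (auto simp: add_left_cancel)

lemma UNIV_letter: "(UNIV :: 3 set) = {a, a + 1, a + 2}"
proof -
  have "card {a, a + 1, a + 2 :: 3} = 3" by simp
  then show ?thesis by (intro card_subset_eq[symmetric]) auto
qed

lemma letter_cases: "(c::3) = a \<or> c = a + 1 \<or> c = a + 2"
  using UNIV_letter[of a] by auto

lemma letter_add [simp]: "(a::3) + 1 + 1 = a + 2" "(a::3) + 1 + 2 = a" "(a::3) + 2 + 1 = a" "(a::3) + 2 + 2 = a + 1"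
  by (simp_all add: add.assoc)

lemma letter_diff: "(a::3) - 1 = a + 2"
  by (simp add: diff_eq_eq)

lemma sum_letters: "(\<Sum>c\<in>UNIV. f c) = f a + f (a + 1) + f ((a::3) + 2)" for f :: "3 \<Rightarrow> 'b::comm_monoid_add"
  by (subst UNIV_letter[of a]) (simp add: add.assoc)

locale gasket =
  fixes q :: "3 \<Rightarrow> plane"
  assumes equilateral: "equilateral q"
begin

section \<open>The triangle and its barycentric coordinates\<close>

definition side :: real where "side = (SOME s. s > 0 \<and> (\<forall>i j. i \<noteq> j \<longrightarrow> dist (q i) (q j) = s))"

lemma side: "side > 0" "i \<noteq> j \<Longrightarrow> dist (q i) (q j) = side"
proof -
  have *: "side > 0 \<and> (\<forall>i j. i \<noteq> j \<longrightarrow> dist (q i) (q j) = side)"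
    unfolding side_def by (rule someI_ex[OF equilateral[unfolded equilateral_def]])
  show "side > 0" using * by (rule conjunct1)
  show "i \<noteq> j \<Longrightarrow> dist (q i) (q j) = side" using conjunct2[OF *] by metis
qed

lemma inj_q: "inj q"
  using side by (metis dist_self injI less_irrefl)

lemma q_eq_iff [simp]: "q i = q j \<longleftrightarrow> i = j"
  using inj_q by (auto simp: inj_def)

text \<open>The barycentric coordinate belonging to the corner \<open>i\<close>. The sum of the two
  edge vectors at \<open>q i\<close> points along the altitude and has inner product
  \<open>3 * side\<^sup>2 / 2\<close> with each of them; hence the constant.\<close>

definition bary :: "3 \<Rightarrow> plane \<Rightarrow> real" where
  "bary i x = 1 - 2 / (3 * side\<^sup>2) * ((x - q i) \<bullet> (q (i + 1) + q (i + 2) - 2 *\<^sub>R q i))"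

lemma bary_q: "bary i (q j) = of_bool (i = j)"
proof -
  define a where "a = q (i + 1) - q i"
  define c where "c = q (i + 2) - q i"
  have n: "norm a = side" "norm c = side" "norm (a - c) = side"
    using side(2)[of "i + 1" i] side(2)[of "i + 2" i] side(2)[of "i + 1" "i + 2"]
    by (auto simp: a_def c_def dist_norm)
  then have "a \<bullet> a = side\<^sup>2" "c \<bullet> c = side\<^sup>2" "(a - c) \<bullet> (a - c) = side\<^sup>2"
    by (auto simp: dot_square_norm)
  then have ac: "a \<bullet> a = side\<^sup>2" "c \<bullet> c = side\<^sup>2" "a \<bullet> c = side\<^sup>2 / 2" "c \<bullet> a = side\<^sup>2 / 2"
    by (auto simp: inner_diff_left inner_diff_right inner_commute)
  have e: "q (i + 1) + q (i + 2) - 2 *\<^sub>R q i = a + c"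
    by (simp add: a_def c_def scaleR_2)
  have "bary i (q j) = 1 - 2 / (3 * side\<^sup>2) * ((q j - q i) \<bullet> (a + c))"
    by (simp add: bary_def e)
  moreover have "j = i \<or> q j - q i = a \<or> q j - q i = c"
    using letter_cases[of j i] by (auto simp: a_def c_def)
  moreover have "j \<noteq> i" if "q j - q i = a \<or> q j - q i = c"
    using that n side(1) by auto
  ultimately show ?thesis
    using side(1) ac by (auto simp: inner_add_right field_simps)
qed

lemma bary_combination:
  assumes "(\<Sum>j\<in>UNIV. t j) = 1"
  shows "bary i (\<Sum>j\<in>UNIV. t j *\<^sub>R q j) = t i"
proof -
  let ?n = "q (i + 1) + q (i + 2) - 2 *\<^sub>R q i" and ?c = "2 / (3 * side\<^sup>2)"
  have "(\<Sum>j\<in>UNIV. t j *\<^sub>R q j) - q i = (\<Sum>j\<in>UNIV. t j *\<^sub>R (q j - q i))"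
    using assms by (simp add: scaleR_diff_right sum_subtractf flip: scaleR_left.sum)
  then have "bary i (\<Sum>j\<in>UNIV. t j *\<^sub>R q j) = 1 - ?c * (\<Sum>j\<in>UNIV. t j * ((q j - q i) \<bullet> ?n))"
    unfolding bary_def by (simp add: inner_sum_left)
  also have "\<dots> = (\<Sum>j\<in>UNIV. t j) - (\<Sum>j\<in>UNIV. t j * (?c * ((q j - q i) \<bullet> ?n)))"
    using assms by (simp add: sum_distrib_left mult_ac)
  also have "\<dots> = (\<Sum>j\<in>UNIV. t j * bary i (q j))"
    unfolding bary_def by (simp add: right_diff_distrib sum_subtractf)
  also have "\<dots> = t i" by (simp add: bary_q)
  finally show ?thesis .
qed

definition triangle :: "plane set" where "triangle = convex hull (range q)"

lemma triangle_iff: "x \<in> triangle \<longleftrightarrow> (\<exists>t. (\<forall>j. 0 \<le> t j) \<and> (\<Sum>j\<in>UNIV. t j) = 1 \<and> x = (\<Sum>j\<in>UNIV. t j *\<^sub>R q j))"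
proof
  assume "x \<in> triangle"
  then obtain u where u: "\<forall>y\<in>range q. 0 \<le> u y" "sum u (range q) = 1" "(\<Sum>y\<in>range q. u y *\<^sub>R y) = x"
    by (auto simp: triangle_def convex_hull_finite)
  then show "\<exists>t. (\<forall>j. 0 \<le> t j) \<and> (\<Sum>j\<in>UNIV. t j) = 1 \<and> x = (\<Sum>j\<in>UNIV. t j *\<^sub>R q j)"
    by (intro exI[of _ "u \<circ> q"]) (auto simp: sum.reindex[OF inj_q] o_def)
next
  assume "\<exists>t. (\<forall>j. 0 \<le> t j) \<and> (\<Sum>j\<in>UNIV. t j) = 1 \<and> x = (\<Sum>j\<in>UNIV. t j *\<^sub>R q j)"
  then obtain t where t: "\<And>j. 0 \<le> t j" "(\<Sum>j\<in>UNIV. t j) = 1" "x = (\<Sum>j\<in>UNIV. t j *\<^sub>R q j)" by blast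
  show "x \<in> triangle"
    unfolding triangle_def t(3) by (rule convex_sum[OF _ convex_convex_hull]) (use t in \<open>auto intro: hull_inc\<close>)
qed

lemma q_in_triangle [simp]: "q i \<in> triangle"
  by (simp add: triangle_def hull_inc)

lemma bary_triangle:
  assumes "x \<in> triangle"
  shows "0 \<le> bary i x" "bary i x \<le> 1" "bary i x = 1 \<Longrightarrow> x = q i"
proof -
  obtain t where t: "\<And>j. 0 \<le> t j" "(\<Sum>j\<in>UNIV. t j) = 1" "x = (\<Sum>j\<in>UNIV. t j *\<^sub>R q j)"
    using assms triangle_iff by auto
  have b: "bary i x = t i" using bary_combination[OF t(2)] t(3) by simp
  have s: "t i + t (i + 1) + t (i + 2) = 1" using t(2) sum_letters[of t i] by simp
  show "0 \<le> bary i x" "bary i x \<le> 1" using b s t(1)[of i] t(1)[of "i+1"] t(1)[of "i+2"] by auto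
  assume "bary i x = 1"
  then have "t i = 1" "t (i + 1) = 0" "t (i + 2) = 0"
    using b s t(1)[of "i+1"] t(1)[of "i+2"] by auto
  then show "x = q i" using t(3) sum_letters[of "\<lambda>j. t j *\<^sub>R q j" i] by simp
qed

lemma bary_F: "bary i (F q j x) = (bary i x + of_bool (i = j)) / 2"
proof -
  have "bary i (F q j x) = (bary i x + bary i (q j)) / 2"
    by (simp add: bary_def F_def inner_diff_left inner_add_left inner_scaleR_left algebra_simps add_divide_distrib diff_divide_distrib)
  then show ?thesis by (simp add: bary_q)
qed

lemma F_triangle: "x \<in> triangle \<Longrightarrow> F q j x \<in> triangle"
proof -
  assume "x \<in> triangle"
  then have "(1/2) *\<^sub>R x + (1/2) *\<^sub>R q j \<in> triangle"
    using q_in_triangle[of j] unfolding triangle_def by (intro convexD[OF convex_convex_hull]) auto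
  then show ?thesis by (simp add: F_def scaleR_add_right)
qed

lemma F_eq_iff [simp]: "F q i x = F q i y \<longleftrightarrow> x = y"
  by (simp add: F_def)

text \<open>In a common point the coordinates \<open>i\<close> and \<open>j\<close> give
  \<open>bary i y = bary i x + 1\<close> and the symmetric equation. Coordinates in the triangle lie
  between 0 and 1, so both points are corners.\<close>

lemma F_eq_F:
  assumes "x \<in> triangle" "y \<in> triangle" "i \<noteq> j" "F q i x = F q j y"
  shows "x = q j" "y = q i"
proof -
  have "bary i x + 1 = bary i y" "bary j x = bary j y + 1"
    using bary_F[of i i x] bary_F[of i j y] bary_F[of j i x] bary_F[of j j y] assms by auto
  then have "bary i y = 1" "bary j x = 1"
    using bary_triangle[OF assms(1)] bary_triangle[OF assms(2)] by (smt (verit))+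
  then show "x = q j" "y = q i" using bary_triangle(3) assms by auto
qed

lemma F_swap: "F q i (q j) = F q j (q i)"
  by (simp add: F_def add.commute)

lemma F_q [simp]: "F q i (q i) = q i"
  by (simp add: F_def scaleR_2[symmetric])

section \<open>Words, addresses of vertices, and the attractor\<close>

lemma Fw_append: "Fw q (v @ w) x = Fw q v (Fw q w x)"
  by (induction v) auto

lemma Fw_inj [simp]: "Fw q w x = Fw q w y \<longleftrightarrow> x = y"
  by (induction w) auto

lemma Fw_dist: "dist (Fw q w x) (Fw q w y) = dist x y / 2 ^ length w"
proof (induction w)
  case (Cons i w)
  have F: "dist (F q i a) (F q i b) = dist a b / 2" for a b
  proof -
    have "F q i a - F q i b = (1/2) *\<^sub>R (a - b)" by (simp add: F_def algebra_simps)
    then show ?thesis by (simp add: dist_norm)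
  qed
  show ?case by (simp add: F Cons.IH)
qed simp

lemma Fw_replicate [simp]: "Fw q (replicate k i) (q i) = q i"
  by (induction k) auto

lemma funpow_F: "(F q i ^^ m) x = Fw q (replicate m i) x"
  by (induction m arbitrary: x) auto

definition vx :: "3 list \<Rightarrow> 3 \<Rightarrow> plane" where "vx w i = Fw q w (q i)"

lemma vx_append: "vx (v @ w) i = Fw q v (vx w i)"
  by (simp add: vx_def Fw_append)

lemma vx_Cons: "vx (a # w) i = F q a (vx w i)"
  by (simp add: vx_def)

lemma vx_Nil: "vx [] i = q i" by (simp add: vx_def)

lemma vx_replicate [simp]: "vx (w @ replicate k i) i = vx w i"
  by (simp add: vx_def Fw_append)

lemma vx_last [simp]: "vx (w @ [i]) i = vx w i"
  by (simp add: vx_def Fw_append)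

lemma vx_swap: "vx (w @ [i]) j = vx (w @ [j]) i"
  by (simp add: vx_def Fw_append F_swap)

lemma vx_junction: "vx (v @ a # replicate k b) b = vx (v @ b # replicate k a) a"
  by (simp add: vx_def Fw_append F_swap)

lemma V_eq: "V q n = {vx w i | w i. length w = n}"
proof (induction n)
  case 0 then show ?case by (auto simp: vx_def)
next
  case (Suc n)
  have "V q (Suc n) = (\<Union>a. F q a ` {vx w i | w i. length w = n})" using Suc by simp
  also have "\<dots> = {vx w i | w i. length w = Suc n}"
    by (auto simp: length_Suc_conv image_iff vx_Cons) (metis vx_Cons length_Cons)+
  finally show ?case .
qed

lemma vx_in_V: "length w = n \<Longrightarrow> vx w i \<in> V q n" by (auto simp: V_eq)

definition vertices :: "plane set" where "vertices = range (\<lambda>(w,i). vx w i)"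

lemma vx_in_vertices [simp]: "vx w i \<in> vertices" by (auto simp: vertices_def)

lemma q_in_vertices [simp]: "q i \<in> vertices" using vx_in_vertices[of "[]" i] by (simp add: vx_def)

lemma vertices_eq: "vertices = (\<Union>i. F q i ` vertices)"
proof
  show "vertices \<subseteq> (\<Union>i. F q i ` vertices)"
  proof
    fix x assume "x \<in> vertices"
    then obtain w i where x: "x = vx w i" by (auto simp: vertices_def)
    then have "x = vx (w @ [i]) i" by simp
    moreover obtain a u where "w @ [i] = a # u" by (metis list.exhaust snoc_eq_iff_butlast)
    ultimately show "x \<in> (\<Union>i. F q i ` vertices)" by (metis UN_I UNIV_I image_eqI vx_Cons vx_in_vertices)
  qed
  show "(\<Union>i. F q i ` vertices) \<subseteq> vertices"
    by (auto simp: vertices_def image_iff) (metis vx_Cons)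
qed

lemma vertices_triangle: "vertices \<subseteq> triangle"
proof -
  have "vx w i \<in> triangle" for w i
    by (induction w) (auto simp: vx_Nil vx_Cons F_triangle)
  then show ?thesis by (auto simp: vertices_def)
qed

lemma compact_triangle: "compact triangle"
  unfolding triangle_def by (intro compact_convex_hull finite_imp_compact) auto

text \<open>A point of \<open>K\<close> lies in images of \<open>K\<close> under arbitrarily long
  words. The image of a fixed point of \<open>L\<close> under the same word is in \<open>L\<close>
  and arbitrarily close, and \<open>L\<close> is closed.\<close>

lemma attractor_unique:
  assumes "compact K" "K \<noteq> {}" "K = (\<Union>i. F q i ` K)" "compact L" "L \<noteq> {}" "L = (\<Union>i. F q i ` L)"
  shows "K \<subseteq> L"
proof
  fix x assume "x \<in> K"
  have split: "\<exists>w y. length w = n \<and> y \<in> K \<and> x = Fw q w y" for n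
  proof (induction n)
    case 0 then show ?case using \<open>x \<in> K\<close> by (intro exI[of _ "[]"]) auto
  next
    case (Suc n)
    then obtain w y where w: "length w = n" "y \<in> K" "x = Fw q w y" by blast
    then obtain i z where "z \<in> K" "y = F q i z" using assms(3) by blast
    then show ?case using w by (intro exI[of _ "w @ [i]"] exI[of _ z]) (auto simp: Fw_append)
  qed
  obtain z where z: "z \<in> L" using assms by auto
  have Fz: "Fw q w z \<in> L" for w
  proof (induction w)
    case (Cons a w) then show ?case using assms(6) by auto
  qed (use z in auto)
  obtain D where D: "\<And>y. y \<in> K \<Longrightarrow> dist z y \<le> D"
    using compact_imp_bounded[OF assms(1)] bounded_any_center[of K z] by auto
  have "\<exists>y\<in>L. dist y x < e" if "e > 0" for e
  proof -
    obtain n where n: "D / e < 2 ^ n" using real_arch_pow[of 2] by auto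
    obtain w y where w: "length w = n" "y \<in> K" "x = Fw q w y" using split by blast
    have "dist (Fw q w z) x \<le> D / 2 ^ n"
      using w D by (simp add: Fw_dist divide_right_mono)
    also have "\<dots> < e" using n that by (simp add: field_simps)
    finally show ?thesis using Fz by blast
  qed
  then show "x \<in> L" using compact_imp_closed[OF assms(4)] closure_approachable[of x L] by auto
qed

text \<open>The vertex set is already invariant, and the maps, being translates of a scaling,
  commute with closure. So the gasket is obtained as the closure of its vertices, and continuous
  functions on it are determined by their values there.\<close>

lemma closure_vertices_attractor:
  "compact (closure vertices)" "closure vertices \<noteq> {}" "closure vertices = (\<Union>i. F q i ` closure vertices)"
proof -
  show "compact (closure vertices)"
    using bounded_subset[OF compact_imp_bounded[OF compact_triangle] vertices_triangle]
    by (simp add: compact_closure)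
  show "closure vertices \<noteq> {}" by (metis closure_eq_empty empty_iff q_in_vertices)
  have "closure (F q i ` S) = F q i ` closure S" for i S
  proof -
    have "F q i ` T = (\<lambda>x. (1/2) *\<^sub>R q i + x) ` ((\<lambda>x. (1/2) *\<^sub>R x) ` T)" for T
      by (simp add: image_image F_def scaleR_add_right add.commute)
    then show ?thesis by (simp add: closure_translation closure_scaleR)
  qed
  then show "closure vertices = (\<Union>i. F q i ` closure vertices)"
    by (subst vertices_eq) (simp add: UNIV_letter[of 0] closure_Un)
qed

lemma SG_eq: "SG q = closure vertices"
  unfolding SG_def
proof (rule the_equality)
  fix K assume K: "compact K \<and> K \<noteq> {} \<and> K = (\<Union>i. F q i ` K)"
  show "K = closure vertices"
    using attractor_unique[OF conjunct1[OF K] conjunct1[OF conjunct2[OF K]] conjunct2[OF conjunct2[OF K]]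
        closure_vertices_attractor]
      attractor_unique[OF closure_vertices_attractor conjunct1[OF K] conjunct1[OF conjunct2[OF K]]
        conjunct2[OF conjunct2[OF K]]]
    by (rule equalityI)
qed (intro conjI closure_vertices_attractor)

lemma compact_SG: "compact (SG q)" and SG_ne: "SG q \<noteq> {}" and SG_union: "SG q = (\<Union>i. F q i ` SG q)"
  unfolding SG_eq by (rule closure_vertices_attractor)+

lemma vertices_SG: "vertices \<subseteq> SG q"
  by (simp add: SG_eq closure_subset)

lemma vx_in_SG [simp]: "vx w i \<in> SG q" using vertices_SG by auto

lemma q_in_SG [simp]: "q i \<in> SG q" using vertices_SG by auto

lemma SG_triangle: "SG q \<subseteq> triangle"
  unfolding SG_eq by (rule closure_minimal[OF vertices_triangle]) (rule compact_imp_closed[OF compact_triangle])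

lemma Fw_in_SG: "x \<in> SG q \<Longrightarrow> Fw q w x \<in> SG q"
proof (induction w)
  case (Cons a w) then show ?case using SG_union by auto
qed auto

lemma SG_cell: "x \<in> SG q \<Longrightarrow> \<exists>w. length w = n \<and> x \<in> cell q w"
proof (induction n arbitrary: x)
  case 0 then show ?case by (intro exI[of _ "[]"]) (auto simp: cell_def)
next
  case (Suc n)
  then obtain i z where z: "z \<in> SG q" "x = F q i z" using SG_union by blast
  then obtain w where "length w = n" "z \<in> cell q w" using Suc.IH by blast
  then show ?case using z by (intro exI[of _ "i # w"]) (auto simp: cell_def)
qed

lemma compact_cell: "compact (cell q w)"
proof -
  have "continuous_on (SG q) (Fw q w)"
  proof (induction w)
    case (Cons a w)
    have "continuous_on UNIV (F q a)" unfolding F_def by (intro continuous_intros)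
    then show ?case using continuous_on_compose2[of UNIV "F q a" "SG q" "Fw q w"] Cons by (simp add: o_def)
  qed (auto simp: id_def)
  then show ?thesis unfolding cell_def by (rule compact_continuous_image[OF _ compact_SG])
qed

lemma vx_in_cell [simp]: "vx w i \<in> cell q w" by (auto simp: vx_def cell_def)

section \<open>Intersections of cells\<close>

lemma Fw_eq_q: "x \<in> SG q \<Longrightarrow> Fw q w x = q a \<Longrightarrow> w = replicate (length w) a \<and> x = q a"
proof (induction w)
  case (Cons b w)
  have t: "Fw q w x \<in> triangle" "q a \<in> triangle" using Cons.prems Fw_in_SG SG_triangle by auto
  have "b = a"
  proof (rule ccontr)
    assume "b \<noteq> a"
    moreover have "F q b (Fw q w x) = F q a (q a)" using Cons.prems by simp
    ultimately have "q a = q b" using F_eq_F(2)[OF t] by simp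
    then show False using \<open>b \<noteq> a\<close> by simp
  qed
  moreover from this have "F q a (Fw q w x) = F q a (q a)" using Cons.prems by simp
  then have "Fw q w x = q a" by (simp only: F_eq_iff)
  ultimately show ?case using Cons by simp
qed simp

text \<open>At the first letters that differ, \<open>F_eq_F\<close> puts the common point at the
  junction of two neighbouring subcells; a corner has only constant addresses, which forces the rest
  of both words. So cells of one level meet in at most one point, with the addresses
  \<open>v a b ... b\<close> and \<open>v b a ... a\<close>.\<close>

lemma cell_inter:
  assumes "x \<in> SG q" "y \<in> SG q" "length w = length w'" "Fw q w x = Fw q w' y"
  shows "w = w' \<and> x = y \<or> (\<exists>v a b k. a \<noteq> b \<and> w = v @ a # replicate k b \<and> w' = v @ b # replicate k a
      \<and> x = q b \<and> y = q a)"
  using assms(3,4)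
proof (induction w w' rule: list_induct2)
  case (Cons a w b w')
  show ?case
  proof (cases "a = b")
    case True
    then have "Fw q w x = Fw q w' y" using Cons.prems by simp
    from Cons.IH[OF this] show ?thesis
    proof
      assume "w = w' \<and> x = y" then show ?thesis using True by simp
    next
      assume "\<exists>v a b k. a \<noteq> b \<and> w = v @ a # replicate k b \<and> w' = v @ b # replicate k a \<and> x = q b \<and> y = q a"
      then obtain v c d k where "c \<noteq> d" "w = v @ c # replicate k d" "w' = v @ d # replicate k c" "x = q d" "y = q c"
        by blast
      then show ?thesis using True by (intro disjI2 exI[of _ "a # v"] exI[of _ c] exI[of _ d] exI[of _ k]) auto
    qed
  next
    case False
    have "Fw q w x \<in> triangle" "Fw q w' y \<in> triangle" using assms Fw_in_SG SG_triangle by auto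
    from F_eq_F[OF this False] Cons.prems have "Fw q w x = q b" "Fw q w' y = q a" by auto
    then have "w = replicate (length w) b" "x = q b" "w' = replicate (length w) a" "y = q a"
      using Fw_eq_q assms(1,2) Cons.hyps by metis+
    then show ?thesis using False
      by (intro disjI2 exI[of _ "[]"] exI[of _ a] exI[of _ b] exI[of _ "length w"]) auto
  qed
qed (use assms in auto)

lemma cell_vertex:
  assumes "p \<in> V q (length w)" "p \<in> cell q w"
  shows "\<exists>i. p = vx w i"
proof -
  obtain w' j where w': "length w' = length w" "p = vx w' j" using assms by (auto simp: V_eq)
  obtain x where x: "x \<in> SG q" "p = Fw q w x" using assms by (auto simp: cell_def)
  have "\<exists>i. x = q i"
    using cell_inter[OF x(1) q_in_SG[of j] w'(1)[symmetric]] x w' by (auto simp: vx_def)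
  then show ?thesis using x by (auto simp: vx_def)
qed

text \<open>Strips the final run of \<open>b\<close>. If nothing is left, the vertex
  \<open>vx w b\<close> is a corner of the gasket; otherwise the letter before the run names the
  other cell at this junction.\<close>

lemma split_word: "w = replicate (length w) b \<or> (\<exists>v a k. a \<noteq> b \<and> w = v @ a # replicate k b)" for b :: 3
proof (induction w rule: rev_induct)
  case (snoc c w)
  show ?case
  proof (cases "c = b")
    case True
    from snoc.IH show ?thesis
    proof
      assume "w = replicate (length w) b"
      then show ?thesis using True by (metis length_append_singleton replicate_append_same replicate_Suc)
    next
      assume "\<exists>v a k. a \<noteq> b \<and> w = v @ a # replicate k b"
      then obtain v a k where "a \<noteq> b" "w = v @ a # replicate k b" by blast
      then show ?thesis using True
        by (intro disjI2 exI[of _ v] exI[of _ a] exI[of _ "Suc k"]) (auto simp: replicate_append_same)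
    qed
  next
    case False
    then show ?thesis by (intro disjI2 exI[of _ w] exI[of _ c] exI[of _ 0]) auto
  qed
qed simp

lemma first_difference:
  "v @ a # x = v' @ a' # x' \<Longrightarrow> v @ b # y = v' @ b' # y' \<Longrightarrow> a \<noteq> b \<Longrightarrow> a' \<noteq> b' \<Longrightarrow> v = v' \<and> a = a' \<and> b = b'"
  by (induction v arbitrary: v') (auto simp: Cons_eq_append_conv append_eq_Cons_conv)

lemma split_word_unique:
  assumes "v @ a # replicate k b = v' @ a' # replicate k' b" "a \<noteq> b" "a' \<noteq> b"
  shows "v = v' \<and> a = a' \<and> k = k'"
proof -
  have *: "k = length (takeWhile (\<lambda>c. c = b) (rev (v @ a # replicate k b)))" if "a \<noteq> b" for v a k
    using that by (simp add: takeWhile_append)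
  have "k = k'" using *[OF assms(2), of k v] *[OF assms(3), of k' v'] assms(1) by simp
  then show ?thesis using assms(1) by simp
qed

section \<open>Interior vertices, their neighbours, and nearby points\<close>

lemma interior_vertex:
  assumes "x \<in> V q n - V q 0"
  obtains v a b k where "a \<noteq> b" "n = length v + Suc k" "x = vx (v @ a # replicate k b) b"
proof -
  obtain w b where w: "length w = n" "x = vx w b" using assms by (auto simp: V_eq)
  have "w \<noteq> replicate (length w) b"
  proof
    assume "w = replicate (length w) b"
    then have "x = q b" using w by (metis Fw_replicate vx_def)
    then show False using assms by auto
  qed
  then show ?thesis using split_word[of w b] w that by (metis length_Cons length_append length_replicate add_Suc_right)
qed

lemma junction_interior:
  assumes "a \<noteq> b"
  shows "vx (v @ a # replicate k b) b \<in> V q (length v + Suc k) - V q 0"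
proof
  show "vx (v @ a # replicate k b) b \<in> V q (length v + Suc k)" by (rule vx_in_V) auto
  show "vx (v @ a # replicate k b) b \<notin> V q 0"
  proof
    assume "vx (v @ a # replicate k b) b \<in> V q 0"
    then obtain c where "Fw q (v @ a # replicate k b) (q b) = q c" by (auto simp: vx_def)
    from Fw_eq_q[OF q_in_SG this] have "v @ a # replicate k b = replicate (length v + Suc k) c" "b = c" by auto
    then have "a \<in> set (replicate (length v + Suc k) c)" by (metis in_set_conv_decomp)
    then show False using assms \<open>b = c\<close> by auto
  qed
qed

text \<open>By \<open>cell_inter\<close> exactly two cells of this level contain the junction, and
  each contributes its two other corners. These are four different points since the two cells share
  only the junction.\<close>

lemma nbrs_junction:
  fixes v :: "3 list" and k :: nat
  assumes "a \<noteq> b"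
  defines "w \<equiv> v @ a # replicate k b" and "w' \<equiv> v @ b # replicate k a"
  shows "nbrs q (length v + Suc k) (vx w b) = {vx w (b + 1), vx w (b + 2)} \<union> {vx w' (a + 1), vx w' (a + 2)}"
    and "{vx w (b + 1), vx w (b + 2)} \<inter> {vx w' (a + 1), vx w' (a + 2)} = {}"
proof -
  have len: "length w = length v + Suc k" "length w' = length v + Suc k" by (auto simp: w_def w'_def)
  have x: "vx w b = vx w' a" unfolding w_def w'_def by (rule vx_junction)
  have ww: "w \<noteq> w'" using assms(1) by (auto simp: w_def w'_def)
  have cells: "w0 = w \<or> w0 = w'" if l: "length w0 = length w" and c: "vx w b \<in> cell q w0" for w0
  proof -
    obtain y where y: "y \<in> SG q" "vx w b = Fw q w0 y" using c unfolding cell_def by blast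
    have "Fw q w (q b) = Fw q w0 y" using y(2) by (simp add: vx_def)
    from cell_inter[OF q_in_SG y(1) l[symmetric] this]
    have "w = w0 \<or> (\<exists>v' a' k'. a' \<noteq> b \<and> w = v' @ a' # replicate k' b \<and> w0 = v' @ b # replicate k' a')"
      by fastforce
    then show ?thesis using split_word_unique[of v a k b] assms(1) unfolding w_def w'_def by blast
  qed
  have vxinj: "vx u i = vx u j \<longleftrightarrow> i = j" for u i j by (simp add: vx_def)
  have mem: "vx u i \<in> nbrs q (length w) (vx w b)"
    if u: "length u = length w" "vx u j = vx w b" "i \<noteq> j" for u i j
  proof -
    have "vx u i \<noteq> vx w b" using u vxinj by metis
    moreover have "vx w b \<in> cell q u" using u(2) vx_in_cell by metis
    ultimately show ?thesis unfolding nbrs_def using u(1) vx_in_V[OF u(1)] vx_in_cell by blast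
  qed
  have "nbrs q (length w) (vx w b) = vx w ` {i. i \<noteq> b} \<union> vx w' ` {i. i \<noteq> a}"
  proof (intro equalityI subsetI)
    fix y assume y: "y \<in> nbrs q (length w) (vx w b)"
    then obtain w0 where w0: "length w0 = length w" "vx w b \<in> cell q w0" "y \<in> cell q w0" "y \<in> V q (length w)" "y \<noteq> vx w b"
      by (auto simp: nbrs_def)
    obtain i where "y = vx w0 i" using cell_vertex[of y w0] w0 by auto
    then show "y \<in> vx w ` {i. i \<noteq> b} \<union> vx w' ` {i. i \<noteq> a}"
      using cells[OF w0(1,2)] w0(5) x by auto
  next
    fix y assume "y \<in> vx w ` {i. i \<noteq> b} \<union> vx w' ` {i. i \<noteq> a}"
    then show "y \<in> nbrs q (length w) (vx w b)"
      using mem[of w b] mem[of w' a] len x by auto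
  qed
  moreover have "{i. i \<noteq> c} = {c + 1, c + 2}" for c :: 3 using letter_cases[of _ c] by auto
  ultimately show "nbrs q (length v + Suc k) (vx w b) = {vx w (b + 1), vx w (b + 2)} \<union> {vx w' (a + 1), vx w' (a + 2)}"
    using len by simp
  have "i = b" if eq: "vx w i = vx w' j" for i j
  proof -
    from cell_inter[of "q i" "q j" w w'] eq ww len obtain v' a' b' k' where
      "a' \<noteq> b'" "w = v' @ a' # replicate k' b'" "w' = v' @ b' # replicate k' a'" "i = b'"
      by (auto simp: vx_def)
    then show ?thesis using first_difference[of v a _ v' a' _ b _ b'] assms(1) unfolding w_def w'_def by metis
  qed
  then have "vx w (b + 1) \<noteq> vx w' j" "vx w (b + 2) \<noteq> vx w' j" for j
    using letter_neq by metis+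
  then show "{vx w (b + 1), vx w (b + 2)} \<inter> {vx w' (a + 1), vx w' (a + 2)} = {}"
    by blast
qed

definition opposite :: "(plane \<Rightarrow> 'b::ab_group_add) \<Rightarrow> 3 list \<Rightarrow> 3 \<Rightarrow> 'b" where
  "opposite f w i = f (vx w (i + 1)) + f (vx w (i + 2))"

lemma sum_nbrs:
  fixes v :: "3 list" and k :: nat
  assumes "a \<noteq> b"
  defines "w \<equiv> v @ a # replicate k b" and "w' \<equiv> v @ b # replicate k a"
  shows "(\<Sum>y\<in>nbrs q (length v + Suc k) (vx w b). f y) = opposite f w b + opposite f w' a"
proof -
  have vxinj: "vx u i = vx u j \<longleftrightarrow> i = j" for u i j by (simp add: vx_def)
  show ?thesis
    unfolding w_def w'_def nbrs_junction(1)[OF assms(1)]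
    by (subst sum.union_disjoint) (use nbrs_junction(2)[OF assms(1), of v k] in \<open>auto simp: opposite_def vxinj\<close>)
qed

lemma card_nbrs: "x \<in> V q n - V q 0 \<Longrightarrow> card (nbrs q n x) = 4"
proof -
  assume "x \<in> V q n - V q 0"
  then obtain v a b k where x: "a \<noteq> b" "n = length v + Suc k" "x = vx (v @ a # replicate k b) b"
    by (rule interior_vertex)
  have "int (card (nbrs q n x)) = (\<Sum>y\<in>nbrs q n x. 1)" by simp
  also have "\<dots> = 4" using sum_nbrs[OF x(1), where v = v and k = k and f = "\<lambda>_. 1::int"] x by (simp add: opposite_def)
  finally show ?thesis by simp
qed

text \<open>There are finitely many pairs of disjoint cells of level \<open>n\<close>, and these are
  compact, so their distances are bounded below. Closer points lie in cells that meet, and cells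
  meet in a common vertex.\<close>

lemma close_points:
  "\<exists>\<delta>>0. \<forall>x\<in>SG q. \<forall>y\<in>SG q. dist x y < \<delta> \<longrightarrow>
     (\<exists>w w' i j. length w = n \<and> length w' = n \<and> x \<in> cell q w \<and> y \<in> cell q w' \<and> vx w i = vx w' j)"
proof -
  let ?W = "{w :: 3 list. length w = n}"
  have fin: "finite ?W" using finite_lists_length_eq[of "UNIV :: 3 set" n] by simp
  define P where "P = {p \<in> ?W \<times> ?W. cell q (fst p) \<inter> cell q (snd p) = {}}"
  have "finite P" unfolding P_def by (rule finite_subset[of _ "?W \<times> ?W"]) (use fin in auto)
  define Q where "Q = (\<lambda>p (d::real). d > 0 \<and> (\<forall>x\<in>cell q (fst p). \<forall>y\<in>cell q (snd p). d \<le> dist x y))"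
  have "\<forall>p\<in>P. \<exists>d. Q p d"
    using separate_compact_closed[OF compact_cell compact_imp_closed[OF compact_cell]] by (auto simp: Q_def P_def)
  then obtain d where "\<forall>p\<in>P. Q p (d p)" by metis
  then have d: "d p > 0" "\<And>x y. x \<in> cell q (fst p) \<Longrightarrow> y \<in> cell q (snd p) \<Longrightarrow> d p \<le> dist x y"
    if "p \<in> P" for p
    using that by (simp_all add: Q_def)
  define \<delta> where "\<delta> = Min (insert 1 (d ` P))"
  have fd: "finite (insert 1 (d ` P))" using \<open>finite P\<close> by simp
  have "\<delta> > 0" unfolding \<delta>_def using fd d(1) by (subst Min_gr_iff) auto
  moreover have "\<exists>w w' i j. length w = n \<and> length w' = n \<and> x \<in> cell q w \<and> y \<in> cell q w' \<and> vx w i = vx w' j"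
    if xy: "x \<in> SG q" "y \<in> SG q" "dist x y < \<delta>" for x y
  proof -
    obtain w w' where w: "length w = n" "x \<in> cell q w" "length w' = n" "y \<in> cell q w'"
      using SG_cell xy by metis
    have "cell q w \<inter> cell q w' \<noteq> {}"
    proof
      assume "cell q w \<inter> cell q w' = {}"
      then have p: "(w,w') \<in> P" using w by (auto simp: P_def)
      then have "\<delta> \<le> d (w,w')" unfolding \<delta>_def using fd by (intro Min_le) auto
      then show False using d(2)[OF p, of x y] w xy by auto
    qed
    then obtain x' y' where *: "x' \<in> SG q" "y' \<in> SG q" "Fw q w x' = Fw q w' y'" by (auto simp: cell_def)
    have "length w = length w'" using w by simp
    from cell_inter[OF *(1,2) this *(3)] have "\<exists>i j. vx w i = vx w' j"
      using *(3) unfolding vx_def by metis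
    then show ?thesis using w by blast
  qed
  ultimately show ?thesis by blast
qed

end

section \<open>Spectral decimation\<close>

context gasket
begin

text \<open>The graph Laplacian with the positive sign, at the junction with the addresses
  \<open>v a b ... b\<close> and \<open>v b a ... a\<close> on the level
  \<open>length v + Suc k\<close>. Addressing it by both words lets the neighbours be read off
  without sets, also for values in a vector space.\<close>

definition graph_lap :: "(plane \<Rightarrow> 'b::real_vector) \<Rightarrow> 3 list \<Rightarrow> 3 \<Rightarrow> 3 \<Rightarrow> nat \<Rightarrow> 'b" where
  "graph_lap f v a b k = 4 *\<^sub>R f (vx (v @ a # replicate k b) b)
     - opposite f (v @ a # replicate k b) b - opposite f (v @ b # replicate k a) a"

lemma sum_nbrs_graph_lap:
  fixes f :: "plane \<Rightarrow> real"
  assumes "a \<noteq> b" "n = length v + Suc k"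
  shows "(\<Sum>y\<in>nbrs q n (vx (v @ a # replicate k b) b). f y - f (vx (v @ a # replicate k b) b)) = - graph_lap f v a b k"
  using card_nbrs[OF junction_interior[OF assms(1), of v k]]
  unfolding assms(2) sum_subtractf sum_nbrs[OF assms(1)] by (simp add: graph_lap_def opposite_def)

lemma has_laplacian_SG_iff:
  "has_laplacian_SG q u f \<longleftrightarrow> continuous_on (SG q) u \<and> continuous_on (SG q) f \<and>
     (\<forall>\<epsilon>>0. \<exists>M. \<forall>v a b k. a \<noteq> b \<longrightarrow> M \<le> length v + Suc k \<longrightarrow>
        \<bar>- (3/2 * 5 ^ (length v + Suc k) * graph_lap u v a b k) - f (vx (v @ a # replicate k b) b)\<bar> < \<epsilon>)"
proof -
  have "(\<forall>m\<ge>M. \<forall>x \<in> V q m - V q 0. \<bar>3 / 2 * 5 ^ m * (\<Sum>y \<in> nbrs q m x. u y - u x) - f x\<bar> < \<epsilon>)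
      \<longleftrightarrow> (\<forall>v a b k. a \<noteq> b \<longrightarrow> M \<le> length v + Suc k \<longrightarrow>
        \<bar>- (3/2 * 5 ^ (length v + Suc k) * graph_lap u v a b k) - f (vx (v @ a # replicate k b) b)\<bar> < \<epsilon>)"
    (is "?A \<longleftrightarrow> ?B") for M \<epsilon>
  proof
    assume A: ?A
    show ?B
    proof (intro allI impI)
      fix v :: "3 list" and a k and b :: 3 assume ab: "a \<noteq> b" and M: "M \<le> length v + Suc k"
      show "\<bar>- (3/2 * 5 ^ (length v + Suc k) * graph_lap u v a b k) - f (vx (v @ a # replicate k b) b)\<bar> < \<epsilon>"
        using A[rule_format, OF M junction_interior[OF ab]] unfolding sum_nbrs_graph_lap[OF ab refl] by simp
    qed
  next
    assume B: ?B
    show ?A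
    proof (intro allI impI ballI)
      fix m x assume m: "M \<le> m" and x: "x \<in> V q m - V q 0"
      from x obtain v a b k where *: "a \<noteq> b" "m = length v + Suc k" "x = vx (v @ a # replicate k b) b"
        by (rule interior_vertex)
      show "\<bar>3 / 2 * 5 ^ m * (\<Sum>y \<in> nbrs q m x. u y - u x) - f x\<bar> < \<epsilon>"
        using B[rule_format, OF *(1), of v k] m unfolding *(3) sum_nbrs_graph_lap[OF *(1,2)] by (simp add: *(2))
    qed
  qed
  then show ?thesis unfolding has_laplacian_SG_def by simp
qed

text \<open>In the subdivision of the cell \<open>w\<close>, the values at the corners are \<open>p\<close>, \<open>b\<close>, \<open>c\<close> and those at the
  midpoints opposite to \<open>c\<close>, \<open>b\<close>, \<open>p\<close> are \<open>s1\<close>, \<open>s2\<close>, \<open>s3\<close>.\<close>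

lemma graph_lap_midpoints:
  fixes f :: "plane \<Rightarrow> 'b::real_vector"
  defines "p w i \<equiv> f (vx w i)" and "s1 w i \<equiv> f (vx (w @ [i]) (i + 1))"
    and "s2 w i \<equiv> f (vx (w @ [i]) (i + 2))" and "s3 w i \<equiv> f (vx (w @ [i + 1]) (i + 2))"
  shows "graph_lap f w i (i + 1) 0 = 4 *\<^sub>R s1 w i - (p w i + p w (i + 1) + s2 w i + s3 w i)"
    and "graph_lap f w i (i + 2) 0 = 4 *\<^sub>R s2 w i - (p w i + p w (i + 2) + s1 w i + s3 w i)"
    and "graph_lap f w (i + 1) (i + 2) 0 = 4 *\<^sub>R s3 w i - (p w (i + 1) + p w (i + 2) + s1 w i + s2 w i)"
  unfolding assms graph_lap_def opposite_def
  by (simp_all add: vx_swap[of w "i + 1" i] vx_swap[of w "i + 2" i] vx_swap[of w "i + 2" "i + 1"])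

lemma opposite_last: "opposite f (w @ [i]) i = f (vx (w @ [i]) (i + 1)) + f (vx (w @ [i]) (i + 2))"
  by (simp add: opposite_def)

lemma vx_replicate_Suc: "vx (v @ a # replicate (Suc k) b) b = vx (v @ a # replicate k b) b"
  by (simp add: vx_def Fw_append)

lemma graph_lap_Suc:
  "graph_lap f v a b (Suc k) = 4 *\<^sub>R f (vx (v @ a # replicate k b) b)
     - opposite f ((v @ a # replicate k b) @ [b]) b - opposite f ((v @ b # replicate k a) @ [a]) a"
proof -
  have e: "v @ c # replicate (Suc k) d = (v @ c # replicate k d) @ [d]" for c d
    by (simp add: replicate_append_same)
  show ?thesis unfolding graph_lap_def vx_replicate_Suc unfolding e ..
qed

text \<open>The decimation identity at \<open>K = 0\<close>. The weights on the right add up to 10 +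
  2 (2 + 8) = 30, five times the 6 on the left, so the graph Laplacians multiplied by powers of 5
  are weighted means of those one level deeper.\<close>

lemma graph_lap_real_average:
  fixes f :: "plane \<Rightarrow> real"
  defines "e w i \<equiv> 2 * graph_lap f w (i + 1) (i + 2) 0 + 4 * (graph_lap f w i (i + 1) 0 + graph_lap f w i (i + 2) 0)"
  shows "6 * graph_lap f v a b k = 10 * graph_lap f v a b (Suc k)
     + e (v @ a # replicate k b) b + e (v @ b # replicate k a) a"
  unfolding assms graph_lap_midpoints graph_lap_Suc opposite_last
  by (simp add: graph_lap_def vx_junction[of v a k b] opposite_def)

text \<open>The limit controls the quotients only from some unknown level on. By the averaging
  identity the bound moves to all coarser levels without loss, so it holds with a constant that does
  not depend on that level.\<close>

lemma graph_lap_bound: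
  assumes lap: "has_laplacian_SG q u f" and B: "\<And>x. x \<in> SG q \<Longrightarrow> \<bar>f x\<bar> \<le> B" and ab: "a \<noteq> b"
  shows "\<bar>3/2 * 5 ^ (length v + Suc k) * graph_lap u v a b k\<bar> \<le> B"
proof (rule field_le_epsilon)
  fix \<epsilon> :: real assume "\<epsilon> > 0"
  then obtain M where M: "\<And>v a b k. a \<noteq> b \<Longrightarrow> M \<le> length v + Suc k \<Longrightarrow>
        \<bar>- (3/2 * 5 ^ (length v + Suc k) * graph_lap u v a b k) - f (vx (v @ a # replicate k b) b)\<bar> < \<epsilon>"
    using lap unfolding has_laplacian_SG_iff by metis
  have "\<forall>v a b k. a \<noteq> b \<longrightarrow> M \<le> length v + Suc k + d \<longrightarrow>
      \<bar>3/2 * 5 ^ (length v + Suc k) * graph_lap u v a b k\<bar> \<le> B + \<epsilon>" for d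
  proof (induction d)
    case 0
    show ?case
    proof (intro allI impI)
      fix v :: "3 list" and a k and b :: 3 assume "a \<noteq> b" "M \<le> length v + Suc k + 0"
      then show "\<bar>3/2 * 5 ^ (length v + Suc k) * graph_lap u v a b k\<bar> \<le> B + \<epsilon>"
        using M[of a b v k] B[OF vx_in_SG, of "v @ a # replicate k b" b] by (simp add: abs_less_iff abs_le_iff)
    qed
  next
    case (Suc d)
    show ?case
    proof (intro allI impI)
      fix v :: "3 list" and a k and b :: 3 assume ab: "a \<noteq> b" and le: "M \<le> length v + Suc k + Suc d"
      define c where "c = 3/2 * (5::real) ^ (length v + Suc k)"
      \<comment> \<open>The bound for unscaled Laplacians one level deeper; averaging costs a factor
        5, and one level of scaling returns it.\<close>
      define X where "X = (B + \<epsilon>) / (5 * c)"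
      have c: "c > 0" by (simp add: c_def)
      have IH: "\<bar>graph_lap u v' a' b' k'\<bar> \<le> X"
        if "a' \<noteq> b'" "length v' + Suc k' = Suc (length v + Suc k)" for v' a' b' k'
        using Suc[rule_format, OF that(1), of v' k'] that(2) le c
        by (simp add: X_def c_def field_simps abs_mult)
      have avg: "\<bar>graph_lap u v a b k\<bar> \<le> 5 * X"
        using graph_lap_real_average[of u v a b k] IH[of a b v "Suc k"] ab
          IH[of "b+1" "b+2" "v @ a # replicate k b" 0] IH[of b "b+1" "v @ a # replicate k b" 0]
          IH[of b "b+2" "v @ a # replicate k b" 0] IH[of "a+1" "a+2" "v @ b # replicate k a" 0]
          IH[of a "a+1" "v @ b # replicate k a" 0] IH[of a "a+2" "v @ b # replicate k a" 0]
        by (simp add: abs_le_iff)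
      have "\<bar>c * graph_lap u v a b k\<bar> = c * \<bar>graph_lap u v a b k\<bar>" using c by (simp add: abs_mult)
      also have "\<dots> \<le> c * (5 * X)" using avg c by (intro mult_left_mono) auto
      also have "\<dots> = B + \<epsilon>" using c by (simp add: X_def)
      finally show "\<bar>3/2 * 5 ^ (length v + Suc k) * graph_lap u v a b k\<bar> \<le> B + \<epsilon>" by (simp add: c_def)
    qed
  qed
  from this[of M] ab show "\<bar>3/2 * 5 ^ (length v + Suc k) * graph_lap u v a b k\<bar> \<le> B + \<epsilon>" by simp
qed

section \<open>Residuals of the level equations\<close>

definition residual :: "real \<Rightarrow> (plane \<Rightarrow> bseq) \<Rightarrow> 3 list \<Rightarrow> 3 \<Rightarrow> 3 \<Rightarrow> nat \<Rightarrow> bseq" where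
  "residual r G v a b k = graph_lap G v a b k
     - opr (r / 5 ^ (length v + Suc k)) decim (G (vx (v @ a # replicate k b) b))"

definition level :: "real \<Rightarrow> nat \<Rightarrow> (plane \<Rightarrow> bseq) \<Rightarrow> bool" where
  "level r n G \<longleftrightarrow> (\<forall>v a b k. a \<noteq> b \<longrightarrow> n = length v + Suc k \<longrightarrow> residual r G v a b k = 0)"

text \<open>Decimation as an identity for defects of arbitrary functions: \<open>6 - K\<close> of
  the coarse residual is \<open>(2 - K) (5 - K)\<close> of the fine one at the same vertex plus
  terms at the adjacent new midpoints. It transports equations to coarser levels by inverting
  \<open>6 - K\<close>, and to finer ones, once the midpoint equations hold, by inverting
  \<open>2 - K\<close> and \<open>5 - K\<close>.\<close>

lemma residual_decimation:
  fixes G :: "plane \<Rightarrow> bseq"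
  assumes r: "0 \<le> r"
  defines "\<rho> v k \<equiv> r / 5 ^ Suc (length v + Suc k)"
  defines "K v k \<equiv> opr (\<rho> v k) decim"
  defines "e L w i \<equiv> 2 *\<^sub>R residual r G w (i + 1) (i + 2) 0 + (4 *\<^sub>R (residual r G w i (i + 1) 0 + residual r G w i (i + 2) 0)
     - L (residual r G w i (i + 1) 0 + residual r G w i (i + 2) 0))"
  shows "6 *\<^sub>R residual r G v a b k - K v k (residual r G v a b k) =
    (10 *\<^sub>R residual r G v a b (Suc k) - 7 *\<^sub>R K v k (residual r G v a b (Suc k)) + K v k (K v k (residual r G v a b (Suc k))))
     + e (K v k) (v @ a # replicate k b) b + e (K v k) (v @ b # replicate k a) a"
proof -
  have c: "convergent_at (\<rho> v k) decim" using r by (simp add: \<rho>_def)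
  have len: "length (v @ c # replicate k d) + Suc 0 = Suc (length v + Suc k)" for c d by simp
  have K0: "opr (r / 5 ^ (length v + Suc k)) decim s = 5 *\<^sub>R K v k s - K v k (K v k s)" for s
    using opr_decim_step[of "r / 5 ^ (length v + Suc k)" s] r by (simp add: K_def \<rho>_def mult.commute)
  have KL: "opr (r / 5 ^ Suc (length v + Suc k)) decim = K v k" by (simp add: K_def \<rho>_def)
  have KS: "opr (r / 5 ^ (length v + Suc (Suc k))) decim = K v k" by (simp add: K_def \<rho>_def)
  have lin: "K v k (s + t) = K v k s + K v k t" "K v k (s - t) = K v k s - K v k t"
    "K v k (x *\<^sub>R s) = x *\<^sub>R K v k s" for s t x
    by (simp_all add: K_def opr_linear[OF c])
  show ?thesis
    unfolding e_def residual_def len KL KS K0 graph_lap_midpoints graph_lap_Suc opposite_last vx_replicate_Suc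
    by (rule bcontfun_eqI)
      (simp add: lin graph_lap_def opposite_def vx_junction[of v a k b] algebra_simps)
qed

definition residual_le :: "real \<Rightarrow> nat \<Rightarrow> (plane \<Rightarrow> bseq) \<Rightarrow> real \<Rightarrow> bool" where
  "residual_le r n G E \<longleftrightarrow> (\<forall>v a b k. a \<noteq> b \<longrightarrow> n = length v + Suc k \<longrightarrow> norm (residual r G v a b k) \<le> E)"

lemma residual_leD: "residual_le r n G E \<Longrightarrow> a \<noteq> b \<Longrightarrow> length v + Suc k = n \<Longrightarrow> norm (residual r G v a b k) \<le> E"
  by (auto simp: residual_le_def)

lemma level_iff_residual_le: "level r n G \<longleftrightarrow> residual_le r n G 0"
  by (simp add: level_def residual_le_def)

lemma residual_step:
  assumes r: "0 \<le> r" and c: "r / 5 ^ Suc n < rad3"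
    and A: "\<And>s. norm (opr (r / 5 ^ Suc n) (resolvent 6) s) \<le> A * norm s" "0 \<le> A"
    and B: "\<And>s. norm (opr (r / 5 ^ Suc n) decim s) \<le> B * norm s" "0 \<le> B"
    and E: "residual_le r (Suc n) G E"
  shows "residual_le r n G (A * (30 + 11 * B + B * B) * E)"
  unfolding residual_le_def
proof (intro allI impI)
  fix v :: "3 list" and a b :: 3 and k assume ab: "a \<noteq> b" and n: "n = length v + Suc k"
  define K where "K = opr (r / 5 ^ Suc n) decim"
  define R where "R = residual r G v a b k"
  define e where "e = (\<lambda>w i. 2 *\<^sub>R residual r G w (i + 1) (i + 2) 0 + (4 *\<^sub>R (residual r G w i (i + 1) 0 + residual r G w i (i + 2) 0)
     - K (residual r G w i (i + 1) 0 + residual r G w i (i + 2) 0)))"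
  let ?R' = "residual r G v a b (Suc k)"
  have eq: "6 *\<^sub>R R - K R = (10 *\<^sub>R ?R' - 7 *\<^sub>R K ?R' + K (K ?R'))
      + e (v @ a # replicate k b) b + e (v @ b # replicate k a) a"
    using residual_decimation[OF r, of G v a b k] by (simp add: K_def R_def e_def n)
  have cI: "convergent_at (r / 5 ^ Suc n) (resolvent 6)"
    by (rule convergent_at_resolvent_3) (use r c in auto)
  have E0: "0 \<le> E" by (rule order_trans[OF norm_ge_zero residual_leD[OF E ab, of v "Suc k"]]) (simp add: n)
  have KB: "norm (K s) \<le> B * X" if "norm s \<le> X" for s X
    using B(1)[of s] mult_left_mono[OF that B(2)] by (simp add: K_def)
  have ne: "norm (e w i) \<le> 2 * E + (4 * (E + E) + B * (E + E))" if "length w = n" for w i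
  proof -
    have *: "norm (residual r G w i (i + 1) 0 + residual r G w i (i + 2) 0) \<le> E + E"
      using residual_leD[OF E, of i "i+1" w 0] residual_leD[OF E, of i "i+2" w 0] that
      by (intro norm_triangle_le add_mono) auto
    have "norm (2 *\<^sub>R residual r G w (i + 1) (i + 2) 0) \<le> 2 * E"
      using residual_leD[OF E, of "i+1" "i+2" w 0] that by simp
    moreover have "norm (4 *\<^sub>R (residual r G w i (i + 1) 0 + residual r G w i (i + 2) 0)) \<le> 4 * (E + E)"
      using * by simp
    ultimately show ?thesis
      unfolding e_def by (intro norm_triangle_le add_mono order_trans[OF norm_triangle_ineq4] KB *) auto
  qed
  have R': "norm ?R' \<le> E" using residual_leD[OF E ab, of v "Suc k"] n by simp
  have "norm (10 *\<^sub>R ?R' - 7 *\<^sub>R K ?R' + K (K ?R')) \<le> (10 * E + 7 * (B * E)) + B * (B * E)"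
    using R' KB[OF R'] KB[OF KB[OF R']]
    by (intro norm_triangle_le add_mono order_trans[OF norm_triangle_ineq4]) auto
  note Y = this
  have "norm (6 *\<^sub>R R - K R) \<le> ((10 * E + 7 * (B * E)) + B * (B * E))
      + (2 * E + (4 * (E + E) + B * (E + E))) + (2 * E + (4 * (E + E) + B * (E + E)))"
    unfolding eq by (rule norm_triangle_mono[OF norm_triangle_mono[OF Y ne] ne]) (auto simp: n)
  also have "\<dots> = (30 + 11 * B + B * B) * E" by (simp add: algebra_simps)
  finally have le: "norm (6 *\<^sub>R R - K R) \<le> (30 + 11 * B + B * B) * E" .
  have "R = opr (r / 5 ^ Suc n) (resolvent 6) (6 *\<^sub>R R - K R)"
    unfolding K_def by (rule opr_resolvent(1)[OF cI, symmetric]) simp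
  then have "norm R \<le> A * norm (6 *\<^sub>R R - K R)" using A(1) by metis
  also have "\<dots> \<le> A * ((30 + 11 * B + B * B) * E)" by (intro mult_left_mono le A(2))
  finally show "norm (residual r G v a b k) \<le> A * (30 + 11 * B + B * B) * E"
    by (simp add: R_def mult_ac)
qed

lemma level_step:
  assumes "0 \<le> r" "r / 5 ^ Suc n < rad3" "level r (Suc n) G"
  shows "level r n G"
proof -
  have cI: "convergent_at (r / 5 ^ Suc n) (resolvent 6)"
    by (rule convergent_at_resolvent_3) (use assms in auto)
  have cd: "convergent_at (r / 5 ^ Suc n) decim" using assms by simp
  show ?thesis
    using residual_step[OF assms(1,2) norm_opr[OF cI] wnorm_nonneg[OF cI] norm_opr[OF cd] wnorm_nonneg[OF cd], of G 0]
      assms(3) by (simp add: level_iff_residual_le)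
qed

text \<open>For vanishing \<open>K\<close> the factor in \<open>residual_step\<close> is 30 / 6 = 5.
  The operators differ from their limits by a multiple of 5^-n, and these errors are summable, so
  iterated factors remain comparable to powers of 5.\<close>

lemma residual_step_asymptotic:
  assumes r: "0 \<le> r"
  shows "\<exists>D\<ge>0. \<exists>n1. \<forall>n\<ge>n1. \<forall>E\<ge>0. residual_le r (Suc n) G E \<longrightarrow> residual_le r n G (5 * (1 + D / 5 ^ n) * E)"
proof -
  define \<rho>0 where "\<rho>0 = min 1 (rad3 / 2)"
  have \<rho>0: "0 < \<rho>0" "\<rho>0 < rad3" "\<rho>0 \<le> 1" using rad3(1) by (auto simp: \<rho>0_def)
  have "convergent_at \<rho>0 (resolvent 6)" using \<rho>0 by (intro convergent_at_resolvent_3) auto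
  from opr_near_const[OF this \<rho>0(1)] obtain C where C: "C \<ge> 0"
    "\<And>\<rho> s. 0 \<le> \<rho> \<Longrightarrow> \<rho> \<le> \<rho>0 \<Longrightarrow> norm (opr \<rho> (resolvent 6) s - (1/6) *\<^sub>R s) \<le> C * \<rho> * norm s"
    by (auto simp: resolvent_nth_0)
  have "convergent_at \<rho>0 decim" using \<rho>0 by simp
  from opr_near_const[OF this \<rho>0(1)] obtain B where B: "B \<ge> 0"
    "\<And>\<rho> s. 0 \<le> \<rho> \<Longrightarrow> \<rho> \<le> \<rho>0 \<Longrightarrow> norm (opr \<rho> decim s) \<le> B * \<rho> * norm s"
    by auto
  define M where "M = 11 * B + B * B"
  have M: "M \<ge> 0" using B by (simp add: M_def)
  define C3 where "C3 = M / 6 + 30 * C + C * M"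
  have C3: "C3 \<ge> 0" using C M by (simp add: C3_def)
  obtain n1 where n1: "r / \<rho>0 < 5 ^ n1" using real_arch_pow[of 5] by auto
  show ?thesis
  \<comment> \<open>With \<open>\<rho> = r / 5 ^ Suc n\<close>, the error \<open>C3 * \<rho>\<close>
    in the factor equals 5 times \<open>C3 * r / 25 / 5 ^ n\<close>.\<close>
  proof (intro exI[of _ "C3 * r / 25"] conjI exI[of _ n1] allI impI)
    show "0 \<le> C3 * r / 25" using C3 r by simp
    fix n E assume n: "n1 \<le> n" and E: "0 \<le> (E::real)" "residual_le r (Suc n) G E"
    define \<rho> where "\<rho> = r / 5 ^ Suc n"
    have "(5::real) ^ n1 \<le> 5 ^ Suc n" using n by (intro power_increasing) auto
    then have "r / \<rho>0 < 5 ^ Suc n" using n1 by linarith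
    then have \<rho>: "0 \<le> \<rho>" "\<rho> \<le> \<rho>0" using r \<rho>0 by (auto simp: \<rho>_def field_simps)
    have A: "norm (opr \<rho> (resolvent 6) s) \<le> (1/6 + C * \<rho>) * norm s" for s
      using norm_triangle_ineq2[of "opr \<rho> (resolvent 6) s" "(1/6) *\<^sub>R s"] C(2)[OF \<rho>, of s]
      by (simp add: algebra_simps)
    have "residual_le r n G ((1/6 + C * \<rho>) * (30 + 11 * (B * \<rho>) + (B * \<rho>) * (B * \<rho>)) * E)"
      by (rule residual_step[OF r]) (use A B \<rho> \<rho>0 C(1) E(2) in \<open>auto simp: \<rho>_def[symmetric] simp del: power_Suc\<close>)
    moreover have "(1/6 + C * \<rho>) * (30 + 11 * (B * \<rho>) + (B * \<rho>) * (B * \<rho>)) \<le> 5 * (1 + C3 * r / 25 / 5 ^ n)"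
    proof -
      have "\<rho> * \<rho> \<le> \<rho> * 1" using \<rho> \<rho>0 by (intro mult_left_mono) auto
      then have 1: "(B * B) * (\<rho> * \<rho>) \<le> (B * B) * \<rho>" using B(1) by (simp add: mult_left_mono)
      have "30 + 11 * (B * \<rho>) + (B * \<rho>) * (B * \<rho>) \<le> 30 + M * \<rho>"
        using 1 by (simp add: M_def algebra_simps)
      then have "(1/6 + C * \<rho>) * (30 + 11 * (B * \<rho>) + (B * \<rho>) * (B * \<rho>)) \<le> (1/6 + C * \<rho>) * (30 + M * \<rho>)"
        using C(1) \<rho> by (intro mult_left_mono) auto
      also have "\<dots> = 5 + (M / 6 + 30 * C) * \<rho> + (C * M) * (\<rho> * \<rho>)" by (simp add: field_simps)
      also have "\<dots> \<le> 5 + (M / 6 + 30 * C) * \<rho> + (C * M) * \<rho>"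
        using \<open>\<rho> * \<rho> \<le> \<rho> * 1\<close> C(1) M by (intro add_left_mono mult_left_mono) auto
      also have "\<dots> = 5 * (1 + C3 * r / 25 / 5 ^ n)"
        by (simp add: C3_def \<rho>_def field_simps)
      finally show ?thesis .
    qed
    ultimately show "residual_le r n G (5 * (1 + C3 * r / 25 / 5 ^ n) * E)"
      unfolding residual_le_def using mult_right_mono[OF _ E(1)] order_trans by blast
  qed
qed

text \<open>A defect of size \<epsilon> / 5^N at a deep level N is amplified on the way to level m
  by at most 5^(N - m) times a bounded product. Since \<epsilon> is arbitrary, the defect at large m
  is exactly zero, and \<open>level_step\<close> carries the equation down to
  \<open>n\<close>.\<close>

lemma residuals_vanish:
  assumes r: "0 \<le> r" and lim: "\<And>\<epsilon>. 0 < \<epsilon> \<Longrightarrow> \<exists>N0. \<forall>N\<ge>N0. residual_le r N G (\<epsilon> / 5 ^ N)"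
    and n: "r / 5 ^ Suc n < rad3"
  shows "level r n G"
proof -
  obtain D n1 where D: "D \<ge> 0"
    "\<And>n E. n1 \<le> n \<Longrightarrow> 0 \<le> E \<Longrightarrow> residual_le r (Suc n) G E \<Longrightarrow> residual_le r n G (5 * (1 + D / 5 ^ n) * E)"
    using residual_step_asymptotic[OF r, of G] by blast
  have large: "level r m G" if "n1 \<le> m" for m
    unfolding level_def
  proof (intro allI impI)
    fix v :: "3 list" and a b :: 3 and k assume ab: "a \<noteq> b" and m: "m = length v + Suc k"
    have "norm (residual r G v a b k) \<le> 0"
    proof (rule field_le_epsilon)
      fix \<delta> :: real assume "\<delta> > 0"
      define \<epsilon> where "\<epsilon> = \<delta> / exp (2 * D)"
      have \<epsilon>: "\<epsilon> > 0" using \<open>\<delta> > 0\<close> by (simp add: \<epsilon>_def)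
      from lim[OF \<epsilon>] obtain N0 where N0: "\<And>N. N0 \<le> N \<Longrightarrow> residual_le r N G (\<epsilon> / 5 ^ N)" by blast
      define N where "N = max N0 m"
      have "m \<le> N" by (simp add: N_def)
      \<comment> \<open>The exponential absorbs the factors \<open>1 + D / 5 ^ j\<close>: the
        induction needs D / 5^j + 2 D / 5^(j+1) to be at most 2 D / 5^j.\<close>
      then have "residual_le r m G (\<epsilon> / 5 ^ m * exp (2 * D / 5 ^ m))"
      proof (induction rule: inc_induct)
        case base
        have "\<epsilon> / 5 ^ N * 1 \<le> \<epsilon> / 5 ^ N * exp (2 * D / 5 ^ N)"
          using \<epsilon> D(1) by (intro mult_left_mono) auto
        moreover have "residual_le r N G (\<epsilon> / 5 ^ N)" by (rule N0) (simp add: N_def)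
        ultimately show ?case unfolding residual_le_def by fastforce
      next
        case (step j)
        have "n1 \<le> j" using step \<open>n1 \<le> m\<close> by simp
        from D(2)[OF this _ step.IH] \<epsilon>
        have *: "residual_le r j G (5 * (1 + D / 5 ^ j) * (\<epsilon> / 5 ^ Suc j * exp (2 * D / 5 ^ Suc j)))" by simp
        have "5 * (1 + D / 5 ^ j) * (\<epsilon> / 5 ^ Suc j * exp (2 * D / 5 ^ Suc j))
            = \<epsilon> / 5 ^ j * ((1 + D / 5 ^ j) * exp (2 * D / 5 ^ Suc j))" by (simp add: divide_simps)
        also have "\<dots> \<le> \<epsilon> / 5 ^ j * (exp (D / 5 ^ j) * exp (2 * D / 5 ^ Suc j))"
          using \<epsilon> exp_ge_add_one_self[of "D / 5 ^ j"] by (intro mult_left_mono mult_right_mono) auto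
        also have "\<dots> = \<epsilon> / 5 ^ j * exp (D / 5 ^ j + 2 * D / 5 ^ Suc j)" by (simp only: exp_add)
        also have "\<dots> \<le> \<epsilon> / 5 ^ j * exp (2 * D / 5 ^ j)"
          using \<epsilon> D(1) by (intro mult_left_mono) (auto simp: field_simps)
        finally show ?case using * order_trans unfolding residual_le_def by blast
      qed
      then have "norm (residual r G v a b k) \<le> \<epsilon> / 5 ^ m * exp (2 * D / 5 ^ m)"
        using residual_leD ab m by blast
      also have "\<dots> \<le> \<epsilon> / 1 * exp (2 * D / 1)"
      proof (intro mult_mono)
        show "\<epsilon> / 5 ^ m \<le> \<epsilon> / 1" using \<epsilon> by (intro divide_left_mono) auto
        have "2 * D / 5 ^ m \<le> 2 * D / 1" using D(1) by (intro divide_left_mono) auto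
        then show "exp (2 * D / 5 ^ m) \<le> exp (2 * D / 1)" by simp
      qed (use \<epsilon> in auto)
      also have "\<dots> = \<delta>" by (simp add: \<epsilon>_def)
      finally show "norm (residual r G v a b k) \<le> 0 + \<delta>" by simp
    qed
    then show "residual r G v a b k = 0" by simp
  qed
  have "n \<le> max n n1" by simp
  then show ?thesis
  proof (induction rule: inc_induct)
    case base then show ?case using large by simp
  next
    case (step j)
    have "r / 5 ^ Suc j \<le> r / 5 ^ Suc n" using step r by (intro divide_left_mono power_increasing) auto
    then have "r / 5 ^ Suc j < rad3" using n by linarith
    from level_step[OF r this step.IH] show ?case .
  qed
qed

section \<open>Towers of iterated Laplacians\<close>

text \<open>A function together with all powers of its Laplacian, given as one sequence with a
  geometric bound. This avoids iterating a definite description and also covers functions on a cell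
  after rescaling.\<close>

definition tower :: "real \<Rightarrow> (nat \<Rightarrow> plane \<Rightarrow> real) \<Rightarrow> bool" where
  "tower R g \<longleftrightarrow> (\<forall>j. has_laplacian_SG q (g j) (g (Suc j))) \<and> (\<exists>C. \<forall>j. \<forall>x\<in>SG q. \<bar>g j x\<bar> \<le> C * R ^ j)"

text \<open>The normalization that turns \<open>-2/3\<close> times the Laplacian into \<open>r\<close> times the shift.\<close>

definition seq_of :: "real \<Rightarrow> (nat \<Rightarrow> plane \<Rightarrow> real) \<Rightarrow> plane \<Rightarrow> bseq" where
  "seq_of r g x = Bcontfun (\<lambda>j. (-2/3) ^ j * g j x / r ^ j)"

lemma apply_seq_of:
  assumes "0 \<le> R" "0 < r" "2/3 * R \<le> r" "\<And>j. \<bar>g j x\<bar> \<le> C * R ^ j"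
  shows "apply_bcontfun (seq_of r g x) j = (-2/3) ^ j * g j x / r ^ j" "norm (seq_of r g x) \<le> C"
proof -
  have C: "0 \<le> C" using assms(4)[of 0] by (simp add: order_trans[OF abs_ge_zero])
  have *: "\<bar>(-2/3) ^ j * g j x / r ^ j\<bar> \<le> C" for j
  proof -
    have "\<bar>(-2/3) ^ j * g j x / r ^ j\<bar> = (2/3) ^ j * \<bar>g j x\<bar> / r ^ j"
      using assms(2) by (simp add: abs_mult power_abs)
    also have "\<dots> \<le> (2/3) ^ j * (C * R ^ j) / r ^ j"
      using assms by (intro divide_right_mono mult_left_mono) auto
    also have "\<dots> = C * ((2/3 * R / r) ^ j)" by (simp add: power_mult_distrib power_divide)
    also have "\<dots> \<le> C * 1" using assms C by (intro mult_left_mono power_le_one) auto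
    finally show ?thesis by simp
  qed
  show ap: "apply_bcontfun (seq_of r g x) j = (-2/3) ^ j * g j x / r ^ j" for j
    unfolding seq_of_def by (rule apply_Bcontfun[OF *])
  show "norm (seq_of r g x) \<le> C" by (rule norm_bseq_le) (use ap * in auto)
qed

lemma apply_graph_lap: "apply_bcontfun (graph_lap G v a b k) j = graph_lap (\<lambda>x. apply_bcontfun (G x) j) v a b k"
  by (simp add: graph_lap_def opposite_def)

lemma graph_lap_cmult: "graph_lap (\<lambda>x. c * f x) v a b k = c * graph_lap f v a b k" for f :: "plane \<Rightarrow> real"
  by (simp add: graph_lap_def opposite_def algebra_simps)

lemma graph_lap_cong: "(\<And>w i. f (vx w i) = g (vx w i)) \<Longrightarrow> graph_lap f v a b k = graph_lap g v a b k"
  by (simp add: graph_lap_def opposite_def)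

text \<open>Each limit defining a power of the Laplacian gives a small residual in one component. To
  have it in the supremum norm, components of high index are bounded by
  \<open>graph_lap_bound\<close> and the growth rate, and only finitely many limits are used. The
  residuals are then o(5^-N), so they vanish.\<close>

theorem tower_level:
  assumes "tower R g" "0 \<le> R" "2/3 * R < r" "r / 5 ^ Suc n < rad3"
  shows "level r n (seq_of r g)"
proof (rule residuals_vanish)
  obtain C where C: "\<And>j x. x \<in> SG q \<Longrightarrow> \<bar>g j x\<bar> \<le> C * R ^ j" and lap: "\<And>j. has_laplacian_SG q (g j) (g (Suc j))"
    using assms(1) by (auto simp: tower_def)
  have r: "0 < r" using assms by linarith
  have C0: "0 \<le> C" using C[OF vx_in_SG[of "[]" 0], of 0] by (simp add: order_trans[OF abs_ge_zero])
  have ap: "apply_bcontfun (seq_of r g x) j = (-2/3) ^ j * g j x / r ^ j" "norm (seq_of r g x) \<le> C"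
    if "x \<in> SG q" for x j
    using apply_seq_of[of R r g x C] assms(2,3) r C[OF that] by auto
  show "0 \<le> r" using r by simp
  show "r / 5 ^ Suc n < rad3" by fact
  fix \<epsilon> :: real assume \<epsilon>: "\<epsilon> > 0"
  obtain C2 where C2: "C2 \<ge> 0" "\<And>\<rho> s. 0 \<le> \<rho> \<Longrightarrow> \<rho> \<le> r \<Longrightarrow> norm (opr \<rho> decim s - \<rho> *\<^sub>R shift s) \<le> C2 * \<rho>\<^sup>2 * norm s"
    using opr_decim_near_shift[OF r] by blast
  define \<theta> where "\<theta> = 2/3 * R / r"
  have \<theta>: "0 \<le> \<theta>" "\<theta> < 1" using assms r by (auto simp: \<theta>_def)
  have "(\<lambda>j. 2 * C * R * \<theta> ^ j) \<longlonglongrightarrow> 2 * C * R * 0"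
    using \<theta> by (intro tendsto_intros LIMSEQ_realpow_zero) auto
  then have "\<forall>\<^sub>F j in sequentially. 2 * C * R * \<theta> ^ j < \<epsilon> / 2"
    using \<epsilon> by (intro order_tendstoD(2)) auto
  \<comment> \<open>Because \<open>2/3 * R < r\<close> is strict, the rescaled components decay like
    powers of \<open>\<theta>\<close>, and from \<open>J\<close> on the crude bound is
    enough.\<close>
  then obtain J where J: "\<And>j. J \<le> j \<Longrightarrow> 2 * C * R * \<theta> ^ j < \<epsilon> / 2" by (auto simp: eventually_sequentially)
  define c where "c = (\<lambda>j. (2/3 / r) ^ j)"
  have c: "c j > 0" for j using r by (simp add: c_def)
  have "\<exists>M. \<forall>v a b k. a \<noteq> b \<longrightarrow> M \<le> length v + Suc k \<longrightarrow>
        \<bar>- (3/2 * 5 ^ (length v + Suc k) * graph_lap (g j) v a b k) - g (Suc j) (vx (v @ a # replicate k b) b)\<bar> < \<epsilon> / 2 / c j" for j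
    using lap[of j] \<epsilon> c[of j] unfolding has_laplacian_SG_iff by (metis half_gt_zero divide_pos_pos)
  then obtain M where M: "\<And>j v a b k. a \<noteq> b \<Longrightarrow> M j \<le> length v + Suc k \<Longrightarrow>
        \<bar>- (3/2 * 5 ^ (length v + Suc k) * graph_lap (g j) v a b k) - g (Suc j) (vx (v @ a # replicate k b) b)\<bar> < \<epsilon> / 2 / c j"
    by metis
  obtain N1 where N1: "2 * C2 * r\<^sup>2 * C / \<epsilon> < 5 ^ N1" using real_arch_pow[of 5] by auto
  define N0 where "N0 = Max (insert N1 (M ` {..<J}))"
  have N0: "N1 \<le> N0" "\<And>j. j < J \<Longrightarrow> M j \<le> N0" unfolding N0_def by (auto intro!: Max_ge)
  show "\<exists>N0. \<forall>N\<ge>N0. residual_le r N (seq_of r g) (\<epsilon> / 5 ^ N)"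
  proof (intro exI[of _ N0] allI impI)
    fix N assume N: "N0 \<le> N"
    show "residual_le r N (seq_of r g) (\<epsilon> / 5 ^ N)"
      unfolding residual_le_def
    proof (intro allI impI)
      fix v :: "3 list" and a b :: 3 and k assume ab: "a \<noteq> b" and NN: "N = length v + Suc k"
      define x where "x = vx (v @ a # replicate k b) b"
      let ?G = "seq_of r g" and ?L = "\<lambda>j. - (3/2 * 5 ^ N * graph_lap (g j) v a b k)"
      have x: "x \<in> SG q" by (simp add: x_def)
      have diff: "\<bar>apply_bcontfun (5 ^ N *\<^sub>R graph_lap ?G v a b k - r *\<^sub>R shift (?G x)) j\<bar> \<le> \<epsilon> / 2" for j
      proof -
        have lapG: "apply_bcontfun (graph_lap ?G v a b k) j = (-2/3) ^ j / r ^ j * graph_lap (g j) v a b k"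
          unfolding apply_graph_lap graph_lap_cmult[symmetric] by (rule graph_lap_cong) (simp add: ap)
        have "apply_bcontfun (5 ^ N *\<^sub>R graph_lap ?G v a b k - r *\<^sub>R shift (?G x)) j
            = (-2/3) ^ j / r ^ j * (-2/3) * (?L j - g (Suc j) x)"
          using r x by (simp add: lapG ap field_simps)
        also have "\<bar>\<dots>\<bar> = c j * (2/3) * \<bar>?L j - g (Suc j) x\<bar>"
          using r by (simp add: abs_mult power_abs c_def power_divide)
        also have "\<dots> \<le> c j * \<bar>?L j - g (Suc j) x\<bar>" using c[of j] by (simp add: mult_right_mono)
        also have "\<dots> \<le> \<epsilon> / 2"
        proof (cases "j < J")
          case True
          then have "\<bar>?L j - g (Suc j) x\<bar> < \<epsilon> / 2 / c j"
            using M[OF ab, of j v k] N0(2)[OF True] N NN by (simp add: x_def)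
          then show ?thesis using c[of j] by (simp add: field_simps)
        next
          case False
          have "\<bar>3/2 * 5 ^ (length v + Suc k) * graph_lap (g j) v a b k\<bar> \<le> C * R ^ Suc j"
            by (rule graph_lap_bound[OF lap C ab])
          then have "\<bar>?L j - g (Suc j) x\<bar> \<le> 2 * (C * R ^ Suc j)"
            using C[OF x, of "Suc j"] by (simp add: NN abs_le_iff)
          then have "c j * \<bar>?L j - g (Suc j) x\<bar> \<le> c j * (2 * (C * R ^ Suc j))"
            using c[of j] by (intro mult_left_mono) auto
          also have "\<dots> = 2 * C * R * \<theta> ^ j" by (simp add: c_def \<theta>_def power_mult_distrib power_divide)
          finally show ?thesis using J[of j] False by simp
        qed
        finally show ?thesis .
      qed
      have 5: "(5::real) ^ N > 0" by simp
      have "r / 5 ^ N \<le> r / 1" using r by (intro divide_left_mono) auto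
      then have "norm (opr (r / 5 ^ N) decim (?G x) - (r / 5 ^ N) *\<^sub>R shift (?G x)) \<le> C2 * (r / 5 ^ N)\<^sup>2 * norm (?G x)"
        using r by (intro C2(2)) auto
      also have "\<dots> \<le> C2 * (r / 5 ^ N)\<^sup>2 * C" using ap(2)[OF x] C2(1) by (intro mult_left_mono) auto
      also have "\<dots> = (C2 * r\<^sup>2 * C / 5 ^ N) / 5 ^ N" by (simp add: power2_eq_square)
      also have "\<dots> \<le> (\<epsilon> / 2) / 5 ^ N"
      proof (rule divide_right_mono)
        have "(5::real) ^ N1 \<le> 5 ^ N" using N N0(1) by (intro power_increasing) auto
        then have "2 * C2 * r\<^sup>2 * C / \<epsilon> < 5 ^ N" using N1 by linarith
        then show "C2 * r\<^sup>2 * C / 5 ^ N \<le> \<epsilon> / 2" using \<epsilon> by (simp add: field_simps)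
      qed simp
      finally have 2: "norm (opr (r / 5 ^ N) decim (?G x) - (r / 5 ^ N) *\<^sub>R shift (?G x)) \<le> (\<epsilon> / 2) / 5 ^ N" .
      have "residual r ?G v a b k = (1 / 5 ^ N) *\<^sub>R (5 ^ N *\<^sub>R graph_lap ?G v a b k - r *\<^sub>R shift (?G x))
          - (opr (r / 5 ^ N) decim (?G x) - (r / 5 ^ N) *\<^sub>R shift (?G x))"
        using 5 by (simp add: residual_def NN x_def scaleR_diff_right)
      also have "norm \<dots> \<le> (1 / 5 ^ N) * (\<epsilon> / 2) + (\<epsilon> / 2) / 5 ^ N"
      proof (rule order_trans[OF norm_triangle_ineq4 add_mono[OF _ 2]])
        have "(1 / 5 ^ N) * norm (5 ^ N *\<^sub>R graph_lap ?G v a b k - r *\<^sub>R shift (?G x)) \<le> (1 / 5 ^ N) * (\<epsilon> / 2)"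
          by (rule mult_left_mono[OF norm_bseq_le[OF diff]]) simp
        then show "norm ((1 / 5 ^ N) *\<^sub>R (5 ^ N *\<^sub>R graph_lap ?G v a b k - r *\<^sub>R shift (?G x))) \<le> (1 / 5 ^ N) * (\<epsilon> / 2)"
          by (simp only: norm_scaleR) simp
      qed
      finally show "norm (residual r ?G v a b k) \<le> \<epsilon> / 5 ^ N" by simp
    qed
  qed
qed

end

section \<open>Extension from a finite level\<close>

text \<open>The index of the midpoint between the corners \<open>a\<close> and \<open>i\<close> is the opposite corner \<open>- (a + i)\<close>.\<close>

definition midpoint_value :: "real \<Rightarrow> (3 \<Rightarrow> bseq) \<Rightarrow> 3 \<Rightarrow> bseq" where
  "midpoint_value \<rho> P c = opr \<rho> (resolvent 5) ((\<Sum>i\<in>UNIV. P i) - P c + 2 *\<^sub>R opr \<rho> (resolvent 2) (\<Sum>i\<in>UNIV. P i))"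

lemma opposite_letter [simp]: "- (i + (i + 1)) = (i::3) + 2" "- (i + (i + 2)) = (i::3) + 1" "- (i + 1 + i) = (i::3) + 2"
  "- (i + 2 + i) = (i::3) + 1" "- (i + 1 + (i + 2)) = (i::3)" "- (i + 2 + (i + 1)) = (i::3)"
proof -
  have "i + i + i = 0" using exhaust_3[of i] by auto
  then show "- (i + (i + 1)) = i + 2" "- (i + (i + 2)) = i + 1" "- (i + 1 + i) = i + 2"
    "- (i + 2 + i) = i + 1" "- (i + 1 + (i + 2)) = i" "- (i + 2 + (i + 1)) = i"
    by (simp_all add: minus_equation_iff[of _ "_ + _"] eq_neg_iff_add_eq_0 neg_eq_iff_add_eq_0 algebra_simps)
qed

context
  fixes \<rho> :: real
  assumes \<rho>: "0 \<le> \<rho>" "\<rho> < rad2"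
begin

lemma resolvents_25:
  shows "convergent_at \<rho> (resolvent 2)" "convergent_at \<rho> (resolvent 5)" "convergent_at \<rho> decim"
  using \<rho> by (auto intro: convergent_at_resolvent_2)

lemmas decim_linear = opr_linear[OF resolvents_25(3)]
lemmas res2 = opr_resolvent[OF resolvents_25(1), simplified]
lemmas res5 = opr_resolvent[OF resolvents_25(2), simplified]

text \<open>Adding the three midpoint equations gives \<open>2 - K\<close> on the sum of the
  midpoints, equal to twice the sum of the corners. Once this sum is known, each single equation has
  the form \<open>5 - K\<close> applied to its midpoint. Consistency is the computation that the
  values so defined have the assumed sum.\<close>

lemma midpoint_value_solves:
  fixes P :: "3 \<Rightarrow> bseq"
  defines "K \<equiv> opr \<rho> decim"
  defines "s c \<equiv> midpoint_value \<rho> P c"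
  shows "4 *\<^sub>R s (i + 2) - K (s (i + 2)) = P i + P (i + 1) + s (i + 1) + s i"
proof -
  define \<Sigma> where "\<Sigma> = (\<Sum>i\<in>UNIV. P i)"
  define T where "T = opr \<rho> (resolvent 2) \<Sigma>"
  have T: "2 *\<^sub>R T - K T = \<Sigma>" unfolding T_def K_def by (rule res2(2))
  have s: "5 *\<^sub>R s c - K (s c) = \<Sigma> - P c + 2 *\<^sub>R T" for c
    unfolding s_def midpoint_value_def K_def T_def \<Sigma>_def by (rule res5(2))
  have \<Sigma>: "\<Sigma> = P i + P (i + 1) + P (i + 2)" unfolding \<Sigma>_def by (rule sum_letters)
  have "s i + s (i + 1) + s (i + 2) = opr \<rho> (resolvent 5) ((\<Sigma> - P i + 2 *\<^sub>R T) + (\<Sigma> - P (i + 1) + 2 *\<^sub>R T) + (\<Sigma> - P (i + 2) + 2 *\<^sub>R T))"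
    unfolding s_def midpoint_value_def \<Sigma>_def T_def opr_linear(1)[OF resolvents_25(2)] ..
  also have "(\<Sigma> - P i + 2 *\<^sub>R T) + (\<Sigma> - P (i + 1) + 2 *\<^sub>R T) + (\<Sigma> - P (i + 2) + 2 *\<^sub>R T) = 2 *\<^sub>R \<Sigma> + 6 *\<^sub>R T"
    unfolding \<Sigma> by (rule bcontfun_eqI) simp
  also have "\<dots> = 5 *\<^sub>R (2 *\<^sub>R T) - opr \<rho> decim (2 *\<^sub>R T)"
    unfolding T[symmetric] decim_linear by (rule bcontfun_eqI) (simp add: K_def)
  finally have S: "s i + s (i + 1) + s (i + 2) = 2 *\<^sub>R T" by (simp only: res5(1))
  have "4 *\<^sub>R s (i + 2) - K (s (i + 2)) = (5 *\<^sub>R s (i + 2) - K (s (i + 2))) - s (i + 2)"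
    by (rule bcontfun_eqI) simp
  also have "\<dots> = P i + P (i + 1) + s (i + 1) + s i"
    unfolding s S[symmetric] \<Sigma> by (rule bcontfun_eqI) simp
  finally show ?thesis .
qed

lemma midpoint_value_unique:
  defines "K \<equiv> opr \<rho> decim"
  assumes eq: "4 *\<^sub>R s1 - K s1 = p + b + s2 + s3" "4 *\<^sub>R s2 - K s2 = p + c + s1 + s3" "4 *\<^sub>R s3 - K s3 = b + c + s1 + s2"
    and P: "P i = p" "P (i + 1) = b" "P (i + 2) = c"
  shows "s1 = midpoint_value \<rho> P (i + 2)" "s2 = midpoint_value \<rho> P (i + 1)" "s3 = midpoint_value \<rho> P i"
proof -
  define \<Sigma> where "\<Sigma> = (\<Sum>i\<in>UNIV. P i)"
  have \<Sigma>: "\<Sigma> = p + b + c" unfolding \<Sigma>_def P[symmetric] by (rule sum_letters)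
  have K: "K x = opr \<rho> decim x" for x by (simp add: K_def)
  have "2 *\<^sub>R (s1 + s2 + s3) - opr \<rho> decim (s1 + s2 + s3) = 2 *\<^sub>R \<Sigma>"
  proof (rule bcontfun_eqI)
    fix j
    show "apply_bcontfun (2 *\<^sub>R (s1 + s2 + s3) - opr \<rho> decim (s1 + s2 + s3)) j = apply_bcontfun (2 *\<^sub>R \<Sigma>) j"
      using arg_cong[OF eq(1), of "\<lambda>f. apply_bcontfun f j"] arg_cong[OF eq(2), of "\<lambda>f. apply_bcontfun f j"]
        arg_cong[OF eq(3), of "\<lambda>f. apply_bcontfun f j"]
      by (simp add: decim_linear K_def \<Sigma>)
  qed
  then have "s1 + s2 + s3 = opr \<rho> (resolvent 2) (2 *\<^sub>R \<Sigma>)" using res2(1) by metis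
  then have S: "s1 + s2 + s3 = 2 *\<^sub>R opr \<rho> (resolvent 2) \<Sigma>" by (simp add: opr_linear[OF resolvents_25(1)])
  have "5 *\<^sub>R s1 - opr \<rho> decim s1 = \<Sigma> - c + (s1 + s2 + s3)"
    "5 *\<^sub>R s2 - opr \<rho> decim s2 = \<Sigma> - b + (s1 + s2 + s3)"
    "5 *\<^sub>R s3 - opr \<rho> decim s3 = \<Sigma> - p + (s1 + s2 + s3)"
    by (rule bcontfun_eqI; use eq[THEN arg_cong[of _ _ apply_bcontfun], THEN fun_cong] in
        \<open>simp add: K_def \<Sigma> algebra_simps\<close>)+
  then show "s1 = midpoint_value \<rho> P (i + 2)" "s2 = midpoint_value \<rho> P (i + 1)" "s3 = midpoint_value \<rho> P i"
    unfolding S midpoint_value_def P \<Sigma>_def by (metis res5(1))+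
qed

end

text \<open>At \<rho> = 0 the two resolvents are division by 2 and by 5, and the rule becomes the
  harmonic extension with weights 2/5, 2/5 and 1/5. The resolvents deviate linearly in
  \<rho>.\<close>

lemma midpoint_value_near_harmonic:
  assumes \<rho>0: "0 < \<rho>0" "\<rho>0 < rad2"
  shows "\<exists>D\<ge>0. \<forall>\<rho> P M i. 0 \<le> \<rho> \<longrightarrow> \<rho> \<le> \<rho>0 \<longrightarrow> (\<forall>c. norm (P c) \<le> M) \<longrightarrow>
    norm (midpoint_value \<rho> P (i + 2) - (1/5) *\<^sub>R (2 *\<^sub>R P i + 2 *\<^sub>R P (i + 1) + P (i + 2))) \<le> D * \<rho> * M"
proof -
  have c: "convergent_at \<rho>0 (resolvent 2)" "convergent_at \<rho>0 (resolvent 5)"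
    using \<rho>0 by (auto intro: convergent_at_resolvent_2)
  obtain A where A: "A \<ge> 0" "\<And>\<rho> s. 0 \<le> \<rho> \<Longrightarrow> \<rho> \<le> \<rho>0 \<Longrightarrow> norm (opr \<rho> (resolvent 2) s - (1/2) *\<^sub>R s) \<le> A * \<rho> * norm s"
    using opr_near_const[OF c(1) \<rho>0(1)] by (auto simp: resolvent_nth_0)
  obtain B where B: "B \<ge> 0" "\<And>\<rho> s. 0 \<le> \<rho> \<Longrightarrow> \<rho> \<le> \<rho>0 \<Longrightarrow> norm (opr \<rho> (resolvent 5) s - (1/5) *\<^sub>R s) \<le> B * \<rho> * norm s"
    using opr_near_const[OF c(2) \<rho>0(1)] by (auto simp: resolvent_nth_0)
  show ?thesis
  proof (intro exI[of _ "B * (5 + 6 * A * \<rho>0) + 6 * A"] conjI allI impI)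
    show "0 \<le> B * (5 + 6 * A * \<rho>0) + 6 * A" using A(1) B(1) \<rho>0 by simp
    fix \<rho> M i and P :: "3 \<Rightarrow> bseq"
    assume \<rho>: "0 \<le> \<rho>" "\<rho> \<le> \<rho>0" and P: "\<forall>c. norm (P c) \<le> M"
    have M: "0 \<le> M" using P order_trans[OF norm_ge_zero] by blast
    define \<Sigma> where "\<Sigma> = P i + P (i + 1) + P (i + 2)"
    have n\<Sigma>: "norm \<Sigma> \<le> M + M + M" unfolding \<Sigma>_def using P by (intro norm_triangle_mono) auto
    define E where "E = opr \<rho> (resolvent 2) \<Sigma> - (1/2) *\<^sub>R \<Sigma>"
    have nE: "norm E \<le> A * \<rho> * (M + M + M)" unfolding E_def
      by (rule order_trans[OF A(2)[OF \<rho>] mult_left_mono[OF n\<Sigma>]]) (use A(1) \<rho> in simp)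
    define X where "X = (2 *\<^sub>R P i + 2 *\<^sub>R P (i + 1) + P (i + 2)) + 2 *\<^sub>R E"
    have X: "midpoint_value \<rho> P (i + 2) = opr \<rho> (resolvent 5) X"
    proof -
      have "\<Sigma> - P (i + 2) + 2 *\<^sub>R opr \<rho> (resolvent 2) \<Sigma> = X"
        by (rule bcontfun_eqI) (simp add: X_def E_def \<Sigma>_def field_simps)
      then show ?thesis unfolding midpoint_value_def sum_letters[of P i] \<Sigma>_def by simp
    qed
    have "norm X \<le> (2 * M + 2 * M + M) + 2 * (A * \<rho> * (M + M + M))"
      unfolding X_def using P nE by (intro norm_triangle_mono) (auto simp: mult_ac)
    also have "\<dots> = 5 * M + 6 * A * \<rho> * M" by (simp add: algebra_simps)
    also have "\<dots> \<le> 5 * M + 6 * A * \<rho>0 * M"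
      using \<rho> A(1) M by (intro add_left_mono mult_right_mono mult_left_mono) auto
    finally have nX: "norm X \<le> (5 + 6 * A * \<rho>0) * M" by (simp add: algebra_simps)
    have "midpoint_value \<rho> P (i + 2) - (1/5) *\<^sub>R (2 *\<^sub>R P i + 2 *\<^sub>R P (i + 1) + P (i + 2))
        = (opr \<rho> (resolvent 5) X - (1/5) *\<^sub>R X) + (2/5) *\<^sub>R E"
      unfolding X by (rule bcontfun_eqI) (simp add: X_def add_divide_distrib)
    also have "norm \<dots> \<le> B * \<rho> * ((5 + 6 * A * \<rho>0) * M) + 2/5 * (A * \<rho> * (M + M + M))"
      using nE by (intro norm_triangle_mono order_trans[OF B(2)[OF \<rho>] mult_left_mono[OF nX]]) (use B(1) \<rho> in \<open>auto simp: mult_ac\<close>)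
    also have "\<dots> \<le> B * \<rho> * ((5 + 6 * A * \<rho>0) * M) + 2 * (A * \<rho> * (M + M + M))"
      using A(1) \<rho> M by (intro add_left_mono mult_right_mono) auto
    also have "\<dots> = (B * (5 + 6 * A * \<rho>0) + 6 * A) * \<rho> * M" by (simp add: algebra_simps)
    finally show "norm (midpoint_value \<rho> P (i + 2) - (1/5) *\<^sub>R (2 *\<^sub>R P i + 2 *\<^sub>R P (i + 1) + P (i + 2)))
        \<le> (B * (5 + 6 * A * \<rho>0) + 6 * A) * \<rho> * M" .
  qed
qed

section \<open>Refinement by midpoint values\<close>

definition subcell :: "real \<Rightarrow> 3 \<Rightarrow> (3 \<Rightarrow> bseq) \<Rightarrow> 3 \<Rightarrow> bseq" where
  "subcell \<rho> a P i = (if i = a then P a else midpoint_value \<rho> P (- (a + i)))"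

lemma subcell_letters: "subcell \<rho> a P a = P a"
  "subcell \<rho> a P (a + 1) = midpoint_value \<rho> P (a + 2)" "subcell \<rho> a P (a + 2) = midpoint_value \<rho> P (a + 1)"
  by (simp_all only: subcell_def letter_neq opposite_letter simp_thms if_True if_False)

text \<open>Values are attached to a cell and a corner instead of a point, which makes the recursion
  local to one cell. That different addresses of a vertex receive the same value is a separate
  result and needs the equations at the starting level.\<close>

function refine :: "real \<Rightarrow> nat \<Rightarrow> (3 list \<Rightarrow> 3 \<Rightarrow> bseq) \<Rightarrow> 3 list \<Rightarrow> 3 \<Rightarrow> bseq" where
  "refine r n0 Q w = (if length w \<le> n0 then Q w
     else subcell (r / 5 ^ length w) (last w) (refine r n0 Q (butlast w)))"
  by pat_completeness auto
termination by (relation "Wellfounded.measure (\<lambda>(r,n0,Q,w). length w)") auto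

declare refine.simps [simp del]

lemma refine_base: "length w \<le> n0 \<Longrightarrow> refine r n0 Q w = Q w"
  by (simp add: refine.simps)

lemma refine_snoc: "n0 \<le> length w \<Longrightarrow> refine r n0 Q (w @ [a]) = subcell (r / 5 ^ Suc (length w)) a (refine r n0 Q w)"
  by (subst refine.simps) simp

lemma refine_corner: "n0 \<le> length w \<Longrightarrow> refine r n0 Q (w @ [a]) a = refine r n0 Q w a"
  by (simp add: refine_snoc subcell_def)

lemma refine_replicate: "n0 \<le> length w \<Longrightarrow> refine r n0 Q (w @ replicate d a) a = refine r n0 Q w a"
proof (induction d)
  case (Suc d)
  have "w @ replicate (Suc d) a = (w @ replicate d a) @ [a]" by (simp add: replicate_append_same)
  then show ?case using Suc refine_corner[of n0 "w @ replicate d a" r Q a] by simp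
qed simp

lemma refine_swap: "n0 \<le> length w \<Longrightarrow> refine r n0 Q (w @ [a]) b = refine r n0 Q (w @ [b]) a"
  by (cases "a = b") (auto simp: refine_snoc subcell_def add.commute)

context
  fixes r :: real and n0 :: nat
  assumes r: "0 < r" "r / 5 ^ Suc n0 < rad2"
begin

text \<open>A harmonic step does not increase the maximum and contracts the oscillation of a cell by
  3/5. The true steps deviate by O(5^-n), so the maximum grows by a convergent product and the
  contraction can be kept at 4/5. The constants do not depend on the data.\<close>

lemma refine_bounds:
  "\<exists>C\<ge>0. \<exists>A\<ge>0. \<forall>Q M. (\<forall>w i. length w = n0 \<longrightarrow> norm (Q w i) \<le> M) \<longrightarrow>
     (\<forall>w i j. n0 \<le> length w \<longrightarrow> norm (refine r n0 Q w i) \<le> C * M \<and>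
        norm (refine r n0 Q w i - refine r n0 Q w j) \<le> A * M * (4/5) ^ length w)"
proof -
  have "0 < r / 5 ^ Suc n0" using r by simp
  from midpoint_value_near_harmonic[OF this r(2)] obtain D where D: "D \<ge> 0" and
    mid: "\<And>\<rho> P M i. 0 \<le> \<rho> \<Longrightarrow> \<rho> \<le> r / 5 ^ Suc n0 \<Longrightarrow> (\<And>c. norm (P c) \<le> M) \<Longrightarrow>
    norm (midpoint_value \<rho> P (i + 2) - (1/5) *\<^sub>R (2 *\<^sub>R P i + 2 *\<^sub>R P (i + 1) + P (i + 2))) \<le> D * \<rho> * M"
    by blast
  \<comment> \<open>The maximum grows by at most \<open>1 + D * \<rho>\<close> per level, and the
    values of \<rho> over the levels up to n add up to at most r (1 - 5^-n), the exponent in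
    \<open>bound\<close>. In \<open>A\<close>, the first summand serves level \<open>n0\<close> and
    the second absorbs the deviation \<open>e\<close>.\<close>
  define C where "C = exp (D * r)"
  define A where "A = 2 * C * (5/4) ^ n0 + 2 * D * C * r"
  have C: "C > 0" by (simp add: C_def)
  have A: "A \<ge> 0" using C D r by (simp add: A_def)
  show ?thesis
  proof (rule exI[of _ C], intro conjI, use C in simp, rule exI[of _ A], intro conjI A allI impI)
    fix Q :: "3 list \<Rightarrow> 3 \<Rightarrow> bseq" and M
    assume Q: "\<forall>w i. length w = n0 \<longrightarrow> norm (Q w i) \<le> M"
    have M: "0 \<le> M" using Q[rule_format, of "replicate n0 0" 0] order_trans[OF norm_ge_zero] by auto
    let ?W = "refine r n0 Q"
    have \<rho>: "0 \<le> r / 5 ^ Suc (length w)" "r / 5 ^ Suc (length w) \<le> r / 5 ^ Suc n0" if "n0 \<le> length w" for w :: "3 list"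
      using r that by (auto intro!: divide_left_mono power_increasing simp del: power_Suc)
    have bound: "norm (?W w i) \<le> M * exp (D * r * (1 - 1 / 5 ^ length w))" if "n0 \<le> length w" for w i
      using that
    proof (induction w arbitrary: i rule: rev_induct)
      case Nil
      then show ?case using Q by (simp add: refine_base)
    next
      case (snoc a w)
      show ?case
      proof (cases "length w < n0")
        case True
        then have "length (w @ [a]) = n0" using snoc.prems by simp
        then have "norm (?W (w @ [a]) i) \<le> M * 1" using Q by (simp add: refine_base)
        also have "\<dots> \<le> M * exp (D * r * (1 - 1 / 5 ^ length (w @ [a])))"
          using M D r one_le_power[of "5::real" "length (w @ [a])"]
          by (intro mult_left_mono) (auto intro!: mult_nonneg_nonneg simp: divide_le_eq)
        finally show ?thesis .
      next
        case False
        then have n: "n0 \<le> length w" by simp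
        define \<rho> where "\<rho> = r / 5 ^ Suc (length w)"
        define N where "N = M * exp (D * r * (1 - 1 / 5 ^ length w))"
        have N: "0 \<le> N" using M by (simp add: N_def)
        have IH: "norm (?W w j) \<le> N" for j using snoc.IH[OF n] by (simp add: N_def)
        have \<rho>0: "0 \<le> \<rho>" "\<rho> \<le> r / 5 ^ Suc n0" using \<rho>[OF n] by (auto simp: \<rho>_def)
        have mv: "norm (midpoint_value \<rho> (?W w) c) \<le> N * (1 + D * \<rho>)" for c
        proof -
          obtain j where c: "c = j + 2" by (metis diff_add_cancel)
          have "norm ((1/5) *\<^sub>R (2 *\<^sub>R ?W w j + 2 *\<^sub>R ?W w (j + 1) + ?W w (j + 2))) \<le> (1/5) * (2 * N + 2 * N + N)"
            unfolding norm_scaleR using IH by (intro mult_mono norm_triangle_mono) auto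
          moreover have "norm (midpoint_value \<rho> (?W w) (j + 2) - (1/5) *\<^sub>R (2 *\<^sub>R ?W w j + 2 *\<^sub>R ?W w (j + 1) + ?W w (j + 2))) \<le> D * \<rho> * N"
            by (rule mid[OF \<rho>0 IH])
          ultimately show ?thesis unfolding c
            using norm_triangle_sub[of "midpoint_value \<rho> (?W w) (j + 2)" "(1/5) *\<^sub>R (2 *\<^sub>R ?W w j + 2 *\<^sub>R ?W w (j + 1) + ?W w (j + 2))"]
            by (simp add: algebra_simps)
        qed
        have "norm (?W (w @ [a]) i) \<le> N * (1 + D * \<rho>)"
        proof (cases "i = a")
          case True
          have "N * 1 \<le> N * (1 + D * \<rho>)" using N D \<rho>0 by (intro mult_left_mono) auto
          then show ?thesis using True IH[of a] by (simp add: refine_corner[OF n])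
        next
          case False
          then show ?thesis using mv by (simp add: refine_snoc[OF n] subcell_def \<rho>_def)
        qed
        also have "\<dots> \<le> N * exp (D * \<rho>)" using N by (intro mult_left_mono exp_ge_add_one_self)
        also have "\<dots> = M * exp (D * r * (1 - 1 / 5 ^ length w) + D * \<rho>)"
          unfolding N_def by (simp only: exp_add mult.assoc)
        also have "\<dots> \<le> M * exp (D * r * (1 - 1 / 5 ^ length (w @ [a])))"
        proof -
          have "(1 - 1 / 5 ^ length w) + 1 / 5 ^ Suc (length w) \<le> 1 - 1 / (5::real) ^ length (w @ [a])"
            by (simp add: field_simps)
          from mult_left_mono[OF this, of "D * r"] have
            "D * r * (1 - 1 / 5 ^ length w + 1 / 5 ^ Suc (length w)) \<le> D * r * (1 - 1 / 5 ^ length (w @ [a]))"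
            using D r by simp
          moreover have "D * r * (1 - 1 / 5 ^ length w + 1 / 5 ^ Suc (length w)) = D * r * (1 - 1 / 5 ^ length w) + D * \<rho>"
            unfolding distrib_left \<rho>_def by simp
          ultimately have "D * r * (1 - 1 / 5 ^ length w) + D * \<rho> \<le> D * r * (1 - 1 / 5 ^ length (w @ [a]))"
            by simp
          then show ?thesis using M by (intro mult_left_mono) auto
        qed
        finally show ?thesis .
      qed
    qed
    have bC: "norm (?W w i) \<le> C * M" if "n0 \<le> length w" for w i
    proof -
      have "exp (D * r * (1 - 1 / 5 ^ length w)) \<le> C" unfolding C_def using D r by (simp add: mult_left_le)
      then have "M * exp (D * r * (1 - 1 / 5 ^ length w)) \<le> M * C" using M by (rule mult_left_mono)
      then show ?thesis using bound[OF that, of i] by (simp add: mult.commute)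
    qed
    have osc: "norm (?W w i - ?W w j) \<le> A * M * (4/5) ^ length w" if "n0 \<le> length w" for w i j
      using that
    proof (induction w arbitrary: i j rule: rev_induct)
      case Nil
      have "norm (?W [] i - ?W [] j) \<le> C * M + C * M"
        using bC[OF Nil.prems] by (intro order_trans[OF norm_triangle_ineq4] add_mono) auto
      also have "\<dots> \<le> A * M" using Nil D C M r by (simp add: A_def algebra_simps)
      finally show ?case by simp
    next
      case (snoc a w)
      show ?case
      proof (cases "length w < n0")
        case True
        then have n: "length (w @ [a]) = n0" using snoc.prems by simp
        have "norm (?W (w @ [a]) i - ?W (w @ [a]) j) \<le> C * M + C * M"
          using bC[OF snoc.prems] by (intro order_trans[OF norm_triangle_ineq4] add_mono) auto
        also have "\<dots> = (2 * C * (5/4) ^ n0) * M * (4/5) ^ n0"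
          by (simp add: power_mult_distrib[symmetric])
        also have "\<dots> \<le> A * M * (4/5) ^ n0"
          using D C M r by (intro mult_right_mono) (auto simp: A_def)
        finally show ?thesis using n by simp
      next
        case False
        then have n: "n0 \<le> length w" by simp
        define \<rho> where "\<rho> = r / 5 ^ Suc (length w)"
        define d where "d = A * M * (4/5) ^ length w"
        define e where "e = D * \<rho> * (C * M)"
        have \<rho>0: "0 \<le> \<rho>" "\<rho> \<le> r / 5 ^ Suc n0" using \<rho>[OF n] by (auto simp: \<rho>_def)
        have IH: "norm (?W w i - ?W w j) \<le> d" for i j using snoc.IH[OF n] by (simp add: d_def)
        have d0: "0 \<le> d" using A M by (simp add: d_def)
        define h where "h = (\<lambda>c. midpoint_value \<rho> (?W w) c - (1/5) *\<^sub>R (2 *\<^sub>R ?W w (c + 1) + 2 *\<^sub>R ?W w (c + 2) + ?W w c))"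
        have h: "norm (h c) \<le> e" for c
          using mid[where i = "c + 1" and P = "?W w" and M = "C * M", OF \<rho>0 bC[OF n]] by (simp add: h_def e_def)
        have e0: "0 \<le> e" using h norm_ge_zero order_trans by blast
        have mvh: "midpoint_value \<rho> (?W w) c = h c + (1/5) *\<^sub>R (2 *\<^sub>R ?W w (c + 1) + 2 *\<^sub>R ?W w (c + 2) + ?W w c)" for c
          by (simp add: h_def)
        \<comment> \<open>The harmonic weights give at most 3/5 of the oscillation \<open>d\<close>;
          the choice of \<open>A\<close> makes \<open>2 * e\<close> at most \<open>d / 5\<close>,
          which leads to 4/5.\<close>
        have step: "norm (?W (w @ [a]) i - ?W (w @ [a]) j) \<le> 3/5 * d + 2 * e"
        proof -
          have 1: "norm (midpoint_value \<rho> (?W w) c - ?W w (c + 1)) \<le> 3/5 * d + 2 * e" for c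
          proof -
            have "midpoint_value \<rho> (?W w) c - ?W w (c + 1) = h c + (1/5) *\<^sub>R (2 *\<^sub>R (?W w (c + 2) - ?W w (c + 1)) + (?W w c - ?W w (c + 1)))"
              unfolding mvh by (rule bcontfun_eqI) simp
            also have "norm \<dots> \<le> e + (1/5) * (2 * d + d)"
              using h IH[of "c + 2" "c + 1"] IH[of c "c + 1"] by (intro norm_triangle_mono) (auto intro!: order_trans[OF norm_triangle_ineq] add_mono)
            finally show ?thesis using e0 by simp
          qed
          have 2: "norm (midpoint_value \<rho> (?W w) c - ?W w (c + 2)) \<le> 3/5 * d + 2 * e" for c
          proof -
            have "midpoint_value \<rho> (?W w) c - ?W w (c + 2) = h c + (1/5) *\<^sub>R (2 *\<^sub>R (?W w (c + 1) - ?W w (c + 2)) + (?W w c - ?W w (c + 2)))"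
              unfolding mvh by (rule bcontfun_eqI) simp
            also have "norm \<dots> \<le> e + (1/5) * (2 * d + d)"
              using h IH[of "c + 1" "c + 2"] IH[of c "c + 2"] by (intro norm_triangle_mono) (auto intro!: order_trans[OF norm_triangle_ineq] add_mono)
            finally show ?thesis using e0 by simp
          qed
          have 3: "norm (midpoint_value \<rho> (?W w) c - midpoint_value \<rho> (?W w) (c + 1)) \<le> 3/5 * d + 2 * e" for c
          proof -
            have "midpoint_value \<rho> (?W w) c - midpoint_value \<rho> (?W w) (c + 1) = (h c - h (c + 1)) + (1/5) *\<^sub>R (?W w (c + 1) - ?W w c)"
              unfolding mvh by (rule bcontfun_eqI) (simp add: add_divide_distrib)
            also have "norm \<dots> \<le> (e + e) + (1/5) * d"
              using h[of c] h[of "c + 1"] IH[of "c + 1" c] by (intro norm_triangle_mono) (auto intro!: order_trans[OF norm_triangle_ineq4] add_mono)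
            finally show ?thesis using d0 by simp
          qed
          have sub: "?W (w @ [a]) a = ?W w a" "?W (w @ [a]) (a + 1) = midpoint_value \<rho> (?W w) (a + 2)"
            "?W (w @ [a]) (a + 2) = midpoint_value \<rho> (?W w) (a + 1)"
            by (simp_all only: refine_snoc[OF n] subcell_letters \<rho>_def)
          show ?thesis
            using letter_cases[of i a] letter_cases[of j a] 1[of "a + 2"] 2[of "a + 1"] 3[of "a + 1"] d0 e0
            by (auto simp: sub norm_minus_commute)
        qed
        also have "\<dots> \<le> A * M * (4/5) ^ Suc (length w)"
        proof -
          have "(1/5::real) ^ length w \<le> (4/5) ^ length w" by (intro power_mono) auto
          then have "2 * D * C * r * M * (1/5) ^ length w \<le> 2 * D * C * r * M * (4/5) ^ length w"
            using D C M r by (intro mult_left_mono) auto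
          also have "\<dots> \<le> A * M * (4/5) ^ length w"
            using D C M r by (intro mult_right_mono) (auto simp: A_def)
          finally have "2 * e \<le> 1/5 * d" by (simp add: e_def d_def \<rho>_def power_divide field_simps)
          then show ?thesis by (simp add: d_def)
        qed
        finally show ?thesis by simp
      qed
    qed
    show "norm (refine r n0 Q w i) \<le> C * M" "norm (refine r n0 Q w i - refine r n0 Q w j) \<le> A * M * (4/5) ^ length w"
      if "n0 \<le> length w" for w i j
      using bC[OF that] osc[OF that] by auto
  qed
qed

end

section \<open>Solutions of the level equations on the gasket\<close>

context gasket
begin

lemma level_midpoints:
  assumes "level r (Suc n) G" "length w = n"
  defines "K \<equiv> opr (r / 5 ^ Suc n) decim"
  shows "4 *\<^sub>R G (vx (w @ [i]) (i + 1)) - K (G (vx (w @ [i]) (i + 1)))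
      = G (vx w i) + G (vx w (i + 1)) + G (vx (w @ [i]) (i + 2)) + G (vx (w @ [i + 1]) (i + 2))"
    and "4 *\<^sub>R G (vx (w @ [i]) (i + 2)) - K (G (vx (w @ [i]) (i + 2)))
      = G (vx w i) + G (vx w (i + 2)) + G (vx (w @ [i]) (i + 1)) + G (vx (w @ [i + 1]) (i + 2))"
    and "4 *\<^sub>R G (vx (w @ [i + 1]) (i + 2)) - K (G (vx (w @ [i + 1]) (i + 2)))
      = G (vx w (i + 1)) + G (vx w (i + 2)) + G (vx (w @ [i]) (i + 1)) + G (vx (w @ [i]) (i + 2))"
proof -
  have *: "graph_lap G w a b 0 = K (G (vx (w @ [a]) b))" if "a \<noteq> b" for a b
    using assms(1)[unfolded level_def, rule_format, OF that, of w 0] assms(2) by (simp add: residual_def K_def)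
  show "4 *\<^sub>R G (vx (w @ [i]) (i + 1)) - K (G (vx (w @ [i]) (i + 1)))
      = G (vx w i) + G (vx w (i + 1)) + G (vx (w @ [i]) (i + 2)) + G (vx (w @ [i + 1]) (i + 2))"
    using *[of i "i + 1"] unfolding graph_lap_midpoints by (metis diff_eq_eq add.commute letter_neq(2))
  show "4 *\<^sub>R G (vx (w @ [i]) (i + 2)) - K (G (vx (w @ [i]) (i + 2)))
      = G (vx w i) + G (vx w (i + 2)) + G (vx (w @ [i]) (i + 1)) + G (vx (w @ [i + 1]) (i + 2))"
    using *[of i "i + 2"] unfolding graph_lap_midpoints by (metis diff_eq_eq add.commute letter_neq(4))
  show "4 *\<^sub>R G (vx (w @ [i + 1]) (i + 2)) - K (G (vx (w @ [i + 1]) (i + 2)))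
      = G (vx w (i + 1)) + G (vx w (i + 2)) + G (vx (w @ [i]) (i + 1)) + G (vx (w @ [i]) (i + 2))"
    using *[of "i + 1" "i + 2"] unfolding graph_lap_midpoints by (metis diff_eq_eq add.commute letter_neq(5))
qed

lemma level_eq_refine:
  assumes r: "0 \<le> r" "r / 5 ^ Suc n0 < rad2" and lev: "\<And>n. n0 < n \<Longrightarrow> level r n G"
  shows "n0 \<le> length w \<Longrightarrow> G (vx w i) = refine r n0 (\<lambda>w i. G (vx w i)) w i"
proof (induction w arbitrary: i rule: rev_induct)
  case Nil
  then show ?case by (simp add: refine_base)
next
  case (snoc a w)
  show ?case
  proof (cases "length w < n0")
    case True
    then show ?thesis using snoc.prems by (simp add: refine_base)
  next
    case False
    then have n: "n0 \<le> length w" by simp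
    let ?\<rho> = "r / 5 ^ Suc (length w)" and ?P = "refine r n0 (\<lambda>w i. G (vx w i)) w"
    have "?\<rho> \<le> r / 5 ^ Suc n0" using n r by (intro divide_left_mono power_increasing) auto
    then have \<rho>: "0 \<le> ?\<rho>" "?\<rho> < rad2" using r by auto
    have P: "?P j = G (vx w j)" for j using snoc.IH[OF n] by simp
    have "level r (Suc (length w)) G" using lev n by simp
    from midpoint_value_unique(1,2)[OF \<rho> level_midpoints[OF this refl, of a], where i = a and P = ?P] P
    have "G (vx (w @ [a]) (a + 1)) = midpoint_value ?\<rho> ?P (a + 2)"
      "G (vx (w @ [a]) (a + 2)) = midpoint_value ?\<rho> ?P (a + 1)" by auto
    then show ?thesis using letter_cases[of i a] P[of a]
      by (elim disjE) (simp_all only: refine_snoc[OF n] subcell_letters vx_last)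
  qed
qed

lemma vertex_deep: "p \<in> vertices \<Longrightarrow> \<exists>w i. n \<le> length w \<and> p = vx w i"
proof -
  assume "p \<in> vertices"
  then obtain w i where "p = vx w i" by (auto simp: vertices_def)
  then have "p = vx (w @ replicate n i) i" by simp
  then show ?thesis by (intro exI[of _ "w @ replicate n i"] exI[of _ i]) auto
qed

text \<open>Below \<open>rad2\<close> the midpoints are determined by the corners of a cell, so a
  solution is fixed by its values at level \<open>n0\<close>. This is the means of proving that two
  solutions agree once they agree at finitely many points.\<close>

lemma level_zero:
  assumes r: "0 \<le> r" "r / 5 ^ Suc n0 < rad2" and lev: "\<And>n. n0 < n \<Longrightarrow> level r n G"
    and z: "\<And>w i. length w = n0 \<Longrightarrow> G (vx w i) = 0"
    and p: "p \<in> vertices"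
  shows "G p = 0"
proof -
  have "refine r n0 (\<lambda>w i. G (vx w i)) w i = 0" if "n0 \<le> length w" for w i
    using that
  proof (induction w arbitrary: i rule: rev_induct)
    case Nil then show ?case using z by (simp add: refine_base)
  next
    case (snoc a w)
    show ?case
    proof (cases "length w < n0")
      case True
      then show ?thesis using snoc.prems z[of "w @ [a]"] by (simp add: refine_base)
    next
      case False
      then have n: "n0 \<le> length w" by simp
      let ?\<rho> = "r / 5 ^ Suc (length w)"
      have "?\<rho> \<le> r / 5 ^ Suc n0" using n r by (intro divide_left_mono power_increasing) auto
      then have "0 \<le> ?\<rho>" "?\<rho> < rad2" using r by auto
      from opr_linear(4)[OF resolvents_25(1)[OF this]] opr_linear(4)[OF resolvents_25(2)[OF this]]
      show ?thesis using snoc.IH[OF n]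
        by (simp add: refine_snoc[OF n] subcell_def midpoint_value_def del: power_Suc)
    qed
  qed
  then show ?thesis using vertex_deep[OF p, of n0] level_eq_refine[OF r lev] by metis
qed

lemma vertices_cell:
  assumes "p \<in> vertices" "p \<in> cell q w"
  shows "\<exists>u i. p = vx (w @ u) i"
proof -
  obtain w'' j where w'': "length w \<le> length w''" "p = vx w'' j" using vertex_deep[OF assms(1)] by blast
  define w0 u where "w0 = take (length w) w''" and "u = drop (length w) w''"
  have w0: "length w = length w0" "w'' = w0 @ u" using w'' by (auto simp: w0_def u_def)
  obtain x where x: "x \<in> SG q" "p = Fw q w x" using assms(2) by (auto simp: cell_def)
  have "Fw q w x = Fw q w0 (vx u j)" using x w'' w0 by (simp add: vx_append)
  from cell_inter[OF x(1) vx_in_SG w0(1) this]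
  have "w = w0 \<or> (\<exists>b. x = q b)" by blast
  then show ?thesis
  proof
    assume "w = w0" then show ?thesis using w0 w'' by blast
  next
    assume "\<exists>b. x = q b"
    then obtain b where "p = vx (w @ []) b" using x by (auto simp: vx_def)
    then show ?thesis by blast
  qed
qed

context
  fixes r :: real and n0 :: nat and Q :: "3 list \<Rightarrow> 3 \<Rightarrow> bseq"
  assumes r: "0 < r" "r / 5 ^ Suc n0 < rad2"
    and consistent: "\<And>v a b k. a \<noteq> b \<Longrightarrow> length v + Suc k = n0 \<Longrightarrow> Q (v @ a # replicate k b) b = Q (v @ b # replicate k a) a"
    and equation: "\<And>v a b k. a \<noteq> b \<Longrightarrow> length v + Suc k = n0 \<Longrightarrow>
      4 *\<^sub>R Q (v @ a # replicate k b) b - opr (r / 5 ^ n0) decim (Q (v @ a # replicate k b) b) =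
      (Q (v @ a # replicate k b) (b + 1) + Q (v @ a # replicate k b) (b + 2)) +
      (Q (v @ b # replicate k a) (a + 1) + Q (v @ b # replicate k a) (a + 2))"
begin

lemma refine_junction:
  assumes "a \<noteq> b"
  shows "n0 \<le> length v + Suc k \<Longrightarrow> refine r n0 Q (v @ a # replicate k b) b = refine r n0 Q (v @ b # replicate k a) a"
proof (induction k)
  case 0
  show ?case
  proof (cases "n0 \<le> length v")
    case True then show ?thesis using refine_swap[of n0 v r Q a b] by simp
  next
    case False
    then show ?thesis using consistent[OF assms, of v 0] 0 by (simp add: refine_base)
  qed
next
  case (Suc k)
  show ?case
  proof (cases "n0 \<le> length v + Suc k")
    case True
    have e: "v @ c # replicate (Suc k) d = (v @ c # replicate k d) @ [d]" for c d
      by (simp add: replicate_append_same)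
    show ?thesis unfolding e using Suc.IH[OF True] True by (subst (1 2) refine_corner) auto
  next
    case False
    then show ?thesis using consistent[OF assms, of v "Suc k"] Suc.prems by (simp add: refine_base)
  qed
qed

lemma refine_well_defined:
  assumes "n0 \<le> length w" "n0 \<le> length w'" "vx w i = vx w' i'"
  shows "refine r n0 Q w i = refine r n0 Q w' i'"
proof -
  have same: "refine r n0 Q w i = refine r n0 Q w' i'"
    if "n0 \<le> length w" "length w = length w'" "vx w i = vx w' i'" for w w' i i'
  proof -
    have "Fw q w (q i) = Fw q w' (q i')" using that(3) by (simp add: vx_def)
    from cell_inter[OF q_in_SG q_in_SG that(2) this] show ?thesis
    proof
      assume "\<exists>v a b k. a \<noteq> b \<and> w = v @ a # replicate k b \<and> w' = v @ b # replicate k a \<and> q i = q b \<and> q i' = q a"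
      then obtain v a b k where *: "a \<noteq> b" "w = v @ a # replicate k b" "w' = v @ b # replicate k a" "i = b" "i' = a"
        by auto
      show ?thesis using refine_junction[OF *(1), of v k] that(1) by (simp add: *)
    qed auto
  qed
  define d where "d = max (length w) (length w')"
  have "refine r n0 Q (w @ replicate (d - length w) i) i = refine r n0 Q (w' @ replicate (d - length w') i') i'"
    by (rule same) (use assms in \<open>auto simp: d_def\<close>)
  then show ?thesis using assms by (simp add: refine_replicate)
qed

definition refined :: "plane \<Rightarrow> bseq" where
  "refined p = (let (w,i) = (SOME (w,i). n0 \<le> length w \<and> p = vx w i) in refine r n0 Q w i)"

lemma refined_vx: "n0 \<le> length w \<Longrightarrow> refined (vx w i) = refine r n0 Q w i"
proof -
  assume n: "n0 \<le> length w"
  define x where "x = (SOME (w',i'). n0 \<le> length w' \<and> vx w i = vx w' i')"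
  have "case x of (w',i') \<Rightarrow> n0 \<le> length w' \<and> vx w i = vx w' i'"
    unfolding x_def by (rule someI[of _ "(w,i)"]) (use n in simp)
  then show ?thesis unfolding refined_def x_def[symmetric]
    using refine_well_defined[OF _ n] by (auto split: prod.splits)
qed

text \<open>New midpoints satisfy their equations by construction. At an old vertex
  \<open>residual_decimation\<close> leaves \<open>(2 - K) (5 - K)\<close> of the new residual equal
  to 0, and both factors are injective below \<open>rad2\<close>.\<close>

lemma refined_level: "n0 \<le> n \<Longrightarrow> level r n refined"
proof (induction n rule: dec_induct)
  case base
  show ?case unfolding level_def
  proof (intro allI impI)
    fix v :: "3 list" and a b :: 3 and k assume *: "a \<noteq> b" "n0 = length v + Suc k"
    have R: "refined (vx (v @ c # replicate k d) e) = Q (v @ c # replicate k d) e" for c d e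
      using *(2) by (subst refined_vx) (simp_all add: refine_base)
    show "residual r refined v a b k = 0"
      unfolding residual_def graph_lap_def opposite_def *(2)[symmetric] R
      using equation[OF *(1) *(2)[symmetric]] by (simp add: algebra_simps)
  qed
next
  case (step n)
  let ?\<rho> = "r / 5 ^ Suc n"
  have "?\<rho> \<le> r / 5 ^ Suc n0" using step r by (intro divide_left_mono power_increasing) auto
  then have \<rho>: "0 \<le> ?\<rho>" "?\<rho> < rad2" using r by auto
  have mids: "residual r refined w i j 0 = 0" if w: "length w = n" and ij: "i \<noteq> j" for w i j
  proof -
    have n: "n0 \<le> length w" using w step by simp
    let ?P = "refine r n0 Q w"
    have P: "refined (vx w c) = ?P c" for c by (rule refined_vx[OF n])
    have S: "refined (vx (w @ [a]) (a + 1)) = midpoint_value ?\<rho> ?P (a + 2)"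
      "refined (vx (w @ [a]) (a + 2)) = midpoint_value ?\<rho> ?P (a + 1)" for a
      using n w by (simp_all only: refined_vx refine_snoc[OF n] subcell_letters length_append list.size trans_le_add1)
    note S' = S S(1)[of "i + 1", unfolded letter_add] S(2)[of "i + 1", unfolded letter_add]
    from letter_cases[of j i] ij consider "j = i + 1" | "j = i + 2" by auto
    then show ?thesis
    proof cases
      case 1
      show ?thesis unfolding 1 residual_def graph_lap_midpoints replicate_0 P S' w
        using midpoint_value_solves[OF \<rho>, of ?P i] by (simp add: algebra_simps del: power_Suc)
    next
      case 2
      show ?thesis unfolding 2 residual_def graph_lap_midpoints replicate_0 P S' w
        using midpoint_value_solves[OF \<rho>, of ?P "i + 2", unfolded letter_add] by (simp add: algebra_simps del: power_Suc)
    qed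
  qed
  show ?case unfolding level_def
  proof (intro allI impI)
    fix v :: "3 list" and a b :: 3 and k assume ab: "a \<noteq> b" and k: "Suc n = length v + Suc k"
    show "residual r refined v a b k = 0"
    proof (cases k)
      case 0
      then show ?thesis using mids[of v a b] ab k by simp
    next
      case (Suc k')
      have n: "n = length v + Suc k'" using Suc k by simp
      have R: "residual r refined v a b k' = 0" using step.IH[unfolded level_def, rule_format, OF ab n] .
      let ?R = "residual r refined v a b (Suc k')" and ?K = "opr ?\<rho> decim"
      have c: "convergent_at ?\<rho> decim" using \<rho> by simp
      have z: "opr x decim 0 = 0" if "0 \<le> x" for x using that by (simp add: opr_linear)
      have "10 *\<^sub>R ?R - 7 *\<^sub>R ?K ?R + ?K (?K ?R) = 0"
        using residual_decimation[of r refined v a b k'] r R mids[of "v @ a # replicate k' b"] mids[of "v @ b # replicate k' a"] n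
        by (simp add: z del: power_Suc)
      moreover have "10 *\<^sub>R ?R - 7 *\<^sub>R ?K ?R + ?K (?K ?R) = 2 *\<^sub>R (5 *\<^sub>R ?R - ?K ?R) - ?K (5 *\<^sub>R ?R - ?K ?R)"
        unfolding opr_linear[OF c] by (rule bcontfun_eqI) simp
      ultimately have "5 *\<^sub>R ?R - ?K ?R = opr ?\<rho> (resolvent 2) 0" using res2(1)[OF \<rho>] by metis
      then have "5 *\<^sub>R ?R - ?K ?R = 0" by (simp only: opr_linear(4)[OF resolvents_25(1)[OF \<rho>]])
      then have "?R = opr ?\<rho> (resolvent 5) 0" using res5(1)[OF \<rho>] by metis
      then have "?R = 0" by (simp only: opr_linear(4)[OF resolvents_25(2)[OF \<rho>]])
      then show ?thesis using Suc by simp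
    qed
  qed
qed

lemma refined_uniformly_continuous: "uniformly_continuous_on vertices refined"
  unfolding uniformly_continuous_on_def
proof (intro allI impI)
  fix \<epsilon> :: real assume \<epsilon>: "\<epsilon> > 0"
  obtain M where M: "\<And>w i. length w = n0 \<Longrightarrow> norm (Q w i) \<le> M"
  proof -
    let ?S = "(\<lambda>(w,i). norm (Q w i)) ` ({w. length w = n0} \<times> UNIV)"
    have "finite ?S" using finite_lists_length_eq[of "UNIV :: 3 set" n0] by simp
    then have "norm (Q w i) \<le> Max ?S" if "length w = n0" for w i
      using that by (intro Max_ge) force+
    then show ?thesis using that by blast
  qed
  from refine_bounds[OF r] obtain A0 where "A0 \<ge> 0" "\<And>w i j. n0 \<le> length w \<Longrightarrow>
      norm (refine r n0 Q w i - refine r n0 Q w j) \<le> A0 * M * (4/5) ^ length w"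
    using M by metis
  then obtain A where A: "\<And>w i j. n0 \<le> length w \<Longrightarrow> norm (refine r n0 Q w i - refine r n0 Q w j) \<le> A * (4/5) ^ length w"
    by blast
  have A0: "0 \<le> A"
  proof (rule ccontr)
    assume "\<not> 0 \<le> A"
    then have "A * (4/5) ^ n0 < 0" by (intro mult_neg_pos) auto
    then show False using A[of "replicate n0 0" 0 0] by simp
  qed
  have cellosc: "norm (refined p - refined (vx w j)) \<le> 5 * A * (4/5) ^ length w"
    if w: "n0 \<le> length w" and p: "p \<in> vertices" "p \<in> cell q w" for p w j
  proof -
    \<comment> \<open>The subtracted term makes the geometric series telescope: one more letter adds
      \<open>A * (4/5) ^ length (w @ u @ [a])\<close>, which is the decrease of the subtracted
      term.\<close>
    have "norm (refine r n0 Q (w @ u) i - refine r n0 Q w j) \<le> 5 * A * (4/5) ^ length w - 4 * A * (4/5) ^ length (w @ u)" for u i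
    proof (induction u arbitrary: i rule: rev_induct)
      case Nil
      then show ?case using A[OF w, of i j] by simp
    next
      case (snoc a u)
      have "norm (refine r n0 Q (w @ u @ [a]) i - refine r n0 Q (w @ u @ [a]) a) \<le> A * (4/5) ^ length (w @ u @ [a])"
        by (rule A) (use w in simp)
      moreover have "refine r n0 Q (w @ u @ [a]) a = refine r n0 Q (w @ u) a"
        using refine_corner[of n0 "w @ u" r Q a] w by simp
      ultimately have "norm (refine r n0 Q (w @ u @ [a]) i - refine r n0 Q w j)
          \<le> A * (4/5) ^ length (w @ u @ [a]) + (5 * A * (4/5) ^ length w - 4 * A * (4/5) ^ length (w @ u))"
        using snoc.IH[of a] norm_diff_triangle_le by metis
      then show ?case by simp
    qed
    moreover have "0 \<le> 4 * A * (4/5) ^ length (w @ u)" for u :: "3 list" using A0 by simp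
    ultimately have "norm (refine r n0 Q (w @ u) i - refine r n0 Q w j) \<le> 5 * A * (4/5) ^ length w" for u i
      by (smt (verit))
    then show ?thesis using vertices_cell[OF p] w by (auto simp: refined_vx)
  qed
  have "(\<lambda>n. 10 * A * (4/5) ^ n) \<longlonglongrightarrow> 10 * A * 0"
    by (intro tendsto_intros LIMSEQ_realpow_zero) auto
  then have "\<forall>\<^sub>F n in sequentially. 10 * A * (4/5) ^ n < \<epsilon>" using \<epsilon> by (intro order_tendstoD(2)) auto
  then obtain n1 where n1: "\<And>n. n1 \<le> n \<Longrightarrow> 10 * A * (4/5) ^ n < \<epsilon>" by (auto simp: eventually_sequentially)
  define n where "n = max n0 n1"
  obtain \<delta> where \<delta>: "\<delta> > 0" "\<And>x y. x \<in> SG q \<Longrightarrow> y \<in> SG q \<Longrightarrow> dist x y < \<delta> \<Longrightarrow>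
     \<exists>w w' i j. length w = n \<and> length w' = n \<and> x \<in> cell q w \<and> y \<in> cell q w' \<and> vx w i = vx w' j"
    using close_points[of n] by metis
  show "\<exists>d>0. \<forall>x\<in>vertices. \<forall>x'\<in>vertices. dist x' x < d \<longrightarrow> dist (refined x') (refined x) < \<epsilon>"
  proof (intro exI[of _ \<delta>] conjI \<delta>(1) ballI impI)
    fix x y assume xy: "x \<in> vertices" "y \<in> vertices" "dist y x < \<delta>"
    then obtain w w' i j where w: "length w = n" "length w' = n" "y \<in> cell q w" "x \<in> cell q w'" "vx w i = vx w' j"
      using \<delta>(2)[of y x] vertices_SG by blast
    have "norm (refined y - refined (vx w i)) \<le> 5 * A * (4/5) ^ n" "norm (refined x - refined (vx w' j)) \<le> 5 * A * (4/5) ^ n"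
      using cellosc[of w y i] cellosc[of w' x j] w xy by (auto simp: n_def)
    then have "dist (refined y) (refined x) \<le> 5 * A * (4/5) ^ n + 5 * A * (4/5) ^ n"
      unfolding w(5) dist_norm using norm_diff_triangle_le norm_minus_commute by metis
    then show "dist (refined y) (refined x) < \<epsilon>" using n1[of n] by (simp add: n_def)
  qed
qed

end

text \<open>The constant depends only on \<open>r\<close> and \<open>n0\<close>, not on the data.
  This uniformity later turns the construction of solutions from jets into bounded operators and
  thereby bounds the monomials.\<close>

theorem extension_exists:
  assumes r: "0 < r" "r / 5 ^ Suc n0 < rad2"
  shows "\<exists>C\<ge>0. \<forall>Q M. (\<forall>v a b k. a \<noteq> b \<longrightarrow> length v + Suc k = n0 \<longrightarrow> Q (v @ a # replicate k b) b = Q (v @ b # replicate k a) a) \<longrightarrow>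
    (\<forall>v a b k. a \<noteq> b \<longrightarrow> length v + Suc k = n0 \<longrightarrow>
      4 *\<^sub>R Q (v @ a # replicate k b) b - opr (r / 5 ^ n0) decim (Q (v @ a # replicate k b) b) =
      (Q (v @ a # replicate k b) (b + 1) + Q (v @ a # replicate k b) (b + 2)) +
      (Q (v @ b # replicate k a) (a + 1) + Q (v @ b # replicate k a) (a + 2))) \<longrightarrow>
    (\<forall>w i. length w = n0 \<longrightarrow> norm (Q w i) \<le> M) \<longrightarrow>
    (\<exists>G. (\<forall>j. continuous_on (SG q) (\<lambda>x. apply_bcontfun (G x) j)) \<and> (\<forall>n\<ge>n0. level r n G) \<and> (\<forall>w i. length w = n0 \<longrightarrow> G (vx w i) = Q w i) \<and>
      (\<forall>x\<in>SG q. norm (G x) \<le> C * M))"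
proof -
  from refine_bounds[OF r] obtain C where C: "C \<ge> 0"
    "\<And>Q M w i. (\<And>w i. length w = n0 \<Longrightarrow> norm (Q w i) \<le> M) \<Longrightarrow> n0 \<le> length w \<Longrightarrow> norm (refine r n0 Q w i) \<le> C * M"
    by metis
  show ?thesis
  proof (intro exI[of _ C] conjI C(1) allI impI)
    fix Q :: "3 list \<Rightarrow> 3 \<Rightarrow> bseq" and M
    assume Q: "\<forall>v a b k. a \<noteq> b \<longrightarrow> length v + Suc k = n0 \<longrightarrow> Q (v @ a # replicate k b) b = Q (v @ b # replicate k a) a"
     "\<forall>v a b k. a \<noteq> b \<longrightarrow> length v + Suc k = n0 \<longrightarrow>
      4 *\<^sub>R Q (v @ a # replicate k b) b - opr (r / 5 ^ n0) decim (Q (v @ a # replicate k b) b) =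
      (Q (v @ a # replicate k b) (b + 1) + Q (v @ a # replicate k b) (b + 2)) +
      (Q (v @ b # replicate k a) (a + 1) + Q (v @ b # replicate k a) (a + 2))"
     and M: "\<forall>w i. length w = n0 \<longrightarrow> norm (Q w i) \<le> M"
    let ?U = "refined r n0 Q"
    have uc: "uniformly_continuous_on vertices ?U"
      by (rule refined_uniformly_continuous[OF r]) (erule (1) Q(1)[rule_format] Q(2)[rule_format])+
    have ulev: "level r n ?U" if "n0 \<le> n" for n
      using that by (intro refined_level[OF r]) (erule (1) Q(1)[rule_format] Q(2)[rule_format])+
    have uvx: "?U (vx w i) = refine r n0 Q w i" if "n0 \<le> length w" for w i
      using that by (intro refined_vx[OF r]) (erule (1) Q(1)[rule_format] Q(2)[rule_format])+
    have le: "norm (?U x) \<le> C * M" if "x \<in> vertices" for x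
      using vertex_deep[OF that, of n0] C(2)[of Q M] M by (auto simp: uvx)
    \<comment> \<open>Each component is extended separately from the vertices to their closure; the
      bound \<open>C * M\<close>, common to all components, then makes the limits a bounded sequence
      again.\<close>
    have "\<exists>g. uniformly_continuous_on (closure vertices) g \<and> (\<forall>x\<in>vertices. apply_bcontfun (?U x) j = g x)" for j
    proof -
      have "uniformly_continuous_on vertices (\<lambda>x. apply_bcontfun (?U x) j)"
        unfolding uniformly_continuous_on_def
      proof (intro allI impI)
        fix \<epsilon> :: real assume "\<epsilon> > 0"
        then obtain d where d: "d > 0" "\<forall>x\<in>vertices. \<forall>x'\<in>vertices. dist x' x < d \<longrightarrow> dist (?U x') (?U x) < \<epsilon>"
          using uc unfolding uniformly_continuous_on_def by blast
        have "dist (apply_bcontfun (?U x') j) (apply_bcontfun (?U x) j) < \<epsilon>"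
          if "x \<in> vertices" "x' \<in> vertices" "dist x' x < d" for x x'
          by (rule le_less_trans[OF dist_bounded]) (use d(2) that in blast)
        then show "\<exists>d>0. \<forall>x\<in>vertices. \<forall>x'\<in>vertices. dist x' x < d \<longrightarrow>
            dist (apply_bcontfun (?U x') j) (apply_bcontfun (?U x) j) < \<epsilon>"
          using d(1) by blast
      qed
      from uniformly_continuous_on_extension_on_closure[OF this] show ?thesis by metis
    qed
    then obtain g where g: "\<And>j. uniformly_continuous_on (closure vertices) (g j)"
      "\<And>j x. x \<in> vertices \<Longrightarrow> apply_bcontfun (?U x) j = g j x" by metis
    have cont: "continuous_on (SG q) (g j)" for j using uniformly_continuous_imp_continuous[OF g(1)] by (simp add: SG_eq)
    have gle: "\<bar>g j x\<bar> \<le> C * M" if "x \<in> SG q" for j x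
    proof -
      have "norm (g j y) \<le> C * M" if "y \<in> vertices" for y
        using abs_bseq_le[of "?U y" j] le[OF that] g(2)[OF that, of j] by simp
      then show ?thesis
        using continuous_on_closure_norm_le[of vertices "g j" "C * M" x] cont that by (auto simp: SG_eq)
    qed
    define G where "G = (\<lambda>x. Bcontfun (\<lambda>j. g j x))"
    have apG: "apply_bcontfun (G x) j = g j x" if "x \<in> SG q" for x j
      unfolding G_def by (rule apply_Bcontfun[OF gle[OF that]])
    have contG: "continuous_on (SG q) (\<lambda>x. apply_bcontfun (G x) j)" for j
      using cont[of j] apG by (simp cong: continuous_on_cong)
    have Gv: "G (vx w i) = ?U (vx w i)" for w i
      by (rule bcontfun_eqI) (simp add: apG g(2))
    have lev: "level r n G" if "n0 \<le> n" for n
      using ulev[OF that] unfolding level_def residual_def graph_lap_def opposite_def by (simp add: Gv)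
    have "norm (G x) \<le> C * M" if "x \<in> SG q" for x
      by (rule norm_bseq_le) (simp add: apG[OF that] gle[OF that])
    then show "\<exists>G. (\<forall>j. continuous_on (SG q) (\<lambda>x. apply_bcontfun (G x) j)) \<and> (\<forall>n\<ge>n0. level r n G) \<and> (\<forall>w i. length w = n0 \<longrightarrow> G (vx w i) = Q w i) \<and>
      (\<forall>x\<in>SG q. norm (G x) \<le> C * M)"
      using contG lev by (intro exI[of _ G]) (auto simp: Gv uvx refine_base)
  qed
qed

section \<open>From level equations back to the Laplacian\<close>

definition fun_of :: "real \<Rightarrow> (plane \<Rightarrow> bseq) \<Rightarrow> nat \<Rightarrow> plane \<Rightarrow> real" where
  "fun_of r G j x = (-3/2 * r) ^ j * apply_bcontfun (G x) j"

text \<open>A level equation replaces the graph Laplacian by \<open>K\<close>, which is r / 5^n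
  times the shift up to order 25^-n. After multiplication by 5^n the error still tends to 0
  uniformly in the vertex, as the definition of the Laplacian demands.\<close>

theorem level_tower:
  assumes r: "0 < r" and cont: "\<And>j. continuous_on (SG q) (\<lambda>x. apply_bcontfun (G x) j)" and lev: "\<And>n. n0 \<le> n \<Longrightarrow> level r n G"
    and B: "\<And>x. x \<in> SG q \<Longrightarrow> norm (G x) \<le> B"
  shows "tower (3/2 * r) (fun_of r G)"
  unfolding tower_def
proof (intro conjI allI)
  show "\<exists>C. \<forall>j. \<forall>x\<in>SG q. \<bar>fun_of r G j x\<bar> \<le> C * (3/2 * r) ^ j"
  proof (intro exI[of _ B] allI ballI)
    fix j x assume "x \<in> SG q"
    then have "\<bar>apply_bcontfun (G x) j\<bar> \<le> B" using abs_bseq_le B order_trans by blast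
    then show "\<bar>fun_of r G j x\<bar> \<le> B * (3/2 * r) ^ j"
      using r by (simp add: fun_of_def abs_mult power_abs mult.commute[of B] mult_left_mono)
  qed
  fix j
  have contj: "continuous_on (SG q) (fun_of r G j)" for j
    unfolding fun_of_def by (intro continuous_intros cont)
  obtain C where C: "C \<ge> 0" "\<And>\<rho> s. 0 \<le> \<rho> \<Longrightarrow> \<rho> \<le> r \<Longrightarrow> norm (opr \<rho> decim s - \<rho> *\<^sub>R shift s) \<le> C * \<rho>\<^sup>2 * norm s"
    using opr_decim_near_shift[OF r] by blast
  have B0: "0 \<le> B" using B[OF q_in_SG[of 0]] norm_ge_zero order_trans by blast
  define D where "D = 3/2 * (3/2 * r) ^ j * C * r\<^sup>2 * B"
  have D: "0 \<le> D" using C(1) B0 r by (simp add: D_def)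
  have est: "\<bar>- (3/2 * 5 ^ (length v + Suc k) * graph_lap (fun_of r G j) v a b k)
        - fun_of r G (Suc j) (vx (v @ a # replicate k b) b)\<bar> \<le> D / 5 ^ (length v + Suc k)"
    if ab: "a \<noteq> b" and n: "n0 \<le> length v + Suc k" for v a b k
  proof -
    define n where "n = length v + Suc k"
    define x where "x = vx (v @ a # replicate k b) b"
    have "residual r G v a b k = 0" using lev[OF n] ab by (auto simp: level_def)
    then have "graph_lap G v a b k = opr (r / 5 ^ n) decim (G x)" by (simp add: residual_def n_def x_def)
    then have "graph_lap (fun_of r G j) v a b k = (-3/2 * r) ^ j * apply_bcontfun (opr (r / 5 ^ n) decim (G x)) j"
      unfolding fun_of_def graph_lap_cmult by (simp flip: apply_graph_lap)
    then have "- (3/2 * 5 ^ n * graph_lap (fun_of r G j) v a b k) - fun_of r G (Suc j) x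
        = - (3/2 * 5 ^ n * (-3/2 * r) ^ j) * apply_bcontfun (opr (r / 5 ^ n) decim (G x) - (r / 5 ^ n) *\<^sub>R shift (G x)) j"
      by (simp add: fun_of_def field_simps)
    also have "\<bar>\<dots>\<bar> \<le> (3/2 * 5 ^ n * (3/2 * r) ^ j) * (C * (r / 5 ^ n)\<^sup>2 * B)"
    proof -
      have "r / 5 ^ n \<le> r / 1" using r by (intro divide_left_mono) auto
      then have "norm (opr (r / 5 ^ n) decim (G x) - (r / 5 ^ n) *\<^sub>R shift (G x)) \<le> C * (r / 5 ^ n)\<^sup>2 * norm (G x)"
        using r by (intro C(2)) auto
      also have "\<dots> \<le> C * (r / 5 ^ n)\<^sup>2 * B" using C(1) by (intro mult_left_mono B) (auto simp: x_def)
      finally have "\<bar>apply_bcontfun (opr (r / 5 ^ n) decim (G x) - (r / 5 ^ n) *\<^sub>R shift (G x)) j\<bar> \<le> C * (r / 5 ^ n)\<^sup>2 * B"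
        using abs_bseq_le order_trans by blast
      moreover have "\<bar>- (3/2 * 5 ^ n * (-3/2 * r) ^ j)\<bar> = 3/2 * 5 ^ n * (3/2 * r) ^ j"
        using r by (simp add: abs_mult power_abs)
      ultimately show ?thesis unfolding abs_mult[of "- (3/2 * 5 ^ n * (-3/2 * r) ^ j)"]
        using r by (intro mult_mono) auto
    qed
    also have "\<dots> = D / 5 ^ n" by (simp add: D_def power2_eq_square)
    finally show ?thesis by (simp only: n_def x_def)
  qed
  show "has_laplacian_SG q (fun_of r G j) (fun_of r G (Suc j))"
    unfolding has_laplacian_SG_iff
  proof (intro conjI contj allI impI)
    fix \<epsilon> :: real assume \<epsilon>: "\<epsilon> > 0"
    obtain N where N: "D / \<epsilon> < 5 ^ N" using real_arch_pow[of 5] by auto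
    show "\<exists>M. \<forall>v a b k. a \<noteq> b \<longrightarrow> M \<le> length v + Suc k \<longrightarrow>
        \<bar>- (3/2 * 5 ^ (length v + Suc k) * graph_lap (fun_of r G j) v a b k) - fun_of r G (Suc j) (vx (v @ a # replicate k b) b)\<bar> < \<epsilon>"
    proof (intro exI[of _ "max n0 N"] allI impI)
      fix v :: "3 list" and a b :: 3 and k assume ab: "a \<noteq> b" and n: "max n0 N \<le> length v + Suc k"
      have "(5::real) ^ N \<le> 5 ^ (length v + Suc k)" using n by (intro power_increasing) auto
      then have "D / \<epsilon> < 5 ^ (length v + Suc k)" using N by linarith
      then have "D / 5 ^ (length v + Suc k) < \<epsilon>" using \<epsilon> by (simp add: field_simps)
      then show "\<bar>- (3/2 * 5 ^ (length v + Suc k) * graph_lap (fun_of r G j) v a b k) - fun_of r G (Suc j) (vx (v @ a # replicate k b) b)\<bar> < \<epsilon>"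
        using est[OF ab, of v k] n by linarith
    qed
  qed
qed

end

section \<open>Jets at a corner\<close>

lemma infinite_product_obtain:
  fixes f :: "real fps"
  assumes "fps_nth f 0 = 1" "fps_conv_radius f > 0"
  obtains P \<rho>0 where "0 < \<rho>0" "fps_nth P 0 = 1" "convergent_at \<rho>0 P" "convergent_at \<rho>0 (inverse P)"
    "convergent_at \<rho>0 f" "P = f * dilate (1/5) P"
proof -
  obtain P where P: "fps_nth P 0 = 1" "fps_conv_radius P > 0" "P = f * dilate (1/5) P"
    using infinite_product_fps[OF assms] by blast
  have "fps_conv_radius (inverse P) > 0" using P by (intro fps_conv_radius_inverse_pos) auto
  then have "0 < min (fps_conv_radius f) (min (fps_conv_radius P) (fps_conv_radius (inverse P)))"
    using P assms by simp
  from ereal_dense2[OF this] obtain \<rho> :: real where "0 < ereal \<rho>"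
    "ereal \<rho> < min (fps_conv_radius f) (min (fps_conv_radius P) (fps_conv_radius (inverse P)))" by blast
  then have "0 < \<rho>" "convergent_at \<rho> P" "convergent_at \<rho> (inverse P)" "convergent_at \<rho> f"
    by (auto simp: convergent_at_def)
  then show ?thesis using that P by blast
qed

text \<open>The product satisfies P z = f z * P (z / 5), so P at r / 5^n applied to a fixed
  \<open>T\<close> solves the recursion. \<open>T\<close> is read off at the level
  \<open>n1\<close>, where P is invertible; it is the limit of the sequence and later becomes a
  derivative.\<close>

lemma product_solution:
  assumes P: "fps_nth P 0 = 1" "convergent_at \<rho>0 P" "convergent_at \<rho>0 (inverse P)" "convergent_at \<rho>0 f"
      "P = f * dilate (1/5) P"
    and r: "0 \<le> r" "r / 5 ^ n1 \<le> \<rho>0"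
    and X: "\<And>n. n1 \<le> n \<Longrightarrow> X n = opr (r / 5 ^ n) f (X (Suc n))"
  defines "T \<equiv> opr (r / 5 ^ n1) (inverse P) (X n1)"
  shows "n1 \<le> n \<Longrightarrow> X n = opr (r / 5 ^ n) P T"
proof (induction n rule: dec_induct)
  case base
  have c: "convergent_at (r / 5 ^ n1) P" "convergent_at (r / 5 ^ n1) (inverse P)"
    using convergent_at_mono[OF P(2), of "r / 5 ^ n1"] convergent_at_mono[OF P(3), of "r / 5 ^ n1"] r by auto
  have "P * inverse P = 1" using inverse_mult_eq_1'[of P] P(1) by simp
  then have "opr (r / 5 ^ n1) P T = opr (r / 5 ^ n1) 1 (X n1)"
    unfolding T_def by (simp flip: opr_mult[OF c])
  then show ?case using r by (simp add: opr_numeral)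
next
  case (step n)
  define \<rho> where "\<rho> = r / 5 ^ n"
  have "\<rho> \<le> r / 5 ^ n1" using step r by (auto simp: \<rho>_def intro!: divide_left_mono power_increasing)
  then have \<rho>: "0 \<le> \<rho>" "\<rho> \<le> \<rho>0" using r by (auto simp: \<rho>_def)
  have c: "convergent_at \<rho> P" "convergent_at \<rho> (inverse P)" "convergent_at \<rho> f"
    using convergent_at_mono[OF _ \<rho>] P by auto
  have "convergent_at (1/5 * \<rho>) P" using convergent_at_mono[OF c(1), of "1/5 * \<rho>"] \<rho> by simp
  then have cd: "convergent_at \<rho> (dilate (1/5) P)" using \<rho> by (simp add: convergent_at_dilate)
  \<comment> \<open>The factor f has the inverse P (z / 5) / P z, so the recursion can also be
    solved towards deeper levels.\<close>
  have one: "dilate (1/5) P * inverse P * f = 1"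
    using inverse_mult_eq_1[of P] P(1) arg_cong[OF P(5), of "\<lambda>x. inverse P * x"] by (simp add: mult_ac)
  have g: "convergent_at \<rho> (dilate (1/5) P * inverse P)" using cd c by (intro convergent_at_combine)
  have "X (Suc n) = opr \<rho> (dilate (1/5) P * inverse P * f) (X (Suc n))"
    unfolding one using \<rho> by (simp add: opr_numeral)
  also have "\<dots> = opr \<rho> (dilate (1/5) P * inverse P) (opr \<rho> P T)"
  proof -
    have "opr \<rho> f (X (Suc n)) = opr \<rho> P T" using X[of n] step.hyps(1) step.IH by (simp add: \<rho>_def)
    then show ?thesis by (simp only: opr_mult[OF g c(3)])
  qed
  also have "\<dots> = opr \<rho> (dilate (1/5) P * (inverse P * P)) T"
    by (simp add: opr_mult[OF g c(1), symmetric] mult.assoc)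
  also have "dilate (1/5) P * (inverse P * P) = dilate (1/5) P"
    using inverse_mult_eq_1[of P] P(1) by simp
  also have "opr \<rho> (dilate (1/5) P) T = opr (r / 5 ^ Suc n) P T"
    by (simp add: opr_dilate \<rho>_def mult.commute)
  finally show ?case .
qed

lemma opr_scaled_tendsto:
  assumes "convergent_at \<rho>0 P" "0 < \<rho>0" "0 \<le> r"
  shows "(\<lambda>n. opr (r / 5 ^ n) P T) \<longlonglongrightarrow> fps_nth P 0 *\<^sub>R T"
proof -
  obtain C where C: "C \<ge> 0" "\<And>\<rho> s. 0 \<le> \<rho> \<Longrightarrow> \<rho> \<le> \<rho>0 \<Longrightarrow> norm (opr \<rho> P s - fps_nth P 0 *\<^sub>R s) \<le> C * \<rho> * norm s"
    using opr_near_const[OF assms(1,2)] by blast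
  have lim: "(\<lambda>n. r / 5 ^ n) \<longlonglongrightarrow> 0"
    using tendsto_mult_right_zero[OF LIMSEQ_realpow_zero[of "1/5::real"], of r] by (simp add: power_divide)
  then have ev: "\<forall>\<^sub>F n in sequentially. r / 5 ^ n < \<rho>0" using assms(2) by (intro order_tendstoD(2)) auto
  have "(\<lambda>n. C * (r / 5 ^ n) * norm T) \<longlonglongrightarrow> C * 0 * norm T" by (intro tendsto_intros lim)
  then have "(\<lambda>n. C * (r / 5 ^ n) * norm T) \<longlonglongrightarrow> 0" by simp
  then have "(\<lambda>n. opr (r / 5 ^ n) P T - fps_nth P 0 *\<^sub>R T) \<longlonglongrightarrow> 0"
  proof (rule Lim_null_comparison[rotated])
    show "\<forall>\<^sub>F n in sequentially. norm (opr (r / 5 ^ n) P T - fps_nth P 0 *\<^sub>R T) \<le> C * (r / 5 ^ n) * norm T"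
      using ev by eventually_elim (intro C(2), use assms(3) in auto)
  qed
  then show ?thesis by (simp add: LIM_zero_iff)
qed

text \<open>The factors by which the antisymmetric and the symmetric parts at a corner change from level
  to level, normalized to have the constant term 1.\<close>

definition anti_factor :: "real fps" where
  "anti_factor = fps_const (1/5) * dilate (1/5) (fps_const 5 - decim)"

definition sym_factor :: "real fps" where
  "sym_factor = fps_const (3/5) * dilate (1/5) (resolvent 6 * ((fps_const 2 - decim) * (fps_const 5 - decim)))"

lemma factor_nth_0: "fps_nth anti_factor 0 = 1" "fps_nth sym_factor 0 = 1"
  by (simp_all add: anti_factor_def sym_factor_def resolvent_nth_0 fps_mult_nth_0)

lemma convergent_at_factor:
  assumes "0 \<le> \<rho>" "\<rho> / 5 < rad3"
  shows "convergent_at \<rho> anti_factor" "convergent_at \<rho> sym_factor"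
proof -
  have "convergent_at (\<rho> / 5) (resolvent 6)" by (rule convergent_at_resolvent_3) (use assms in auto)
  then show "convergent_at \<rho> anti_factor" "convergent_at \<rho> sym_factor"
    unfolding anti_factor_def sym_factor_def using assms
    by (auto intro!: convergent_at_combine simp: convergent_at_dilate simp del: dilate_simps)
qed

lemma factor_conv_radius: "fps_conv_radius anti_factor > 0" "fps_conv_radius sym_factor > 0"
  using convergent_at_factor[of rad3] rad3(1) by (auto simp: convergent_at_def intro: less_trans[of 0 "ereal rad3"])

lemma opr_anti_factor:
  assumes "0 \<le> \<rho>"
  shows "opr \<rho> anti_factor s = (1/5) *\<^sub>R (5 *\<^sub>R s - opr (\<rho>/5) decim s)"
proof -
  have c: "convergent_at \<rho> (dilate (1/5) (fps_const 5 - decim))"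
    using assms by (auto intro!: convergent_at_combine simp: convergent_at_dilate simp del: dilate_simps)
  have "opr \<rho> anti_factor s = (1/5) *\<^sub>R opr (\<rho>/5) (fps_const 5 - decim) s"
    unfolding anti_factor_def using assms c by (simp add: opr_mult opr_const opr_dilate del: dilate_simps)
  then show ?thesis using assms by (simp add: opr_diff_fps opr_const)
qed

lemma opr_sym_factor:
  assumes "0 \<le> \<rho>" "\<rho> / 5 < rad3"
  defines "K \<equiv> opr (\<rho>/5) decim"
  shows "opr \<rho> sym_factor s = (3/5) *\<^sub>R opr (\<rho>/5) (resolvent 6) (10 *\<^sub>R s - 7 *\<^sub>R K s + K (K s))"
proof -
  have c6: "convergent_at (\<rho> / 5) (resolvent 6)" by (rule convergent_at_resolvent_3) (use assms in auto)
  have c: "convergent_at (\<rho>/5) (fps_const 2 - decim)" "convergent_at (\<rho>/5) (fps_const 5 - decim)"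
    "convergent_at (\<rho>/5) decim"
    using assms by (auto intro!: convergent_at_combine)
  have "convergent_at (1/5 * \<rho>) (resolvent 6 * ((fps_const 2 - decim) * (fps_const 5 - decim)))"
    using c c6 by (auto intro!: convergent_at_combine(3))
  then have cd: "convergent_at \<rho> (dilate (1/5) (resolvent 6 * ((fps_const 2 - decim) * (fps_const 5 - decim))))"
    using assms by (subst convergent_at_dilate) auto
  have "opr \<rho> sym_factor s = (3/5) *\<^sub>R opr (\<rho>/5) (resolvent 6 * ((fps_const 2 - decim) * (fps_const 5 - decim))) s"
    unfolding sym_factor_def using assms cd by (simp only: opr_mult convergent_at_const opr_const opr_dilate) simp
  also have "opr (\<rho>/5) (resolvent 6 * ((fps_const 2 - decim) * (fps_const 5 - decim))) s
      = opr (\<rho>/5) (resolvent 6) (opr (\<rho>/5) (fps_const 2 - decim) (opr (\<rho>/5) (fps_const 5 - decim) s))"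
    using c c6 by (simp only: opr_mult convergent_at_combine(3))
  also have "opr (\<rho>/5) (fps_const 2 - decim) (opr (\<rho>/5) (fps_const 5 - decim) s) = 10 *\<^sub>R s - 7 *\<^sub>R K s + K (K s)"
    using assms by (intro bcontfun_eqI) (simp add: opr_diff_fps opr_const opr_linear[OF c(3)] K_def)
  finally show ?thesis .
qed

text \<open>One radius serves both products, their inverses and the factors, and it is below
  \<open>rad2\<close>, so that refinement from the three corners of the gasket is possible at the
  same parameter.\<close>

definition corner_products :: "real fps \<times> real fps \<times> real" where
  "corner_products = (SOME (A, S, \<rho>). 0 < \<rho> \<and> \<rho> < rad2 \<and>
     fps_nth A 0 = 1 \<and> convergent_at \<rho> A \<and> convergent_at \<rho> (inverse A) \<and> convergent_at \<rho> anti_factor \<and> A = anti_factor * dilate (1/5) A \<and>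
     fps_nth S 0 = 1 \<and> convergent_at \<rho> S \<and> convergent_at \<rho> (inverse S) \<and> convergent_at \<rho> sym_factor \<and> S = sym_factor * dilate (1/5) S)"

definition anti_product :: "real fps" where "anti_product = fst corner_products"
definition sym_product :: "real fps" where "sym_product = fst (snd corner_products)"
definition jet_radius :: real where "jet_radius = snd (snd corner_products)"

lemma corner_products:
  "0 < jet_radius" "jet_radius < rad2"
  "fps_nth anti_product 0 = 1" "convergent_at jet_radius anti_product" "convergent_at jet_radius (inverse anti_product)"
  "convergent_at jet_radius anti_factor" "anti_product = anti_factor * dilate (1/5) anti_product"
  "fps_nth sym_product 0 = 1" "convergent_at jet_radius sym_product" "convergent_at jet_radius (inverse sym_product)"
  "convergent_at jet_radius sym_factor" "sym_product = sym_factor * dilate (1/5) sym_product"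
proof -
  obtain A \<rho>1 where A: "0 < \<rho>1" "fps_nth A 0 = 1" "convergent_at \<rho>1 A" "convergent_at \<rho>1 (inverse A)"
    "convergent_at \<rho>1 anti_factor" "A = anti_factor * dilate (1/5) A"
    using infinite_product_obtain[OF factor_nth_0(1) factor_conv_radius(1)] by metis
  obtain S \<rho>2 where S: "0 < \<rho>2" "fps_nth S 0 = 1" "convergent_at \<rho>2 S" "convergent_at \<rho>2 (inverse S)"
    "convergent_at \<rho>2 sym_factor" "S = sym_factor * dilate (1/5) S"
    using infinite_product_obtain[OF factor_nth_0(2) factor_conv_radius(2)] by metis
  define \<rho> where "\<rho> = min (rad2 / 2) (min \<rho>1 \<rho>2)"
  have \<rho>: "0 < \<rho>" "\<rho> < rad2" "\<rho> \<le> \<rho>1" "\<rho> \<le> \<rho>2" using A(1) S(1) rad2(4) by (auto simp: \<rho>_def)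
  have "case corner_products of (A, S, \<rho>) \<Rightarrow> 0 < \<rho> \<and> \<rho> < rad2 \<and>
     fps_nth A 0 = 1 \<and> convergent_at \<rho> A \<and> convergent_at \<rho> (inverse A) \<and> convergent_at \<rho> anti_factor \<and> A = anti_factor * dilate (1/5) A \<and>
     fps_nth S 0 = 1 \<and> convergent_at \<rho> S \<and> convergent_at \<rho> (inverse S) \<and> convergent_at \<rho> sym_factor \<and> S = sym_factor * dilate (1/5) S"
    unfolding corner_products_def
  proof (rule someI[of _ "(A, S, \<rho>)"], unfold split, intro conjI)
    show "convergent_at \<rho> A" "convergent_at \<rho> (inverse A)" "convergent_at \<rho> anti_factor"
      using A(3-5) \<rho> convergent_at_mono less_imp_le by blast+
    show "convergent_at \<rho> S" "convergent_at \<rho> (inverse S)" "convergent_at \<rho> sym_factor"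
      using S(3-5) \<rho> convergent_at_mono less_imp_le by blast+
  qed (fact \<rho> A S)+
  then show "0 < jet_radius" "jet_radius < rad2"
    "fps_nth anti_product 0 = 1" "convergent_at jet_radius anti_product" "convergent_at jet_radius (inverse anti_product)"
    "convergent_at jet_radius anti_factor" "anti_product = anti_factor * dilate (1/5) anti_product"
    "fps_nth sym_product 0 = 1" "convergent_at jet_radius sym_product" "convergent_at jet_radius (inverse sym_product)"
    "convergent_at jet_radius sym_factor" "sym_product = sym_factor * dilate (1/5) sym_product"
    unfolding anti_product_def sym_product_def jet_radius_def by (simp_all only: case_prod_beta)
qed

section \<open>Restriction to cells, and the recursion at a corner\<close>

context gasket
begin

text \<open>Restriction to a cell lowers the level by the length of the word and divides
  \<open>r\<close> by the same power of 5. The quotient that enters the operator is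
  unchanged.\<close>

lemma residual_restrict: "residual (r / 5 ^ length w) (G \<circ> Fw q w) v a b k = residual r G (w @ v) a b k"
  by (simp add: residual_def graph_lap_def opposite_def vx_append power_add mult_ac)

lemma level_restrict:
  assumes "level r (length w + n) G"
  shows "level (r / 5 ^ length w) n (G \<circ> Fw q w)"
  using assms unfolding level_def residual_restrict by (auto simp: add.assoc)

lemma residual_linear:
  assumes "0 \<le> r"
  shows "residual r (\<lambda>x. G x + H x) v a b k = residual r G v a b k + residual r H v a b k"
    "residual r (\<lambda>x. G x - H x) v a b k = residual r G v a b k - residual r H v a b k"
    "residual r (\<lambda>x. c *\<^sub>R G x) v a b k = c *\<^sub>R residual r G v a b k"
    "residual r (\<lambda>x. shift (G x)) v a b k = shift (residual r G v a b k)"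
proof -
  have cv: "convergent_at (r / 5 ^ (length v + Suc k)) decim" using assms by simp
  note lin = opr_linear[OF cv] opr_shift[OF cv]
  show "residual r (\<lambda>x. G x + H x) v a b k = residual r G v a b k + residual r H v a b k"
    "residual r (\<lambda>x. G x - H x) v a b k = residual r G v a b k - residual r H v a b k"
    "residual r (\<lambda>x. c *\<^sub>R G x) v a b k = c *\<^sub>R residual r G v a b k"
    "residual r (\<lambda>x. shift (G x)) v a b k = shift (residual r G v a b k)"
    unfolding residual_def graph_lap_def opposite_def lin shift_linear
    by (simp_all add: scaleR_diff_right scaleR_add_right mult.commute)
qed

lemma level_linear:
  assumes "0 \<le> r" "level r n G" "level r n H"
  shows "level r n (\<lambda>x. G x + H x)" "level r n (\<lambda>x. G x - H x)" "level r n (\<lambda>x. c *\<^sub>R G x)" "level r n (\<lambda>x. shift (G x))"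
  using assms unfolding level_def residual_linear[OF assms(1)] by (simp_all add: shift_linear)

definition corner_sum :: "(plane \<Rightarrow> 'b::real_vector) \<Rightarrow> 3 \<Rightarrow> nat \<Rightarrow> 'b" where
  "corner_sum G a n = opposite G (replicate n a) a"

definition corner_diff :: "(plane \<Rightarrow> 'b::real_vector) \<Rightarrow> 3 \<Rightarrow> nat \<Rightarrow> 'b" where
  "corner_diff G a n = G (vx (replicate n a) (a + 1)) - G (vx (replicate n a) (a + 2))"

text \<open>For real functions these are the normal and the tangential derivative. For
  sequence-valued functions the limits are taken in the supremum norm, so that one pair of sequences
  holds the derivatives of all powers of the Laplacian.\<close>

definition has_jet :: "(plane \<Rightarrow> 'b::real_normed_vector) \<Rightarrow> 3 \<Rightarrow> 'b \<Rightarrow> 'b \<Rightarrow> bool" where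
  "has_jet G a N T \<longleftrightarrow> ((\<lambda>n. (5/3) ^ n *\<^sub>R (2 *\<^sub>R G (q a) - corner_sum G a n)) \<longlonglongrightarrow> N) \<and>
     ((\<lambda>n. 5 ^ n *\<^sub>R corner_diff G a n) \<longlonglongrightarrow> T)"

lemma has_jet_real:
  "has_jet (G :: plane \<Rightarrow> real) a N T \<longleftrightarrow> has_normal_deriv q G a N \<and> has_tangential_deriv q G a T"
  unfolding has_jet_def has_normal_deriv_def has_tangential_deriv_def corner_sum_def corner_diff_def opposite_def
  by (simp add: funpow_F vx_def letter_diff algebra_simps)

lemma has_jet_unique: "has_jet G a N T \<Longrightarrow> has_jet G a N' T' \<Longrightarrow> N = N' \<and> T = T'"
  unfolding has_jet_def using LIMSEQ_unique by blast

lemma has_jet_linear: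
  assumes "has_jet G a N T" "has_jet H a N' T'"
  shows "has_jet (\<lambda>x. G x + H x) a (N + N') (T + T')" "has_jet (\<lambda>x. G x - H x) a (N - N') (T - T')"
    "has_jet (\<lambda>x. c *\<^sub>R G x) a (c *\<^sub>R N) (c *\<^sub>R T)"
proof -
  note l = assms[unfolded has_jet_def]
  show "has_jet (\<lambda>x. G x + H x) a (N + N') (T + T')"
    using tendsto_add[OF l(1)[THEN conjunct1] l(2)[THEN conjunct1]] tendsto_add[OF l(1)[THEN conjunct2] l(2)[THEN conjunct2]]
    unfolding has_jet_def corner_sum_def corner_diff_def opposite_def by (simp add: algebra_simps)
  show "has_jet (\<lambda>x. G x - H x) a (N - N') (T - T')"
    using tendsto_diff[OF l(1)[THEN conjunct1] l(2)[THEN conjunct1]] tendsto_diff[OF l(1)[THEN conjunct2] l(2)[THEN conjunct2]]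
    unfolding has_jet_def corner_sum_def corner_diff_def opposite_def by (simp add: algebra_simps)
  show "has_jet (\<lambda>x. c *\<^sub>R G x) a (c *\<^sub>R N) (c *\<^sub>R T)"
    using tendsto_scaleR[OF tendsto_const l(1)[THEN conjunct1], of c] tendsto_scaleR[OF tendsto_const l(1)[THEN conjunct2], of c]
    unfolding has_jet_def corner_sum_def corner_diff_def opposite_def by (simp add: algebra_simps)
qed

lemma has_jet_bounded_linear:
  assumes "bounded_linear L" "has_jet G a N T"
  shows "has_jet (\<lambda>x. L (G x)) a (L N) (L T)"
proof -
  interpret L: bounded_linear L by fact
  note l = assms(2)[unfolded has_jet_def]
  show ?thesis
    using L.tendsto[OF l[THEN conjunct1]] L.tendsto[OF l[THEN conjunct2]]
    unfolding has_jet_def corner_sum_def corner_diff_def opposite_def by (simp add: L.add L.diff L.scaleR)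
qed

text \<open>Composition with \<open>F q a\<close> shifts the defining sequences by one index, and
  their scaling factors are 5/3 and 5.\<close>

lemma has_jet_restrict: "has_jet G a N T \<longleftrightarrow> has_jet (G \<circ> F q a) a ((3/5) *\<^sub>R N) ((1/5) *\<^sub>R T)"
proof -
  have e: "corner_sum (G \<circ> F q a) a n = corner_sum G a (Suc n)" "corner_diff (G \<circ> F q a) a n = corner_diff G a (Suc n)" for n
    by (simp_all add: corner_sum_def corner_diff_def opposite_def vx_Cons)
  have N: "(\<lambda>n. (5/3) ^ n *\<^sub>R (2 *\<^sub>R G (q a) - corner_sum G a (Suc n))) \<longlonglongrightarrow> (3/5) *\<^sub>R N
      \<longleftrightarrow> (\<lambda>n. (5/3) ^ n *\<^sub>R (2 *\<^sub>R G (q a) - corner_sum G a n)) \<longlonglongrightarrow> N" (is "?A \<longleftrightarrow> ?B")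
  proof -
    have "?B \<longleftrightarrow> (\<lambda>n. (5/3) ^ Suc n *\<^sub>R (2 *\<^sub>R G (q a) - corner_sum G a (Suc n))) \<longlonglongrightarrow> N"
      using filterlim_sequentially_Suc[of "\<lambda>n. (5/3) ^ n *\<^sub>R (2 *\<^sub>R G (q a) - corner_sum G a n)" "nhds N"] by simp
    also have "\<dots> \<longleftrightarrow> ?A"
      using tendsto_scaleR[OF tendsto_const, of "\<lambda>n. (5/3) ^ Suc n *\<^sub>R (2 *\<^sub>R G (q a) - corner_sum G a (Suc n))" N sequentially "3/5"]
        tendsto_scaleR[OF tendsto_const, of "\<lambda>n. (5/3) ^ n *\<^sub>R (2 *\<^sub>R G (q a) - corner_sum G a (Suc n))" "(3/5) *\<^sub>R N" sequentially "5/3"]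
      by auto
    finally show ?thesis by simp
  qed
  have T: "(\<lambda>n. 5 ^ n *\<^sub>R corner_diff G a (Suc n)) \<longlonglongrightarrow> (1/5) *\<^sub>R T
      \<longleftrightarrow> (\<lambda>n. 5 ^ n *\<^sub>R corner_diff G a n) \<longlonglongrightarrow> T" (is "?A \<longleftrightarrow> ?B")
  proof -
    have "?B \<longleftrightarrow> (\<lambda>n. 5 ^ Suc n *\<^sub>R corner_diff G a (Suc n)) \<longlonglongrightarrow> T"
      using filterlim_sequentially_Suc[of "\<lambda>n. 5 ^ n *\<^sub>R corner_diff G a n" "nhds T"] by simp
    also have "\<dots> \<longleftrightarrow> ?A"
      using tendsto_scaleR[OF tendsto_const, of "\<lambda>n. 5 ^ Suc n *\<^sub>R corner_diff G a (Suc n)" T sequentially "1/5"]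
        tendsto_scaleR[OF tendsto_const, of "\<lambda>n. 5 ^ n *\<^sub>R corner_diff G a (Suc n)" "(1/5) *\<^sub>R T" sequentially "5"]
      by auto
    finally show ?thesis by simp
  qed
  show ?thesis unfolding has_jet_def e using N T by simp
qed

text \<open>Twice the value at the corner, corrected to second order, is the sum over the neighbours of the even solution with that value.\<close>

definition sym_part :: "real \<Rightarrow> (plane \<Rightarrow> bseq) \<Rightarrow> 3 \<Rightarrow> nat \<Rightarrow> bseq" where
  "sym_part r G a n = corner_sum G a n - 2 *\<^sub>R G (q a) + (1/2) *\<^sub>R opr (r / 5 ^ n) decim (G (q a))"

text \<open>The difference of the two midpoint equations at the corner gives the antisymmetric part.
  In their sum the third midpoint is eliminated by its own equation; the correction by half of
  \<open>K\<close> in \<open>sym_part\<close> is the particular solution that removes the corner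
  value and leaves a homogeneous recursion.\<close>

lemma corner_recursion:
  assumes r: "0 \<le> r" and lev: "level r (Suc n) G"
  defines "K \<equiv> opr (r / 5 ^ Suc n) decim"
  shows "corner_diff G a n = 5 *\<^sub>R corner_diff G a (Suc n) - K (corner_diff G a (Suc n))"
    and "6 *\<^sub>R sym_part r G a n - K (sym_part r G a n)
      = 10 *\<^sub>R sym_part r G a (Suc n) - 7 *\<^sub>R K (sym_part r G a (Suc n)) + K (K (sym_part r G a (Suc n)))"
proof -
  let ?w = "replicate n a"
  have c: "convergent_at (r / 5 ^ Suc n) decim" using r by simp
  note lin = opr_linear[OF c, folded K_def]
  have K0: "opr (r / 5 ^ n) decim s = 5 *\<^sub>R K s - K (K s)" for s
    using opr_decim_step[of "r / 5 ^ n" s] r by (simp add: K_def mult.commute)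
  have w: "replicate (Suc n) a = ?w @ [a]" by (simp add: replicate_append_same)
  have va: "vx ?w a = q a" by (simp add: vx_def)
  define p b c s1 s2 s3 where "p = G (q a)" and "b = G (vx ?w (a + 1))" and "c = G (vx ?w (a + 2))"
    and "s1 = G (vx (?w @ [a]) (a + 1))" and "s2 = G (vx (?w @ [a]) (a + 2))" and "s3 = G (vx (?w @ [a + 1]) (a + 2))"
  note eqs = level_midpoints[OF lev, of ?w a, folded K_def, unfolded va, folded p_def b_def c_def s1_def s2_def s3_def, simplified length_replicate, OF refl]
  have pt: "4 * apply_bcontfun s1 j - apply_bcontfun (K s1) j = apply_bcontfun p j + apply_bcontfun b j + apply_bcontfun s2 j + apply_bcontfun s3 j"
    "4 * apply_bcontfun s2 j - apply_bcontfun (K s2) j = apply_bcontfun p j + apply_bcontfun c j + apply_bcontfun s1 j + apply_bcontfun s3 j"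
    "4 * apply_bcontfun s3 j - apply_bcontfun (K s3) j = apply_bcontfun b j + apply_bcontfun c j + apply_bcontfun s1 j + apply_bcontfun s2 j" for j
    using eqs[THEN arg_cong[of _ _ apply_bcontfun], THEN fun_cong, of j] by simp_all
  have pK: "4 * apply_bcontfun (K s1) j - apply_bcontfun (K (K s1)) j = apply_bcontfun (K p) j + apply_bcontfun (K b) j + apply_bcontfun (K s2) j + apply_bcontfun (K s3) j"
    "4 * apply_bcontfun (K s2) j - apply_bcontfun (K (K s2)) j = apply_bcontfun (K p) j + apply_bcontfun (K c) j + apply_bcontfun (K s1) j + apply_bcontfun (K s3) j" for j
    using eqs(1,2)[THEN arg_cong[of _ _ K], THEN arg_cong[of _ _ apply_bcontfun], THEN fun_cong, of j] by (simp_all add: lin)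
  show "corner_diff G a n = 5 *\<^sub>R corner_diff G a (Suc n) - K (corner_diff G a (Suc n))"
    unfolding corner_diff_def w
    by (rule bcontfun_eqI) (use pt in \<open>simp add: lin flip: b_def c_def s1_def s2_def; smt (verit)\<close>)
  show "6 *\<^sub>R sym_part r G a n - K (sym_part r G a n)
      = 10 *\<^sub>R sym_part r G a (Suc n) - 7 *\<^sub>R K (sym_part r G a (Suc n)) + K (K (sym_part r G a (Suc n)))"
  proof (rule bcontfun_eqI)
    fix j
    show "apply_bcontfun (6 *\<^sub>R sym_part r G a n - K (sym_part r G a n)) j
      = apply_bcontfun (10 *\<^sub>R sym_part r G a (Suc n) - 7 *\<^sub>R K (sym_part r G a (Suc n)) + K (K (sym_part r G a (Suc n)))) j"
      unfolding sym_part_def K0 K_def[symmetric] corner_sum_def opposite_def w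
      unfolding p_def[symmetric] b_def[symmetric] c_def[symmetric] s1_def[symmetric] s2_def[symmetric]
      using pt[of j] pK[of j] by (simp add: lin) argo
  qed
qed

text \<open>After scaling by 5 and 5/3, both recursions have factors with constant term 1, so they
  are solved by the infinite products and have limits. The existence of the derivatives thus follows
  from the level equations, and the values near the corner are explicit functions of the
  jet.\<close>

theorem corner_solution:
  assumes r: "0 \<le> r" "r / 5 ^ n1 \<le> jet_radius" and lev: "\<And>n. n1 \<le> n \<Longrightarrow> level r (Suc n) G"
  shows "\<exists>N T. has_jet G a N T \<and> (\<forall>n\<ge>n1. 5 ^ n *\<^sub>R corner_diff G a n = opr (r / 5 ^ n) anti_product T \<and>
    (5/3) ^ n *\<^sub>R sym_part r G a n = - opr (r / 5 ^ n) sym_product N)"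
proof -
  define X where "X = (\<lambda>n. 5 ^ n *\<^sub>R corner_diff G a n)"
  define Y where "Y = (\<lambda>n. (5/3) ^ n *\<^sub>R sym_part r G a n)"
  have X: "X n = opr (r / 5 ^ n) anti_factor (X (Suc n))" if "n1 \<le> n" for n
  proof -
    have c: "convergent_at (r / 5 ^ Suc n) decim" using r by simp
    let ?K = "opr (r / 5 ^ Suc n) decim"
    have "opr (r / 5 ^ n) anti_factor (X (Suc n)) = (1/5) *\<^sub>R (5 *\<^sub>R X (Suc n) - ?K (X (Suc n)))"
      using opr_anti_factor[of "r / 5 ^ n" "X (Suc n)"] r by (simp add: mult.commute)
    also have "\<dots> = 5 ^ n *\<^sub>R (5 *\<^sub>R corner_diff G a (Suc n) - ?K (corner_diff G a (Suc n)))"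
      unfolding X_def opr_linear(3)[OF c] by (rule bcontfun_eqI) (simp add: field_simps)
    also have "\<dots> = X n" by (simp only: X_def corner_recursion(1)[OF r(1) lev[OF that], symmetric])
    finally show ?thesis by simp
  qed
  have Y: "Y n = opr (r / 5 ^ n) sym_factor (Y (Suc n))" if "n1 \<le> n" for n
  proof -
    let ?\<rho> = "r / 5 ^ Suc n"
    let ?K = "opr ?\<rho> decim" and ?I = "opr ?\<rho> (resolvent 6)" and ?s = "sym_part r G a"
    have "?\<rho> \<le> r / 5 ^ n1" using that r by (intro divide_left_mono power_increasing) auto
    then have \<rho>: "0 \<le> ?\<rho>" "?\<rho> < rad3" using r corner_products(2) rad2(2) by auto
    have c: "convergent_at ?\<rho> decim" "convergent_at ?\<rho> (resolvent 6)"
      using \<rho> by (auto intro: convergent_at_resolvent_3 simp del: power_Suc)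
    have "opr (r / 5 ^ n) sym_factor (Y (Suc n)) = (3/5) *\<^sub>R ?I (10 *\<^sub>R Y (Suc n) - 7 *\<^sub>R ?K (Y (Suc n)) + ?K (?K (Y (Suc n))))"
      using opr_sym_factor[of "r / 5 ^ n" "Y (Suc n)"] \<rho> r by (simp add: mult.commute)
    also have "10 *\<^sub>R Y (Suc n) - 7 *\<^sub>R ?K (Y (Suc n)) + ?K (?K (Y (Suc n)))
        = (5/3) ^ Suc n *\<^sub>R (10 *\<^sub>R ?s (Suc n) - 7 *\<^sub>R ?K (?s (Suc n)) + ?K (?K (?s (Suc n))))"
      unfolding Y_def opr_linear(3)[OF c(1)] scaleR_diff_right scaleR_add_right scaleR_scaleR by (simp only: mult.commute)
    also have "\<dots> = (5/3) ^ Suc n *\<^sub>R (6 *\<^sub>R ?s n - ?K (?s n))"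
      by (simp only: corner_recursion(2)[OF r(1) lev[OF that]])
    also have "?I \<dots> = (5/3) ^ Suc n *\<^sub>R ?s n"
      unfolding opr_linear(3)[OF c(2)] using opr_resolvent(1)[OF c(2)] by simp
    finally show ?thesis by (simp add: Y_def)
  qed
  define T where "T = opr (r / 5 ^ n1) (inverse anti_product) (X n1)"
  define N where "N = - opr (r / 5 ^ n1) (inverse sym_product) (Y n1)"
  have XT: "X n = opr (r / 5 ^ n) anti_product T" if "n1 \<le> n" for n
    unfolding T_def using that by (intro product_solution[OF corner_products(3-7) r X])
  have YN: "Y n = - opr (r / 5 ^ n) sym_product N" if "n1 \<le> n" for n
  proof -
    have "r / 5 ^ n \<le> r / 5 ^ n1" using that r by (intro divide_left_mono power_increasing) auto
    then have c: "convergent_at (r / 5 ^ n) sym_product"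
      using r by (intro convergent_at_mono[OF corner_products(9)]) auto
    show ?thesis
      unfolding N_def opr_linear(5)[OF c] minus_minus
      using that by (intro product_solution[OF corner_products(8-12) r Y])
  qed
  have "X \<longlonglongrightarrow> T"
  proof (rule Lim_transform_eventually)
    show "(\<lambda>n. opr (r / 5 ^ n) anti_product T) \<longlonglongrightarrow> T"
      using opr_scaled_tendsto[OF corner_products(4,1) r(1), of T] corner_products(3) by simp
    show "\<forall>\<^sub>F n in sequentially. opr (r / 5 ^ n) anti_product T = X n"
      by (rule eventually_sequentiallyI[of n1]) (rule XT[symmetric])
  qed
  moreover have "(\<lambda>n. (5/3) ^ n *\<^sub>R (2 *\<^sub>R G (q a) - corner_sum G a n)) \<longlonglongrightarrow> N"
  proof -
    have "Y \<longlonglongrightarrow> - N"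
    proof (rule Lim_transform_eventually)
      show "(\<lambda>n. - opr (r / 5 ^ n) sym_product N) \<longlonglongrightarrow> - N"
        using tendsto_minus[OF opr_scaled_tendsto[OF corner_products(9,1) r(1), of N]] corner_products(8) by simp
      show "\<forall>\<^sub>F n in sequentially. - opr (r / 5 ^ n) sym_product N = Y n"
        by (rule eventually_sequentiallyI[of n1]) (rule YN[symmetric])
    qed
    \<comment> \<open>The second-order correction in \<open>sym_part\<close> is O(5^-n); multiplied
      by (5/3)^n it is O(3^-n) and does not affect the normal derivative.\<close>
    moreover have "(\<lambda>n. (5/3) ^ n *\<^sub>R (1/2) *\<^sub>R opr (r / 5 ^ n) decim (G (q a))) \<longlonglongrightarrow> 0"
    proof -
      have "convergent_at (r + 1) decim" "0 < r + 1" using r by auto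
      from opr_near_const[OF this] obtain C where C: "C \<ge> 0"
        "\<And>\<rho> s. 0 \<le> \<rho> \<Longrightarrow> \<rho> \<le> r + 1 \<Longrightarrow> norm (opr \<rho> decim s) \<le> C * \<rho> * norm s" by auto
      show ?thesis
      proof (rule Lim_null_comparison)
        have "(\<lambda>n. (1/2 * C * r * norm (G (q a))) * (1/3) ^ n) \<longlonglongrightarrow> (1/2 * C * r * norm (G (q a))) * 0"
          by (intro tendsto_intros LIMSEQ_realpow_zero) auto
        then show "(\<lambda>n. (1/2 * C * r * norm (G (q a))) * (1/3) ^ n) \<longlonglongrightarrow> 0" by simp
        have "norm ((5/3) ^ n *\<^sub>R (1/2) *\<^sub>R opr (r / 5 ^ n) decim (G (q a))) \<le> (1/2 * C * r * norm (G (q a))) * (1/3) ^ n" for n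
        proof -
          have "r / 5 ^ n \<le> r / 1" using r by (intro divide_left_mono) auto
          then have "norm (opr (r / 5 ^ n) decim (G (q a))) \<le> C * (r / 5 ^ n) * norm (G (q a))"
            using r by (intro C(2)) auto
          from mult_left_mono[OF this, of "(5/3) ^ n / 2"]
          show ?thesis by (simp add: power_divide)
        qed
        then show "\<forall>\<^sub>F n in sequentially. norm ((5/3) ^ n *\<^sub>R (1/2) *\<^sub>R opr (r / 5 ^ n) decim (G (q a))) \<le> (1/2 * C * r * norm (G (q a))) * (1/3) ^ n"
          by simp
      qed
    qed
    ultimately have "(\<lambda>n. (5/3) ^ n *\<^sub>R (1/2) *\<^sub>R opr (r / 5 ^ n) decim (G (q a)) - Y n) \<longlonglongrightarrow> 0 - - N"
      by (intro tendsto_diff)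
    moreover have "(5/3) ^ n *\<^sub>R (1/2) *\<^sub>R opr (r / 5 ^ n) decim (G (q a)) - Y n
        = (5/3) ^ n *\<^sub>R (2 *\<^sub>R G (q a) - corner_sum G a n)" for n
      by (rule bcontfun_eqI) (simp add: Y_def sym_part_def algebra_simps)
    ultimately show ?thesis by simp
  qed
  ultimately have "has_jet G a N T" unfolding has_jet_def X_def by blast
  then show ?thesis using XT YN unfolding X_def Y_def by blast
qed

lemma exists_small_level: "\<exists>n1. r / 5 ^ n1 \<le> jet_radius"
proof -
  obtain n where "r / jet_radius < 5 ^ n" using real_arch_pow[of 5] by auto
  then show ?thesis using corner_products(1) by (intro exI[of _ n]) (simp add: field_simps)
qed

text \<open>With zero jet the explicit formulas make the symmetric and the antisymmetric part vanish
  at level \<open>n1\<close>. Hence all three corner values of the small cell are zero, and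
  refinement inside this cell starts from zero.\<close>

lemma zero_jet:
  assumes r: "0 \<le> r" "r / 5 ^ n1 \<le> jet_radius" and lev: "\<And>n. n1 \<le> n \<Longrightarrow> level r (Suc n) G"
    and z: "G (q a) = 0" "has_jet G a 0 0" and p: "p \<in> vertices"
  shows "G (Fw q (replicate n1 a) p) = 0"
proof -
  obtain N T where NT: "has_jet G a N T" "\<And>n. n1 \<le> n \<Longrightarrow> 5 ^ n *\<^sub>R corner_diff G a n = opr (r / 5 ^ n) anti_product T"
    "\<And>n. n1 \<le> n \<Longrightarrow> (5/3) ^ n *\<^sub>R sym_part r G a n = - opr (r / 5 ^ n) sym_product N"
    using corner_solution[OF r lev, of a] by blast
  have NT0: "N = 0" "T = 0" using has_jet_unique[OF NT(1) z(2)] by auto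
  have c: "convergent_at (r / 5 ^ n1) anti_product" "convergent_at (r / 5 ^ n1) sym_product" "convergent_at (r / 5 ^ n1) decim"
    using r convergent_at_mono[OF corner_products(4), of "r / 5 ^ n1"] convergent_at_mono[OF corner_products(9), of "r / 5 ^ n1"] by auto
  let ?w = "replicate n1 a"
  have d: "corner_diff G a n1 = 0" using NT(2)[of n1] by (simp add: NT0 opr_linear(4)[OF c(1)])
  have "sym_part r G a n1 = 0" using NT(3)[of n1] by (simp add: NT0 opr_linear(4)[OF c(2)])
  then have "corner_sum G a n1 = 0" by (simp add: sym_part_def z opr_linear(4)[OF c(3)])
  then have "G (vx ?w (a + 1)) + G (vx ?w (a + 2)) = 0" "G (vx ?w (a + 1)) = G (vx ?w (a + 2))"
    using d by (auto simp: corner_sum_def corner_diff_def opposite_def)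
  then have "2 *\<^sub>R G (vx ?w (a + 1)) = 0" "2 *\<^sub>R G (vx ?w (a + 2)) = 0" by (simp_all add: scaleR_2)
  then have z0: "G (vx ?w i) = 0" for i
    using letter_cases[of i a] z(1) by (auto simp: vx_def)
  have "(G \<circ> Fw q ?w) p = 0"
  proof (rule level_zero[OF _ _ _ _ p, of "r / 5 ^ n1" 0])
    show "0 \<le> r / 5 ^ n1" using r by simp
    have "r / 5 ^ n1 / 5 ^ Suc 0 \<le> r / 5 ^ n1 / 1" using r by (intro divide_left_mono) auto
    then show "r / 5 ^ n1 / 5 ^ Suc 0 < rad2" using r(2) corner_products(2) by linarith
    fix n :: nat assume "0 < n"
    then obtain m where "n = Suc m" by (cases n) auto
    then show "level (r / 5 ^ n1) n (G \<circ> Fw q ?w)"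
      using level_restrict[of r ?w n G] lev[of "n1 + m"] by simp
  next
    fix w :: "3 list" and i assume "length w = 0"
    then show "(G \<circ> Fw q ?w) (vx w i) = 0" using z0[of i] by (simp add: vx_def)
  qed
  then show ?thesis by simp
qed

text \<open>There are no interior vertices of level 0, so the three corner values can be prescribed
  freely, and \<open>corner_solution\<close> at n = 0 says which ones belong to a jet. The solution
  built from them has some jet; invertibility of the two products identifies it with the given
  one.\<close>

theorem small_jet_exists:
  assumes r: "0 < r" "r \<le> jet_radius"
  shows "\<exists>C\<ge>0. \<forall>p N T. \<exists>G. (\<forall>j. continuous_on (SG q) (\<lambda>x. apply_bcontfun (G x) j)) \<and> (\<forall>n. level r n G) \<and>
    G (q a) = p \<and> has_jet G a N T \<and> (\<forall>x\<in>SG q. norm (G x) \<le> C * (norm p + norm N + norm T))"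
proof -
  have r': "r / 5 ^ Suc 0 < rad2"
  proof -
    have "r / 5 ^ Suc 0 \<le> r" using r by simp
    then show ?thesis using r corner_products(2) by linarith
  qed
  have c: "convergent_at r anti_product" "convergent_at r sym_product" "convergent_at r decim"
    "convergent_at r (inverse anti_product)" "convergent_at r (inverse sym_product)"
    using r convergent_at_mono[OF corner_products(4), of r] convergent_at_mono[OF corner_products(9), of r]
      convergent_at_mono[OF corner_products(5), of r] convergent_at_mono[OF corner_products(10), of r] by auto
  obtain C where C: "C \<ge> 0" "\<And>Q M. (\<And>i. norm (Q i) \<le> M) \<Longrightarrow>
    \<exists>G. (\<forall>j. continuous_on (SG q) (\<lambda>x. apply_bcontfun (G x) j)) \<and> (\<forall>n. level r n G) \<and> (\<forall>i. G (q i) = Q i) \<and>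
      (\<forall>x\<in>SG q. norm (G x) \<le> C * M)"
  proof -
    from extension_exists[OF r(1) r'] obtain C where C: "C \<ge> 0" "\<And>Q M. (\<forall>w i. length w = 0 \<longrightarrow> norm (Q w i) \<le> M) \<Longrightarrow>
      \<exists>G. (\<forall>j. continuous_on (SG q) (\<lambda>x. apply_bcontfun (G x) j)) \<and> (\<forall>n\<ge>0. level r n G) \<and>
        (\<forall>w i. length w = 0 \<longrightarrow> G (vx w i) = Q w i) \<and> (\<forall>x\<in>SG q. norm (G x) \<le> C * M)"
      by auto
    show ?thesis
    proof (rule that[OF C(1)])
      fix Q :: "3 \<Rightarrow> bseq" and M assume "\<And>i. norm (Q i) \<le> M"
      then show "\<exists>G. (\<forall>j. continuous_on (SG q) (\<lambda>x. apply_bcontfun (G x) j)) \<and> (\<forall>n. level r n G) \<and> (\<forall>i. G (q i) = Q i) \<and>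
        (\<forall>x\<in>SG q. norm (G x) \<le> C * M)"
        using C(2)[of "\<lambda>_. Q" M] by (auto simp: vx_Nil)
    qed
  qed
  define W where "W = 1 + wnorm r decim + wnorm r sym_product + wnorm r anti_product"
  have w0: "0 \<le> wnorm r decim" "0 \<le> wnorm r sym_product" "0 \<le> wnorm r anti_product"
    using c wnorm_nonneg by auto
  then have W: "W \<ge> 1" by (simp add: W_def)
  show ?thesis
  proof (intro exI[of _ "C * W"] conjI allI)
    show "0 \<le> C * W" using C W by simp
    fix p N T :: bseq
    \<comment> \<open>The required sum and difference of the values at the two other corners,
      obtained by solving the formulas of \<open>corner_solution\<close> at level 0.\<close>
    define \<sigma> where "\<sigma> = 2 *\<^sub>R p - (1/2) *\<^sub>R opr r decim p - opr r sym_product N"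
    define \<delta> where "\<delta> = opr r anti_product T"
    define Q where "Q = (\<lambda>i. if i = a then p else if i = a + 1 then (1/2) *\<^sub>R (\<sigma> + \<delta>) else (1/2) *\<^sub>R (\<sigma> - \<delta>))"
    have n\<sigma>: "norm \<sigma> \<le> 2 * norm p + 1/2 * (wnorm r decim * norm p) + wnorm r sym_product * norm N"
      unfolding \<sigma>_def using norm_opr[OF c(3), of p] norm_opr[OF c(2), of N]
      by (intro order_trans[OF norm_triangle_ineq4] add_mono) auto
    have n\<delta>: "norm \<delta> \<le> wnorm r anti_product * norm T" unfolding \<delta>_def by (rule norm_opr[OF c(1)])
    have "norm (Q i) \<le> W * (norm p + norm N + norm T)" for i
    proof -
      have Wm: "x * norm s \<le> W * norm s" if "x \<le> W" for x and s :: bseq using that by (intro mult_right_mono) auto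
      have 1: "1 * norm p \<le> W * norm p" "wnorm r decim * norm p \<le> W * norm p" "wnorm r sym_product * norm N \<le> W * norm N"
        "wnorm r anti_product * norm T \<le> W * norm T"
        by (intro Wm; use w0 in \<open>simp add: W_def\<close>)+
      have 2: "norm p + 1/4 * (wnorm r decim * norm p) \<le> W * norm p"
      proof -
        have "(1 + 1/4 * wnorm r decim) * norm p \<le> W * norm p" by (rule Wm) (use w0 in \<open>simp add: W_def\<close>)
        then show ?thesis by (simp add: algebra_simps)
      qed
      have nn: "0 \<le> W * norm N" "0 \<le> W * norm T" "0 \<le> W * norm p" using W by auto
      have "norm ((1/2) *\<^sub>R (\<sigma> + \<delta>)) \<le> 1/2 * (norm \<sigma> + norm \<delta>)" "norm ((1/2) *\<^sub>R (\<sigma> - \<delta>)) \<le> 1/2 * (norm \<sigma> + norm \<delta>)"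
        using norm_triangle_ineq[of \<sigma> \<delta>] norm_triangle_ineq4[of \<sigma> \<delta>] by simp_all
      then have "norm (Q i) \<le> max (norm p) (1/2 * (norm \<sigma> + norm \<delta>))" by (auto simp: Q_def le_max_iff_disj)
      also have "\<dots> \<le> W * norm p + W * norm N + W * norm T"
      proof (rule max.boundedI)
        have arith: "1/2 * (s + d) \<le> A + B + D"
          if "s \<le> 2 * p + 1/2 * dp + sn" "d \<le> tn" "sn \<le> B" "tn \<le> D" "p + 1/4 * dp \<le> A" "0 \<le> B" "0 \<le> D"
          for s d p dp sn tn A B D :: real
          using that by (simp add: field_simps)
        show "1/2 * (norm \<sigma> + norm \<delta>) \<le> W * norm p + W * norm N + W * norm T"
          by (rule arith[OF n\<sigma> n\<delta> 1(3,4) 2 nn(1,2)])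
        show "norm p \<le> W * norm p + W * norm N + W * norm T" using 1(1) nn by simp
      qed
      finally show ?thesis by (simp add: algebra_simps)
    qed
    note ex = C(2)[OF this]
    define G where "G = (SOME G. (\<forall>j. continuous_on (SG q) (\<lambda>x. apply_bcontfun (G x) j)) \<and> (\<forall>n. level r n G) \<and> (\<forall>i. G (q i) = Q i) \<and>
      (\<forall>x\<in>SG q. norm (G x) \<le> C * (W * (norm p + norm N + norm T))))"
    have G': "(\<forall>j. continuous_on (SG q) (\<lambda>x. apply_bcontfun (G x) j)) \<and> (\<forall>n. level r n G) \<and> (\<forall>i. G (q i) = Q i) \<and>
      (\<forall>x\<in>SG q. norm (G x) \<le> C * (W * (norm p + norm N + norm T)))"
      unfolding G_def by (rule someI_ex[OF ex])
    then have G: "\<And>j. continuous_on (SG q) (\<lambda>x. apply_bcontfun (G x) j)" "\<And>n. level r n G"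
      "\<And>i. G (q i) = Q i" "\<And>x. x \<in> SG q \<Longrightarrow> norm (G x) \<le> C * (W * (norm p + norm N + norm T))"
      by simp_all
    have Q: "Q a = p" "Q (a + 1) = (1/2) *\<^sub>R (\<sigma> + \<delta>)" "Q (a + 2) = (1/2) *\<^sub>R (\<sigma> - \<delta>)" by (simp_all add: Q_def)
    have "r / 5 ^ 0 \<le> jet_radius" using r by simp
    then obtain N' T' where NT: "has_jet G a N' T'" "5 ^ 0 *\<^sub>R corner_diff G a 0 = opr (r / 5 ^ 0) anti_product T'"
      "(5/3) ^ 0 *\<^sub>R sym_part r G a 0 = - opr (r / 5 ^ 0) sym_product N'"
      using corner_solution[of r 0 G a] G(2) r by (metis le_refl less_imp_le)
    have "corner_diff G a 0 = \<delta>"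
      by (rule bcontfun_eqI) (simp add: corner_diff_def vx_Nil G(3) Q add_divide_distrib diff_divide_distrib)
    then have "opr r anti_product T' = opr r anti_product T" using NT(2) by (simp add: \<delta>_def)
    moreover have "opr r (inverse anti_product) (opr r anti_product s) = s" for s
      using opr_mult[OF c(4,1), of s] inverse_mult_eq_1[of anti_product] corner_products(3) r by (simp add: opr_numeral)
    ultimately have T: "T' = T" by metis
    have "sym_part r G a 0 = - opr r sym_product N"
      by (rule bcontfun_eqI) (simp add: sym_part_def corner_sum_def opposite_def vx_Nil G(3) Q \<sigma>_def add_divide_distrib diff_divide_distrib)
    then have "opr r sym_product N' = opr r sym_product N" using NT(3) by simp
    moreover have "opr r (inverse sym_product) (opr r sym_product s) = s" for s
      using opr_mult[OF c(5,2), of s] inverse_mult_eq_1[of sym_product] corner_products(8) r by (simp add: opr_numeral)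
    ultimately have N: "N' = N" by metis
    show "\<exists>G. (\<forall>j. continuous_on (SG q) (\<lambda>x. apply_bcontfun (G x) j)) \<and> (\<forall>n. level r n G) \<and>
      G (q a) = p \<and> has_jet G a N T \<and> (\<forall>x\<in>SG q. norm (G x) \<le> C * W * (norm p + norm N + norm T))"
      using G NT(1) Q(1) unfolding N T by (intro exI[of _ G]) (auto simp: mult.assoc)
  qed
qed

end

section \<open>Extension from a subcell\<close>

context
  fixes \<rho> :: real
  assumes \<rho>: "0 \<le> \<rho>" "\<rho> < rad3"
begin

lemma resolvents_35:
  shows "convergent_at \<rho> (resolvent 3)" "convergent_at \<rho> (resolvent 5)" "convergent_at \<rho> decim"
  using \<rho> by (auto intro: convergent_at_resolvent_3)

lemma resolvent_5_injective: "5 *\<^sub>R s - opr \<rho> decim s = 5 *\<^sub>R t - opr \<rho> decim t \<Longrightarrow> s = t"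
  using opr_resolvent(1)[OF resolvents_35(2)] by (metis zero_neq_numeral)

lemma resolvent_3_injective: "3 *\<^sub>R s - opr \<rho> decim s = 3 *\<^sub>R t - opr \<rho> decim t \<Longrightarrow> s = t"
  using opr_resolvent(1)[OF resolvents_35(1)] by (metis zero_neq_numeral)

end

definition subcell_bound :: "real \<Rightarrow> real" where
  "subcell_bound \<rho> = (let k = wnorm \<rho> decim; Y = wnorm \<rho> (resolvent 3) * (13 + 3 * k); C = 6 + 5 * k + k * k + Y; S = 6 + k
     in 1 + Y + C + S + wnorm \<rho> (resolvent 5) * (Y + C) + (3 * S + k * S + 2 + Y + C))"

text \<open>The gasket has the corner \<open>p\<close> of the given cell, whose other corners are \<open>x1\<close>, \<open>x2\<close>; its midpoints
  opposite to \<open>x2\<close>, \<open>x1\<close>, \<open>p\<close> are \<open>z1\<close>, \<open>z2\<close>, \<open>z3\<close>.  The common corner of the two other cells is \<open>y\<close>, and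
  \<open>c1\<close>, \<open>c2\<close> are the other corners of the gasket.  Since \<open>2 - K\<close> need not be invertible, the
  formula for \<open>y\<close> uses the midpoints; after multiplication by \<open>2 - K\<close> it becomes the decimation formula.\<close>

locale subcell_data =
  fixes \<rho> :: real and p x1 x2 z1 z2 z3 :: bseq and e :: "bseq \<Rightarrow> bseq"
  assumes \<rho>: "0 \<le> \<rho>" "\<rho> < rad3"
  defines e_def: "e \<equiv> opr \<rho> decim"
  assumes z: "4 *\<^sub>R z1 - e z1 = p + x1 + z2 + z3" "4 *\<^sub>R z2 - e z2 = p + x2 + z1 + z3" "4 *\<^sub>R z3 - e z3 = x1 + x2 + z1 + z2"
begin

definition "e1 s = 5 *\<^sub>R e s - e (e s)"
definition "rhs = (7/2) *\<^sub>R (x1 + x2) - e (x1 + x2) - (5/2) *\<^sub>R (z1 + z2) + (1/2) *\<^sub>R e (z1 + z2) + p"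
definition "y = opr \<rho> (resolvent 3) rhs"
definition "c1 = 4 *\<^sub>R x1 - e1 x1 - p - x2 - y"
definition "c2 = 4 *\<^sub>R x2 - e1 x2 - p - x1 - y"
definition "S1 = 4 *\<^sub>R x1 - e x1 - z1 - z3"
definition "S2 = 4 *\<^sub>R x2 - e x2 - z2 - z3"
definition "d1 = opr \<rho> (resolvent 5) (y - c1)"
definition "d2 = opr \<rho> (resolvent 5) (y - c2)"
definition "sy = (1/2) *\<^sub>R (S1 + d1)"
definition "sc = (1/2) *\<^sub>R (S1 - d1)"
definition "so = (1/2) *\<^sub>R (3 *\<^sub>R S1 - e S1 - 2 *\<^sub>R x1 - y - c1)"
definition "ty = (1/2) *\<^sub>R (S2 + d2)"
definition "tc = (1/2) *\<^sub>R (S2 - d2)"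
definition "to = (1/2) *\<^sub>R (3 *\<^sub>R S2 - e S2 - 2 *\<^sub>R x2 - y - c2)"

lemmas elin = opr_linear[OF resolvents_35(3)[OF \<rho>], folded e_def]

lemma y_eq: "3 *\<^sub>R y - e y = rhs"
  unfolding y_def e_def by (rule opr_resolvent(2)[OF resolvents_35(1)[OF \<rho>]]) simp

lemma d_eq: "5 *\<^sub>R d1 - e d1 = y - c1" "5 *\<^sub>R d2 - e d2 = y - c2"
  unfolding d1_def d2_def e_def by (rule opr_resolvent(2)[OF resolvents_35(2)[OF \<rho>]], simp)+

text \<open>The equations make the three midpoints free generators.\<close>

lemma free_generators:
  obtains Z1 Z2 Z3 where "z1 = 2 *\<^sub>R Z1" "z2 = 2 *\<^sub>R Z2" "z3 = 2 *\<^sub>R Z3"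
    "p = 4 *\<^sub>R Z1 + 4 *\<^sub>R Z2 - 6 *\<^sub>R Z3 - e Z1 - e Z2 + e Z3"
    "x1 = 4 *\<^sub>R Z1 - 6 *\<^sub>R Z2 + 4 *\<^sub>R Z3 - e Z1 + e Z2 - e Z3"
    "x2 = 4 *\<^sub>R Z2 - 6 *\<^sub>R Z1 + 4 *\<^sub>R Z3 + e Z1 - e Z2 - e Z3"
proof -
  \<comment> \<open>Solving the equations for the corners introduces a factor 1/2; with halved
    midpoints all coefficients are integers. The remaining identities are then checked as linear
    identities in the iterates of \<open>e\<close> on these generators.\<close>
  define Z1 Z2 Z3 where "Z1 = (1/2) *\<^sub>R z1" and "Z2 = (1/2) *\<^sub>R z2" and "Z3 = (1/2) *\<^sub>R z3"
  have halves: "z1 = 2 *\<^sub>R Z1" "z2 = 2 *\<^sub>R Z2" "z3 = 2 *\<^sub>R Z3"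
    by (simp_all add: Z1_def Z2_def Z3_def)
  have pt: "8 * apply_bcontfun Z1 j - 2 * apply_bcontfun (e Z1) j = apply_bcontfun p j + apply_bcontfun x1 j + 2 * apply_bcontfun Z2 j + 2 * apply_bcontfun Z3 j"
    "8 * apply_bcontfun Z2 j - 2 * apply_bcontfun (e Z2) j = apply_bcontfun p j + apply_bcontfun x2 j + 2 * apply_bcontfun Z1 j + 2 * apply_bcontfun Z3 j"
    "8 * apply_bcontfun Z3 j - 2 * apply_bcontfun (e Z3) j = apply_bcontfun x1 j + apply_bcontfun x2 j + 2 * apply_bcontfun Z1 j + 2 * apply_bcontfun Z2 j" for j
    using z[unfolded halves, THEN arg_cong[of _ _ apply_bcontfun], THEN fun_cong, of j] by (simp_all add: elin)
  show ?thesis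
  proof (rule that[OF halves]; rule bcontfun_eqI)
    fix j
    show "apply_bcontfun p j = apply_bcontfun (4 *\<^sub>R Z1 + 4 *\<^sub>R Z2 - 6 *\<^sub>R Z3 - e Z1 - e Z2 + e Z3) j" using pt[of j] by simp
    show "apply_bcontfun x1 j = apply_bcontfun (4 *\<^sub>R Z1 - 6 *\<^sub>R Z2 + 4 *\<^sub>R Z3 - e Z1 + e Z2 - e Z3) j" using pt[of j] by simp
    show "apply_bcontfun x2 j = apply_bcontfun (4 *\<^sub>R Z2 - 6 *\<^sub>R Z1 + 4 *\<^sub>R Z3 + e Z1 - e Z2 - e Z3) j" using pt[of j] by simp
  qed
qed

lemma y_c: "y + c1 = 4 *\<^sub>R x1 - e1 x1 - p - x2" "y + c2 = 4 *\<^sub>R x2 - e1 x2 - p - x1"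
  by (simp_all add: c1_def c2_def)

lemma x_eqs: "4 *\<^sub>R x1 - e x1 = (z1 + z3) + (sc + sy)" "4 *\<^sub>R x2 - e x2 = (z2 + z3) + (tc + ty)"
  by (rule bcontfun_eqI, simp add: sc_def sy_def tc_def ty_def S1_def S2_def add_divide_distrib diff_divide_distrib)+

lemma side_eqs:
  "4 *\<^sub>R sc - e sc = x1 + c1 + sy + so" "4 *\<^sub>R sy - e sy = x1 + y + sc + so"
  "4 *\<^sub>R tc - e tc = x2 + c2 + ty + to" "4 *\<^sub>R ty - e ty = x2 + y + tc + to"
proof -
  have pt: "apply_bcontfun (e d1) j = 5 * apply_bcontfun d1 j - apply_bcontfun y j + apply_bcontfun c1 j"
    "apply_bcontfun (e d2) j = 5 * apply_bcontfun d2 j - apply_bcontfun y j + apply_bcontfun c2 j" for j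
    using d_eq[THEN arg_cong[of _ _ apply_bcontfun], THEN fun_cong, of j] by simp_all
  show "4 *\<^sub>R sc - e sc = x1 + c1 + sy + so" "4 *\<^sub>R sy - e sy = x1 + y + sc + so"
    "4 *\<^sub>R tc - e tc = x2 + c2 + ty + to" "4 *\<^sub>R ty - e ty = x2 + y + tc + to"
    unfolding sc_def sy_def so_def tc_def ty_def to_def elin
    by (rule bcontfun_eqI, simp add: pt field_simps)+
qed

text \<open>Twice an outer midpoint depends on \<open>y\<close> and \<open>c1\<close> only through
  their sum, which \<open>y_c\<close> gives by the data of the subcell. The equation therefore
  becomes an identity in the free generators, without reference to the resolvent in
  \<open>y\<close>.\<close>

lemma outer_eqs: "4 *\<^sub>R so - e so = c1 + y + sc + sy" "4 *\<^sub>R to - e to = c2 + y + tc + ty"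
proof -
  obtain Z1 Z2 Z3 where halves: "z1 = 2 *\<^sub>R Z1" "z2 = 2 *\<^sub>R Z2" "z3 = 2 *\<^sub>R Z3" and corners:
    "p = 4 *\<^sub>R Z1 + 4 *\<^sub>R Z2 - 6 *\<^sub>R Z3 - e Z1 - e Z2 + e Z3"
    "x1 = 4 *\<^sub>R Z1 - 6 *\<^sub>R Z2 + 4 *\<^sub>R Z3 - e Z1 + e Z2 - e Z3"
    "x2 = 4 *\<^sub>R Z2 - 6 *\<^sub>R Z1 + 4 *\<^sub>R Z3 + e Z1 - e Z2 - e Z3" by (rule free_generators)
  define N1 where "N1 = 3 *\<^sub>R S1 - e S1 - 2 *\<^sub>R x1 - (4 *\<^sub>R x1 - e1 x1 - p - x2)"
  define N2 where "N2 = 3 *\<^sub>R S2 - e S2 - 2 *\<^sub>R x2 - (4 *\<^sub>R x2 - e1 x2 - p - x1)"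
  have N: "so = (1/2) *\<^sub>R N1" "to = (1/2) *\<^sub>R N2"
    unfolding so_def to_def N1_def N2_def y_c[symmetric] by (simp_all add: algebra_simps)
  have "4 *\<^sub>R N1 - e N1 = 2 *\<^sub>R (4 *\<^sub>R x1 - e1 x1 - p - x2) + 2 *\<^sub>R S1"
    "4 *\<^sub>R N2 - e N2 = 2 *\<^sub>R (4 *\<^sub>R x2 - e1 x2 - p - x1) + 2 *\<^sub>R S2"
    unfolding N1_def N2_def S1_def S2_def e1_def unfolding halves corners elin
    by (rule bcontfun_eqI, simp)+
  then have hN: "4 *\<^sub>R N1 - e N1 = 2 *\<^sub>R (y + c1) + 2 *\<^sub>R S1" "4 *\<^sub>R N2 - e N2 = 2 *\<^sub>R (y + c2) + 2 *\<^sub>R S2"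
    by (simp_all only: y_c)
  have pt: "apply_bcontfun (e N1) j = 4 * apply_bcontfun N1 j - (2 * (apply_bcontfun y j + apply_bcontfun c1 j) + 2 * apply_bcontfun S1 j)"
    "apply_bcontfun (e N2) j = 4 * apply_bcontfun N2 j - (2 * (apply_bcontfun y j + apply_bcontfun c2 j) + 2 * apply_bcontfun S2 j)" for j
    using hN[THEN arg_cong[of _ _ apply_bcontfun], THEN fun_cong, of j] by simp_all
  show "4 *\<^sub>R so - e so = c1 + y + sc + sy" "4 *\<^sub>R to - e to = c2 + y + tc + ty"
    unfolding N sc_def sy_def tc_def ty_def elin
    by (rule bcontfun_eqI, simp add: pt field_simps)+
qed

text \<open>The differences \<open>d1\<close> and \<open>d2\<close> are known only through
  \<open>5 - e\<close>. So \<open>5 - e\<close> is applied to \<open>U\<close>, twice the defect of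
  the equation; the result reduces to zero with the equation of \<open>y\<close>, and injectivity of
  \<open>5 - e\<close> gives \<open>U = 0\<close>.\<close>

lemma junction_eq: "4 *\<^sub>R y - e y = (sy + so) + (ty + to)"
proof -
  obtain Z1 Z2 Z3 where halves: "z1 = 2 *\<^sub>R Z1" "z2 = 2 *\<^sub>R Z2" "z3 = 2 *\<^sub>R Z3" and corners:
    "p = 4 *\<^sub>R Z1 + 4 *\<^sub>R Z2 - 6 *\<^sub>R Z3 - e Z1 - e Z2 + e Z3"
    "x1 = 4 *\<^sub>R Z1 - 6 *\<^sub>R Z2 + 4 *\<^sub>R Z3 - e Z1 + e Z2 - e Z3"
    "x2 = 4 *\<^sub>R Z2 - 6 *\<^sub>R Z1 + 4 *\<^sub>R Z3 + e Z1 - e Z2 - e Z3" by (rule free_generators)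
  define U where "U = 8 *\<^sub>R y - 2 *\<^sub>R e y - (S1 + d1) - (S2 + d2)
    - (3 *\<^sub>R S1 - e S1 - 2 *\<^sub>R x1 - (4 *\<^sub>R x1 - e1 x1 - p - x2)) - (3 *\<^sub>R S2 - e S2 - 2 *\<^sub>R x2 - (4 *\<^sub>R x2 - e1 x2 - p - x1))"
  have rhs: "rhs = 7 *\<^sub>R (4 *\<^sub>R Z3 - e Z3 - Z1 - Z2) - 2 *\<^sub>R e (4 *\<^sub>R Z3 - e Z3 - Z1 - Z2) - 5 *\<^sub>R (Z1 + Z2) + e (Z1 + Z2) + p"
    unfolding rhs_def unfolding corners halves elin by (rule bcontfun_eqI) (simp add: field_simps)
  have py: "apply_bcontfun (e y) j = 3 * apply_bcontfun y j - apply_bcontfun rhs j"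
    "apply_bcontfun (e (e y)) j = 3 * apply_bcontfun (e y) j - apply_bcontfun (e rhs) j" for j
    using y_eq[THEN arg_cong[of _ _ apply_bcontfun], THEN fun_cong, of j]
      y_eq[THEN arg_cong[of _ _ e], THEN arg_cong[of _ _ apply_bcontfun], THEN fun_cong, of j]
    by (simp_all add: elin)
  have pd: "apply_bcontfun (e d1) j = 5 * apply_bcontfun d1 j - apply_bcontfun y j + apply_bcontfun c1 j"
    "apply_bcontfun (e d2) j = 5 * apply_bcontfun d2 j - apply_bcontfun y j + apply_bcontfun c2 j" for j
    using d_eq[THEN arg_cong[of _ _ apply_bcontfun], THEN fun_cong, of j] by simp_all
  have "5 *\<^sub>R U - e U = 0"
  proof (rule bcontfun_eqI)
    fix j
    have "apply_bcontfun (5 *\<^sub>R U - e U) j =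
        40 * apply_bcontfun y j - 10 * apply_bcontfun (e y) j - 8 * apply_bcontfun (e y) j + 2 * apply_bcontfun (e (e y)) j
        - (2 * apply_bcontfun y j - apply_bcontfun c1 j - apply_bcontfun c2 j)
        - apply_bcontfun (5 *\<^sub>R (S1 + S2) - e (S1 + S2)) j
        - apply_bcontfun (5 *\<^sub>R (3 *\<^sub>R (S1 + S2) - e (S1 + S2) - 2 *\<^sub>R (x1 + x2) - (3 *\<^sub>R (x1 + x2) - e1 (x1 + x2) - 2 *\<^sub>R p))
           - e (3 *\<^sub>R (S1 + S2) - e (S1 + S2) - 2 *\<^sub>R (x1 + x2) - (3 *\<^sub>R (x1 + x2) - e1 (x1 + x2) - 2 *\<^sub>R p))) j"
      unfolding U_def e1_def elin by (simp add: pd)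
    also have "apply_bcontfun c1 j = apply_bcontfun (4 *\<^sub>R x1 - e1 x1 - p - x2) j - apply_bcontfun y j" by (simp add: c1_def)
    also have "apply_bcontfun c2 j = apply_bcontfun (4 *\<^sub>R x2 - e1 x2 - p - x1) j - apply_bcontfun y j" by (simp add: c2_def)
    also note py(2)
    also note py(1)
    finally have "apply_bcontfun (5 *\<^sub>R U - e U) j =
        40 * apply_bcontfun y j - 18 * (3 * apply_bcontfun y j - apply_bcontfun rhs j)
        + 2 * (3 * (3 * apply_bcontfun y j - apply_bcontfun rhs j) - apply_bcontfun (e rhs) j)
        - (4 * apply_bcontfun y j - apply_bcontfun (3 *\<^sub>R (x1 + x2) - e1 (x1 + x2) - 2 *\<^sub>R p) j)
        - apply_bcontfun (5 *\<^sub>R (S1 + S2) - e (S1 + S2)) j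
        - apply_bcontfun (5 *\<^sub>R (3 *\<^sub>R (S1 + S2) - e (S1 + S2) - 2 *\<^sub>R (x1 + x2) - (3 *\<^sub>R (x1 + x2) - e1 (x1 + x2) - 2 *\<^sub>R p))
           - e (3 *\<^sub>R (S1 + S2) - e (S1 + S2) - 2 *\<^sub>R (x1 + x2) - (3 *\<^sub>R (x1 + x2) - e1 (x1 + x2) - 2 *\<^sub>R p))) j"
      unfolding e1_def elin by simp
    also have "\<dots> = 0"
      unfolding S1_def S2_def rhs e1_def unfolding halves corners elin by simp
    finally show "apply_bcontfun (5 *\<^sub>R U - e U) j = apply_bcontfun 0 j" by simp
  qed
  then have "5 *\<^sub>R U - opr \<rho> decim U = 5 *\<^sub>R 0 - opr \<rho> decim 0" using elin(4) by (simp add: e_def)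
  then have "U = 0" by (rule resolvent_5_injective[OF \<rho>])
  moreover have "4 *\<^sub>R y - e y - ((sy + so) + (ty + to)) = (1/2) *\<^sub>R U"
    unfolding U_def y_c[symmetric] sy_def so_def ty_def to_def
    by (rule bcontfun_eqI) (simp add: field_simps)
  ultimately show ?thesis by simp
qed

context
  fixes M :: real
  assumes M: "norm p \<le> M" "norm x1 \<le> M" "norm x2 \<le> M" "norm z1 \<le> M" "norm z2 \<le> M" "norm z3 \<le> M"
begin

lemma norm_e: "norm s \<le> X \<Longrightarrow> norm (e s) \<le> wnorm \<rho> decim * X"
  unfolding e_def using norm_opr[OF resolvents_35(3)[OF \<rho>], of s] wnorm_nonneg[OF resolvents_35(3)[OF \<rho>]]
  by (meson mult_left_mono order_trans)

lemma norm_res: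
  "norm s \<le> X \<Longrightarrow> norm (opr \<rho> (resolvent 3) s) \<le> wnorm \<rho> (resolvent 3) * X"
  "norm s \<le> X \<Longrightarrow> norm (opr \<rho> (resolvent 5) s) \<le> wnorm \<rho> (resolvent 5) * X"
  using norm_opr[OF resolvents_35(1)[OF \<rho>], of s] wnorm_nonneg[OF resolvents_35(1)[OF \<rho>]]
    norm_opr[OF resolvents_35(2)[OF \<rho>], of s] wnorm_nonneg[OF resolvents_35(2)[OF \<rho>]]
  by (meson mult_left_mono order_trans)+

lemma norm_diff_mono: "norm s \<le> X \<Longrightarrow> norm t \<le> Y \<Longrightarrow> norm (s - t) \<le> X + Y" for s t :: bseq
  by (intro order_trans[OF norm_triangle_ineq4] add_mono)

lemma norm_scaleR_mono: "norm s \<le> X \<Longrightarrow> norm (c *\<^sub>R s) \<le> \<bar>c\<bar> * X" for s :: bseq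
  by (simp add: mult_left_mono)

lemmas norm_intros = norm_diff_mono norm_triangle_mono norm_scaleR_mono norm_e norm_res M

lemma values_bounded:
  "\<forall>s\<in>{p, x1, x2, z1, z2, z3, y, c1, c2, sy, sc, so, ty, tc, to}. norm s \<le> subcell_bound \<rho> * M"
proof -
  define k where "k = wnorm \<rho> decim"
  define k3 where "k3 = wnorm \<rho> (resolvent 3)"
  define k5 where "k5 = wnorm \<rho> (resolvent 5)"
  have k: "0 \<le> k" "0 \<le> k3" "0 \<le> k5"
    using wnorm_nonneg[OF resolvents_35(3)[OF \<rho>]] wnorm_nonneg[OF resolvents_35(1)[OF \<rho>]]
      wnorm_nonneg[OF resolvents_35(2)[OF \<rho>]] by (auto simp: k_def k3_def k5_def)
  have M0: "0 \<le> M" using M(1) norm_ge_zero order_trans by blast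
  define Y C S D E where "Y = k3 * (13 + 3 * k)" and "C = 6 + 5 * k + k * k + Y" and "S = 6 + k"
    and "D = k5 * (Y + C)" and "E = 3 * S + k * S + 2 + Y + C"
  have nn: "0 \<le> Y" "0 \<le> C" "0 \<le> S" "0 \<le> D" "0 \<le> E" using k by (auto simp: Y_def C_def S_def D_def E_def)
  have B: "subcell_bound \<rho> = 1 + Y + C + S + D + E"
    unfolding subcell_bound_def Let_def Y_def C_def S_def D_def E_def k_def k3_def k5_def ..
  have rhs: "norm rhs \<le> (13 + 3 * k) * M"
  proof -
    have "norm rhs \<le> \<bar>7/2\<bar> * (M + M) + k * (M + M) + \<bar>5/2\<bar> * (M + M) + \<bar>1/2\<bar> * (k * (M + M)) + M"
      unfolding rhs_def k_def by (intro norm_intros)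
    then show ?thesis by (simp add: algebra_simps)
  qed
  have y: "norm y \<le> Y * M"
    using norm_res(1)[OF rhs] by (simp add: y_def Y_def k3_def mult.assoc)
  have c: "norm c1 \<le> C * M" "norm c2 \<le> C * M"
  proof -
    have "norm c1 \<le> \<bar>4\<bar> * M + (\<bar>5\<bar> * (k * M) + k * (k * M)) + M + M + Y * M"
      "norm c2 \<le> \<bar>4\<bar> * M + (\<bar>5\<bar> * (k * M) + k * (k * M)) + M + M + Y * M"
      unfolding c1_def c2_def e1_def k_def by (intro norm_intros y)+
    then show "norm c1 \<le> C * M" "norm c2 \<le> C * M" by (simp_all add: C_def algebra_simps)
  qed
  have S: "norm S1 \<le> S * M" "norm S2 \<le> S * M"
  proof -
    have "norm S1 \<le> \<bar>4\<bar> * M + k * M + M + M" "norm S2 \<le> \<bar>4\<bar> * M + k * M + M + M"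
      unfolding S1_def S2_def k_def by (intro norm_intros)+
    then show "norm S1 \<le> S * M" "norm S2 \<le> S * M" by (simp_all add: S_def algebra_simps)
  qed
  have d: "norm d1 \<le> D * M" "norm d2 \<le> D * M"
  proof -
    have "norm d1 \<le> k5 * (Y * M + C * M)" "norm d2 \<le> k5 * (Y * M + C * M)"
      unfolding d1_def d2_def k5_def by (intro norm_intros y c)+
    then show "norm d1 \<le> D * M" "norm d2 \<le> D * M" by (simp_all add: D_def algebra_simps)
  qed
  have s: "norm s \<le> \<bar>1/2\<bar> * (S * M + D * M)" if "s \<in> {sy, sc, ty, tc}" for s
    using that unfolding sy_def sc_def ty_def tc_def by (elim insertE emptyE; simp only:; intro norm_intros S d)
  have o: "norm s \<le> \<bar>1/2\<bar> * (E * M)" if "s \<in> {so, to}" for s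
  proof -
    have "norm s \<le> \<bar>1/2\<bar> * (\<bar>3\<bar> * (S * M) + k * (S * M) + \<bar>2\<bar> * M + Y * M + C * M)"
      using that unfolding so_def to_def k_def by (elim insertE emptyE; simp only:; intro norm_intros S y c)
    then show ?thesis by (simp add: E_def algebra_simps)
  qed
  have le: "X * M \<le> subcell_bound \<rho> * M" if "X \<le> 1 + Y + C + S + D + E" for X
    unfolding B using that M0 by (intro mult_right_mono)
  show ?thesis
  proof
    fix s assume "s \<in> {p, x1, x2, z1, z2, z3, y, c1, c2, sy, sc, so, ty, tc, to}"
    then consider "norm s \<le> 1 * M" | "norm s \<le> Y * M" | "norm s \<le> C * M" | "norm s \<le> (S/2 + D/2) * M" | "norm s \<le> E/2 * M"
      using M y c s o by (auto simp: algebra_simps)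
    then show "norm s \<le> subcell_bound \<rho> * M"
      by cases (erule order_trans, rule le, use nn in simp)+
  qed
qed

end

end

section \<open>Extension over the gasket and propagation of zeros\<close>

definition cell_values :: "(3 \<Rightarrow> 'a) \<Rightarrow> (3 \<Rightarrow> 'a) \<Rightarrow> 3 \<Rightarrow> 3 \<Rightarrow> 'a" where
  "cell_values P m d j = (if d = j then P j else m (- (d + j)))"

lemma cell_values_letters: "cell_values P m i i = P i" "cell_values P m i (i + 1) = m (i + 2)" "cell_values P m i (i + 2) = m (i + 1)"
  "cell_values P m (i + 1) i = m (i + 2)" "cell_values P m (i + 2) i = m (i + 1)"
  by (simp_all only: cell_values_def letter_neq opposite_letter simp_thms if_True if_False)

lemma cell_values_commute: "i \<noteq> j \<Longrightarrow> cell_values P m i j = cell_values P m j i"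
  by (simp add: cell_values_def add.commute)

definition letters :: "3 \<Rightarrow> 'a \<Rightarrow> 'a \<Rightarrow> 'a \<Rightarrow> 3 \<Rightarrow> 'a" where
  "letters a s t u j = (if j = a then s else if j = a + 1 then t else u)"

lemma letters_simps: "letters a s t u a = s" "letters a s t u (a + 1) = t" "letters a s t u (a + 2) = u"
  by (simp_all only: letters_def letter_neq simp_thms if_True if_False)

lemma letter_induct: "Q a \<Longrightarrow> Q (a + 1) \<Longrightarrow> Q (a + 2) \<Longrightarrow> Q (j::3)"
  using letter_cases[of j a] by auto

context gasket
begin

text \<open>Of the fifteen vertices of level two, six are given by level one of the subcell, and
  \<open>subcell_data\<close> determines the other nine by inverting only \<open>3 - K\<close> and
  \<open>5 - K\<close>. One level deeper the parameter is below \<open>rad3 / 5\<close>, hence below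
  \<open>rad2\<close>, and ordinary refinement takes over. Agreement at the six points is enough, as
  \<open>level_zero\<close> extends it to the whole subcell.\<close>

theorem extend_from_subcell:
  assumes r: "0 < r" "r / 25 < rad3"
  shows "\<exists>C\<ge>0. \<forall>G' M. level (r / 5) 1 G' \<longrightarrow> (\<forall>p\<in>vertices. norm (G' p) \<le> M) \<longrightarrow>
    (\<exists>G. (\<forall>j. continuous_on (SG q) (\<lambda>x. apply_bcontfun (G x) j)) \<and> (\<forall>n\<ge>1. level r n G) \<and>
      (\<forall>w i. length w = 1 \<longrightarrow> G (F q a (vx w i)) = G' (vx w i)) \<and> (\<forall>x\<in>SG q. norm (G x) \<le> C * M))"
proof -
  have "r / 5 ^ Suc 2 < rad2" using r rad2(1) by simp
  from extension_exists[OF r(1) this] obtain C where C: "C \<ge> 0" and ext: "\<And>Q M.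
    (\<forall>v a b k. a \<noteq> b \<longrightarrow> length v + Suc k = 2 \<longrightarrow> Q (v @ a # replicate k b) b = Q (v @ b # replicate k a) a) \<Longrightarrow>
    (\<forall>v a b k. a \<noteq> b \<longrightarrow> length v + Suc k = 2 \<longrightarrow>
      4 *\<^sub>R Q (v @ a # replicate k b) b - opr (r / 5 ^ 2) decim (Q (v @ a # replicate k b) b) =
      (Q (v @ a # replicate k b) (b + 1) + Q (v @ a # replicate k b) (b + 2)) +
      (Q (v @ b # replicate k a) (a + 1) + Q (v @ b # replicate k a) (a + 2))) \<Longrightarrow>
    (\<forall>w i. length w = 2 \<longrightarrow> norm (Q w i) \<le> M) \<Longrightarrow>
    (\<exists>G. (\<forall>j. continuous_on (SG q) (\<lambda>x. apply_bcontfun (G x) j)) \<and> (\<forall>n\<ge>2. level r n G) \<and> (\<forall>w i. length w = 2 \<longrightarrow> G (vx w i) = Q w i) \<and>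
      (\<forall>x\<in>SG q. norm (G x) \<le> C * M))" by blast
  let ?\<rho> = "r / 25"
  let ?e = "opr ?\<rho> decim"
  have \<rho>: "0 \<le> ?\<rho>" "?\<rho> < rad3" using r by auto
  have wn: "0 \<le> wnorm ?\<rho> decim" "0 \<le> wnorm ?\<rho> (resolvent 3)" "0 \<le> wnorm ?\<rho> (resolvent 5)"
    using wnorm_nonneg[OF resolvents_35(3)[OF \<rho>]] wnorm_nonneg[OF resolvents_35(1)[OF \<rho>]]
      wnorm_nonneg[OF resolvents_35(2)[OF \<rho>]] by auto
  have B0: "0 \<le> subcell_bound ?\<rho>" using wn by (auto simp: subcell_bound_def Let_def)
  show ?thesis
  proof (intro exI[of _ "C * subcell_bound ?\<rho>"] conjI allI impI)
    show "0 \<le> C * subcell_bound ?\<rho>" using C B0 by simp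
    fix G' M assume lev: "level (r / 5) 1 G'" and M: "\<forall>p\<in>vertices. norm (G' p) \<le> M"
    define p x1 x2 z1 z2 z3 where "p = G' (q a)" and "x1 = G' (q (a + 1))" and "x2 = G' (q (a + 2))"
      and "z1 = G' (vx [a] (a + 1))" and "z2 = G' (vx [a] (a + 2))" and "z3 = G' (vx [a + 1] (a + 2))"
    have e5: "r / 5 / 5 ^ Suc 0 = ?\<rho>" by simp
    have lev': "level (r / 5) (Suc 0) G'" using lev by simp
    note eqs = level_midpoints[OF lev', of "[]" a, unfolded vx_Nil append_Nil e5, folded p_def x1_def x2_def z1_def z2_def z3_def, OF list.size(3)]
    interpret D: subcell_data ?\<rho> p x1 x2 z1 z2 z3 ?e
      using \<rho> eqs by unfold_locales simp_all
    have bound: "\<forall>s\<in>{p, x1, x2, z1, z2, z3, D.y, D.c1, D.c2, D.sy, D.sc, D.so, D.ty, D.tc, D.to}. norm s \<le> subcell_bound ?\<rho> * M"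
      by (rule D.values_bounded) (use M in \<open>auto simp: p_def x1_def x2_def z1_def z2_def z3_def\<close>)
    \<comment> \<open>\<open>P c d\<close> is the value at the corner \<open>d\<close> of the cell
      \<open>c\<close>. Symmetry of this matrix expresses that neighbouring cells agree at their
      junction; the diagonal holds the corners of the gasket. \<open>m\<close> lists the midpoints
      of each cell by their opposite corners.\<close>
    define P where "P = letters a (letters a p x1 x2) (letters a x1 D.c1 D.y) (letters a x2 D.y D.c2)"
    define m where "m = letters a (letters a z3 z2 z1) (letters a D.so D.sy D.sc) (letters a D.to D.tc D.ty)"
    define Q where "Q = (\<lambda>w j. cell_values (P (w ! 0)) (m (w ! 0)) (w ! 1) j)"
    have Q: "Q [c, d] j = cell_values (P c) (m c) d j" for c d j by (simp add: Q_def)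
    have cell: "4 *\<^sub>R m c (i + 2) - ?e (m c (i + 2)) = P c i + P c (i + 1) + m c i + m c (i + 1)" for c i
    proof -
      have 1: "4 *\<^sub>R letters a z3 z2 z1 (i + 2) - ?e (letters a z3 z2 z1 (i + 2))
          = letters a p x1 x2 i + letters a p x1 x2 (i + 1) + letters a z3 z2 z1 i + letters a z3 z2 z1 (i + 1)"
        by (rule letter_induct[of _ a i]; unfold letter_add letters_simps; simp add: D.z[simplified] add_ac)
      have 2: "4 *\<^sub>R letters a D.so D.sy D.sc (i + 2) - ?e (letters a D.so D.sy D.sc (i + 2))
          = letters a x1 D.c1 D.y i + letters a x1 D.c1 D.y (i + 1) + letters a D.so D.sy D.sc i + letters a D.so D.sy D.sc (i + 1)"
        by (rule letter_induct[of _ a i]; unfold letter_add letters_simps; simp add: D.side_eqs D.outer_eqs add_ac)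
      have 3: "4 *\<^sub>R letters a D.to D.tc D.ty (i + 2) - ?e (letters a D.to D.tc D.ty (i + 2))
          = letters a x2 D.y D.c2 i + letters a x2 D.y D.c2 (i + 1) + letters a D.to D.tc D.ty i + letters a D.to D.tc D.ty (i + 1)"
        by (rule letter_induct[of _ a i]; unfold letter_add letters_simps; simp add: D.side_eqs D.outer_eqs add_ac)
      show ?thesis unfolding P_def m_def
        by (rule letter_induct[of _ a c]; unfold letters_simps; fact 1 2 3)
    qed
    have Psym: "P c d = P d c" for c d
      unfolding P_def
      by (rule letter_induct[of _ a c]; rule letter_induct[of _ a d]; unfold letters_simps; rule refl)
    have vert: "4 *\<^sub>R P c d - ?e (P c d) = (m c (d + 1) + m c (d + 2)) + (m d (c + 1) + m d (c + 2))" if "c \<noteq> d" for c d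
    proof -
      have "c \<noteq> d \<longrightarrow> 4 *\<^sub>R P c d - ?e (P c d) = (m c (d + 1) + m c (d + 2)) + (m d (c + 1) + m d (c + 2))"
        unfolding P_def m_def
        by (rule letter_induct[of _ a c]; rule letter_induct[of _ a d]; unfold letter_add letters_simps;
            simp add: D.x_eqs D.junction_eq add_ac)
      then show ?thesis using that by simp
    qed
    have cases: "(v = [] \<and> k = 1) \<or> (\<exists>c. v = [c] \<and> k = 0)" if "length v + Suc k = 2" for v :: "3 list" and k
      using that by (cases v) auto
    have "\<exists>G. (\<forall>j. continuous_on (SG q) (\<lambda>x. apply_bcontfun (G x) j)) \<and> (\<forall>n\<ge>2. level r n G) \<and> (\<forall>w i. length w = 2 \<longrightarrow> G (vx w i) = Q w i) \<and>
      (\<forall>x\<in>SG q. norm (G x) \<le> C * (subcell_bound ?\<rho> * M))"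
    proof (rule ext; intro allI impI)
      fix v :: "3 list" and c d :: 3 and k assume cd: "c \<noteq> d" and l: "length v + Suc k = 2"
      show "Q (v @ c # replicate k d) d = Q (v @ d # replicate k c) c"
        using cases[OF l] cd by (elim disjE conjE exE) (simp_all add: Q cell_values_letters Psym[of c d] cell_values_commute)
      have r25: "r / 5 ^ 2 = ?\<rho>" by simp
      from cases[OF l] show "4 *\<^sub>R Q (v @ c # replicate k d) d - opr (r / 5 ^ 2) decim (Q (v @ c # replicate k d) d) =
        (Q (v @ c # replicate k d) (d + 1) + Q (v @ c # replicate k d) (d + 2)) +
        (Q (v @ d # replicate k c) (c + 1) + Q (v @ d # replicate k c) (c + 2))"
        unfolding r25
      proof (elim disjE conjE exE)
        assume v: "v = []" "k = 1"
        have Qv: "Q (v @ s # replicate k t) j = cell_values (P s) (m s) t j" for s t j by (simp add: v Q)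
        show "4 *\<^sub>R Q (v @ c # replicate k d) d - ?e (Q (v @ c # replicate k d) d) =
          (Q (v @ c # replicate k d) (d + 1) + Q (v @ c # replicate k d) (d + 2)) +
          (Q (v @ d # replicate k c) (c + 1) + Q (v @ d # replicate k c) (c + 2))"
          unfolding Qv cell_values_letters using vert[OF cd] by (simp add: add_ac)
      next
        fix b assume v: "v = [b]" "k = 0"
        from letter_cases[of d c] cd have "d = c + 1 \<or> d = c + 2" by auto
        then have "d = c + 1 \<or> c = d + 1" by auto
        then show "4 *\<^sub>R Q (v @ c # replicate k d) d - ?e (Q (v @ c # replicate k d) d) =
          (Q (v @ c # replicate k d) (d + 1) + Q (v @ c # replicate k d) (d + 2)) +
          (Q (v @ d # replicate k c) (c + 1) + Q (v @ d # replicate k c) (c + 2))"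
        proof
          assume d: "d = c + 1"
          have Qv: "Q (v @ s # replicate k t) j = cell_values (P b) (m b) s j" for s t j by (simp add: v Q)
          show ?thesis unfolding Qv d letter_add cell_values_letters
            using cell[of b c] cell_values_letters(2)[of "P b" "m b" "c + 1", unfolded letter_add] by (simp add: add_ac)
        next
          assume c: "c = d + 1"
          have Qv: "Q (v @ s # replicate k t) j = cell_values (P b) (m b) s j" for s t j by (simp add: v Q)
          show ?thesis unfolding Qv c letter_add cell_values_letters
            using cell[of b d] cell_values_letters(2)[of "P b" "m b" "d + 1", unfolded letter_add] by (simp add: add_ac)
        qed
      qed
    next
      fix w :: "3 list" and i
      have PM: "norm (P c d) \<le> subcell_bound ?\<rho> * M" "norm (m c d) \<le> subcell_bound ?\<rho> * M" for c d
        using bound by (auto simp: P_def m_def letters_def)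
      show "norm (Q w i) \<le> subcell_bound ?\<rho> * M" by (simp add: Q_def cell_values_def PM)
    qed
    then obtain G where G: "\<forall>j. continuous_on (SG q) (\<lambda>x. apply_bcontfun (G x) j)" "\<forall>n\<ge>2. level r n G"
      "\<forall>w i. length w = 2 \<longrightarrow> G (vx w i) = Q w i" "\<forall>x\<in>SG q. norm (G x) \<le> C * (subcell_bound ?\<rho> * M)"
      by blast
    \<comment> \<open>The equations of level one are inherited from level two, since
      \<open>r / 25 < rad3\<close> makes \<open>6 - K\<close> invertible.\<close>
    have "level r 1 G" using level_step[of r 1 G] r G(2) by (simp add: numeral_2_eq_2)
    then have lev1: "\<forall>n\<ge>1. level r n G" using G(2) by (metis le_antisym not_less_eq_eq numeral_2_eq_2 One_nat_def)
    have sub: "\<forall>w i. length w = 1 \<longrightarrow> G (F q a (vx w i)) = G' (vx w i)"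
    proof (intro allI impI)
      fix w :: "3 list" and i assume "length w = 1"
      then obtain d where w: "w = [d]" by (auto simp: length_Suc_conv)
      have "G (F q a (vx w i)) = cell_values (P a) (m a) d i"
        using G(3)[rule_format, of "[a, d]" i] by (simp add: w Q vx_Cons)
      also have "\<dots> = G' (vx [d] i)"
      proof -
        have m: "vx [a + 1] a = vx [a] (a + 1)" "vx [a + 2] a = vx [a] (a + 2)" "vx [a + 2] (a + 1) = vx [a + 1] (a + 2)"
          using vx_swap[of "[]" "a + 1" a] vx_swap[of "[]" "a + 2" a] vx_swap[of "[]" "a + 2" "a + 1"] by simp_all
        have cv: "cell_values P' m' (a + 1) (a + 2) = m' a" "cell_values P' m' (a + 2) (a + 1) = m' a" for P' m'
          using cell_values_letters(2,4)[of P' m' "a + 1", unfolded letter_add] by auto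
        have d: "vx [j] j = q j" for j by (simp add: vx_def)
        show ?thesis unfolding P_def m_def letters_simps
          by (rule letter_induct[of _ a d]; rule letter_induct[of _ a i];
              simp only: cell_values_letters cv letters_simps m d p_def x1_def x2_def z1_def z2_def z3_def)
      qed
      finally show "G (F q a (vx w i)) = G' (vx w i)" by (simp add: w)
    qed
    show "\<exists>G. (\<forall>j. continuous_on (SG q) (\<lambda>x. apply_bcontfun (G x) j)) \<and> (\<forall>n\<ge>1. level r n G) \<and>
      (\<forall>w i. length w = 1 \<longrightarrow> G (F q a (vx w i)) = G' (vx w i)) \<and> (\<forall>x\<in>SG q. norm (G x) \<le> C * subcell_bound ?\<rho> * M)"
      by (intro exI[of _ G] conjI G(1) lev1 sub) (use G(4) in \<open>simp add: mult.assoc\<close>)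
  qed
qed

text \<open>If a solution vanishes on a subcell, then \<open>K y = 2 y\<close> at the opposite junction \<open>y\<close>, by the level 1
  equations, and \<open>K y = 4 y\<close>, by those of level 2.\<close>

lemma zero_propagates:
  assumes r: "0 \<le> r" "r / 25 < rad3" and lev: "\<And>n. 1 \<le> n \<Longrightarrow> level r n G"
    and zero: "\<And>p. p \<in> vertices \<Longrightarrow> G (F q a p) = 0" and p: "p \<in> vertices"
  shows "G p = 0"
proof -
  let ?i = "a + 1" and ?l = "a + 2"
  define \<rho> where "\<rho> = r / 5 ^ Suc (Suc 0)"
  define e where "e = opr \<rho> decim"
  have \<rho>: "0 \<le> \<rho>" "\<rho> < rad3" using r by (auto simp: \<rho>_def)
  note lin = opr_linear[OF resolvents_35(3)[OF \<rho>], folded e_def]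
  have K1: "opr (r / 5 ^ Suc 0) decim s = 5 *\<^sub>R e s - e (e s)" for s
    using opr_decim_step[of "r / 5" s] r by (simp add: e_def \<rho>_def)
  have K1': "opr (r / 5) decim s = 5 *\<^sub>R e s - e (e s)" for s using K1 by simp
  have K10: "opr (r / 5) decim 0 = 0" unfolding K1' by (simp add: lin)
  have A: "G (vx (a # w) j) = 0" for w j using zero[of "vx w j"] by (simp add: vx_Cons)
  have x: "G (vx [?i] a) = 0" "G (vx [?l] a) = 0" "G (q a) = 0"
    using A[of "[]" ?i] A[of "[]" ?l] A[of "[]" a] vx_swap[of "[]" ?i a] vx_swap[of "[]" ?l a] by (simp_all add: vx_def)
  have vq: "vx [j] j = q j" for j by (simp add: vx_def)
  define y c1 c2 where "y = G (vx [?i] ?l)" and "c1 = G (q ?i)" and "c2 = G (q ?l)"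
  have yl: "G (vx [?l] ?i) = y" using vx_swap[of "[]" ?l ?i] by (simp add: y_def)
  define sc sy so where "sc = G (vx [?i, a] ?i)" and "sy = G (vx [?i, a] ?l)" and "so = G (vx [?i, ?i] ?l)"
  define ty tc to where "ty = G (vx [?l, a] ?i)" and "tc = G (vx [?l, a] ?l)" and "to = G (vx [?l, ?i] ?l)"
  have l1: "level r (Suc 0) G" and l2: "level r (Suc (Suc 0)) G" using lev by auto
  have "0 = c1 + y" "0 = c2 + y" "4 *\<^sub>R y - (5 *\<^sub>R e y - e (e y)) = c1 + c2"
    using level_midpoints[OF l1, of "[]" a] by (simp_all add: vx_Nil A K10 x c1_def c2_def y_def K1' lin)
  then have c: "c1 = - y" "c2 = - y" and "4 *\<^sub>R y - (5 *\<^sub>R e y - e (e y)) = c1 + c2"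
    by (simp_all add: eq_neg_iff_add_eq_0)
  then have e2: "4 *\<^sub>R y - (5 *\<^sub>R e y - e (e y)) = - y - y" by simp
  \<comment> \<open>The previous equation reads 6 - 5 K + K^2 = (3 - K) (2 - K) applied to
    \<open>y\<close>; only the first factor is known to be injective.\<close>
  have "3 *\<^sub>R (2 *\<^sub>R y - e y) - opr \<rho> decim (2 *\<^sub>R y - e y) = 3 *\<^sub>R 0 - opr \<rho> decim 0"
    unfolding e_def[symmetric] lin
    by (rule bcontfun_eqI) (use e2[THEN arg_cong[of _ _ apply_bcontfun], THEN fun_cong] in \<open>simp add: algebra_simps\<close>)
  then have "2 *\<^sub>R y - e y = 0" by (rule resolvent_3_injective[OF \<rho>])
  then have ey: "e y = 2 *\<^sub>R y" by simp
  have cell1: "4 *\<^sub>R sc - e sc = c1 + sy + so" "4 *\<^sub>R sy - e sy = y + sc + so"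
    using level_midpoints(1,2)[OF l2, of "[?i]" a]
    by (simp_all add: x vq sc_def sy_def so_def c1_def y_def e_def \<rho>_def del: power_Suc)
  have cell2: "4 *\<^sub>R ty - e ty = y + tc + to" "4 *\<^sub>R tc - e tc = c2 + ty + to"
    using level_midpoints(1,2)[OF l2, of "[?l]" a] yl
    by (simp_all add: x vq ty_def tc_def to_def c2_def e_def \<rho>_def del: power_Suc)
  have junc: "graph_lap G [] b d 1 = e (G (vx [b, d] d))" if "b \<noteq> d" for b d
    using l2[unfolded level_def, rule_format, OF that, of "[]" 1] by (simp add: residual_def e_def \<rho>_def del: power_Suc)
  have j1: "sc + sy = 0"
    using junc[of a ?i] by (simp add: graph_lap_def opposite_def A lin sc_def sy_def neg_eq_iff_add_eq_0 algebra_simps)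
  have j2: "ty + tc = 0"
    using junc[of a ?l] by (simp add: graph_lap_def opposite_def A lin ty_def tc_def neg_eq_iff_add_eq_0 algebra_simps)
  have sw: "vx [?i, ?l] a = vx [?i, a] ?l" "vx [?i, ?l] ?i = vx [?i, ?i] ?l" "vx [?l, ?i] a = vx [?l, a] ?i"
    "vx [?i, ?l] ?l = vx [?i] ?l"
    using vx_swap[of "[?i]" ?l a] vx_swap[of "[?i]" ?l ?i] vx_swap[of "[?l]" ?i a] vx_last[of "[?i]" ?l] by simp_all
  have "graph_lap G [] ?i ?l 1 = 4 *\<^sub>R y - (sy + so) - (to + ty)"
    unfolding graph_lap_def opposite_def
    by (simp only: letter_add replicate_Suc replicate_0 One_nat_def append_Nil sw y_def sy_def so_def to_def ty_def)
  then have j3: "4 *\<^sub>R y - (sy + so) - (to + ty) = e y" using junc[of ?i ?l] sw(4) by (simp add: y_def)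
  have sc: "sc = - sy" "tc = - ty" using j1 j2 by (simp_all add: eq_neg_iff_add_eq_0 add.commute)
  have pt1: "- 4 * apply_bcontfun sy j + apply_bcontfun (e sy) j = - apply_bcontfun y j + apply_bcontfun sy j + apply_bcontfun so j"
    "4 * apply_bcontfun sy j - apply_bcontfun (e sy) j = apply_bcontfun y j - apply_bcontfun sy j + apply_bcontfun so j" for j
    using cell1[unfolded sc c lin, THEN arg_cong[of _ _ apply_bcontfun], THEN fun_cong, of j] by simp_all
  have pt2: "4 * apply_bcontfun ty j - apply_bcontfun (e ty) j = apply_bcontfun y j - apply_bcontfun ty j + apply_bcontfun to j"
    "- 4 * apply_bcontfun ty j + apply_bcontfun (e ty) j = - apply_bcontfun y j + apply_bcontfun ty j + apply_bcontfun to j" for j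
    using cell2[unfolded sc c lin, THEN arg_cong[of _ _ apply_bcontfun], THEN fun_cong, of j] by simp_all
  have so: "so = 0" and to: "to = 0"
    by (rule bcontfun_eqI; use pt1 pt2 in \<open>simp; smt (verit)\<close>)+
  have s5: "5 *\<^sub>R sy - e sy = y" and t5: "5 *\<^sub>R ty - e ty = y"
    by (rule bcontfun_eqI; use pt1(2) pt2(1) in \<open>simp add: so to\<close>)+
  have "sy = ty" using resolvent_5_injective[OF \<rho>, of sy ty] s5 t5 by (simp add: e_def)
  have "apply_bcontfun sy j = apply_bcontfun y j" for j
    using j3[unfolded ey so to \<open>sy = ty\<close>[symmetric], THEN arg_cong[of _ _ apply_bcontfun], THEN fun_cong, of j] by simp
  then have "sy = y" by (rule bcontfun_eqI)
  \<comment> \<open>At level two both adjacent midpoints equal \<open>y\<close>, and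
    \<open>5 - K\<close> maps them to \<open>y\<close>. With \<open>K y = 2 y\<close> this reads
    \<open>3 y = y\<close>.\<close>
  then have y5: "5 *\<^sub>R y - 2 *\<^sub>R y = y" using s5 ey by simp
  have "apply_bcontfun y j = 0" for j
    using y5[THEN arg_cong[of _ _ apply_bcontfun], THEN fun_cong, of j] by simp
  then have y0: "y = 0" by (intro bcontfun_eqI) simp
  then have all0: "c1 = 0" "c2 = 0" "sy = 0" "sc = 0" "ty = 0" "tc = 0" "so = 0" "to = 0"
    using c sc \<open>sy = y\<close> \<open>sy = ty\<close> so to by auto
  have z2: "G (vx [c, d] j) = 0" for c d j
  proof -
    have m: "vx [b, ?i] a = vx [b, a] ?i" "vx [b, ?l] a = vx [b, a] ?l" "vx [b, ?l] ?i = vx [b, ?i] ?l" for b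
      using vx_swap[of "[b]" ?i a] vx_swap[of "[b]" ?l a] vx_swap[of "[b]" ?l ?i] by simp_all
    have d: "vx [b, j] j = vx [b] j" for b j using vx_last[of "[b]" j] by simp
    have 0: "G (vx [a, d] j) = 0" by (rule A)
    have 1: "G (vx [?i, d] j) = 0"
      by (rule letter_induct[of _ a d]; rule letter_induct[of _ a j];
          simp only: m d vq x all0 y0 sc_def[symmetric] sy_def[symmetric] so_def[symmetric] c1_def[symmetric] y_def[symmetric])
    have 2: "G (vx [?l, d] j) = 0"
      by (rule letter_induct[of _ a d]; rule letter_induct[of _ a j];
          simp only: m d vq x all0 y0 yl tc_def[symmetric] ty_def[symmetric] to_def[symmetric] c2_def[symmetric])
    show ?thesis by (rule letter_induct[of _ a c]; fact 0 1 2)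
  qed
  show ?thesis
  proof (rule level_zero[OF r(1) _ _ _ p, of 2])
    show "r / 5 ^ Suc 2 < rad2" using r rad2(1) by simp
    show "level r n G" if "2 < n" for n using lev that by simp
    show "G (vx w j) = 0" if w: "length w = 2" for w j
    proof -
      obtain c d where "w = [c, d]" using w by (auto simp: numeral_2_eq_2 length_Suc_conv)
      then show ?thesis using z2 by simp
    qed
  qed
qed

text \<open>A zero jet makes the solution vanish on a tiny cell at the corner. Each application of
  \<open>zero_propagates\<close> then enlarges this cell by one level, with a parameter r / 5^m that
  stays within the bound.\<close>

theorem jet_unique:
  assumes r: "0 \<le> r" "r / 25 < rad3" and lev: "\<And>n. 1 \<le> n \<Longrightarrow> level r n G"
    and z: "G (q a) = 0" "has_jet G a 0 0" and p: "p \<in> vertices"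
  shows "G p = 0"
proof -
  obtain n1 where "r / 5 ^ n1 \<le> jet_radius" using exists_small_level by blast
  then have start: "G (Fw q (replicate n1 a) p) = 0" if "p \<in> vertices" for p
    using zero_jet[OF r(1) _ _ z that] lev by simp
  have "\<forall>p\<in>vertices. G (Fw q (replicate m a) p) = 0" if "m \<le> n1" for m
    using that
  proof (induction rule: inc_induct)
    case base then show ?case using start by blast
  next
    case (step m)
    let ?w = "replicate m a"
    show ?case
    proof
      fix p assume p: "p \<in> vertices"
      have "r / 5 ^ m \<le> r / 1" using r by (intro divide_left_mono) auto
      then have r': "0 \<le> r / 5 ^ m" "r / 5 ^ m / 25 < rad3" using r by auto
      have "(G \<circ> Fw q ?w) p = 0"
      proof (rule zero_propagates[OF r' _ _ p, of _ a])
        show "level (r / 5 ^ m) n (G \<circ> Fw q ?w)" if "1 \<le> n" for n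
          using level_restrict[of r ?w n G] lev that by simp
        show "(G \<circ> Fw q ?w) (F q a p) = 0" if "p \<in> vertices" for p
        proof -
          have "Fw q ?w (F q a p) = Fw q (replicate (Suc m) a) p"
            using Fw_append[of ?w "[a]" p] by (simp add: replicate_append_same)
          then show ?thesis using step.IH that by (simp del: replicate_Suc)
        qed
      qed
      then show "G (Fw q ?w p) = 0" by simp
    qed
  qed
  from this[of 0] p show ?thesis by simp
qed

section \<open>Existence of solutions with prescribed jets\<close>

lemma has_jet_cong: "(\<And>p. p \<in> vertices \<Longrightarrow> G p = H p) \<Longrightarrow> has_jet G a N T \<longleftrightarrow> has_jet H a N T"
  unfolding has_jet_def corner_sum_def corner_diff_def opposite_def by simp

text \<open>On the cell of level s at the corner the parameter is below \<open>jet_radius\<close>,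
  where the products converge. Each induction step extends from the corner cell to the next larger
  one, which multiplies the parameter by 5, and the norm bound survives because every extension is
  bounded.\<close>

lemma jet_exists_induct:
  "0 < r \<Longrightarrow> r / 25 < rad3 \<Longrightarrow> r / 5 ^ s \<le> jet_radius \<Longrightarrow>
   \<exists>C\<ge>0. \<forall>p N T. \<exists>G. (\<forall>j. continuous_on (SG q) (\<lambda>x. apply_bcontfun (G x) j)) \<and> (\<forall>n\<ge>1. level r n G) \<and>
    G (q a) = p \<and> has_jet G a N T \<and> (\<forall>x\<in>SG q. norm (G x) \<le> C * (norm p + norm N + norm T))"
proof (induction s arbitrary: r)
  case 0
  then have "r \<le> jet_radius" by simp
  from small_jet_exists[OF 0(1) this, of a] show ?case by meson
next
  case (Suc s)
  have "0 < r / 5" "r / 5 / 25 < rad3" "r / 5 / 5 ^ s \<le> jet_radius" using Suc.prems by auto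
  from Suc.IH[OF this] obtain C' where C': "C' \<ge> 0" and ex': "\<And>p N T. \<exists>G. (\<forall>j. continuous_on (SG q) (\<lambda>x. apply_bcontfun (G x) j)) \<and>
    (\<forall>n\<ge>1. level (r / 5) n G) \<and> G (q a) = p \<and> has_jet G a N T \<and> (\<forall>x\<in>SG q. norm (G x) \<le> C' * (norm p + norm N + norm T))"
    by blast
  from extend_from_subcell[OF Suc.prems(1,2), of a] obtain C where C: "C \<ge> 0" and ext: "\<And>G' M. level (r / 5) 1 G' \<Longrightarrow>
    \<forall>p\<in>vertices. norm (G' p) \<le> M \<Longrightarrow> \<exists>G. (\<forall>j. continuous_on (SG q) (\<lambda>x. apply_bcontfun (G x) j)) \<and> (\<forall>n\<ge>1. level r n G) \<and>
      (\<forall>w i. length w = 1 \<longrightarrow> G (F q a (vx w i)) = G' (vx w i)) \<and> (\<forall>x\<in>SG q. norm (G x) \<le> C * M)"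
    by blast
  show ?case
  proof (intro exI[of _ "C * C'"] conjI allI)
    show "0 \<le> C * C'" using C C' by simp
    fix p N T :: bseq
    \<comment> \<open>The jet of the restriction to the corner cell is the given one scaled by 3/5
      and 1/5.\<close>
    from ex'[of p "(3/5) *\<^sub>R N" "(1/5) *\<^sub>R T"] obtain G' where G': "\<And>n. 1 \<le> n \<Longrightarrow> level (r / 5) n G'" "G' (q a) = p"
      "has_jet G' a ((3/5) *\<^sub>R N) ((1/5) *\<^sub>R T)"
      "\<And>x. x \<in> SG q \<Longrightarrow> norm (G' x) \<le> C' * (norm p + norm ((3/5) *\<^sub>R N) + norm ((1/5) *\<^sub>R T))" by blast
    have "C' * (norm p + norm ((3/5) *\<^sub>R N) + norm ((1/5) *\<^sub>R T)) \<le> C' * (norm p + norm N + norm T)"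
      using C' norm_ge_zero[of N] norm_ge_zero[of T] by (intro mult_left_mono) (simp_all add: add_mono)
    then have "\<forall>x\<in>vertices. norm (G' x) \<le> C' * (norm p + norm N + norm T)"
      using G'(4) vertices_SG by fastforce
    from ext[OF G'(1)[OF order_refl] this] obtain G where G: "\<forall>j. continuous_on (SG q) (\<lambda>x. apply_bcontfun (G x) j)"
      "\<forall>n\<ge>1. level r n G" "\<forall>w i. length w = 1 \<longrightarrow> G (F q a (vx w i)) = G' (vx w i)"
      "\<forall>x\<in>SG q. norm (G x) \<le> C * (C' * (norm p + norm N + norm T))" by blast
    \<comment> \<open>The extension is known to agree with \<open>G'\<close> only at level one of
      the subcell; the difference is a solution there, so it vanishes at every vertex and the jet is
      preserved.\<close>
    have eq: "(G \<circ> F q a) v = G' v" if v: "v \<in> vertices" for v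
    proof -
      have Fa: "Fw q [a] = F q a" by auto
      have lv: "level (r / 5) n (G \<circ> F q a)" if "1 \<le> n" for n
        using level_restrict[of r "[a]" n G] G(2) that unfolding Fa by simp
      have "(\<lambda>x. (G \<circ> F q a) x - G' x) v = 0"
      proof (rule level_zero[OF _ _ _ _ v, of "r / 5" 1])
        show "0 \<le> r / 5" using Suc.prems by simp
        show "r / 5 / 5 ^ Suc 1 < rad2" using Suc.prems rad2(1) by simp
        show "level (r / 5) n (\<lambda>x. (G \<circ> F q a) x - G' x)" if "1 < n" for n
          using level_linear(2)[OF _ lv G'(1)] Suc.prems that by simp
        show "(G \<circ> F q a) (vx w i) - G' (vx w i) = 0" if "length w = 1" for w i
          using G(3) that by simp
      qed
      then show ?thesis by simp
    qed
    have "has_jet G a N T"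
      unfolding has_jet_restrict[of G] using has_jet_cong[of "G \<circ> F q a" G' a] eq G'(3) by blast
    moreover have "G (q a) = p" using eq[of "q a"] G'(2) by simp
    ultimately show "\<exists>G. (\<forall>j. continuous_on (SG q) (\<lambda>x. apply_bcontfun (G x) j)) \<and> (\<forall>n\<ge>1. level r n G) \<and>
      G (q a) = p \<and> has_jet G a N T \<and> (\<forall>x\<in>SG q. norm (G x) \<le> C * C' * (norm p + norm N + norm T))"
      using G by (intro exI[of _ G]) (simp add: mult.assoc)
  qed
qed

theorem jet_exists:
  assumes "0 < r" "r / 25 < rad3"
  shows "\<exists>C\<ge>0. \<forall>p N T. \<exists>G. (\<forall>j. continuous_on (SG q) (\<lambda>x. apply_bcontfun (G x) j)) \<and> (\<forall>n\<ge>1. level r n G) \<and>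
    G (q a) = p \<and> has_jet G a N T \<and> (\<forall>x\<in>SG q. norm (G x) \<le> C * (norm p + norm N + norm T))"
  using exists_small_level[of r] jet_exists_induct[OF assms] by blast

end

section \<open>The second Neumann eigenvalue\<close>

lemma bounded_linear_component: "bounded_linear (\<lambda>s :: bseq. apply_bcontfun s j)"
  by (rule bounded_linear_intro[of _ 1]) (auto intro: abs_bseq_le)

text \<open>The two roots of x (5 - x) = v add up to 5. After one division by 5 all values are below
  2, so both arguments select the same root and equality of values descends to the region of local
  injectivity.\<close>

lemma rfun_descend_inj:
  assumes "0 < s" "s < rad3" "0 < t" "t < rad3" "rfun s = rfun t"
  shows "rfun (s / 5 ^ n) = rfun (t / 5 ^ n)"
proof (induction n)
  case 0 then show ?case using assms by simp
next
  case (Suc n)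
  have le: "x / 5 ^ n / 5 \<le> rad3 / 5" if "0 < x" "x < rad3" for x :: real
  proof -
    have "x / 5 ^ n \<le> x / 1" using that by (intro divide_left_mono) auto
    then show ?thesis using that by simp
  qed
  let ?x = "rfun (s / 5 ^ n / 5)" and ?y = "rfun (t / 5 ^ n / 5)"
  have "?x < 2" "?y < 2" using rfun_lt_2 le assms by simp_all
  moreover have "?x * (5 - ?x) = ?y * (5 - ?y)"
    using Suc rfun_eq[of "s / 5 ^ n"] rfun_eq[of "t / 5 ^ n"] by simp
  then have "(?x - ?y) * (5 - ?x - ?y) = 0" by algebra
  ultimately have "?x = ?y" by auto
  then show ?case by (simp add: field_simps)
qed

lemma small_scale:
  assumes "0 < (d::real)"
  obtains n :: nat where "\<bar>s\<bar> / 5 ^ n < d"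
proof -
  have "(\<lambda>n. \<bar>s\<bar> * (1/5) ^ n) \<longlonglongrightarrow> \<bar>s\<bar> * 0" by (intro tendsto_mult tendsto_const LIMSEQ_power_zero) simp
  then have "eventually (\<lambda>n. \<bar>s\<bar> * (1/5) ^ n < d) sequentially" using assms by (intro order_tendstoD(2)) auto
  then obtain n where "\<bar>s\<bar> * (1/5) ^ n < d" by (auto simp: eventually_sequentially)
  then show ?thesis using that[of n] by (simp add: power_one_over)
qed

lemma rfun_inj:
  assumes "0 < s" "s < rad3" "0 < t" "t < rad3" "rfun s = rfun t"
  shows "s = t"
proof -
  obtain d where d: "0 < d" "inj_on dfun (ball 0 d)" using local_injectivity by metis
  obtain n where n: "\<bar>max s t\<bar> / 5 ^ n < d" using small_scale[OF d(1)] .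
  have "s / 5 ^ n \<le> \<bar>max s t\<bar> / 5 ^ n" "t / 5 ^ n \<le> \<bar>max s t\<bar> / 5 ^ n"
    by (intro divide_right_mono; simp)+
  then have "dfun (of_real (s / 5 ^ n)) = dfun (of_real (t / 5 ^ n))" "of_real (s / 5 ^ n) \<in> ball (0::complex) d" "of_real (t / 5 ^ n) \<in> ball (0::complex) d"
    using rfun_descend_inj[OF assms, of n] n assms unfolding dfun_of_real by (simp_all add: norm_divide norm_power)
  then have "(of_real (s / 5 ^ n) :: complex) = of_real (t / 5 ^ n)" using d(2) by (auto dest: inj_onD)
  then have "s / 5 ^ n = t / 5 ^ n" by (simp only: of_real_eq_iff)
  then show ?thesis by simp
qed

lemma rfun_pos:
  assumes t: "0 < t" "t < rad3"
  shows "0 < rfun t"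
proof -
  obtain d where d: "0 < d" "\<And>t. 0 < t \<Longrightarrow> t < d \<Longrightarrow> 0 < rfun t" using local_injectivity by metis
  obtain n where n: "\<bar>t\<bar> / 5 ^ n < d" using small_scale[OF d(1)] .
  have "0 < rfun (t / 5 ^ m)" if "m \<le> n" for m
    using that
  proof (induction rule: inc_induct)
    case base then show ?case using n t by (intro d(2)) auto
  next
    case (step m)
    have "t / 5 ^ m \<le> t / 1" using t by (intro divide_left_mono) auto
    then have "t / 5 ^ m \<le> rad3" using t by linarith
    then have "t / 5 ^ Suc m \<le> rad3 / 5" by simp
    then have "rfun (t / 5 ^ Suc m) < 2" using t by (intro rfun_lt_2) auto
    moreover have "rfun (t / 5 ^ m) = rfun (t / 5 ^ Suc m) * (5 - rfun (t / 5 ^ Suc m))"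
      using rfun_eq[of "t / 5 ^ m"] by (simp add: field_simps)
    ultimately show ?case using step.IH by simp
  qed
  from this[of 0] show ?thesis by simp
qed

section \<open>Neumann eigenfunctions below the bound\<close>

context gasket
begin

lemma zero_by_density:
  assumes "continuous_on (SG q) f" "\<And>p. p \<in> vertices \<Longrightarrow> f p = 0" "x \<in> SG q"
  shows "f x = (0::real)"
proof -
  have "closed {y \<in> SG q. f y = 0}"
    using continuous_closed_preimage_constant[OF assms(1) compact_imp_closed[OF compact_SG], of 0] .
  moreover have "vertices \<subseteq> {y \<in> SG q. f y = 0}" using assms(2) vertices_SG by auto
  ultimately have "closure vertices \<subseteq> {y \<in> SG q. f y = 0}" by (rule closure_minimal[rotated])
  then show ?thesis using assms(3) SG_eq by auto
qed

lemma has_laplacian_SG_cong: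
  assumes "\<And>x. x \<in> SG q \<Longrightarrow> u x = u' x" "\<And>x. x \<in> SG q \<Longrightarrow> f x = f' x"
  shows "has_laplacian_SG q u f \<longleftrightarrow> has_laplacian_SG q u' f'"
proof -
  have "graph_lap u v a b k = graph_lap u' v a b k" for v a b k by (rule graph_lap_cong) (simp add: assms)
  then show ?thesis
    unfolding has_laplacian_SG_iff using assms by (simp cong: continuous_on_cong)
qed

lemma has_laplacian_SG_cmult:
  assumes "has_laplacian_SG q u f"
  shows "has_laplacian_SG q (\<lambda>x. c * u x) (\<lambda>x. c * f x)"
  unfolding has_laplacian_SG_iff
proof (intro conjI allI impI)
  show "continuous_on (SG q) (\<lambda>x. c * u x)" "continuous_on (SG q) (\<lambda>x. c * f x)"
    using assms unfolding has_laplacian_SG_iff by (auto intro: continuous_intros)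
  fix \<epsilon> :: real assume \<epsilon>: "0 < \<epsilon>"
  then have "0 < \<epsilon> / (\<bar>c\<bar> + 1)" by simp
  then obtain M where M: "\<And>v a b k. a \<noteq> b \<Longrightarrow> M \<le> length v + Suc k \<Longrightarrow>
      \<bar>- (3/2 * 5 ^ (length v + Suc k) * graph_lap u v a b k) - f (vx (v @ a # replicate k b) b)\<bar> < \<epsilon> / (\<bar>c\<bar> + 1)"
    using assms unfolding has_laplacian_SG_iff by blast
  show "\<exists>M. \<forall>v a b k. a \<noteq> b \<longrightarrow> M \<le> length v + Suc k \<longrightarrow>
      \<bar>- (3/2 * 5 ^ (length v + Suc k) * graph_lap (\<lambda>x. c * u x) v a b k) - c * f (vx (v @ a # replicate k b) b)\<bar> < \<epsilon>"
  proof (intro exI[of _ M] allI impI)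
    fix v :: "3 list" and a b :: 3 and k assume "a \<noteq> b" "M \<le> length v + Suc k"
    note m = M[OF this]
    let ?e = "- (3/2 * 5 ^ (length v + Suc k) * graph_lap u v a b k) - f (vx (v @ a # replicate k b) b)"
    have "\<bar>c\<bar> * \<bar>?e\<bar> \<le> \<bar>c\<bar> * (\<epsilon> / (\<bar>c\<bar> + 1))" using m by (intro mult_left_mono) auto
    also have "\<dots> < \<epsilon>" using \<epsilon> by (simp add: field_simps)
    finally have "\<bar>c * ?e\<bar> < \<epsilon>" by (simp only: abs_mult)
    moreover have "c * ?e = - (3/2 * 5 ^ (length v + Suc k) * graph_lap (\<lambda>x. c * u x) v a b k) - c * f (vx (v @ a # replicate k b) b)"
      unfolding graph_lap_cmult by (simp add: algebra_simps)
    ultimately show "\<bar>- (3/2 * 5 ^ (length v + Suc k) * graph_lap (\<lambda>x. c * u x) v a b k) - c * f (vx (v @ a # replicate k b) b)\<bar> < \<epsilon>"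
      by simp
  qed
qed

text \<open>The powers of the Laplacian of an eigenfunction form the geometric tower
  \<open>(- b) ^ j * u x\<close>, so the theory of towers applies and every value is an eigenvector
  of the shift.\<close>

lemma eigen_sequence:
  assumes lap: "has_laplacian_SG q u (\<lambda>x. - b * u x)" and r: "2/3 * \<bar>b\<bar> < r"
  obtains G where "\<And>n. r / 5 ^ Suc n < rad3 \<Longrightarrow> level r n G" "\<And>x j. x \<in> SG q \<Longrightarrow> apply_bcontfun (G x) j = (2/3 * b / r) ^ j * u x"
proof -
  have r0: "0 < r" using r abs_ge_zero[of b] by linarith
  define g where "g j x = (- b) ^ j * u x" for j x
  have "compact (u ` SG q)" using lap compact_SG by (intro compact_continuous_image) (auto simp: has_laplacian_SG_def)
  then have "bounded (u ` SG q)" by (rule compact_imp_bounded)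
  then obtain C where C: "\<And>x. x \<in> SG q \<Longrightarrow> \<bar>u x\<bar> \<le> C" unfolding bounded_iff by auto
  have B: "\<bar>g j x\<bar> \<le> C * \<bar>b\<bar> ^ j" if "x \<in> SG q" for x j
    using mult_right_mono[OF C[OF that], of "\<bar>b\<bar> ^ j"] by (simp add: g_def abs_mult power_abs mult.commute)
  have "tower \<bar>b\<bar> g"
    unfolding tower_def
  proof (intro conjI allI exI[of _ C] ballI)
    fix j
    show "has_laplacian_SG q (g j) (g (Suc j))"
      using has_laplacian_SG_cmult[OF lap, of "(- b) ^ j"] unfolding g_def by (simp add: algebra_simps)
  qed (use B in auto)
  then have "level r n (seq_of r g)" if "r / 5 ^ Suc n < rad3" for n
    using tower_level r that by simp
  moreover have "apply_bcontfun (seq_of r g x) j = (2/3 * b / r) ^ j * u x" if "x \<in> SG q" for x j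
  proof -
    have "apply_bcontfun (seq_of r g x) j = (-2/3) ^ j * g j x / r ^ j"
      by (rule apply_seq_of(1)[of "\<bar>b\<bar>" r g x C j]) (use r r0 B[OF that] in simp_all)
    also have "\<dots> = ((-2/3) * (- b) / r) ^ j * u x" by (simp only: g_def power_mult_distrib power_divide) simp
    also have "(-2/3) * (- b) / r = 2/3 * b / r" by simp
    finally show ?thesis .
  qed
  ultimately show ?thesis by (rule that)
qed

text \<open>The Neumann condition makes every component of the normal derivative zero, so the
  symmetric part vanishes at deep levels by the product formula. Inverting \<open>6 - K\<close> in
  the corner recursion carries this up to level \<open>n\<close>.\<close>

lemma neumann_sym_part:
  assumes r: "0 < r" and lev: "\<And>n. r / 5 ^ Suc n < rad3 \<Longrightarrow> level r n G"
    and comp: "\<And>x j. x \<in> SG q \<Longrightarrow> apply_bcontfun (G x) j = \<theta> ^ j * u x"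
    and neumann: "has_normal_deriv q u a 0" and n: "r / 5 ^ Suc n < rad3"
  shows "sym_part r G a n = 0"
proof -
  obtain n1 where n1: "r / 5 ^ n1 \<le> jet_radius" using exists_small_level by blast
  have lev1: "level r (Suc m) G" if "n1 \<le> m" for m
  proof (rule lev)
    have "r / 5 ^ Suc (Suc m) \<le> r / 5 ^ n1" using r that by (intro divide_left_mono power_increasing) auto
    then show "r / 5 ^ Suc (Suc m) < rad3" using n1 corner_products(2) rad2(2) by linarith
  qed
  from corner_solution[OF _ n1 lev1, of a] r obtain N T where
    N: "has_jet G a N T" "\<And>m. n1 \<le> m \<Longrightarrow> (5/3) ^ m *\<^sub>R sym_part r G a m = - opr (r / 5 ^ m) sym_product N"
    by auto
  have "apply_bcontfun N j = 0" for j
  proof -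
    have "has_jet (\<lambda>x. apply_bcontfun (G x) j) a (apply_bcontfun N j) (apply_bcontfun T j)"
      by (rule has_jet_bounded_linear[OF bounded_linear_component N(1)])
    then have "has_jet (\<lambda>x. \<theta> ^ j *\<^sub>R u x) a (apply_bcontfun N j) (apply_bcontfun T j)"
      using has_jet_cong[of "\<lambda>x. apply_bcontfun (G x) j" "\<lambda>x. \<theta> ^ j *\<^sub>R u x"] comp vertices_SG by (simp add: subset_iff)
    then have l1: "(\<lambda>n. (5/3) ^ n *\<^sub>R (2 *\<^sub>R (\<theta> ^ j *\<^sub>R u (q a)) - corner_sum (\<lambda>x. \<theta> ^ j *\<^sub>R u x) a n)) \<longlonglongrightarrow> apply_bcontfun N j"
      by (simp add: has_jet_def)
    have l2: "(\<lambda>n. \<theta> ^ j * ((5/3) ^ n * (2 * u (q a) - corner_sum u a n))) \<longlonglongrightarrow> \<theta> ^ j * 0"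
      using neumann unfolding has_normal_deriv_def
      by (intro tendsto_mult tendsto_const)
        (simp add: corner_sum_def opposite_def funpow_F vx_def letter_diff algebra_simps)
    have eq: "(5/3) ^ n *\<^sub>R (2 *\<^sub>R (\<theta> ^ j *\<^sub>R u (q a)) - corner_sum (\<lambda>x. \<theta> ^ j *\<^sub>R u x) a n)
        = \<theta> ^ j * ((5/3) ^ n * (2 * u (q a) - corner_sum u a n))" for n
      by (simp add: corner_sum_def opposite_def algebra_simps)
    show ?thesis using LIMSEQ_unique[OF l1[unfolded eq] l2] by simp
  qed
  then have "N = 0" by (intro bcontfun_eqI) simp
  have conv: "convergent_at (r / 5 ^ m) sym_product" if "n1 \<le> m" for m
  proof (rule convergent_at_mono[OF corner_products(9)])
    have "r / 5 ^ m \<le> r / 5 ^ n1" using r that by (intro divide_left_mono power_increasing) auto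
    then show "r / 5 ^ m \<le> jet_radius" using n1 by simp
  qed (use r in simp)
  have large: "sym_part r G a m = 0" if "n1 \<le> m" for m
    using N(2)[OF that] opr_linear(4)[OF conv[OF that]] \<open>N = 0\<close> by simp
  have "sym_part r G a m = 0" if "n \<le> m" "m \<le> max n n1" for m
    using that(2,1)
  proof (induction rule: inc_induct)
    case base
    show ?case using large[of "max n n1"] by simp
  next
    case (step m)
    define K where "K = opr (r / 5 ^ Suc m) decim"
    have "r / 5 ^ Suc m \<le> r / 5 ^ Suc n" using r step.prems by (intro divide_left_mono power_increasing) auto
    then have rm: "r / 5 ^ Suc m < rad3" using n by linarith
    have "r / 5 ^ Suc (Suc m) \<le> r / 5 ^ Suc m" using r by (intro divide_left_mono power_increasing) auto
    then have lm: "level r (Suc m) G" using rm by (intro lev) linarith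
    have c6: "convergent_at (r / 5 ^ Suc m) (resolvent 6)" "convergent_at (r / 5 ^ Suc m) decim"
      using rm r by (auto intro!: convergent_at_resolvent_3)
    have "sym_part r G a (Suc m) = 0" using step by simp
    then have "6 *\<^sub>R sym_part r G a m - K (sym_part r G a m) = 0"
      using corner_recursion(2)[OF _ lm, of a] r opr_linear(4)[OF c6(2)] by (simp add: K_def)
    then show ?case using opr_resolvent(1)[OF c6(1), of "sym_part r G a m"] opr_linear(4)[OF c6(1)] by (simp add: K_def)
  qed
  then show ?thesis by simp
qed

text \<open>A corner of the gasket has half the degree of an interior vertex, so the discrete
  Neumann condition is the vertex equation with \<open>m / 2\<close>. It is the interior equation
  after even reflection, halved.\<close>

definition graph_eigen :: "(plane \<Rightarrow> real) \<Rightarrow> real \<Rightarrow> nat \<Rightarrow> bool" where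
  "graph_eigen u m n \<longleftrightarrow>
    (\<forall>v a b k. a \<noteq> b \<longrightarrow> n = length v + Suc k \<longrightarrow> graph_lap u v a b k = m * u (vx (v @ a # replicate k b) b)) \<and>
    (\<forall>a. corner_sum u a n = (2 - m / 2) * u (q a))"

text \<open>The auxiliary rate \<open>r\<close> cancels: at level n the operator acts as m (2/3 b /
  5^n), so a Neumann eigenfunction restricts to a Neumann eigenfunction of the graph. The rate only
  has to leave room for the level equation.\<close>

lemma eigen_levels:
  assumes lap: "has_laplacian_SG q u (\<lambda>x. - b * u x)" and neumann: "\<And>i. has_normal_deriv q u i 0"
    and r: "2/3 * \<bar>b\<bar> < r" and n: "r / 5 ^ Suc n < rad3"
  shows "graph_eigen u (rfun (2/3 * b / 5 ^ n)) n"
proof -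
  have r0: "0 < r" using r abs_ge_zero[of b] by linarith
  obtain G where lev: "\<And>n. r / 5 ^ Suc n < rad3 \<Longrightarrow> level r n G"
    and comp: "\<And>x j. x \<in> SG q \<Longrightarrow> apply_bcontfun (G x) j = (2/3 * b / r) ^ j * u x"
    by (rule eigen_sequence[OF lap r]) (rule that; assumption)
  have op: "opr (r / 5 ^ n) decim (G x) = rfun (2/3 * b / 5 ^ n) *\<^sub>R G x" if "x \<in> SG q" for x
  proof -
    have "shift (G x) = (2/3 * b / r) *\<^sub>R G x" by (rule bcontfun_eqI) (simp add: comp[OF that])
    then have "opr (r / 5 ^ n) decim (G x) = rfun (r / 5 ^ n * (2/3 * b / r)) *\<^sub>R G x"
      using r0 by (intro opr_decim_eigen) simp_all
    also have "r / 5 ^ n * (2/3 * b / r) = 2/3 * b / 5 ^ n" using r0 by simp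
    finally show ?thesis .
  qed
  show ?thesis
    unfolding graph_eigen_def
  proof (intro conjI allI impI)
    fix v :: "3 list" and a c :: 3 and k assume ac: "a \<noteq> c" and nk: "n = length v + Suc k"
    have "graph_lap G v a c k = rfun (2/3 * b / 5 ^ n) *\<^sub>R G (vx (v @ a # replicate k c) c)"
      using lev[OF n, unfolded level_def, rule_format, OF ac nk] op by (simp add: residual_def nk)
    then have "graph_lap (\<lambda>x. apply_bcontfun (G x) 0) v a c k = rfun (2/3 * b / 5 ^ n) * u (vx (v @ a # replicate k c) c)"
      unfolding apply_graph_lap[symmetric] by (simp add: comp)
    moreover have "graph_lap (\<lambda>x. apply_bcontfun (G x) 0) v a c k = graph_lap u v a c k"
      by (rule graph_lap_cong) (simp add: comp)
    ultimately show "graph_lap u v a c k = rfun (2/3 * b / 5 ^ n) * u (vx (v @ a # replicate k c) c)" by simp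
  next
    fix a
    have "sym_part r G a n = 0" by (rule neumann_sym_part[OF r0 lev comp neumann n])
    then have "apply_bcontfun (sym_part r G a n) 0 = 0" by simp
    then show "corner_sum u a n = (2 - rfun (2/3 * b / 5 ^ n) / 2) * u (q a)"
      by (simp add: sym_part_def corner_sum_def opposite_def op comp algebra_simps)
  qed
qed

lemma eigen_zero:
  assumes lap: "has_laplacian_SG q u (\<lambda>x. - b * u x)"
    and r: "2/3 * \<bar>b\<bar> < r" and n: "r / 5 ^ Suc n < rad2" and z: "\<And>w i. length w = n \<Longrightarrow> u (vx w i) = 0" and x: "x \<in> SG q"
  shows "u x = 0"
proof (rule zero_by_density[OF _ _ x])
  show "continuous_on (SG q) u" using lap by (simp add: has_laplacian_SG_def)
  fix p assume p: "p \<in> vertices"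
  have r0: "0 < r" using r abs_ge_zero[of b] by linarith
  obtain G where lev: "\<And>n. r / 5 ^ Suc n < rad3 \<Longrightarrow> level r n G"
    and comp: "\<And>x j. x \<in> SG q \<Longrightarrow> apply_bcontfun (G x) j = (2/3 * b / r) ^ j * u x"
    by (rule eigen_sequence[OF lap r]) (rule that; assumption)
  have "G p = 0"
  proof (rule level_zero[OF _ n _ _ p])
    show "level r m G" if "n < m" for m
    proof (rule lev)
      have "r / 5 ^ Suc m \<le> r / 5 ^ Suc n" using r0 that by (intro divide_left_mono power_increasing) auto
      then show "r / 5 ^ Suc m < rad3" using n rad2(2) by linarith
    qed
    show "G (vx w i) = 0" if "length w = n" for w i
      by (rule bcontfun_eqI) (simp add: comp z[OF that])
  qed (use r0 in simp)
  then have "apply_bcontfun (G p) 0 = 0" by simp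
  then show "u p = 0" using comp[of p 0] p vertices_SG by auto
qed

text \<open>Maximum principle: where the absolute value is maximal, the equation gives
  \<open>4 - m\<close> times the maximum at most 4 times the maximum, or half of this at a
  corner.\<close>

lemma graph_eigen_negative:
  assumes e: "graph_eigen u m n" and m: "m < 0" and w: "length w = n"
  shows "u (vx w i) = 0"
proof -
  have fin: "finite {w :: 3 list. length w = n}" using finite_lists_length_eq[of "UNIV :: 3 set" n] by simp
  have "finite ((\<lambda>(w,i). \<bar>u (vx w i)\<bar>) ` ({w. length w = n} \<times> UNIV))" using fin by simp
  define X where "X = Max ((\<lambda>(w,i). \<bar>u (vx w i)\<bar>) ` ({w. length w = n} \<times> UNIV))"
  have le: "\<bar>u (vx w i)\<bar> \<le> X" if "length w = n" for w i
    unfolding X_def using that fin by (intro Max_ge) force+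
  have "X \<in> (\<lambda>(w,i). \<bar>u (vx w i)\<bar>) ` ({w. length w = n} \<times> UNIV)"
    unfolding X_def using fin w by (intro Max_in) auto
  then obtain w' i' where x: "length w' = n" "X = \<bar>u (vx w' i')\<bar>" by auto
  have "X \<le> 0"
  proof (cases "w' = replicate n i'")
    case True
    then have xq: "vx w' i' = q i'" by (simp add: vx_def)
    have "corner_sum u i' n = (2 - m / 2) * u (q i')" using e by (simp add: graph_eigen_def)
    then have "\<bar>(2 - m / 2) * u (q i')\<bar> \<le> X + X"
      unfolding corner_sum_def opposite_def
      using le[of "replicate n i'" "i' + 1"] le[of "replicate n i'" "i' + 2"] by simp
    then have "(2 - m / 2) * X \<le> 2 * X" using m by (simp add: abs_mult x(2) xq)
    then show ?thesis using m by (simp add: algebra_simps mult_le_0_iff zero_le_mult_iff)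
  next
    case False
    then obtain v a k where v: "a \<noteq> i'" "w' = v @ a # replicate k i'" using split_word[of w' i'] x(1) by metis
    then have nk: "n = length v + Suc k" using x(1) by simp
    have "graph_lap u v a i' k = m * u (vx w' i')" using e v nk unfolding graph_eigen_def by blast
    then have "(4 - m) * u (vx w' i') = opposite u w' i' + opposite u (v @ i' # replicate k a) a"
      by (simp add: graph_lap_def v(2) algebra_simps)
    also have "\<bar>\<dots>\<bar> \<le> (X + X) + (X + X)"
      unfolding opposite_def using le[of w' "i' + 1"] le[of w' "i' + 2"] le[of "v @ i' # replicate k a" "a + 1"] le[of "v @ i' # replicate k a" "a + 2"] nk x(1)
      by (simp add: abs_le_iff)
    finally have "\<bar>(4 - m) * u (vx w' i')\<bar> \<le> 4 * X" by simp
    then have "(4 - m) * X \<le> 4 * X" using m by (simp add: abs_mult x(2))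
    then show ?thesis using m by (simp add: algebra_simps mult_le_0_iff zero_le_mult_iff)
  qed
  then show ?thesis using le[OF w, of i] by simp
qed


lemma letter_words_zero:
  assumes "\<And>c. u (q c) = (0::real)" "\<And>c. u (vx [c] (c + 1)) = 0"
    "\<And>c. u (vx [c, c] (c + 1)) = 0" "\<And>c. u (vx [c, c] (c + 2)) = 0" "\<And>c. u (vx [c, c + 1] (c + 2)) = 0"
    and w: "length w = 2"
  shows "u (vx w j) = 0"
proof -
  have m: "vx [b, c + 1] c = vx [b, c] (c + 1)" "vx [b, c + 2] c = vx [b, c] (c + 2)"
    "vx [b, c + 2] (c + 1) = vx [b, c + 1] (c + 2)" "vx [b, c] c = vx [b] c" for b c
    using vx_swap[of "[b]" "c + 1" c] vx_swap[of "[b]" "c + 2" c] vx_swap[of "[b]" "c + 2" "c + 1"] vx_last[of "[b]" c]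
    by simp_all
  have z1: "u (vx [c] j) = 0" for c j
  proof (rule letter_induct[of _ c j])
    show "u (vx [c] c) = 0" using assms(1) by (simp add: vx_def)
    show "u (vx [c] (c + 2)) = 0" using assms(2)[of "c + 2"] vx_swap[of "[]" "c + 2" c] by simp
  qed (rule assms(2))
  have "u (vx [c, d] j) = 0" for c d j
    by (rule letter_induct[of _ c d]; rule letter_induct[of _ c j]; simp only: m z1 assms(3-5))
  moreover obtain c d where "w = [c, d]" using w by (auto simp: numeral_2_eq_2 length_Suc_conv)
  ultimately show ?thesis by simp
qed

text \<open>Below, \<open>A c\<close> is the value at the midpoint of the edge from \<open>c\<close> to \<open>c + 1\<close>; in the cell \<open>c\<close>, the values at
  the midpoints adjacent to the corner are \<open>s c\<close>, \<open>t c\<close>, and \<open>o' c\<close> is the remaining one.\<close>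

lemma graph_eigen_zero:
  assumes g1: "graph_eigen u m 1" and g2: "graph_eigen u e 2" and m: "m = e * (5 - e)" "0 < e" "e < 3" "m \<noteq> 3"
    and w: "length w = 2"
  shows "u (vx w j) = 0"
proof -
  define Q A s t o' where "Q c = u (q c)" and "A c = u (vx [c] (c + 1))" and "s c = u (vx [c, c] (c + 1))"
    and "t c = u (vx [c, c] (c + 2))" and "o' c = u (vx [c, c + 1] (c + 2))" for c
  have lap1: "graph_lap u v a b k = m * u (vx (v @ a # replicate k b) b)" if "a \<noteq> b" "1 = length v + Suc k" for v a b k
    using g1 that unfolding graph_eigen_def by blast
  have lap2: "graph_lap u v a b k = e * u (vx (v @ a # replicate k b) b)" if "a \<noteq> b" "2 = length v + Suc k" for v a b k
    using g2 that unfolding graph_eigen_def by blast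
  have A2: "u (vx [c] (c + 2)) = A (c + 2)" for c using vx_swap[of "[]" "c + 2" c] by (simp add: A_def)
  have vq: "u (vx [c] c) = Q c" for c by (simp add: vx_def Q_def)
  have M: "4 * A c - (Q c + Q (c + 1) + A (c + 2) + A (c + 1)) = m * A c" for c
    using lap1[of c "c + 1" "[]" 0] graph_lap_midpoints(1)[of u "[]" c] A2[of c]
    by (simp add: A_def Q_def vx_Nil)
  have C1: "A c + A (c + 2) = (2 - m / 2) * Q c" for c
    using g1[unfolded graph_eigen_def, THEN conjunct2, rule_format, of c] A2[of c] by (simp add: corner_sum_def opposite_def A_def Q_def)
  have T: "4 * s c - (Q c + A c + t c + o' c) = e * s c" "4 * t c - (Q c + A (c + 2) + s c + o' c) = e * t c"
    "4 * o' c - (A c + A (c + 2) + s c + t c) = e * o' c" for c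
    using lap2[of c "c + 1" "[c]" 0] lap2[of c "c + 2" "[c]" 0] lap2[of "c + 1" "c + 2" "[c]" 0]
      graph_lap_midpoints[of u "[c]" c] A2[of c] vq[of c]
    by (simp_all add: A_def s_def t_def o'_def)
  have C2: "s c + t c = (2 - e / 2) * Q c" for c
    using g2[unfolded graph_eigen_def, THEN conjunct2, rule_format, of c]
    by (simp add: corner_sum_def opposite_def s_def t_def Q_def numeral_2_eq_2)
  have J: "4 * A c - (o' c + s c) - (t (c + 1) + o' (c + 1)) = e * A c" for c
  proof -
    have sw: "vx [c, c + 1] c = vx [c, c] (c + 1)" "vx [c + 1, c] (c + 1) = vx [c + 1, c + 1] c" "vx [c + 1, c] (c + 2) = vx [c + 1, c + 2] c"
      using vx_swap[of "[c]" "c + 1" c] vx_swap[of "[c + 1]" "c + 1" c] vx_swap[of "[c + 1]" "c + 2" c] by simp_all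
    have "t (c + 1) = u (vx [c + 1, c + 1] c)" "o' (c + 1) = u (vx [c + 1, c + 2] c)" by (simp_all add: t_def o'_def)
    then have tt: "opposite u [c + 1, c] c = t (c + 1) + o' (c + 1)" by (simp add: opposite_def sw)
    have ss: "opposite u [c, c + 1] (c + 1) = o' c + s c" by (simp add: opposite_def sw o'_def s_def)
    have "graph_lap u [] c (c + 1) 1 = e * A c"
      using lap2[of c "c + 1" "[]" 1] vx_last[of "[c]" "c + 1"] by (simp add: A_def)
    moreover have "graph_lap u [] c (c + 1) 1 = 4 * A c - (o' c + s c) - (t (c + 1) + o' (c + 1))"
      using vx_last[of "[c]" "c + 1"] by (simp add: graph_lap_def ss tt A_def)
    ultimately show ?thesis by simp
  qed
  have zero: "Q c = 0 \<and> A c = 0 \<and> s c = 0 \<and> t c = 0 \<and> o' c = 0" for c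
  \<comment> \<open>For e = 2 one has m = 6, an eigenvalue of the level one graph, so level one
    alone does not force zero and both levels are combined. Otherwise the corners and junctions
    vanish by level one, and the cell equations of level two give the rest.\<close>
  proof (cases "e = 2")
    case True
    have eqs: "s c + t c = Q c" "2 * o' c = A c + A (c + 2) + Q c" "2 * s c = Q c + A c + t c + o' c"
      "2 * t c = Q c + A (c + 2) + s c + o' c" "A c + A (c + 2) = - Q c"
      "2 * A c = o' c + s c + t (c + 1) + o' (c + 1)" for c
      using T[of c] C2[of c] C1[of c] J[of c] m(1) True by simp_all
    show ?thesis
      using eqs[of c] eqs[of "c + 1"] eqs[of "c + 2"] by simp
  next
    case False
    have m6: "m \<noteq> 6"
    proof
      assume "m = 6"
      then have "(e - 2) * (e - 3) = 0" using m(1) by (simp add: algebra_simps)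
      then show False using False m(3) by simp
    qed
    have m0: "m \<noteq> 0" using m by auto
    define X Y where "X = A c + A (c + 1) + A (c + 2)" and "Y = Q c + Q (c + 1) + Q (c + 2)"
    have eM: "(5 - m) * A d = Q d + Q (d + 1) + (A d + A (d + 1) + A (d + 2))" for d
      using M[of d] by (simp add: algebra_simps)
    have "(5 - m) * X = 2 * Y + 3 * X"
      using eM[of c] eM[of "c + 1", unfolded letter_add] eM[of "c + 2", unfolded letter_add] by (simp add: X_def Y_def algebra_simps)
    then have 1: "2 * Y = (2 - m) * X" by (simp add: algebra_simps)
    have "2 * X = (2 - m / 2) * Y"
      using C1[of c] C1[of "c + 1", unfolded letter_add] C1[of "c + 2", unfolded letter_add] by (simp add: X_def Y_def algebra_simps)
    then have 2: "4 * X = (4 - m) * Y" by (simp add: algebra_simps)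
    \<comment> \<open>The rotation sums admit only the eigenvalues 0 and 6. Once they vanish, the
      remaining modes admit only 3 and 6; \<open>m\<close> differs from all three.\<close>
    have "m * (m - 6) * X = 0" using 1 2 by algebra
    then have X0: "X = 0" using m0 m6 by simp
    then have Y0: "Y = 0" using 1 by simp
    have AQ: "Q d = 0 \<and> A d = 0" if Xd: "A d + A (d + 1) + A (d + 2) = 0" and Yd: "Q d + Q (d + 1) + Q (d + 2) = 0" for d
    proof -
      have "(5 - m) * A d = - Q (d + 2)" using eM[of d] Xd Yd by simp
      moreover have "2 * A d = - ((4 - m) * Q (d + 2))" using C1[of "d + 2", unfolded letter_add] Xd by (simp add: algebra_simps)
      ultimately have "(m - 3) * (m - 6) * A d = 0" by algebra
      then have Ad: "A d = 0" using m(4) m6 by simp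
      moreover have "(5 - m) * A (d + 2) = - Q (d + 1)" using eM[of "d + 2", unfolded letter_add] Xd Yd by (simp add: algebra_simps)
      moreover have "2 * A (d + 2) = - ((4 - m) * Q (d + 1))" using C1[of "d + 1", unfolded letter_add] Xd by (simp add: algebra_simps)
      ultimately have "(m - 3) * (m - 6) * A (d + 2) = 0" by algebra
      then have "A (d + 2) = 0" using m(4) m6 by simp
      then have Q1: "Q (d + 1) = 0" "Q (d + 2) = 0" using \<open>(5 - m) * A (d + 2) = - Q (d + 1)\<close> \<open>(5 - m) * A d = - Q (d + 2)\<close> Ad by simp_all
      then show ?thesis using Ad Yd by simp
    qed
    have AQ0: "Q d = 0 \<and> A d = 0" for d
      by (rule letter_induct[of _ c d]; rule AQ; (simp only: letter_add)?; use X0[unfolded X_def] Y0[unfolded Y_def] in linarith)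
    have "(2 - e) * (s c + t c + o' c) = 0" using T[of c] AQ0 by (simp add: algebra_simps)
    then have S: "s c + t c + o' c = 0" using False by simp
    have "(5 - e) * s c = 0" "(5 - e) * t c = 0" "(5 - e) * o' c = 0"
      using T[of c] S unfolding AQ0[THEN conjunct1] AQ0[THEN conjunct2] left_diff_distrib by linarith+
    then show ?thesis using m(3) AQ0 by simp
  qed
  show ?thesis
    by (rule letter_words_zero[OF _ _ _ _ _ w]) (use zero in \<open>simp_all add: Q_def A_def s_def t_def o'_def\<close>)
qed

text \<open>For a positive eigenvalue below the bound, the graph eigenvalue at level two lies
  strictly between 0 and 3, and the eigenfunction vanishes at level two unless the graph eigenvalue
  at level one is 3. This value determines the argument uniquely. A negative eigenvalue is refuted
  by the maximum principle on a deep level.\<close>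

theorem small_neumann_eigenvalue:
  assumes b: "neumann_eigenvalue q b" "b \<noteq> 0" "b < 3/2 * (25 * rad3)"
  shows "b = 3/2 * (5 * rad3)"
proof (rule ccontr)
  assume ne: "b \<noteq> 3/2 * (5 * rad3)"
  obtain u x where x: "x \<in> SG q" "u x \<noteq> 0" and lap: "has_laplacian_SG q u (\<lambda>x. - b * u x)" and N: "\<And>i. has_normal_deriv q u i 0"
    using b(1) unfolding neumann_eigenvalue_def has_laplacian_def by auto
  have "u x = 0"
  proof (cases "b < 0")
    case True
    obtain d where d: "0 < d" "\<And>t. -d < t \<Longrightarrow> t < 0 \<Longrightarrow> rfun t < 0" using local_injectivity by metis
    define r where "r = 2/3 * \<bar>b\<bar> + 1"
    \<comment> \<open>So deep that m is negative at the rescaled eigenvalue and that the values at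
      this level determine the function.\<close>
    obtain n where n: "\<bar>r\<bar> / 5 ^ n < min d rad2" using small_scale[of "min d rad2" r] d(1) rad2(4) by auto
    have r: "2/3 * \<bar>b\<bar> < r" "0 < r" unfolding r_def by auto
    have n': "r / 5 ^ Suc n < rad2"
    proof -
      have "r / 5 ^ Suc n \<le> r / 5 ^ n" using r by (intro divide_left_mono) auto
      then show ?thesis using n r by simp
    qed
    have "\<bar>2/3 * b / 5 ^ n\<bar> \<le> r / 5 ^ n" unfolding abs_divide using r by (intro frac_le) (simp_all add: abs_mult)
    then have "rfun (2/3 * b / 5 ^ n) < 0"
      using n r True by (intro d(2)) (auto simp: abs_less_iff divide_neg_pos)
    moreover have "graph_eigen u (rfun (2/3 * b / 5 ^ n)) n"
      using eigen_levels[OF lap N r(1), of n] n' rad2(2) by linarith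
    ultimately have "u (vx w i) = 0" if "length w = n" for w i using graph_eigen_negative that by blast
    then show ?thesis using eigen_zero[OF lap r(1) n' _ x(1)] by blast
  next
    case False
    define z where "z = 2/3 * b"
    have z: "0 < z" "z < 25 * rad3" "z \<noteq> 5 * rad3" using False b ne by (auto simp: z_def)
    define r where "r = (z + 25 * rad3) / 2"
    have r: "2/3 * \<bar>b\<bar> < r" "r < 25 * rad3" using z False by (auto simp: r_def z_def)
    have g1: "graph_eigen u (rfun (z / 5)) 1" and g2: "graph_eigen u (rfun (z / 25)) 2"
      using eigen_levels[OF lap N r(1), of 1] eigen_levels[OF lap N r(1), of 2] r rad3(1) by (simp_all add: z_def)
    have e: "0 < rfun (z / 25)" "rfun (z / 25) < 3" using z by (auto intro: rfun_pos rad3(3))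
    have m: "rfun (z / 5) = rfun (z / 25) * (5 - rfun (z / 25))" using rfun_eq[of "z / 5"] by simp
    have "rfun (z / 5) \<noteq> 3"
    proof
      assume m3: "rfun (z / 5) = 3"
      have "3 = rfun (rad3 / 5) * (5 - rfun (rad3 / 5))" using rfun_eq[of rad3] rad3(2) by simp
      \<comment> \<open>Two roots of x (5 - x) = 3 are equal or add up to 5. As
        \<open>rfun (rad3 / 5)\<close> is below 2, the second case would put \<open>e\<close> above
        3.\<close>
      then have "(rfun (z / 25) - rfun (rad3 / 5)) * (5 - rfun (z / 25) - rfun (rad3 / 5)) = 0" using m m3 by algebra
      moreover have "rfun (rad3 / 5) < 2" using rfun_lt_2[of "rad3 / 5"] rad3(1) by simp
      ultimately have "rfun (z / 25) = rfun (rad3 / 5)" using e by auto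
      then have "z / 25 = rad3 / 5" using z rad3(1) rfun_inj[of "z / 25" "rad3 / 5"] by simp
      then show False using z(3) by simp
    qed
    then have "u (vx w i) = 0" if "length w = 2" for w i using graph_eigen_zero[OF g1 g2 m e _ that] by blast
    then show ?thesis using eigen_zero[OF lap r(1) _ _ x(1), of 2] r rad2(1) by simp
  qed
  then show False using x(2) by simp
qed

text \<open>Multiplying the real values by the constant sequence, a fixed vector of the shift, turns
  \<open>K\<close> into the number m (r / 5^n), so graph eigenfunctions satisfy the hypotheses of
  \<open>extension_exists\<close>. Below \<open>rad2\<close> both the fixed-vector property and the
  vanishing symmetric parts persist at all deeper levels.\<close>

lemma neumann_eigenvalue_from_graph:
  fixes Q :: "3 list \<Rightarrow> 3 \<Rightarrow> real"
  assumes r: "0 < r" "r / 5 ^ Suc n < rad2"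
    and consistent: "\<And>v a b k. a \<noteq> b \<Longrightarrow> length v + Suc k = n \<Longrightarrow> Q (v @ a # replicate k b) b = Q (v @ b # replicate k a) a"
    and equation: "\<And>v a b k. a \<noteq> b \<Longrightarrow> length v + Suc k = n \<Longrightarrow> (4 - rfun (r / 5 ^ n)) * Q (v @ a # replicate k b) b =
      (Q (v @ a # replicate k b) (b + 1) + Q (v @ a # replicate k b) (b + 2)) +
      (Q (v @ b # replicate k a) (a + 1) + Q (v @ b # replicate k a) (a + 2))"
    and corner: "\<And>a. Q (replicate n a) (a + 1) + Q (replicate n a) (a + 2) = (2 - rfun (r / 5 ^ n) / 2) * Q (replicate n a) a"
    and bound: "\<And>w i. \<bar>Q w i\<bar> \<le> 1" and nz: "length w0 = n" "Q w0 i0 \<noteq> 0"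
  shows "neumann_eigenvalue q (3/2 * r)"
proof -
  define c :: bseq where "c = const_bcontfun 1"
  have apply_c: "apply_bcontfun c j = 1" for j by (simp add: c_def)
  have "shift c = 1 *\<^sub>R c" by (rule bcontfun_eqI) (simp add: apply_c)
  then have opr_c: "opr (r / 5 ^ m) decim c = rfun (r / 5 ^ m) *\<^sub>R c" for m
    using opr_decim_eigen[of "r / 5 ^ m" c 1] r by simp
  have dec: "convergent_at (r / 5 ^ m) decim" for m using r by simp
  have nc: "norm (Q w i *\<^sub>R c) \<le> 1" for w i by (rule norm_bseq_le) (simp add: apply_c bound)
  from extension_exists[OF r] obtain C where C: "C \<ge> 0" and ext: "\<And>Q M. (\<forall>v a b k. a \<noteq> b \<longrightarrow> length v + Suc k = n \<longrightarrow> Q (v @ a # replicate k b) b = Q (v @ b # replicate k a) a) \<Longrightarrow>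
    (\<forall>v a b k. a \<noteq> b \<longrightarrow> length v + Suc k = n \<longrightarrow>
      4 *\<^sub>R Q (v @ a # replicate k b) b - opr (r / 5 ^ n) decim (Q (v @ a # replicate k b) b) =
      (Q (v @ a # replicate k b) (b + 1) + Q (v @ a # replicate k b) (b + 2)) +
      (Q (v @ b # replicate k a) (a + 1) + Q (v @ b # replicate k a) (a + 2))) \<Longrightarrow>
    (\<forall>w i. length w = n \<longrightarrow> norm (Q w i) \<le> M) \<Longrightarrow>
    (\<exists>G. (\<forall>j. continuous_on (SG q) (\<lambda>x. apply_bcontfun (G x) j)) \<and> (\<forall>m\<ge>n. level r m G) \<and> (\<forall>w i. length w = n \<longrightarrow> G (vx w i) = Q w i) \<and>
      (\<forall>x\<in>SG q. norm (G x) \<le> C * M))" by blast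
  have "\<exists>G. (\<forall>j. continuous_on (SG q) (\<lambda>x. apply_bcontfun (G x) j)) \<and> (\<forall>m\<ge>n. level r m G) \<and> (\<forall>w i. length w = n \<longrightarrow> G (vx w i) = Q w i *\<^sub>R c) \<and>
      (\<forall>x\<in>SG q. norm (G x) \<le> C * 1)"
  proof (rule ext; intro allI impI)
    fix v :: "3 list" and a b :: 3 and k assume ab: "a \<noteq> b" "length v + Suc k = n"
    show "Q (v @ a # replicate k b) b *\<^sub>R c = Q (v @ b # replicate k a) a *\<^sub>R c" by (simp only: consistent[OF ab])
    show "4 *\<^sub>R Q (v @ a # replicate k b) b *\<^sub>R c - opr (r / 5 ^ n) decim (Q (v @ a # replicate k b) b *\<^sub>R c) =
      (Q (v @ a # replicate k b) (b + 1) *\<^sub>R c + Q (v @ a # replicate k b) (b + 2) *\<^sub>R c) +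
      (Q (v @ b # replicate k a) (a + 1) *\<^sub>R c + Q (v @ b # replicate k a) (a + 2) *\<^sub>R c)"
      unfolding opr_linear(3)[OF dec] opr_c
      by (rule bcontfun_eqI) (use equation[OF ab] in \<open>simp add: apply_c left_diff_distrib mult.commute[of _ "rfun _"]\<close>)
  qed (rule nc)
  then obtain G where G: "(\<forall>j. continuous_on (SG q) (\<lambda>x. apply_bcontfun (G x) j)) \<and> (\<forall>m\<ge>n. level r m G) \<and> (\<forall>w i. length w = n \<longrightarrow> G (vx w i) = Q w i *\<^sub>R c) \<and>
      (\<forall>x\<in>SG q. norm (G x) \<le> C * 1)" ..
  have cont: "continuous_on (SG q) (\<lambda>x. apply_bcontfun (G x) j)" for j using G by (elim conjE) (erule allE)
  have lev: "level r m G" if "n \<le> m" for m using G that by simp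
  have Gw: "G (vx w i) = Q w i *\<^sub>R c" if "length w = n" for w i using G that by simp
  have B: "norm (G x) \<le> C" if "x \<in> SG q" for x using G that by simp
  define u where "u x = apply_bcontfun (G x) 0" for x
  \<comment> \<open>The difference solves all level equations and vanishes at level
    \<open>n\<close>, so the extension consists of constant sequences. Equality of the components 0
    and 1 is the eigenvalue equation.\<close>
  have "(\<lambda>x. shift (G x) - G x) p = 0" if p: "p \<in> vertices" for p
  proof (rule level_zero[OF _ r(2) _ _ p])
    show "level r m (\<lambda>x. shift (G x) - G x)" if "n < m" for m
      using level_linear(2)[OF _ level_linear(4)[OF _ lev lev] lev] r that by simp
    show "shift (G (vx w i)) - G (vx w i) = 0" if "length w = n" for w i
      by (rule bcontfun_eqI) (simp add: Gw[OF that] apply_c)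
  qed (use r in simp)
  then have "apply_bcontfun (G p) 1 - apply_bcontfun (G p) 0 = 0" if "p \<in> vertices" for p
    using that by (metis One_nat_def apply_shift minus_bcontfun.rep_eq zero_bcontfun.rep_eq)
  then have "apply_bcontfun (G x) 1 - apply_bcontfun (G x) 0 = 0" if "x \<in> SG q" for x
    using zero_by_density[OF continuous_on_diff[OF cont[of 1] cont[of 0]] _ that] by blast
  then have G1: "apply_bcontfun (G x) 1 = u x" if "x \<in> SG q" for x using that by (simp add: u_def)
  have "tower (3/2 * r) (fun_of r G)" by (rule level_tower[OF r(1) cont lev B])
  then have "has_laplacian_SG q (fun_of r G 0) (fun_of r G (Suc 0))" by (simp add: tower_def)
  then have lap: "has_laplacian_SG q u (\<lambda>x. - (3/2 * r) * u x)"
    by (subst has_laplacian_SG_cong[of _ "fun_of r G 0" _ "fun_of r G 1"]) (simp_all add: fun_of_def u_def[symmetric] G1[simplified])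
  have neu: "has_normal_deriv q u a 0" for a
  proof -
    have "sym_part r G a m = 0" if "n \<le> m" for m
      using that
    proof (induction rule: dec_induct)
      case base
      have "apply_bcontfun (sym_part r G a n) j = 0" for j
        using Gw[of "replicate n a"] corner[of a] Gw[of "replicate n a" a]
        by (simp add: sym_part_def corner_sum_def opposite_def opr_linear(3)[OF dec] opr_c apply_c vx_def)
          (simp add: algebra_simps)
      then show ?case by (intro bcontfun_eqI) simp
    next
      case (step m)
      define K where "K = opr (r / 5 ^ Suc m) decim"
      have "r / 5 ^ Suc m \<le> r / 5 ^ Suc n" using r step.hyps by (intro divide_left_mono power_increasing) auto
      then have rm: "0 \<le> r / 5 ^ Suc m" "r / 5 ^ Suc m < rad2" using r by auto
      let ?t = "sym_part r G a (Suc m)"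
      have conv: "convergent_at (r / 5 ^ Suc m) (resolvent 2)" "convergent_at (r / 5 ^ Suc m) (resolvent 5)"
        using rm by (auto intro: convergent_at_resolvent_2)
      have "level r (Suc m) G" using lev step.hyps by simp
      from corner_recursion(2)[OF _ this, of a] have "10 *\<^sub>R ?t - 7 *\<^sub>R K ?t + K (K ?t) = 0"
        using r step.IH opr_linear(4)[OF dec[of "Suc m"]] by (simp add: K_def)
      moreover have "2 *\<^sub>R (5 *\<^sub>R ?t - K ?t) - K (5 *\<^sub>R ?t - K ?t) = 10 *\<^sub>R ?t - 7 *\<^sub>R K ?t + K (K ?t)"
        unfolding K_def opr_linear[OF dec[of "Suc m"]] by (rule bcontfun_eqI) simp
      ultimately have "5 *\<^sub>R ?t - K ?t = 0"
        using opr_resolvent(1)[OF conv(1), of "5 *\<^sub>R ?t - K ?t"] opr_linear(4)[OF conv(1)] by (simp add: K_def)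
      then show ?case
        using opr_resolvent(1)[OF conv(2), of ?t] opr_linear(4)[OF conv(2)] by (simp add: K_def)
    qed
    note sym0 = this
    obtain n1' where n1': "r / 5 ^ n1' \<le> jet_radius" using exists_small_level by blast
    define n1 where "n1 = max n n1'"
    have "r / 5 ^ n1 \<le> r / 5 ^ n1'" using r by (intro divide_left_mono power_increasing) (auto simp: n1_def)
    then have n1: "r / 5 ^ n1 \<le> jet_radius" using n1' by linarith
    have lev1: "level r (Suc m) G" if "n1 \<le> m" for m using lev that by (simp add: n1_def)
    from corner_solution[OF _ n1 lev1, of a] r obtain N T where
      N: "has_jet G a N T" "(5/3) ^ n1 *\<^sub>R sym_part r G a n1 = - opr (r / 5 ^ n1) sym_product N"
      by auto
    have conv: "convergent_at (r / 5 ^ n1) sym_product" "convergent_at (r / 5 ^ n1) (inverse sym_product)"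
      using r n1 by (auto intro: convergent_at_mono[OF corner_products(9)] convergent_at_mono[OF corner_products(10)])
    have "opr (r / 5 ^ n1) sym_product N = 0" using N(2) sym0[of n1] by (simp add: n1_def)
    then have "opr (r / 5 ^ n1) (inverse sym_product * sym_product) N = 0"
      using opr_mult[OF conv(2,1), of N] opr_linear(4)[OF conv(2)] by simp
    moreover have "inverse sym_product * sym_product = 1" using corner_products(8) by (intro inverse_mult_eq_1) simp
    ultimately have "N = 0" using r opr_numeral(2)[of "r / 5 ^ n1" N] by simp
    then have "has_jet u a 0 (apply_bcontfun T 0)"
      using has_jet_bounded_linear[OF bounded_linear_component N(1), of 0] by (simp add: u_def[abs_def])
    then show ?thesis by (simp add: has_jet_real)
  qed
  have "u (vx w0 i0) \<noteq> 0" using Gw[OF nz(1), of i0] nz(2) by (simp add: u_def apply_c)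
  then have "\<exists>x\<in>SG q. u x \<noteq> 0" by (intro bexI[of _ "vx w0 i0"]) auto
  then show ?thesis
    unfolding neumann_eigenvalue_def has_laplacian_def using lap neu by (intro exI[of _ u]) (simp add: comp_def)
qed

text \<open>The eigenvalue \<open>3\<close> of the graph approximations: the corner values of every cell sum to zero, and every midpoint has minus
  half the value of the opposite corner.\<close>

lemma neumann_eigenvalue_3:
  fixes P :: "3 list \<Rightarrow> 3 \<Rightarrow> real"
  assumes r: "0 < r" "r / 5 ^ Suc n = rad3"
    and P: "\<And>v a b k. a \<noteq> b \<Longrightarrow> length v + Suc k = n \<Longrightarrow> P (v @ a # replicate k b) b = P (v @ b # replicate k a) a"
    and sum: "\<And>w i. P w i + P w (i + 1) + P w (i + 2) = 0" and bound: "\<And>w i. \<bar>P w i\<bar> \<le> 1"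
    and nz: "length w0 = n" "P w0 i0 \<noteq> 0"
  shows "neumann_eigenvalue q (3/2 * r)"
proof -
  define Q where "Q w j = cell_values (P (butlast w)) (\<lambda>i. - P (butlast w) i / 2) (last w) j" for w :: "3 list" and j
  have Q: "Q (w @ [d]) j = cell_values (P w) (\<lambda>i. - P w i / 2) d j" for w d j by (simp add: Q_def)
  have Qk: "Q (v @ a # replicate (Suc k) b) j = cell_values (P (v @ a # replicate k b)) (\<lambda>i. - P (v @ a # replicate k b) i / 2) b j"
    for v a b k j
    using Q[of "v @ a # replicate k b" b j] by (simp add: replicate_append_same)
  have edge: "b = a + 1 \<or> a = b + 1" if "a \<noteq> b" for a b :: 3 using letter_cases[of b a] that by auto
  show ?thesis
  proof (rule neumann_eigenvalue_from_graph[OF r(1), of "Suc n" Q])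
    show "r / 5 ^ Suc (Suc n) < rad2" using r(2) rad2(1) by simp
    fix v :: "3 list" and a b :: 3 and k assume ab: "a \<noteq> b" "length v + Suc k = Suc n"
    show "Q (v @ a # replicate k b) b = Q (v @ b # replicate k a) a"
    proof (cases k)
      case 0 then show ?thesis using ab(1) by (simp add: Q cell_values_commute)
    next
      case (Suc k')
      then show ?thesis using P[OF ab(1), of v k'] ab(2) by (simp only: Qk cell_values_letters)
    qed
    show "(4 - rfun (r / 5 ^ Suc n)) * Q (v @ a # replicate k b) b =
      (Q (v @ a # replicate k b) (b + 1) + Q (v @ a # replicate k b) (b + 2)) +
      (Q (v @ b # replicate k a) (a + 1) + Q (v @ b # replicate k a) (a + 2))"
    proof (cases k)
      case 0
      have main: "cell_values (P v) (\<lambda>i. - P v i / 2) c (c + 1) = cell_values (P v) (\<lambda>i. - P v i / 2) c (c + 2) + cell_values (P v) (\<lambda>i. - P v i / 2) c c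
        + (cell_values (P v) (\<lambda>i. - P v i / 2) (c + 1) (c + 1) + cell_values (P v) (\<lambda>i. - P v i / 2) (c + 1) (c + 2))" for c
        using sum[of v c] cell_values_letters(2)[of "P v" "\<lambda>i. - P v i / 2" "c + 1", unfolded letter_add]
        unfolding cell_values_letters by (simp add: field_simps)
      from edge[OF ab(1)] show ?thesis
      proof
        assume b: "b = a + 1"
        show ?thesis unfolding r(2) rad3(2) 0 using main[of a] by (simp add: Q b)
      next
        assume a: "a = b + 1"
        show ?thesis unfolding r(2) rad3(2) 0 using main[of b] cell_values_commute[of "b + 1" b "P v" "\<lambda>i. - P v i / 2"]
          by (simp add: Q a)
      qed
    next
      case (Suc k')
      have s: "P w (i + 1) + P w (i + 2) = - P w i" for w i using sum[of w i] by simp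
      have "P (v @ a # replicate k' b) b = P (v @ b # replicate k' a) a" using P[OF ab(1), of v k'] ab(2) Suc by simp
      then show ?thesis unfolding r(2) rad3(2) Suc Qk cell_values_letters
        using s[of "v @ a # replicate k' b" b] s[of "v @ b # replicate k' a" a] by (simp add: field_simps)
    qed
  next
    fix a
    show "Q (replicate (Suc n) a) (a + 1) + Q (replicate (Suc n) a) (a + 2) = (2 - rfun (r / 5 ^ Suc n) / 2) * Q (replicate (Suc n) a) a"
    proof -
      have "Q (replicate (Suc n) a) j = cell_values (P (replicate n a)) (\<lambda>i. - P (replicate n a) i / 2) a j" for j
        using Q[of "replicate n a" a j] by (simp add: replicate_append_same)
      then show ?thesis using sum[of "replicate n a" a] unfolding r(2) rad3(2) by (simp only: cell_values_letters) simp
    qed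
  next
    show "\<bar>Q w i\<bar> \<le> 1" for w i
    proof -
      have "\<bar>P (butlast w) j\<bar> \<le> 2" for j using bound[of "butlast w" j] by linarith
      then show ?thesis using bound by (simp add: Q_def cell_values_def)
    qed
    show "length (w0 @ [i0]) = Suc n" "Q (w0 @ [i0]) i0 \<noteq> 0" using nz by (simp_all add: Q cell_values_letters)
  qed
qed

lemma neumann_eigenvalues: "neumann_eigenvalue q (3/2 * (5 * rad3))" "neumann_eigenvalue q (3/2 * (25 * rad3))"
proof -
  fix a :: 3
  have perm: "letters a x y z i + letters a x y z (i + 1) + letters a x y z (i + 2) = x + y + z" for i and x y z :: real
    by (rule letter_induct[of _ a i]) (simp_all add: letters_simps)
  show "neumann_eigenvalue q (3/2 * (5 * rad3))"
    by (rule neumann_eigenvalue_3[of _ 0 "\<lambda>w. letters a 0 1 (-1)" "[]" "a + 1"])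
      (use rad3(1) perm[of 0 1 "-1"] in \<open>auto simp: letters_simps letters_def\<close>)
  \<comment> \<open>An antisymmetric pattern on two cells that is zero on the third: each cell has
    corner sum zero, and both cells have the value 1 at their common junction.\<close>
  define P where "P w = (if w = [a + 1] then letters a 0 (-1) 1 else if w = [a + 2] then letters a 0 1 (-1) else (\<lambda>_. 0 :: real))" for w
  have "P [c] d = P [d] c" for c d
    by (rule letter_induct[of _ a c]; rule letter_induct[of _ a d]) (simp_all add: P_def letters_def)
  show "neumann_eigenvalue q (3/2 * (25 * rad3))"
  proof (rule neumann_eigenvalue_3[of _ 1 P "[a + 1]" "a + 1"])
    show "P (v @ b # replicate k c) c = P (v @ c # replicate k b) b" if "length v + Suc k = 1" for v b c k
      using that \<open>\<And>c d. P [c] d = P [d] c\<close> by simp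
    show "P w i + P w (i + 1) + P w (i + 2) = 0" for w i
      using perm[of 0 "-1" 1 i] perm[of 0 1 "-1" i] by (simp add: P_def)
    show "\<bar>P w i\<bar> \<le> 1" for w i by (simp add: P_def letters_def)
  qed (use rad3(1) in \<open>auto simp: P_def letters_def\<close>)
qed

text \<open>Both eigenvalues come from the graph eigenvalue 3, the first with m = 3 at level one and
  the second at level two, hence the ratio 5. The factor 3/2 undoes the normalization of the
  Laplacian.\<close>

theorem lambda2_eq: "lambda2 q = 3/2 * (25 * rad3)"
proof -
  let ?S = "\<lambda>a. {b. neumann_eigenvalue q b \<and> b \<noteq> 0 \<and> b < a}"
  have S: "?S (3/2 * (25 * rad3)) = {3/2 * (5 * rad3)}"
  proof (intro equalityI subsetI)
    fix b assume "b \<in> ?S (3/2 * (25 * rad3))"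
    then have "neumann_eigenvalue q b" "b \<noteq> 0" "b < 3/2 * (25 * rad3)" unfolding mem_Collect_eq by blast+
    then show "b \<in> {3/2 * (5 * rad3)}" unfolding singleton_iff by (rule small_neumann_eigenvalue)
  next
    fix b assume "b \<in> {3/2 * (5 * rad3)}"
    then have b: "b = 3/2 * (5 * rad3)" unfolding singleton_iff .
    have "neumann_eigenvalue q b" unfolding b by (rule neumann_eigenvalues(1))
    moreover have "b \<noteq> 0" "b < 3/2 * (25 * rad3)" using b rad3(1) by linarith+
    ultimately show "b \<in> ?S (3/2 * (25 * rad3))" unfolding mem_Collect_eq by (intro conjI)
  qed
  show ?thesis
    unfolding lambda2_def
  proof (rule the_equality)
    show "neumann_eigenvalue q (3/2 * (25 * rad3)) \<and> 3/2 * (25 * rad3) \<noteq> 0 \<and> card (?S (3/2 * (25 * rad3))) = 1"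
      unfolding S using neumann_eigenvalues(2) rad3(1) by simp
    fix a assume a: "neumann_eigenvalue q a \<and> a \<noteq> 0 \<and> card (?S a) = 1"
    then have "card (?S a) = Suc 0" by (elim conjE) (simp only: One_nat_def)
    then have "\<exists>b. ?S a = {b}" by (simp only: card_1_singleton_iff)
    then obtain b where b: "?S a = {b}" ..
    have bS: "neumann_eigenvalue q b" "b \<noteq> 0" "b < a" using b[THEN eqset_imp_iff, of b] unfolding mem_Collect_eq by simp_all
    show "a = 3/2 * (25 * rad3)"
    proof (rule ccontr)
      assume "a \<noteq> 3/2 * (25 * rad3)"
      then consider "a < 3/2 * (25 * rad3)" | "3/2 * (25 * rad3) < a" by linarith
      then show False
      proof cases
        case 1
        then have "a = 3/2 * (5 * rad3)" using small_neumann_eigenvalue a by blast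
        moreover have "b = 3/2 * (5 * rad3)" by (rule small_neumann_eigenvalue[OF bS(1,2)]) (use bS(3) 1 in linarith)
        ultimately show False using bS(3) by simp
      next
        case 2
        have n: "3/2 * (25 * rad3) \<noteq> 0" "3/2 * (5 * rad3) \<noteq> 0" "3/2 * (5 * rad3) < a" using 2 rad3(1) by linarith+
        have "3/2 * (25 * rad3) \<in> ?S a"
          unfolding mem_Collect_eq by (rule conjI[OF neumann_eigenvalues(2) conjI[OF n(1) 2]])
        moreover have "3/2 * (5 * rad3) \<in> ?S a"
          unfolding mem_Collect_eq by (rule conjI[OF neumann_eigenvalues(1) conjI[OF n(2,3)]])
        ultimately have eq: "3/2 * (25 * rad3) = b" "3/2 * (5 * rad3) = b" unfolding b singleton_iff .
        show False using eq rad3(1) by linarith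
      qed
    qed
  qed
qed

end

section \<open>Towers and powers of the Laplacian\<close>

text \<open>A rate strictly above \<open>R\<close> is positive even if \<open>R = 0\<close>, so the
  finitely many terms outside the asymptotic bound can be absorbed into the constant.\<close>

lemma bigo_power_bound:
  fixes f :: "nat \<Rightarrow> real"
  assumes f: "f \<in> O(\<lambda>j. R ^ j)" and R: "0 \<le> R" "R < \<rho>"
  shows "\<exists>C\<ge>0. \<forall>j. \<bar>f j\<bar> \<le> C * \<rho> ^ j"
proof -
  from f obtain c where c: "0 < c" "eventually (\<lambda>j. norm (f j) \<le> c * norm (R ^ j)) sequentially"
    by (rule landau_o.bigE)
  from c(2) obtain N where N: "\<And>j. N \<le> j \<Longrightarrow> \<bar>f j\<bar> \<le> c * R ^ j"
    using R(1) by (auto simp: eventually_sequentially)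
  define B where "B = (\<Sum>i<N. \<bar>f i\<bar> / \<rho> ^ i)"
  have B0: "0 \<le> B" unfolding B_def using R by (intro sum_nonneg) auto
  have "\<bar>f j\<bar> \<le> (c + B) * \<rho> ^ j" for j
  proof (cases "N \<le> j")
    case True
    have "\<bar>f j\<bar> \<le> c * R ^ j" by (rule N[OF True])
    also have "\<dots> \<le> (c + B) * \<rho> ^ j" using c(1) B0 R by (intro mult_mono power_mono) auto
    finally show ?thesis .
  next
    case False
    have "\<bar>f j\<bar> / \<rho> ^ j \<le> B" unfolding B_def using False R by (intro member_le_sum) auto
    then have "\<bar>f j\<bar> / \<rho> ^ j \<le> c + B" using c(1) by linarith
    then show ?thesis using R by (simp add: pos_divide_le_eq)
  qed
  then show ?thesis using c(1) B0 by (intro exI[of _ "c + B"]) simp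
qed

section \<open>Uniqueness of the Laplacian and of its powers\<close>

context gasket
begin

lemma continuous_on_Fw: "continuous_on A (Fw q w)"
proof -
  have "dist (Fw q w y) (Fw q w x) \<le> dist y x" for x y
  proof -
    have "dist y x / 2 ^ length w \<le> dist y x / 1" by (intro divide_left_mono) auto
    then show ?thesis by (simp add: Fw_dist)
  qed
  then show ?thesis unfolding continuous_on_iff by (metis order_le_less_trans)
qed

lemma continuous_on_comp_Fw:
  assumes "continuous_on (SG q) f"
  shows "continuous_on (SG q) (\<lambda>x. f (Fw q w x))"
  using continuous_on_compose2[OF assms continuous_on_Fw] Fw_in_SG by blast

text \<open>The definition of the Laplacian constrains only vertices other than the three corners. A
  corner is the limit of such vertices, so continuity still determines the function there.\<close>

lemma zero_by_interior_density:
  assumes cont: "continuous_on (SG q) f" and z: "\<And>v a b k. a \<noteq> b \<Longrightarrow> f (vx (v @ a # replicate k b) b) = 0"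
    and x: "x \<in> SG q"
  shows "f x = (0::real)"
proof (rule zero_by_density[OF cont _ x])
  fix p assume "p \<in> vertices"
  then obtain w i where p: "p = vx w i" by (auto simp: vertices_def)
  show "f p = 0"
  proof (cases "w = replicate (length w) i")
    case True
    then have pq: "p = q i" by (metis p Fw_replicate vx_def)
    define y where "y n = vx (replicate n i @ [i]) (i + 1)" for n
    have "y n = vx (replicate n i @ (i + 1) # replicate 0 i) i" for n
      using vx_swap[of "replicate n i" i "i + 1"] by (simp add: y_def)
    then have fy: "f (y n) = 0" for n using z[of "i + 1" i "replicate n i" 0] by simp
    have d: "dist (y n) (q i) = dist (q (i + 1)) (q i) * (1/2) ^ Suc n" for n
    proof -
      have "q i = Fw q (replicate n i @ [i]) (q i)" using Fw_replicate[of "Suc n" i] by (simp add: replicate_append_same)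
      then have "dist (y n) (q i) = dist (Fw q (replicate n i @ [i]) (q (i + 1))) (Fw q (replicate n i @ [i]) (q i))"
        by (simp only: y_def vx_def)
      then show ?thesis unfolding Fw_dist by (simp add: power_divide)
    qed
    have t: "(\<lambda>n. dist (q (i + 1)) (q i) * (1/2) ^ Suc n) \<longlonglongrightarrow> dist (q (i + 1)) (q i) * 0"
      by (intro tendsto_mult tendsto_const LIMSEQ_Suc LIMSEQ_power_zero) simp
    have yl: "y \<longlonglongrightarrow> q i"
      by (rule tendsto_dist_iff[THEN iffD2]) (use t in \<open>simp only: d mult_zero_right\<close>)
    have "(\<lambda>n. f (y n)) \<longlonglongrightarrow> f (q i)"
      by (rule continuous_on_tendsto_compose[OF cont yl]) (simp_all add: y_def)
    then show ?thesis unfolding fy pq by (simp add: LIMSEQ_const_iff)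
  next
    case False
    then obtain v a k where "a \<noteq> i" "w = v @ a # replicate k i" using split_word[of w i] by metis
    then show ?thesis using z p by simp
  qed
qed

text \<open>An interior vertex occurs at all deeper levels, so the difference quotients there
  converge to both candidates.\<close>

lemma laplacian_SG_unique:
  assumes "has_laplacian_SG q u f" "has_laplacian_SG q u f'" "x \<in> SG q"
  shows "f x = f' x"
proof -
  have cont: "continuous_on (SG q) (\<lambda>x. f x - f' x)"
    using assms unfolding has_laplacian_SG_iff by (intro continuous_on_diff) simp_all
  have "f x - f' x = 0"
  proof (rule zero_by_interior_density[OF cont _ assms(3)])
    fix v :: "3 list" and a b :: 3 and k assume ab: "a \<noteq> b"
    let ?p = "vx (v @ a # replicate k b) b"
    have p: "vx (v @ a # replicate (k + m) b) b = ?p" for m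
      using vx_replicate[of "v @ a # replicate k b" m b] by (simp add: replicate_add)
    show "f ?p - f' ?p = 0"
    proof (rule ccontr)
      assume ne: "f ?p - f' ?p \<noteq> 0"
      define \<epsilon> where "\<epsilon> = \<bar>f ?p - f' ?p\<bar> / 2"
      have \<epsilon>: "0 < \<epsilon>" using ne by (simp add: \<epsilon>_def)
      obtain M where M: "\<And>v a b k. a \<noteq> b \<Longrightarrow> M \<le> length v + Suc k \<Longrightarrow>
          \<bar>- (3/2 * 5 ^ (length v + Suc k) * graph_lap u v a b k) - f (vx (v @ a # replicate k b) b)\<bar> < \<epsilon>"
        using assms(1) \<epsilon> unfolding has_laplacian_SG_iff by blast
      obtain M' where M': "\<And>v a b k. a \<noteq> b \<Longrightarrow> M' \<le> length v + Suc k \<Longrightarrow>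
          \<bar>- (3/2 * 5 ^ (length v + Suc k) * graph_lap u v a b k) - f' (vx (v @ a # replicate k b) b)\<bar> < \<epsilon>"
        using assms(2) \<epsilon> unfolding has_laplacian_SG_iff by blast
      have "\<bar>f ?p - f' ?p\<bar> < 2 * \<epsilon>"
        using M[OF ab, of v "k + (M + M')"] M'[OF ab, of v "k + (M + M')"] unfolding p by simp
      then show False by (simp add: \<epsilon>_def)
    qed
  qed
  then show ?thesis by simp
qed

lemma has_laplacian_Nil: "has_laplacian q [] u f \<longleftrightarrow> has_laplacian_SG q u f"
  by (simp add: has_laplacian_def comp_def)

lemma cell_Nil: "cell q [] = SG q"
  by (simp add: cell_def)

text \<open>The definite description is legitimate: a representative that is
  \<open>undefined\<close> outside the cell exists by restriction, and the values on the cell are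
  unique. From here on relations between functions replace the iterated operator.\<close>

lemma laplacian_eq:
  assumes "has_laplacian q w u f"
  shows "has_laplacian q w u (laplacian q w u)" "x \<in> cell q w \<Longrightarrow> laplacian q w u x = f x"
proof -
  define f0 where "f0 = restrict f (cell q w)"
  have in_cell: "Fw q w y \<in> cell q w" if "y \<in> SG q" for y using that by (simp add: cell_def)
  have f0: "f0 \<in> extensional (cell q w)" "has_laplacian q w u f0"
    using assms unfolding has_laplacian_def
    by (auto simp: f0_def in_cell intro: has_laplacian_SG_cong[THEN iffD1, rotated 2])
  have "laplacian q w u = f0"
    unfolding laplacian_def
  proof (rule the_equality)
    fix f' assume f': "f' \<in> extensional (cell q w) \<and> has_laplacian q w u f'"
    show "f' = f0"
    proof (rule extensionalityI)
      fix x assume "x \<in> cell q w"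
      then obtain y where y: "y \<in> SG q" "x = Fw q w y" by (auto simp: cell_def)
      have "f' (Fw q w y) / 5 ^ length w = f0 (Fw q w y) / 5 ^ length w"
        using laplacian_SG_unique[OF _ _ y(1)] f' f0(2) unfolding has_laplacian_def by blast
      then show "f' x = f0 x" by (simp add: y(2))
    qed (use f' f0 in auto)
  qed (use f0 in simp)
  then show "has_laplacian q w u (laplacian q w u)" "x \<in> cell q w \<Longrightarrow> laplacian q w u x = f x"
    using f0(2) by (simp_all add: f0_def)
qed

lemma laplacian_dom_step:
  assumes "u \<in> laplacian_dom q w n" "m < n"
  shows "has_laplacian q w (laplacian_pow q w m u) (laplacian_pow q w (Suc m) u)"
proof -
  obtain f where "has_laplacian q w (laplacian_pow q w m u) f" using assms unfolding laplacian_dom_def by blast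
  from laplacian_eq(1)[OF this] show ?thesis by simp
qed

lemma laplacian_pow_eq:
  assumes g: "\<And>i. has_laplacian_SG q (g i) (g (Suc i))" and v: "\<And>x. x \<in> SG q \<Longrightarrow> v x = g 0 x"
  shows "x \<in> SG q \<Longrightarrow> laplacian_pow q [] i v x = g i x" "v \<in> laplacian_dom q [] n"
proof -
  have 1: "has_laplacian q [] (laplacian_pow q [] i v) (g (Suc i))" if "\<And>x. x \<in> SG q \<Longrightarrow> laplacian_pow q [] i v x = g i x" for i
    unfolding has_laplacian_Nil using g[of i] has_laplacian_SG_cong[of "laplacian_pow q [] i v" "g i"] that by blast
  have 2: "\<forall>x\<in>SG q. laplacian_pow q [] i v x = g i x" for i
  proof (induction i)
    case 0 then show ?case using v by simp
  next
    case (Suc i)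
    then show ?case using laplacian_eq(2)[OF 1[of i]] by (simp add: cell_Nil)
  qed
  show "x \<in> SG q \<Longrightarrow> laplacian_pow q [] i v x = g i x" using 2 by blast
  show "v \<in> laplacian_dom q [] n" unfolding laplacian_dom_def using 1 2 by blast
qed

lemma bounded_on_SG:
  assumes "continuous_on (SG q) f"
  shows "\<exists>B\<ge>0. \<forall>x\<in>SG q. \<bar>f x :: real\<bar> \<le> B"
proof -
  have "bounded (f ` SG q)" using assms compact_SG by (intro compact_imp_bounded compact_continuous_image)
  then obtain B where "\<And>x. x \<in> SG q \<Longrightarrow> \<bar>f x\<bar> \<le> B" unfolding bounded_iff by auto
  then show ?thesis by (intro exI[of _ "max B 0"]) fastforce
qed

section \<open>Monomials\<close>

lemma level_zero_function: "0 \<le> r \<Longrightarrow> level r n (\<lambda>_. 0)"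
  by (auto simp: level_def residual_def graph_lap_def opposite_def opr_linear(4))

text \<open>The difference is a solution, so by \<open>corner_solution\<close> it has a jet in the
  supremum norm. Its components are the derivatives of real functions and vanish, so agreement
  component by component suffices for \<open>jet_unique\<close>. This is the form in which the jets
  of real functions are known.\<close>

lemma jet_determines:
  assumes r: "0 < r" "r / 25 < rad3"
    and G: "\<And>j. continuous_on (SG q) (\<lambda>x. apply_bcontfun (G x) j)" "\<And>n. 1 \<le> n \<Longrightarrow> level r n G"
    and H: "\<And>j. continuous_on (SG q) (\<lambda>x. apply_bcontfun (H x) j)" "\<And>n. 1 \<le> n \<Longrightarrow> level r n H"
    and val: "\<And>j. apply_bcontfun (G (q l)) j = apply_bcontfun (H (q l)) j"
    and jet: "\<And>j. \<exists>N T. has_jet (\<lambda>x. apply_bcontfun (G x) j) l N T \<and> has_jet (\<lambda>x. apply_bcontfun (H x) j) l N T"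
    and x: "x \<in> SG q"
  shows "G x = H x"
proof -
  define D where "D x = G x - H x" for x
  have lev: "level r n D" if "1 \<le> n" for n
    unfolding D_def using level_linear(2)[OF _ G(2) H(2)] r that by simp
  have D0: "D (q l) = 0" by (rule bcontfun_eqI) (simp add: D_def val)
  obtain n1' where n1': "r / 5 ^ n1' \<le> jet_radius" using exists_small_level by blast
  have lev1: "level r (Suc m) D" for m using lev by simp
  obtain N T where NT: "has_jet D l N T" using corner_solution[OF _ n1' lev1, of l] r by auto
  have "apply_bcontfun N j = 0 \<and> apply_bcontfun T j = 0" for j
  proof -
    obtain N' T' where J: "has_jet (\<lambda>x. apply_bcontfun (G x) j) l N' T'" "has_jet (\<lambda>x. apply_bcontfun (H x) j) l N' T'"
      using jet[of j] by blast
    have "has_jet (\<lambda>x. apply_bcontfun (D x) j) l 0 0" using has_jet_linear(2)[OF J] by (simp add: D_def)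
    then show ?thesis using has_jet_unique[OF has_jet_bounded_linear[OF bounded_linear_component NT]] by blast
  qed
  then have "N = 0" "T = 0" by (auto intro: bcontfun_eqI)
  then have "D p = 0" if "p \<in> vertices" for p
    using jet_unique[OF _ r(2) lev D0 _ that] NT r by simp
  then have "apply_bcontfun (G x) j - apply_bcontfun (H x) j = 0" for j
    by (intro zero_by_density[OF continuous_on_diff[OF G(1) H(1)] _ x]) (simp add: D_def)
  then show ?thesis by (intro bcontfun_eqI) simp
qed

section \<open>Solutions indexed by their jets\<close>

definition jet_solution :: "real \<Rightarrow> 3 \<Rightarrow> bseq \<Rightarrow> bseq \<Rightarrow> bseq \<Rightarrow> plane \<Rightarrow> bseq" where
  "jet_solution r l p N T = (SOME G. (\<forall>j. continuous_on (SG q) (\<lambda>x. apply_bcontfun (G x) j)) \<and> (\<forall>n\<ge>1. level r n G) \<and>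
    G (q l) = p \<and> has_jet G l N T)"

definition unit_seq :: "nat \<Rightarrow> bseq" where "unit_seq j = Bcontfun (\<lambda>i. of_bool (i = j))"

lemma apply_unit_seq [simp]: "apply_bcontfun (unit_seq j) i = of_bool (i = j)"
  unfolding unit_seq_def by (rule apply_Bcontfun[of _ 1]) simp

text \<open>The solution with the sequence \<open>s\<close> as its value, normal or tangential
  derivative for k = 1, 2, 3 and zero as the two other data. The monomials arise from unit
  sequences.\<close>

definition jet_family :: "real \<Rightarrow> 3 \<Rightarrow> nat \<Rightarrow> bseq \<Rightarrow> plane \<Rightarrow> bseq" where
  "jet_family r l k s = jet_solution r l (of_bool (k = 1) *\<^sub>R s) (of_bool (k = 2) *\<^sub>R s) (of_bool (k = 3) *\<^sub>R s)"

text \<open>In the supremum norm the expansion in unit sequences converges only for null sequences.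
  The geometric decay of the entries is what permits termwise application of a bounded
  operator.\<close>

lemma geometric_unit_sums:
  assumes "\<And>j. \<bar>apply_bcontfun s j\<bar> \<le> C * \<theta> ^ j" "0 \<le> C" "0 \<le> \<theta>" "\<theta> < 1"
  shows "(\<lambda>j. apply_bcontfun s j *\<^sub>R unit_seq j) sums s"
  unfolding sums_def
proof (rule LIM_zero_cancel, rule Lim_null_comparison)
  have ap: "apply_bcontfun (\<Sum>j<n. apply_bcontfun s j *\<^sub>R unit_seq j) i = (if i < n then apply_bcontfun s i else 0)" for n i
    by (induction n) (auto simp: less_Suc_eq)
  have "norm ((\<Sum>j<n. apply_bcontfun s j *\<^sub>R unit_seq j) - s) \<le> C * \<theta> ^ n" for n
  proof (rule norm_bseq_le)
    fix i
    show "\<bar>apply_bcontfun ((\<Sum>j<n. apply_bcontfun s j *\<^sub>R unit_seq j) - s) i\<bar> \<le> C * \<theta> ^ n"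
    proof (cases "i < n")
      case True then show ?thesis using assms by (simp add: ap)
    next
      case False
      have "\<bar>apply_bcontfun s i\<bar> \<le> C * \<theta> ^ i" by fact
      also have "\<dots> \<le> C * \<theta> ^ n" using False assms by (intro mult_left_mono power_decreasing) auto
      finally show ?thesis using False by (simp add: ap)
    qed
  qed
  then show "eventually (\<lambda>n. norm ((\<Sum>j<n. apply_bcontfun s j *\<^sub>R unit_seq j) - s) \<le> C * \<theta> ^ n) sequentially" by simp
  have "(\<lambda>n. C * \<theta> ^ n) \<longlonglongrightarrow> C * 0" using assms by (intro tendsto_mult tendsto_const LIMSEQ_power_zero) simp
  then show "(\<lambda>n. C * \<theta> ^ n) \<longlonglongrightarrow> 0" by simp
qed

context
  fixes r :: real and l :: 3
  assumes r: "0 < r" "r / 25 < rad3"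
begin

lemma jet_solution:
  shows "continuous_on (SG q) (\<lambda>x. apply_bcontfun (jet_solution r l p N T x) j)" "1 \<le> n \<Longrightarrow> level r n (jet_solution r l p N T)"
    "jet_solution r l p N T (q l) = p" "has_jet (jet_solution r l p N T) l N T"
proof -
  obtain C where C: "\<forall>p N T. \<exists>G. (\<forall>j. continuous_on (SG q) (\<lambda>x. apply_bcontfun (G x) j)) \<and> (\<forall>n\<ge>1. level r n G) \<and>
    G (q l) = p \<and> has_jet G l N T \<and> (\<forall>x\<in>SG q. norm (G x) \<le> C * (norm p + norm N + norm T))"
    using jet_exists[OF r, of l] by (elim exE conjE) (rule that)
  have "\<exists>G. (\<forall>j. continuous_on (SG q) (\<lambda>x. apply_bcontfun (G x) j)) \<and> (\<forall>n\<ge>1. level r n G) \<and> G (q l) = p \<and> has_jet G l N T"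
    using C[rule_format, of p N T] by (elim exE conjE) (rule exI, intro conjI)
  from someI_ex[OF this, folded jet_solution_def]
  show "continuous_on (SG q) (\<lambda>x. apply_bcontfun (jet_solution r l p N T x) j)" "1 \<le> n \<Longrightarrow> level r n (jet_solution r l p N T)"
    "jet_solution r l p N T (q l) = p" "has_jet (jet_solution r l p N T) l N T"
    by simp_all
qed

lemma jet_solution_eq:
  assumes G: "\<And>j. continuous_on (SG q) (\<lambda>x. apply_bcontfun (G x) j)" "\<And>n. 1 \<le> n \<Longrightarrow> level r n G"
    "G (q l) = p" "has_jet G l N T" and x: "x \<in> SG q"
  shows "jet_solution r l p N T x = G x"
proof (rule jet_determines[OF r jet_solution(1,2) G(1,2) _ _ x])
  show "apply_bcontfun (jet_solution r l p N T (q l)) j = apply_bcontfun (G (q l)) j" for j by (simp add: jet_solution(3) G(3))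
  show "\<exists>N' T'. has_jet (\<lambda>x. apply_bcontfun (jet_solution r l p N T x) j) l N' T' \<and> has_jet (\<lambda>x. apply_bcontfun (G x) j) l N' T'" for j
    using has_jet_bounded_linear[OF bounded_linear_component jet_solution(4)] has_jet_bounded_linear[OF bounded_linear_component G(4)] by blast
qed

lemma jet_solution_bound:
  "\<exists>C\<ge>0. \<forall>p N T. \<forall>x\<in>SG q. norm (jet_solution r l p N T x) \<le> C * (norm p + norm N + norm T)"
proof -
  obtain C where C0: "0 \<le> C" and C: "\<forall>p N T. \<exists>G. (\<forall>j. continuous_on (SG q) (\<lambda>x. apply_bcontfun (G x) j)) \<and> (\<forall>n\<ge>1. level r n G) \<and>
    G (q l) = p \<and> has_jet G l N T \<and> (\<forall>x\<in>SG q. norm (G x) \<le> C * (norm p + norm N + norm T))"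
    using jet_exists[OF r, of l] by (elim exE conjE) (rule that)
  have "norm (jet_solution r l p N T x) \<le> C * (norm p + norm N + norm T)" if x: "x \<in> SG q" for p N T x
  proof -
    from C[rule_format, of p N T] obtain G where G: "(\<forall>j. continuous_on (SG q) (\<lambda>x. apply_bcontfun (G x) j)) \<and> (\<forall>n\<ge>1. level r n G) \<and>
      G (q l) = p \<and> has_jet G l N T \<and> (\<forall>x\<in>SG q. norm (G x) \<le> C * (norm p + norm N + norm T))" ..
    have "jet_solution r l p N T x = G x" by (rule jet_solution_eq[OF _ _ _ _ x]) (use G in simp_all)
    then show ?thesis using G x by simp
  qed
  then show ?thesis using C0 by blast
qed

lemma jet_family:
  shows "continuous_on (SG q) (\<lambda>x. apply_bcontfun (jet_family r l k s x) j)" "1 \<le> n \<Longrightarrow> level r n (jet_family r l k s)"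
    "jet_family r l k s (q l) = of_bool (k = 1) *\<^sub>R s" "has_jet (jet_family r l k s) l (of_bool (k = 2) *\<^sub>R s) (of_bool (k = 3) *\<^sub>R s)"
  unfolding jet_family_def by (rule jet_solution; assumption)+

lemma jet_family_bound: "\<exists>C\<ge>0. \<forall>s. \<forall>x\<in>SG q. norm (jet_family r l k s x) \<le> C * norm s"
proof -
  obtain C where C0: "0 \<le> C" and C: "\<forall>p N T. \<forall>x\<in>SG q. norm (jet_solution r l p N T x) \<le> C * (norm p + norm N + norm T)"
    using jet_solution_bound by (elim exE conjE) (rule that)
  have "norm (jet_family r l k s x) \<le> C * norm s" if "x \<in> SG q" for s x
  proof -
    have "norm (jet_family r l k s x) \<le> C * (norm (of_bool (k = 1) *\<^sub>R s) + norm (of_bool (k = 2) *\<^sub>R s) + norm (of_bool (k = 3) *\<^sub>R s))"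
      unfolding jet_family_def using C that by blast
    also have "\<dots> \<le> C * norm s" using C0 by (intro mult_left_mono) (auto simp: of_bool_def)
    finally show ?thesis .
  qed
  then show ?thesis using C0 by blast
qed

text \<open>The solutions are chosen arbitrarily, but a jet determines its solution, so the choice
  is additive and homogeneous; the bound comes from the uniform constant of
  \<open>jet_exists\<close>.\<close>

lemma bounded_linear_jet_family:
  assumes x: "x \<in> SG q"
  shows "bounded_linear (\<lambda>s. jet_family r l k s x)"
proof -
  obtain C where C: "\<And>s. norm (jet_family r l k s x) \<le> C * norm s" using jet_family_bound[of k] x by blast
  have r0: "0 \<le> r" using r by simp
  show ?thesis
  proof (rule bounded_linear_intro[of _ C])
    fix s t
    show "jet_family r l k (s + t) x = jet_family r l k s x + jet_family r l k t x"
      unfolding jet_family_def[of r l k "s + t"]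
    proof (rule jet_solution_eq[OF _ _ _ _ x])
      show "continuous_on (SG q) (\<lambda>x. apply_bcontfun (jet_family r l k s x + jet_family r l k t x) j)" for j
        using continuous_on_add[OF jet_family(1) jet_family(1)] by simp
      show "level r n (\<lambda>x. jet_family r l k s x + jet_family r l k t x)" if "1 \<le> n" for n
        by (rule level_linear(1)[OF r0 jet_family(2) jet_family(2)]) (fact that)+
      show "jet_family r l k s (q l) + jet_family r l k t (q l) = of_bool (k = 1) *\<^sub>R (s + t)" by (simp add: jet_family(3) scaleR_add_right)
      show "has_jet (\<lambda>x. jet_family r l k s x + jet_family r l k t x) l (of_bool (k = 2) *\<^sub>R (s + t)) (of_bool (k = 3) *\<^sub>R (s + t))"
        using has_jet_linear(1)[OF jet_family(4) jet_family(4)] by (simp add: scaleR_add_right)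
    qed
    fix c :: real
    show "jet_family r l k (c *\<^sub>R s) x = c *\<^sub>R jet_family r l k s x"
      unfolding jet_family_def[of r l k "c *\<^sub>R s"]
    proof (rule jet_solution_eq[OF _ _ _ _ x])
      show "continuous_on (SG q) (\<lambda>x. apply_bcontfun (c *\<^sub>R jet_family r l k s x) j)" for j
        using continuous_on_mult_left[OF jet_family(1)] by simp
      show "level r n (\<lambda>x. c *\<^sub>R jet_family r l k s x)" if "1 \<le> n" for n
        by (rule level_linear(3)[OF r0 jet_family(2) jet_family(2)]) (fact that)+
      show "c *\<^sub>R jet_family r l k s (q l) = of_bool (k = 1) *\<^sub>R (c *\<^sub>R s)" by (simp add: jet_family(3) mult.commute)
      show "has_jet (\<lambda>x. c *\<^sub>R jet_family r l k s x) l (of_bool (k = 2) *\<^sub>R (c *\<^sub>R s)) (of_bool (k = 3) *\<^sub>R (c *\<^sub>R s))"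
        using has_jet_linear(3)[OF jet_family(4) jet_family(4), of c] by (simp add: mult.commute)
    qed
  qed (simp add: C mult.commute)
qed

lemma apply_funpow_shift: "apply_bcontfun ((shift ^^ n) s) i = apply_bcontfun s (i + n)"
  by (induction n arbitrary: i) simp_all

text \<open>Shifting j + 1 times again yields a solution, and it annihilates the unit sequence in
  the jet. Uniqueness makes the shifted solution zero, which says that the power j + 1 of the
  Laplacian vanishes.\<close>

lemma jet_family_component_zero:
  assumes x: "x \<in> SG q" and "j < i"
  shows "apply_bcontfun (jet_family r l k (unit_seq j) x) i = 0"
proof -
  define K where "K x = (shift ^^ Suc j) (jet_family r l k (unit_seq j) x)" for x
  have r0: "0 \<le> r" using r by simp
  have lev: "level r n (\<lambda>x. (shift ^^ m) (jet_family r l k (unit_seq j) x))" if "1 \<le> n" for n m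
  proof (induction m)
    case 0 then show ?case using jet_family(2) that by simp
  next
    case (Suc m) then show ?case using level_linear(4)[OF r0 Suc Suc] by simp
  qed
  have ap: "apply_bcontfun (K x) i = apply_bcontfun (jet_family r l k (unit_seq j) x) (i + Suc j)" for x i
    unfolding K_def by (rule apply_funpow_shift)
  have "K x = 0"
  proof (rule jet_determines[OF r _ _ _ _ _ _ x, of K "\<lambda>_. 0" l])
    show "continuous_on (SG q) (\<lambda>x. apply_bcontfun (K x) j')" for j' unfolding ap by (rule jet_family(1))
    show "level r n K" if "1 \<le> n" for n unfolding K_def by (rule lev[OF that])
    show "level r n (\<lambda>_. 0)" for n by (rule level_zero_function[OF r0])
    show "apply_bcontfun (K (q l)) j' = apply_bcontfun 0 j'" for j' unfolding ap by (simp add: jet_family(3))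
    show "\<exists>N T. has_jet (\<lambda>x. apply_bcontfun (K x) j') l N T \<and> has_jet (\<lambda>x. apply_bcontfun 0 j') l N T" for j'
    proof (intro exI conjI)
      show "has_jet (\<lambda>x. apply_bcontfun (K x) j') l 0 0"
        unfolding ap using has_jet_bounded_linear[OF bounded_linear_component[of "j' + Suc j"] jet_family(4)[of k "unit_seq j"]] by simp
      show "has_jet (\<lambda>x. apply_bcontfun 0 j') l 0 0"
        by (simp add: has_jet_def corner_sum_def corner_diff_def opposite_def)
    qed
  qed simp
  then have "apply_bcontfun (K x) (i - Suc j) = 0" by simp
  then show ?thesis unfolding ap using assms(2) by simp
qed


text \<open>The factor in \<open>h\<close> cancels the scaling by which \<open>fun_of\<close>
  recovers the power j, so the jet data are exactly those in the definition of the
  monomials.\<close>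

lemma jet_family_laplacians:
  fixes j k :: nat
  defines "h i x \<equiv> (- 2 / (3 * r)) ^ j * fun_of r (jet_family r l k (unit_seq j)) i x"
  shows "has_laplacian_SG q (h i) (h (Suc i))" "x \<in> SG q \<Longrightarrow> j < i \<Longrightarrow> h i x = 0"
    "h i (q l) = of_bool (i = j \<and> k = 1)" "has_jet (h i) l (of_bool (i = j \<and> k = 2)) (of_bool (i = j \<and> k = 3))"
proof -
  let ?S = "jet_family r l k (unit_seq j)"
  have inv: "(- 2 / (3 * r)) ^ j * (- 3 / 2 * r) ^ j = 1"
    unfolding power_mult_distrib[symmetric] using r by simp
  obtain C where C: "\<And>x. x \<in> SG q \<Longrightarrow> norm (?S x) \<le> C * norm (unit_seq j)" using jet_family_bound[of k] by blast
  have "tower (3/2 * r) (fun_of r ?S)" by (rule level_tower[OF r(1) jet_family(1) jet_family(2) C])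
  then have "has_laplacian_SG q (fun_of r ?S i) (fun_of r ?S (Suc i))" by (simp add: tower_def)
  from has_laplacian_SG_cmult[OF this] show "has_laplacian_SG q (h i) (h (Suc i))" unfolding h_def .
  show "h i x = 0" if "x \<in> SG q" "j < i" using jet_family_component_zero[OF that] by (simp add: h_def fun_of_def)
  show "h i (q l) = of_bool (i = j \<and> k = 1)" using inv by (auto simp: h_def fun_of_def jet_family(3))
  define c where "c = (- 2 / (3 * r)) ^ j * (- 3 / 2 * r) ^ i"
  have "h i = (\<lambda>x. c *\<^sub>R apply_bcontfun (?S x) i)" by (simp add: h_def fun_of_def c_def fun_eq_iff)
  moreover have "has_jet (\<lambda>x. c *\<^sub>R apply_bcontfun (?S x) i) l (c *\<^sub>R apply_bcontfun (of_bool (k = 2) *\<^sub>R unit_seq j) i) (c *\<^sub>R apply_bcontfun (of_bool (k = 3) *\<^sub>R unit_seq j) i)"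
  proof -
    have J: "has_jet (\<lambda>x. apply_bcontfun (?S x) i) l (apply_bcontfun (of_bool (k = 2) *\<^sub>R unit_seq j) i) (apply_bcontfun (of_bool (k = 3) *\<^sub>R unit_seq j) i)"
      by (rule has_jet_bounded_linear[OF bounded_linear_component jet_family(4)])
    show ?thesis by (rule has_jet_linear(3)[OF J J])
  qed
  moreover have "c *\<^sub>R apply_bcontfun (of_bool B *\<^sub>R unit_seq j) i = of_bool (i = j \<and> B)" for B
    using inv by (auto simp: c_def)
  ultimately show "has_jet (h i) l (of_bool (i = j \<and> k = 2)) (of_bool (i = j \<and> k = 3))" by simp
qed

section \<open>Identification of the monomials\<close>

definition monomial_data :: "nat \<Rightarrow> nat \<Rightarrow> (plane \<Rightarrow> real) \<Rightarrow> bool" where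
  "monomial_data j k P \<longleftrightarrow> P \<in> polyharmonic q j \<and> (\<forall>m\<le>j.
     laplacian_pow q [] m P (q l) = of_bool (m = j \<and> k = 1) \<and>
     has_normal_deriv q (laplacian_pow q [] m P) l (of_bool (m = j \<and> k = 2)) \<and>
     has_tangential_deriv q (laplacian_pow q [] m P) l (of_bool (m = j \<and> k = 3)))"

text \<open>Only finitely many powers of the Laplacian are nonzero, so they form a tower for the
  growth rate \<open>r\<close>. Its jet is a multiple of that of \<open>jet_family\<close>, and
  solutions with equal jets coincide.\<close>

lemma monomial_data_value:
  assumes P: "monomial_data j k P" and x: "x \<in> SG q"
  shows "P x = (- 2 / (3 * r)) ^ j * apply_bcontfun (jet_family r l k (unit_seq j) x) 0"
proof -
  let ?\<kappa> = "- 2 / (3 * r)"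
  define g where "g i = (if i \<le> j then laplacian_pow q [] i P else (\<lambda>_. 0))" for i
  have dom: "P \<in> laplacian_dom q [] (j + 1)" and ph: "\<And>x. x \<in> SG q \<Longrightarrow> laplacian_pow q [] (j + 1) P x = 0"
    using P by (auto simp: monomial_data_def polyharmonic_def)
  have step: "has_laplacian_SG q (laplacian_pow q [] i P) (laplacian_pow q [] (Suc i) P)" if "i \<le> j" for i
    using laplacian_dom_step[OF dom, of i] that unfolding has_laplacian_Nil by simp
  have lap: "has_laplacian_SG q (g i) (g (Suc i))" for i
  proof -
    consider "i < j" | "i = j" | "j < i" by linarith
    then show ?thesis
    proof cases
      case 1 then show ?thesis using step[of i] by (simp add: g_def del: funpow.simps)
    next
      case 2
      then have "has_laplacian_SG q (laplacian_pow q [] i P) (\<lambda>_. 0)"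
        using step[of i] has_laplacian_SG_cong[of "laplacian_pow q [] i P" "laplacian_pow q [] i P" "laplacian_pow q [] (Suc i) P" "\<lambda>_. 0"] ph
        by (simp del: funpow.simps)
      then show ?thesis using 2 by (simp add: g_def del: funpow.simps)
    next
      case 3 then show ?thesis
        using has_laplacian_SG_cmult[OF step[of j], of 0] by (simp add: g_def)
    qed
  qed
  have "\<forall>i. \<exists>B\<ge>0. \<forall>x\<in>SG q. \<bar>g i x\<bar> \<le> B" using lap bounded_on_SG unfolding has_laplacian_SG_def by blast
  then obtain B where B: "\<forall>i. 0 \<le> B i \<and> (\<forall>x\<in>SG q. \<bar>g i x\<bar> \<le> B i)" by (rule choice[THEN exE])
  define C where "C = (\<Sum>i\<le>j. B i / r ^ i)"
  have bound: "\<bar>g i x\<bar> \<le> C * r ^ i" if "x \<in> SG q" for i x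
  proof (cases "i \<le> j")
    case True
    have "B i / r ^ i \<le> C" unfolding C_def using True B r by (intro member_le_sum) auto
    then have "B i \<le> C * r ^ i" using r by (simp add: pos_divide_le_eq)
    then show ?thesis using B that by (meson order_trans)
  next
    case False
    have "0 \<le> C" unfolding C_def using B r by (intro sum_nonneg) auto
    then show ?thesis using False r by (simp add: g_def)
  qed
  have tow: "tower r g" unfolding tower_def using lap bound by blast
  have ap: "apply_bcontfun (seq_of r g y) i = ?\<kappa> ^ i * g i y" if "y \<in> SG q" for y i
  proof -
    have "apply_bcontfun (seq_of r g y) i = (-2/3) ^ i * g i y / r ^ i"
      by (rule apply_seq_of(1)[of r]) (use r bound[OF that] in simp_all)
    moreover have "?\<kappa> = (-2/3) / r" using r by (simp add: field_simps)
    ultimately show ?thesis by (simp only: power_divide) simp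
  qed
  have r0: "0 \<le> r" using r by simp
  have gj: "g i (q l) = of_bool (i = j \<and> k = 1)" "has_jet (g i) l (of_bool (i = j \<and> k = 2)) (of_bool (i = j \<and> k = 3))" for i
  proof -
    show "g i (q l) = of_bool (i = j \<and> k = 1)" using P by (auto simp: g_def monomial_data_def)
    show "has_jet (g i) l (of_bool (i = j \<and> k = 2)) (of_bool (i = j \<and> k = 3))"
    proof (cases "i \<le> j")
      case True then show ?thesis using P unfolding monomial_data_def has_jet_real by (simp add: g_def)
    next
      case False then show ?thesis
        by (auto simp: g_def has_jet_def corner_sum_def corner_diff_def opposite_def)
    qed
  qed
  have "seq_of r g x = ?\<kappa> ^ j *\<^sub>R jet_family r l k (unit_seq j) x"
  proof (rule jet_determines[OF r _ _ _ _ _ _ x, where l = l])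
    show "continuous_on (SG q) (\<lambda>x. apply_bcontfun (seq_of r g x) i)" for i
      using lap[of i] by (simp add: ap has_laplacian_SG_def continuous_on_mult_left cong: continuous_on_cong)
    show "level r n (seq_of r g)" if "1 \<le> n" for n
    proof (rule tower_level[OF tow r0])
      have "r / 5 ^ Suc n \<le> r / 5 ^ Suc 1" using r0 that by (intro divide_left_mono power_increasing) auto
      then show "r / 5 ^ Suc n < rad3" using r by simp
    qed (use r in simp)
    show "continuous_on (SG q) (\<lambda>x. apply_bcontfun (?\<kappa> ^ j *\<^sub>R jet_family r l k (unit_seq j) x) i)" for i
      using continuous_on_mult_left[OF jet_family(1)] by simp
    show "level r n (\<lambda>x. ?\<kappa> ^ j *\<^sub>R jet_family r l k (unit_seq j) x)" if "1 \<le> n" for n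
      by (rule level_linear(3)[OF r0 jet_family(2) jet_family(2)]) (fact that)+
    show "apply_bcontfun (seq_of r g (q l)) i = apply_bcontfun (?\<kappa> ^ j *\<^sub>R jet_family r l k (unit_seq j) (q l)) i" for i
      by (simp add: ap gj(1) jet_family(3))
    fix i
    have "has_jet (\<lambda>x. ?\<kappa> ^ i *\<^sub>R g i x) l (?\<kappa> ^ i *\<^sub>R of_bool (i = j \<and> k = 2)) (?\<kappa> ^ i *\<^sub>R of_bool (i = j \<and> k = 3))"
      by (rule has_jet_linear(3)[OF gj(2) gj(2)])
    moreover have "has_jet (\<lambda>x. apply_bcontfun (seq_of r g x) i) l N T \<longleftrightarrow> has_jet (\<lambda>x. ?\<kappa> ^ i *\<^sub>R g i x) l N T" for N T
      using vertices_SG by (intro has_jet_cong) (auto simp: ap)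
    ultimately have 1: "has_jet (\<lambda>x. apply_bcontfun (seq_of r g x) i) l (?\<kappa> ^ i *\<^sub>R of_bool (i = j \<and> k = 2)) (?\<kappa> ^ i *\<^sub>R of_bool (i = j \<and> k = 3))"
      by simp
    have "has_jet (\<lambda>x. ?\<kappa> ^ j *\<^sub>R jet_family r l k (unit_seq j) x) l (?\<kappa> ^ j *\<^sub>R (of_bool (k = 2) *\<^sub>R unit_seq j)) (?\<kappa> ^ j *\<^sub>R (of_bool (k = 3) *\<^sub>R unit_seq j))"
      by (rule has_jet_linear(3)[OF jet_family(4) jet_family(4)])
    from has_jet_bounded_linear[OF bounded_linear_component[of i] this]
    have 2: "has_jet (\<lambda>x. apply_bcontfun (?\<kappa> ^ j *\<^sub>R jet_family r l k (unit_seq j) x) i) l (?\<kappa> ^ i *\<^sub>R of_bool (i = j \<and> k = 2)) (?\<kappa> ^ i *\<^sub>R of_bool (i = j \<and> k = 3))"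
      by (cases "i = j") simp_all
    show "\<exists>N T. has_jet (\<lambda>x. apply_bcontfun (seq_of r g x) i) l N T \<and>
        has_jet (\<lambda>x. apply_bcontfun (?\<kappa> ^ j *\<^sub>R jet_family r l k (unit_seq j) x) i) l N T"
      using 1 2 by blast
  qed
  from this[THEN arg_cong[of _ _ apply_bcontfun], THEN fun_cong, of 0] show ?thesis
    using ap[OF x, of 0] by (simp add: g_def)
qed

text \<open>Together with the bounded operators \<open>jet_family\<close> this bounds the monomials
  by a multiple of (2 / (3 r))^j, uniformly on the gasket, for every r below the critical
  value.\<close>

lemma monomial_eq:
  assumes x: "x \<in> SG q"
  shows "monomial q l j k x = (- 2 / (3 * r)) ^ j * apply_bcontfun (jet_family r l k (unit_seq j) x) 0"
proof -
  define h where "h i x = (- 2 / (3 * r)) ^ j * fun_of r (jet_family r l k (unit_seq j)) i x" for i x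
  note h = jet_family_laplacians[where j = j and k = k, folded h_def]
  define v where "v = restrict (h 0) (SG q)"
  have v0: "v x = h 0 x" if "x \<in> SG q" for x using that by (simp add: v_def)
  have pow: "laplacian_pow q [] i v x = h i x" if "x \<in> SG q" for i x by (rule laplacian_pow_eq(1)[OF h(1) v0 that])
  have dom: "v \<in> laplacian_dom q [] n" for n by (rule laplacian_pow_eq(2)[OF h(1) v0])
  have data: "monomial_data j k v"
    unfolding monomial_data_def
  proof (intro conjI allI impI)
    show "v \<in> polyharmonic q j"
      unfolding polyharmonic_def using dom pow h(2)[of _ "j + 1"] by (auto simp: v_def simp del: funpow.simps)
    fix m assume "m \<le> j"
    show "laplacian_pow q [] m v (q l) = of_bool (m = j \<and> k = 1)" using pow[of "q l" m] h(3) by simp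
    have "has_jet (laplacian_pow q [] m v) l (of_bool (m = j \<and> k = 2)) (of_bool (m = j \<and> k = 3))"
      using has_jet_cong[of "laplacian_pow q [] m v" "h m"] pow h(4)[of m] vertices_SG by blast
    then show "has_normal_deriv q (laplacian_pow q [] m v) l (of_bool (m = j \<and> k = 2))"
      "has_tangential_deriv q (laplacian_pow q [] m v) l (of_bool (m = j \<and> k = 3))" unfolding has_jet_real by blast+
  qed
  have "monomial q l j k = v"
    unfolding monomial_def monomial_data_def[symmetric]
  proof (rule the_equality[where P = "monomial_data j k", OF data])
    fix P assume P: "monomial_data j k P"
    show "P = v"
    proof (rule extensionalityI)
      show "P \<in> extensional (SG q)" using P by (simp add: monomial_data_def polyharmonic_def)
      show "P x = v x" if "x \<in> SG q" for x using monomial_data_value[OF P that] monomial_data_value[OF data that] by simp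
    qed (simp add: v_def)
  qed
  then show ?thesis using monomial_data_value[OF data x] by simp
qed

text \<open>Coefficients of a rate below \<open>3/2 * r\<close> become a geometrically decaying
  sequence after scaling. The power series is then the bounded linear map \<open>jet_family\<close>
  applied to the expansion of this sequence in unit sequences.\<close>

lemma monomial_series:
  assumes c: "\<And>j. \<bar>c j\<bar> \<le> C * \<rho> ^ j" and \<rho>: "0 \<le> \<rho>" "2/3 * \<rho> < r" and x: "x \<in> SG q"
  defines "s \<equiv> Bcontfun (\<lambda>j. (- 2 / (3 * r)) ^ j * c j)"
  shows "(\<lambda>j. c j * monomial q l j k x) sums apply_bcontfun (jet_family r l k s x) 0"
    "apply_bcontfun s j = (- 2 / (3 * r)) ^ j * c j"
proof -
  define \<theta> where "\<theta> = 2/3 * \<rho> / r"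
  have \<theta>: "0 \<le> \<theta>" "\<theta> < 1" using \<rho> r by (auto simp: \<theta>_def)
  have C0: "0 \<le> C" using c[of 0] by simp
  have b: "\<bar>(- 2 / (3 * r)) ^ j * c j\<bar> \<le> C * \<theta> ^ j" for j
  proof -
    have "\<bar>(- 2 / (3 * r)) ^ j * c j\<bar> = (2 / (3 * r)) ^ j * \<bar>c j\<bar>" using r by (simp add: abs_mult power_abs)
    also have "\<dots> \<le> (2 / (3 * r)) ^ j * (C * \<rho> ^ j)" using r c by (intro mult_left_mono) auto
    also have "\<dots> = C * ((2 / (3 * r)) * \<rho>) ^ j" by (simp only: power_mult_distrib mult.left_commute)
    also have "(2 / (3 * r)) * \<rho> = \<theta>" by (simp add: \<theta>_def)
    finally show ?thesis .
  qed
  have "C * \<theta> ^ j \<le> C" for j using C0 \<theta> by (simp add: mult_left_le power_le_one)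
  then have "\<bar>(- 2 / (3 * r)) ^ j * c j\<bar> \<le> C" for j using b[of j] order_trans by blast
  then show ap: "apply_bcontfun s j = (- 2 / (3 * r)) ^ j * c j" for j unfolding s_def by (rule apply_Bcontfun)
  have "(\<lambda>j. apply_bcontfun s j *\<^sub>R unit_seq j) sums s"
    by (rule geometric_unit_sums[OF _ C0 \<theta>]) (use ap b in simp)
  then have "(\<lambda>j. apply_bcontfun (jet_family r l k (apply_bcontfun s j *\<^sub>R unit_seq j) x) 0) sums apply_bcontfun (jet_family r l k s x) 0"
    using bounded_linear.sums[OF bounded_linear_compose[OF bounded_linear_component bounded_linear_jet_family[OF x]]] by blast
  moreover have "apply_bcontfun (jet_family r l k (apply_bcontfun s j *\<^sub>R unit_seq j) x) 0 = c j * monomial q l j k x" for j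
    using linear_scale[OF bounded_linear.linear[OF bounded_linear_jet_family[OF x, of k]], of "apply_bcontfun s j" "unit_seq j"]
    by (simp add: ap monomial_eq[OF x])
  ultimately show "(\<lambda>j. c j * monomial q l j k x) sums apply_bcontfun (jet_family r l k s x) 0" by simp
qed

end


section \<open>Entire analytic functions\<close>

lemma seq_of_tower:
  assumes tow: "tower R g" and R: "0 \<le> R" "2/3 * R < r" and r: "r / 25 < rad3"
  shows "x \<in> SG q \<Longrightarrow> apply_bcontfun (seq_of r g x) i = (- 2 / (3 * r)) ^ i * g i x"
    "1 \<le> n \<Longrightarrow> level r n (seq_of r g)"
    "continuous_on (SG q) (\<lambda>x. apply_bcontfun (seq_of r g x) i)"
    "\<exists>B. \<forall>x\<in>SG q. norm (seq_of r g x) \<le> B"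
proof -
  have r0: "0 < r" using R by linarith
  obtain C where C: "\<And>j x. x \<in> SG q \<Longrightarrow> \<bar>g j x\<bar> \<le> C * R ^ j" using tow unfolding tower_def by blast
  have k: "- 2 / (3 * r) = (-2/3) / r" using r0 by (simp add: field_simps)
  show ap: "apply_bcontfun (seq_of r g x) i = (- 2 / (3 * r)) ^ i * g i x" if "x \<in> SG q" for x i
  proof -
    have "apply_bcontfun (seq_of r g x) i = (-2/3) ^ i * g i x / r ^ i"
      by (rule apply_seq_of(1)[of R]) (use R r0 C[OF that] in simp_all)
    then show ?thesis unfolding k power_divide by simp
  qed
  show "level r n (seq_of r g)" if "1 \<le> n"
  proof (rule tower_level[OF tow R])
    have "r / 5 ^ Suc n \<le> r / 5 ^ Suc 1" using r0 that by (intro divide_left_mono power_increasing) auto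
    then show "r / 5 ^ Suc n < rad3" using r by simp
  qed
  have "continuous_on (SG q) (g i)" using tow unfolding tower_def has_laplacian_SG_def by blast
  then have "continuous_on (SG q) (\<lambda>x. (- 2 / (3 * r)) ^ i * g i x)" by (rule continuous_on_mult_left)
  then show "continuous_on (SG q) (\<lambda>x. apply_bcontfun (seq_of r g x) i)"
    by (rule continuous_on_eq) (simp add: ap)
  have "norm (seq_of r g x) \<le> C" if "x \<in> SG q" for x
    by (rule apply_seq_of(2)[of R]) (use R r0 C[OF that] in simp_all)
  then show "\<exists>B. \<forall>x\<in>SG q. norm (seq_of r g x) \<le> B" by blast
qed

definition jet_sum :: "real \<Rightarrow> 3 \<Rightarrow> (nat \<Rightarrow> bseq) \<Rightarrow> plane \<Rightarrow> bseq" where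
  "jet_sum r l s x = jet_family r l 1 (s 1) x + jet_family r l 2 (s 2) x + jet_family r l 3 (s 3) x"

lemma jet_sum:
  assumes r: "0 < r" "r / 25 < rad3"
  shows "continuous_on (SG q) (\<lambda>x. apply_bcontfun (jet_sum r l s x) j)" "1 \<le> n \<Longrightarrow> level r n (jet_sum r l s)"
    "jet_sum r l s (q l) = s 1" "has_jet (jet_sum r l s) l (s 2) (s 3)"
    "\<exists>B. \<forall>x\<in>SG q. norm (jet_sum r l s x) \<le> B"
proof -
  note f = jet_family[OF r, where l = l]
  have js: "jet_sum r l s = (\<lambda>x. jet_family r l 1 (s 1) x + jet_family r l 2 (s 2) x + jet_family r l 3 (s 3) x)"
    by (simp add: jet_sum_def fun_eq_iff)
  show "continuous_on (SG q) (\<lambda>x. apply_bcontfun (jet_sum r l s x) j)"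
    unfolding js plus_bcontfun.rep_eq by (intro continuous_on_add f(1))
  show "level r n (jet_sum r l s)" if n: "1 \<le> n"
  proof -
    have r0: "0 \<le> r" using r by simp
    show ?thesis unfolding js by (rule level_linear(1)[OF r0 level_linear(1)[OF r0 f(2)[OF n] f(2)[OF n]] f(2)[OF n]])
  qed
  show "jet_sum r l s (q l) = s 1" by (simp add: jet_sum_def f(3))
  have "has_jet (jet_sum r l s) l (of_bool (1 = (2::nat)) *\<^sub>R s 1 + of_bool (2 = (2::nat)) *\<^sub>R s 2 + of_bool (3 = (2::nat)) *\<^sub>R s 3)
      (of_bool (1 = (3::nat)) *\<^sub>R s 1 + of_bool (2 = (3::nat)) *\<^sub>R s 2 + of_bool (3 = (3::nat)) *\<^sub>R s 3)"
    unfolding js by (rule has_jet_linear(1)[OF has_jet_linear(1)[OF f(4) f(4)] f(4)])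
  then show "has_jet (jet_sum r l s) l (s 2) (s 3)" by simp
  have b: "\<exists>B. \<forall>x\<in>SG q. norm (jet_family r l k t x) \<le> B" for k t using jet_family_bound[OF r] by blast
  obtain B1 where B1: "\<forall>x\<in>SG q. norm (jet_family r l 1 (s 1) x) \<le> B1" using b by blast
  obtain B2 where B2: "\<forall>x\<in>SG q. norm (jet_family r l 2 (s 2) x) \<le> B2" using b by blast
  obtain B3 where B3: "\<forall>x\<in>SG q. norm (jet_family r l 3 (s 3) x) \<le> B3" using b by blast
  have "norm (jet_sum r l s x) \<le> B1 + B2 + B3" if "x \<in> SG q" for x
    unfolding jet_sum_def by (intro norm_triangle_mono B1[rule_format, OF that] B2[rule_format, OF that] B3[rule_format, OF that])
  then show "\<exists>B. \<forall>x\<in>SG q. norm (jet_sum r l s x) \<le> B" by blast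
qed

lemma sum_three: "(\<Sum>k = 1..3. f k) = f 1 + f 2 + f (3::nat)" for f :: "nat \<Rightarrow> real"
  by (simp add: numeral_3_eq_3 numeral_2_eq_2)

text \<open>The coefficients are the derivatives of all powers of the Laplacian at the corner, where
  the jet exists as a pair of bounded sequences. The series with these coefficients is a solution
  with the same jet, hence the same function.\<close>

theorem tower_entire:
  assumes tow: "tower R g" and R: "0 \<le> R" "2/3 * R < 25 * rad3"
  shows "entire_analytic q (restrict (g 0) (SG q))"
proof -
  fix l :: 3
  \<comment> \<open>Two scales are needed: boundedness of the jet at \<open>r2\<close> bounds the
    coefficients by powers of \<open>3/2 * r2\<close>, and at the larger \<open>r3\<close> this
    bound becomes the strict decay that the series requires.\<close>
  define r2 where "r2 = (2/3 * R + 25 * rad3) / 2"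
  define r3 where "r3 = (r2 + 25 * rad3) / 2"
  have r2: "2/3 * R < r2" "0 < r2" "r2 / 25 < rad3" and r3: "2/3 * R < r3" "0 < r3" "r3 / 25 < rad3" "r2 < r3"
    using R rad3(1) r2_def r3_def by simp_all
  define \<kappa>2 where "\<kappa>2 = - 2 / (3 * r2)"
  define \<kappa>3 where "\<kappa>3 = - 2 / (3 * r3)"
  have k20: "\<kappa>2 \<noteq> 0" using r2 by (simp add: \<kappa>2_def)
  note G2 = seq_of_tower[OF tow R(1) r2(1,3), folded \<kappa>2_def]
  note G3 = seq_of_tower[OF tow R(1) r3(1,3), folded \<kappa>3_def]
  obtain n1 where n1: "r2 / 5 ^ n1 \<le> jet_radius" using exists_small_level by blast
  have lev1: "level r2 (Suc m) (seq_of r2 g)" for m using G2(2) by simp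
  obtain N T where NT: "has_jet (seq_of r2 g) l N T" using corner_solution[OF _ n1 lev1, of l] r2(2) by auto
  define c where "c j k = (if k = 1 then g j (q l) else if k = 2 then apply_bcontfun N j / \<kappa>2 ^ j else apply_bcontfun T j / \<kappa>2 ^ j)" for j and k :: nat
  have jet_g: "has_jet (g j) l (c j 2) (c j 3)" for j
  proof -
    have J: "has_jet (\<lambda>x. apply_bcontfun (seq_of r2 g x) j) l (apply_bcontfun N j) (apply_bcontfun T j)"
      by (rule has_jet_bounded_linear[OF bounded_linear_component NT])
    have "has_jet (\<lambda>x. (1 / \<kappa>2 ^ j) *\<^sub>R apply_bcontfun (seq_of r2 g x) j) l ((1 / \<kappa>2 ^ j) *\<^sub>R apply_bcontfun N j) ((1 / \<kappa>2 ^ j) *\<^sub>R apply_bcontfun T j)"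
      by (rule has_jet_linear(3)[OF J J])
    moreover have "(1 / \<kappa>2 ^ j) *\<^sub>R apply_bcontfun (seq_of r2 g x) j = g j x" if "x \<in> vertices" for x
      using G2(1)[of x j] that vertices_SG k20 by (simp add: subset_iff)
    ultimately have "has_jet (g j) l ((1 / \<kappa>2 ^ j) *\<^sub>R apply_bcontfun N j) ((1 / \<kappa>2 ^ j) *\<^sub>R apply_bcontfun T j)"
      using has_jet_cong[of "\<lambda>x. (1 / \<kappa>2 ^ j) *\<^sub>R apply_bcontfun (seq_of r2 g x) j" "g j" l] by simp
    then show ?thesis by (simp add: c_def)
  qed
  obtain C where C: "\<And>j x. x \<in> SG q \<Longrightarrow> \<bar>g j x\<bar> \<le> C * R ^ j" using tow unfolding tower_def by blast
  have C0: "0 \<le> C" using C[of "q l" 0] by simp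
  define K where "K = C + norm N + norm T"
  define \<rho> where "\<rho> = 3/2 * r2"
  have \<rho>: "0 \<le> \<rho>" "2/3 * \<rho> < r3" "R \<le> \<rho>" "\<rho> < lambda2 q" using r2 r3 \<rho>_def lambda2_eq by linarith+
  have cb: "\<bar>c j k\<bar> \<le> K * \<rho> ^ j" for j k
  proof -
    have s: "\<bar>apply_bcontfun t j / \<kappa>2 ^ j\<bar> \<le> norm t * \<rho> ^ j" for t :: bseq
    proof -
      have "\<bar>1 / \<kappa>2\<bar> = \<rho>" using r2 by (simp add: \<kappa>2_def \<rho>_def)
      then have "\<bar>1 / \<kappa>2 ^ j\<bar> = \<rho> ^ j" by (metis power_abs power_one_over)
      moreover have "\<bar>apply_bcontfun t j * (1 / \<kappa>2 ^ j)\<bar> = \<bar>apply_bcontfun t j\<bar> * \<bar>1 / \<kappa>2 ^ j\<bar>" by (rule abs_mult)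
      ultimately have "\<bar>apply_bcontfun t j / \<kappa>2 ^ j\<bar> = \<bar>apply_bcontfun t j\<bar> * \<rho> ^ j" by simp
      then show ?thesis using abs_bseq_le[of t j] \<rho>(1) by (simp add: mult_right_mono)
    qed
    have "C * R ^ j \<le> C * \<rho> ^ j" using C0 R \<rho> by (intro mult_left_mono power_mono) auto
    then have "\<bar>g j (q l)\<bar> \<le> C * \<rho> ^ j" using C[of "q l" j] by simp
    moreover have "C * \<rho> ^ j \<le> K * \<rho> ^ j" "norm N * \<rho> ^ j \<le> K * \<rho> ^ j" "norm T * \<rho> ^ j \<le> K * \<rho> ^ j"
      using C0 \<rho>(1) by (auto simp: K_def intro!: mult_right_mono)
    ultimately show ?thesis using s[of N] s[of T] unfolding c_def by (auto intro: order_trans)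
  qed
  define s where "s k = Bcontfun (\<lambda>j. \<kappa>3 ^ j * c j k)" for k
  have series: "(\<lambda>j. c j k * monomial q l j k x) sums apply_bcontfun (jet_family r3 l k (s k) x) 0" if "x \<in> SG q" for k x
    using monomial_series(1)[OF r3(2,3) cb \<rho>(1,2) that] unfolding s_def \<kappa>3_def .
  have aps: "apply_bcontfun (s k) j = \<kappa>3 ^ j * c j k" for k j
    using monomial_series(2)[OF r3(2,3) cb \<rho>(1,2), of "q l"] unfolding s_def \<kappa>3_def by simp
  have eq: "seq_of r3 g x = jet_sum r3 l s x" if x: "x \<in> SG q" for x
  proof (rule jet_determines[OF r3(2,3) G3(3,2) jet_sum(1,2)[OF r3(2,3)] _ _ x, where l = l])
    show "apply_bcontfun (seq_of r3 g (q l)) j = apply_bcontfun (jet_sum r3 l s (q l)) j" for j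
      by (simp add: G3(1) jet_sum(3)[OF r3(2,3)] aps c_def)
    fix j
    have "has_jet (\<lambda>x. \<kappa>3 ^ j *\<^sub>R g j x) l (\<kappa>3 ^ j *\<^sub>R c j 2) (\<kappa>3 ^ j *\<^sub>R c j 3)" by (rule has_jet_linear(3)[OF jet_g jet_g])
    moreover have "has_jet (\<lambda>x. apply_bcontfun (seq_of r3 g x) j) l N' T' \<longleftrightarrow> has_jet (\<lambda>x. \<kappa>3 ^ j *\<^sub>R g j x) l N' T'" for N' T'
      using vertices_SG by (intro has_jet_cong) (auto simp: G3(1))
    moreover have "has_jet (\<lambda>x. apply_bcontfun (jet_sum r3 l s x) j) l (apply_bcontfun (s 2) j) (apply_bcontfun (s 3) j)"
      by (rule has_jet_bounded_linear[OF bounded_linear_component jet_sum(4)[OF r3(2,3)]])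
    ultimately show "\<exists>N T. has_jet (\<lambda>x. apply_bcontfun (seq_of r3 g x) j) l N T \<and> has_jet (\<lambda>x. apply_bcontfun (jet_sum r3 l s x) j) l N T"
      by (intro exI[of _ "\<kappa>3 ^ j * c j 2"] exI[of _ "\<kappa>3 ^ j * c j 3"]) (simp add: aps)
  qed
  show ?thesis
    unfolding entire_analytic_def
  proof (intro conjI exI[of _ l] exI[of _ c] exI[of _ \<rho>] ballI)
    show "(\<lambda>j. c j k) \<in> O(\<lambda>j. \<rho> ^ j)" for k
      using cb \<rho>(1) by (intro bigoI[of _ K] always_eventually) simp
    fix x assume x: "x \<in> SG q"
    show "summable (\<lambda>j. c j k * monomial q l j k x)" for k using series[OF x] by (rule sums_summable)
    have "g 0 x = apply_bcontfun (seq_of r3 g x) 0" using G3(1)[OF x, of 0] by simp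
    also have "\<dots> = (\<Sum>k = 1..3. apply_bcontfun (jet_family r3 l k (s k) x) 0)" unfolding eq[OF x] sum_three by (simp add: jet_sum_def)
    also have "\<dots> = (\<Sum>k = 1..3. \<Sum>j. c j k * monomial q l j k x)" by (intro sum.cong refl sums_unique series[OF x])
    finally show "restrict (g 0) (SG q) x = (\<Sum>k = 1..3. \<Sum>j. c j k * monomial q l j k x)" using x by simp
  qed (use \<rho> in auto)
qed

text \<open>A whole interval of rates is offered, so that two entire functions with different growth
  can be represented at a common \<open>r\<close>, even if they are expanded about different
  corners.\<close>

theorem entire_level:
  assumes v: "entire_analytic q v"
  obtains r0 where "r0 < 25 * rad3" "\<And>r. r0 < r \<Longrightarrow> 0 < r \<Longrightarrow> r < 25 * rad3 \<Longrightarrow>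
    \<exists>H. (\<forall>j. continuous_on (SG q) (\<lambda>x. apply_bcontfun (H x) j)) \<and> (\<forall>n\<ge>1. level r n H) \<and> (\<exists>B. \<forall>x\<in>SG q. norm (H x) \<le> B) \<and>
      (\<forall>x\<in>SG q. v x = apply_bcontfun (H x) 0)"
proof -
  obtain l c R where E: "0 \<le> R \<and> R < lambda2 q \<and> (\<forall>k \<in> {1..3}. (\<lambda>j. c j k) \<in> O(\<lambda>j. R ^ j)) \<and>
        (\<forall>x \<in> SG q. (\<forall>k \<in> {1..3}. summable (\<lambda>j. c j k * monomial q l j k x)) \<and>
           v x = (\<Sum>k = 1..3. \<Sum>j. c j k * monomial q l j k x))"
    using v[unfolded entire_analytic_def, THEN conjunct2] by (elim exE) (rule that)
  have R: "0 \<le> R" "R < lambda2 q" using E by blast+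
  have O: "(\<lambda>j. c j k) \<in> O(\<lambda>j. R ^ j)" if "k \<in> {1..3}" for k using E that by blast
  have vx: "v x = (\<Sum>k = 1..3. \<Sum>j. c j k * monomial q l j k x)" if "x \<in> SG q" for x using E that by blast
  have L: "2/3 * R < 25 * rad3" using R(2) unfolding lambda2_eq by linarith
  show ?thesis
  proof (rule that[OF L])
    fix r assume r: "2/3 * R < r" "0 < r" "r < 25 * rad3"
    define \<rho> where "\<rho> = (R + 3/2 * r) / 2"
    have \<rho>: "0 \<le> \<rho>" "2/3 * \<rho> < r" "R < \<rho>" using R(1) r \<rho>_def by simp_all
    have r25: "r / 25 < rad3" using r by linarith
    define s where "s k = Bcontfun (\<lambda>j. (- 2 / (3 * r)) ^ j * c j k)" for k
    have series: "(\<lambda>j. c j k * monomial q l j k x) sums apply_bcontfun (jet_family r l k (s k) x) 0" if k: "k \<in> {1..3}" and x: "x \<in> SG q" for k x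
    proof -
      obtain C where "\<And>j. \<bar>c j k\<bar> \<le> C * \<rho> ^ j" using bigo_power_bound[OF O[OF k] R(1) \<rho>(3)] by blast
      from monomial_series(1)[OF r(2) r25 this \<rho>(1,2) x] show ?thesis unfolding s_def .
    qed
    note H = jet_sum[OF r(2) r25, where l = l and s = s]
    have "v x = apply_bcontfun (jet_sum r l s x) 0" if x: "x \<in> SG q" for x
    proof -
      have "v x = (\<Sum>k = 1..3. \<Sum>j. c j k * monomial q l j k x)" by (rule vx[OF x])
      also have "\<dots> = (\<Sum>k = 1..3. apply_bcontfun (jet_family r l k (s k) x) 0)"
        by (intro sum.cong refl sums_unique[symmetric] series x)
      finally show ?thesis unfolding sum_three by (simp add: jet_sum_def)
    qed
    then show "\<exists>H. (\<forall>j. continuous_on (SG q) (\<lambda>x. apply_bcontfun (H x) j)) \<and> (\<forall>n\<ge>1. level r n H) \<and> (\<exists>B. \<forall>x\<in>SG q. norm (H x) \<le> B) \<and>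
      (\<forall>x\<in>SG q. v x = apply_bcontfun (H x) 0)"
      using H(1,2,5) by (intro exI[of _ "jet_sum r l s"] conjI allI impI ballI)
  qed
qed

section \<open>Extension from an arbitrary cell, and uniqueness\<close>

lemma Fw_vertices:
  assumes "p \<in> vertices"
  shows "Fw q w p \<in> vertices"
proof -
  obtain v i where "p = vx v i" using assms by (auto simp: vertices_def)
  then show ?thesis using vx_in_vertices[of "w @ v" i] by (simp add: vx_append)
qed

lemma level_first_letter: "level r (Suc n) G \<Longrightarrow> level (r / 5) n (\<lambda>x. G (F q a x))"
  using level_restrict[of r "[a]" n G] by (simp add: comp_def)

text \<open>The induction hypothesis, used with r / 5, fills the subcell of the first letter; one
  extension then covers the gasket. The parameters of smaller cells are smaller, so the bound on
  \<open>r\<close> suffices at every step.\<close>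

lemma extend_from_cell:
  assumes "0 < r" "r / 25 < rad3" "\<forall>j. continuous_on (SG q) (\<lambda>x. apply_bcontfun (G' x) j)"
    "\<forall>n\<ge>1. level (r / 5 ^ length w) n G'" "\<forall>x\<in>SG q. norm (G' x) \<le> M"
  shows "\<exists>G. (\<forall>j. continuous_on (SG q) (\<lambda>x. apply_bcontfun (G x) j)) \<and> (\<forall>n\<ge>1. level r n G) \<and>
    (\<exists>B. \<forall>x\<in>SG q. norm (G x) \<le> B) \<and> (\<forall>p\<in>vertices. G (Fw q w p) = G' p)"
  using assms
proof (induction w arbitrary: r)
  case Nil
  have "\<forall>n\<ge>1. level r n G'" using Nil.prems(4) by simp
  then show ?case using Nil.prems(3,5) by (intro exI[of _ G'] conjI) (assumption | rule exI | simp)+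
next
  case (Cons a w)
  have r5: "0 < r / 5" "r / 5 / 25 < rad3" "\<forall>n\<ge>1. level (r / 5 / 5 ^ length w) n G'" using Cons.prems by auto
  from Cons.IH[OF r5(1,2) Cons.prems(3) r5(3) Cons.prems(5)]
  obtain G1 where G1: "(\<forall>j. continuous_on (SG q) (\<lambda>x. apply_bcontfun (G1 x) j)) \<and> (\<forall>n\<ge>1. level (r / 5) n G1) \<and>
    (\<exists>B. \<forall>x\<in>SG q. norm (G1 x) \<le> B) \<and> (\<forall>p\<in>vertices. G1 (Fw q w p) = G' p)" ..
  then obtain B1 where B1: "\<forall>x\<in>SG q. norm (G1 x) \<le> B1" by (elim conjE exE) (rule that)
  have l1: "level (r / 5) 1 G1" and l2: "1 \<le> n \<Longrightarrow> level (r / 5) n G1" for n using G1 by auto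
  from extend_from_subcell[OF Cons.prems(1,2), of a]
  obtain C where C: "0 \<le> C \<and> (\<forall>G' M. level (r / 5) 1 G' \<longrightarrow> (\<forall>p\<in>vertices. norm (G' p) \<le> M) \<longrightarrow>
    (\<exists>G. (\<forall>j. continuous_on (SG q) (\<lambda>x. apply_bcontfun (G x) j)) \<and> (\<forall>n\<ge>1. level r n G) \<and>
      (\<forall>w i. length w = 1 \<longrightarrow> G (F q a (vx w i)) = G' (vx w i)) \<and> (\<forall>x\<in>SG q. norm (G x) \<le> C * M)))" ..
  have "\<forall>p\<in>vertices. norm (G1 p) \<le> B1" using B1 vertices_SG by (simp add: subset_iff)
  from C[THEN conjunct2, rule_format, OF l1 this[THEN bspec]]
  obtain G where G: "(\<forall>j. continuous_on (SG q) (\<lambda>x. apply_bcontfun (G x) j)) \<and> (\<forall>n\<ge>1. level r n G) \<and>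
      (\<forall>w i. length w = 1 \<longrightarrow> G (F q a (vx w i)) = G1 (vx w i)) \<and> (\<forall>x\<in>SG q. norm (G x) \<le> C * B1)" ..
  have "G (F q a p) - G1 p = 0" if p: "p \<in> vertices" for p
  proof (rule level_zero[OF _ _ _ _ p, of "r / 5" 1])
    show "0 \<le> r / 5" "r / 5 / 5 ^ Suc 1 < rad2" using Cons.prems(1,2) rad2(1) by simp_all
    show "level (r / 5) n (\<lambda>x. G (F q a x) - G1 x)" if "1 < n" for n
      using level_linear(2)[OF _ level_first_letter[of r n G a] l2[of n]] G Cons.prems(1) that by simp
    show "G (F q a (vx w i)) - G1 (vx w i) = 0" if "length w = 1" for w i using G that by simp
  qed
  then have "\<forall>p\<in>vertices. G (Fw q (a # w) p) = G' p" using G1 Fw_vertices by simp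
  then show ?case using G by (intro exI[of _ G] conjI) (elim conjE, (assumption | rule exI)+)+
qed

lemma zero_from_cell:
  assumes "0 \<le> r" "r / 25 < rad3" "\<forall>n\<ge>1. level r n D" "\<forall>p\<in>vertices. D (Fw q w p) = 0"
  shows "\<forall>p\<in>vertices. D p = 0"
  using assms
proof (induction w arbitrary: r D)
  case Nil then show ?case by simp
next
  case (Cons a w)
  have "\<forall>n\<ge>1. level (r / 5) n (\<lambda>x. D (F q a x))" using Cons.prems(3) level_first_letter by simp
  then have "\<forall>p\<in>vertices. D (F q a p) = 0"
    using Cons.IH[of "r / 5" "\<lambda>x. D (F q a x)"] Cons.prems by simp
  then show ?case using zero_propagates[OF Cons.prems(1,2), of D a] Cons.prems(3) by simp
qed

text \<open>Component 0 is the function and determines the other components as its iterated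
  Laplacians, so uniqueness of the Laplacian makes all of them zero.\<close>

lemma solution_zero:
  assumes r: "0 < r" and cont: "\<And>j. continuous_on (SG q) (\<lambda>x. apply_bcontfun (D x) j)" and lev: "\<And>n. 1 \<le> n \<Longrightarrow> level r n D"
    and B: "\<And>x. x \<in> SG q \<Longrightarrow> norm (D x) \<le> B" and z: "\<And>x. x \<in> SG q \<Longrightarrow> apply_bcontfun (D x) 0 = 0" and x: "x \<in> SG q"
  shows "D x = 0"
proof -
  have "tower (3/2 * r) (fun_of r D)" by (rule level_tower[OF r cont lev B])
  then have lap: "has_laplacian_SG q (fun_of r D j) (fun_of r D (Suc j))" for j by (simp add: tower_def)
  have zero: "has_laplacian_SG q (\<lambda>_. 0) (\<lambda>_. 0)" using has_laplacian_SG_cmult[OF lap[of 0], of 0] by simp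
  have "\<forall>x\<in>SG q. fun_of r D j x = 0" for j
  proof (induction j)
    case 0 then show ?case by (simp add: fun_of_def z)
  next
    case (Suc j)
    then have "has_laplacian_SG q (\<lambda>_. 0) (fun_of r D (Suc j))"
      using lap[of j] has_laplacian_SG_cong[of "fun_of r D j" "\<lambda>_. 0" "fun_of r D (Suc j)" "fun_of r D (Suc j)"] by simp
    then show ?case using laplacian_SG_unique[OF _ zero] by blast
  qed
  then show ?thesis using x r by (intro bcontfun_eqI) (simp add: fun_of_def)
qed

text \<open>At a common rate both functions are components of solutions. Their difference is zero in
  component 0 on the cell, hence in all components there, and then on the gasket by repeated
  propagation along the letters of \<open>w\<close>.\<close>

theorem entire_unique:
  assumes v: "entire_analytic q v" "entire_analytic q v'" and eq: "\<And>x. x \<in> cell q w \<Longrightarrow> v x = v' x"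
  shows "v = v'"
proof -
  obtain r1 where r1: "r1 < 25 * rad3" and H1: "\<And>r. r1 < r \<Longrightarrow> 0 < r \<Longrightarrow> r < 25 * rad3 \<Longrightarrow>
    \<exists>H. (\<forall>j. continuous_on (SG q) (\<lambda>x. apply_bcontfun (H x) j)) \<and> (\<forall>n\<ge>1. level r n H) \<and> (\<exists>B. \<forall>x\<in>SG q. norm (H x) \<le> B) \<and>
      (\<forall>x\<in>SG q. v x = apply_bcontfun (H x) 0)" by (rule entire_level[OF v(1)]) (rule that; assumption)
  obtain r2 where r2: "r2 < 25 * rad3" and H2: "\<And>r. r2 < r \<Longrightarrow> 0 < r \<Longrightarrow> r < 25 * rad3 \<Longrightarrow>
    \<exists>H. (\<forall>j. continuous_on (SG q) (\<lambda>x. apply_bcontfun (H x) j)) \<and> (\<forall>n\<ge>1. level r n H) \<and> (\<exists>B. \<forall>x\<in>SG q. norm (H x) \<le> B) \<and>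
      (\<forall>x\<in>SG q. v' x = apply_bcontfun (H x) 0)" by (rule entire_level[OF v(2)]) (rule that; assumption)
  define r where "r = (max 0 (max r1 r2) + 25 * rad3) / 2"
  have r: "r1 < r" "r2 < r" "0 < r" "r < 25 * rad3" "r / 25 < rad3" using r1 r2 rad3(1) r_def by simp_all
  obtain H where H: "(\<forall>j. continuous_on (SG q) (\<lambda>x. apply_bcontfun (H x) j)) \<and> (\<forall>n\<ge>1. level r n H) \<and> (\<exists>B. \<forall>x\<in>SG q. norm (H x) \<le> B) \<and>
      (\<forall>x\<in>SG q. v x = apply_bcontfun (H x) 0)" using H1[OF r(1,3,4)] ..
  obtain H' where H': "(\<forall>j. continuous_on (SG q) (\<lambda>x. apply_bcontfun (H' x) j)) \<and> (\<forall>n\<ge>1. level r n H') \<and> (\<exists>B. \<forall>x\<in>SG q. norm (H' x) \<le> B) \<and>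
      (\<forall>x\<in>SG q. v' x = apply_bcontfun (H' x) 0)" using H2[OF r(2,3,4)] ..
  obtain B where B: "\<forall>x\<in>SG q. norm (H x) \<le> B" using H by (elim conjE exE) (rule that)
  obtain B' where B': "\<forall>x\<in>SG q. norm (H' x) \<le> B'" using H' by (elim conjE exE) (rule that)
  have Hc: "continuous_on (SG q) (\<lambda>x. apply_bcontfun (H x) j)" for j using H by (elim conjE allE)
  have Hc': "continuous_on (SG q) (\<lambda>x. apply_bcontfun (H' x) j)" for j using H' by (elim conjE allE)
  have Hl: "1 \<le> n \<Longrightarrow> level r n H" "1 \<le> n \<Longrightarrow> level r n H'" for n using H H' by auto
  define D where "D x = H x - H' x" for x
  have r0: "0 \<le> r" using r by simp
  have lev: "level r n D" if "1 \<le> n" for n unfolding D_def by (rule level_linear(2)[OF r0 Hl(1)[OF that] Hl(2)[OF that]])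
  have cont: "continuous_on (SG q) (\<lambda>x. apply_bcontfun (D x) j)" for j
    unfolding D_def minus_bcontfun.rep_eq by (intro continuous_on_diff Hc Hc')
  have bound: "norm (D x) \<le> B + B'" if "x \<in> SG q" for x
    unfolding D_def by (rule order_trans[OF norm_triangle_ineq4]) (use B B' that in \<open>simp add: add_mono\<close>)
  have D0: "apply_bcontfun (D x) 0 = v x - v' x" if "x \<in> SG q" for x using H H' that by (simp add: D_def)
  have sub: "D (Fw q w p) = 0" if p: "p \<in> vertices" for p
  proof (rule solution_zero[of "r / 5 ^ length w" "\<lambda>x. D (Fw q w x)" "B + B'" p])
    show "0 < r / 5 ^ length w" using r by simp
    show "continuous_on (SG q) (\<lambda>x. apply_bcontfun (D (Fw q w x)) j)" for j by (rule continuous_on_comp_Fw[OF cont])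
    show "level (r / 5 ^ length w) n (\<lambda>x. D (Fw q w x))" if "1 \<le> n" for n
      using level_restrict[of r w n D] lev[of "length w + n"] that by (simp add: comp_def)
    fix x assume x: "x \<in> SG q"
    show "norm (D (Fw q w x)) \<le> B + B'" by (rule bound[OF Fw_in_SG[OF x]])
    show "apply_bcontfun (D (Fw q w x)) 0 = 0" using D0[OF Fw_in_SG[OF x]] eq[of "Fw q w x"] x by (simp add: cell_def)
  qed (use p vertices_SG in auto)
  have "\<forall>p\<in>vertices. D p = 0" by (rule zero_from_cell[OF r0 r(5)]) (use lev sub in auto)
  then have "apply_bcontfun (D x) 0 = 0" if "x \<in> SG q" for x using zero_by_density[OF cont _ that] by simp
  then have "v x = v' x" if "x \<in> SG q" for x using D0 that by simp
  moreover have "v \<in> extensional (SG q)" "v' \<in> extensional (SG q)" using v by (auto simp: entire_analytic_def)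
  ultimately show ?thesis by (intro extensionalityI) auto
qed

text \<open>Pulling back to the gasket divides each power of the Laplacian by 5^|w|, so the growth
  rate of the tower is divided by this factor as well. It matches the division of the parameter
  under restriction to the cell.\<close>

lemma cell_tower:
  assumes dom: "\<And>j. u \<in> laplacian_dom q w j" and R: "0 \<le> R" "R < \<rho>"
    and O: "(\<lambda>j. SUP x \<in> cell q w. \<bar>laplacian_pow q w j u x\<bar>) \<in> O(\<lambda>j. R ^ j)"
  shows "tower (\<rho> / 5 ^ length w) (\<lambda>j y. laplacian_pow q w j u (Fw q w y) / 5 ^ (j * length w))"
proof -
  have lap: "has_laplacian_SG q (\<lambda>y. laplacian_pow q w j u (Fw q w y)) (\<lambda>y. laplacian_pow q w (Suc j) u (Fw q w y) / 5 ^ length w)" for j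
    using laplacian_dom_step[OF dom[of "Suc j"], of j] unfolding has_laplacian_def comp_def by simp
  obtain C where C: "0 \<le> C \<and> (\<forall>j. \<bar>SUP x \<in> cell q w. \<bar>laplacian_pow q w j u x\<bar>\<bar> \<le> C * \<rho> ^ j)"
    using bigo_power_bound[OF O R] ..
  have b: "\<bar>laplacian_pow q w j u (Fw q w y)\<bar> \<le> C * \<rho> ^ j" if y: "y \<in> SG q" for j y
  proof -
    have "continuous_on (SG q) (\<lambda>y. laplacian_pow q w j u (Fw q w y))" using lap[of j] by (simp add: has_laplacian_SG_def)
    then obtain B where B: "0 \<le> B \<and> (\<forall>y\<in>SG q. \<bar>laplacian_pow q w j u (Fw q w y)\<bar> \<le> B)" using bounded_on_SG by blast
    \<comment> \<open>The supremum of an unbounded set of reals would dominate nothing, so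
      boundedness, by continuity on a compact cell, comes before its use as a bound.\<close>
    have "bdd_above ((\<lambda>x. \<bar>laplacian_pow q w j u x\<bar>) ` cell q w)"
      by (rule bdd_aboveI[of _ B]) (use B in \<open>auto simp: cell_def\<close>)
    then have "\<bar>laplacian_pow q w j u (Fw q w y)\<bar> \<le> (SUP x \<in> cell q w. \<bar>laplacian_pow q w j u x\<bar>)"
      using y by (intro cSUP_upper) (auto simp: cell_def)
    also have "\<dots> \<le> C * \<rho> ^ j" using C[THEN conjunct2, rule_format, of j] by (rule order_trans[OF abs_ge_self])
    finally show ?thesis .
  qed
  show ?thesis
    unfolding tower_def
  proof (intro conjI allI exI[of _ C] ballI)
    fix j
    have "has_laplacian_SG q (\<lambda>y. 1 / 5 ^ (j * length w) * laplacian_pow q w j u (Fw q w y))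
        (\<lambda>y. 1 / 5 ^ (j * length w) * (laplacian_pow q w (Suc j) u (Fw q w y) / 5 ^ length w))"
      by (rule has_laplacian_SG_cmult[OF lap])
    moreover have "(\<lambda>y. 1 / 5 ^ (j * length w) * (laplacian_pow q w (Suc j) u (Fw q w y) / 5 ^ length w))
        = (\<lambda>y. laplacian_pow q w (Suc j) u (Fw q w y) / 5 ^ (Suc j * length w))"
      by (simp add: power_add mult.commute)
    moreover have "(\<lambda>y. 1 / 5 ^ (j * length w) * laplacian_pow q w j u (Fw q w y)) = (\<lambda>y. laplacian_pow q w j u (Fw q w y) / 5 ^ (j * length w))"
      by simp
    ultimately show "has_laplacian_SG q (\<lambda>y. laplacian_pow q w j u (Fw q w y) / 5 ^ (j * length w))
        (\<lambda>y. laplacian_pow q w (Suc j) u (Fw q w y) / 5 ^ (Suc j * length w))" by (simp only:)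
    fix y assume y: "y \<in> SG q"
    have "\<bar>laplacian_pow q w j u (Fw q w y) / 5 ^ (j * length w)\<bar> \<le> C * \<rho> ^ j / 5 ^ (j * length w)"
      unfolding abs_divide using b[OF y, of j] by (simp add: divide_right_mono)
    also have "\<dots> = C * (\<rho> / 5 ^ length w) ^ j" by (simp add: power_divide power_mult[symmetric] mult.commute)
    finally show "\<bar>laplacian_pow q w j u (Fw q w y) / 5 ^ (j * length w)\<bar> \<le> C * (\<rho> / 5 ^ length w) ^ j" .
  qed
qed

theorem entire_extension_exists:
  assumes dom: "\<And>j. u \<in> laplacian_dom q w j" and R: "0 \<le> R" "R < lambda2 q"
    and O: "(\<lambda>j. SUP x \<in> cell q w. \<bar>laplacian_pow q w j u x\<bar>) \<in> O(\<lambda>j. R ^ j)"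
  shows "\<exists>v. entire_analytic q v \<and> (\<forall>x \<in> cell q w. v x = u x)"
proof -
  \<comment> \<open>Both gaps are strict: \<rho> lies between \<open>R\<close> and the eigenvalue,
    so that it bounds all terms and not only almost all, and \<open>r\<close> leaves room above
    \<rho> for the decay required by \<open>tower_level\<close>.\<close>
  define \<rho> where "\<rho> = (R + 3/2 * (25 * rad3)) / 2"
  define r where "r = (2/3 * \<rho> + 25 * rad3) / 2"
  have \<rho>: "R < \<rho>" "0 \<le> \<rho>" and r: "0 < r" "r < 25 * rad3" "r / 25 < rad3" "2/3 * \<rho> < r"
    using R(1) R(2)[unfolded lambda2_eq] rad3(1) \<rho>_def r_def by simp_all
  let ?m = "length w"
  define U where "U j y = laplacian_pow q w j u (Fw q w y) / 5 ^ (j * ?m)" for j y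
  have tow: "tower (\<rho> / 5 ^ ?m) U" unfolding U_def by (rule cell_tower[OF dom R(1) \<rho>(1) O])
  have le: "r / 5 ^ ?m \<le> r / 1" using r by (intro divide_left_mono) auto
  have c: "0 \<le> \<rho> / 5 ^ ?m" "2/3 * (\<rho> / 5 ^ ?m) < r / 5 ^ ?m" "r / 5 ^ ?m / 25 < rad3"
    using \<rho> divide_strict_right_mono[OF r(4), of "5 ^ ?m"] le r by simp_all
  note G' = seq_of_tower[OF tow c]
  obtain M where M: "\<forall>x\<in>SG q. norm (seq_of (r / 5 ^ ?m) U x) \<le> M" using G'(4) ..
  have "\<exists>G. (\<forall>j. continuous_on (SG q) (\<lambda>x. apply_bcontfun (G x) j)) \<and> (\<forall>n\<ge>1. level r n G) \<and>
    (\<exists>B. \<forall>x\<in>SG q. norm (G x) \<le> B) \<and> (\<forall>p\<in>vertices. G (Fw q w p) = seq_of (r / 5 ^ ?m) U p)"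
    by (rule extend_from_cell[OF r(1,3) _ _ M]) (use G'(2,3) in auto)
  then obtain G where G: "(\<forall>j. continuous_on (SG q) (\<lambda>x. apply_bcontfun (G x) j)) \<and> (\<forall>n\<ge>1. level r n G) \<and>
    (\<exists>B. \<forall>x\<in>SG q. norm (G x) \<le> B) \<and> (\<forall>p\<in>vertices. G (Fw q w p) = seq_of (r / 5 ^ ?m) U p)" ..
  then obtain B where B: "\<forall>x\<in>SG q. norm (G x) \<le> B" by (elim conjE exE) (rule that)
  have cont: "continuous_on (SG q) (\<lambda>x. apply_bcontfun (G x) j)" for j using G by (elim conjE allE)
  have lev: "level r n G" if "1 \<le> n" for n using G that by simp
  have "tower (3/2 * r) (fun_of r G)" by (rule level_tower[OF r(1) cont lev]) (use B in auto)
  then have "entire_analytic q (restrict (fun_of r G 0) (SG q))"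
    by (rule tower_entire) (use r in linarith)+
  moreover have "restrict (fun_of r G 0) (SG q) x = u x" if xw: "x \<in> cell q w" for x
  proof -
    obtain y where y: "y \<in> SG q" "x = Fw q w y" using xw by (auto simp: cell_def)
    have "apply_bcontfun (G (Fw q w y)) 0 - apply_bcontfun (seq_of (r / 5 ^ ?m) U y) 0 = 0"
      by (rule zero_by_density[OF continuous_on_diff[OF continuous_on_comp_Fw[OF cont] G'(3)] _ y(1)]) (use G in simp)
    then show ?thesis using G'(1)[OF y(1), of 0] Fw_in_SG[OF y(1), of w] by (simp add: fun_of_def y(2) U_def)
  qed
  ultimately show ?thesis by blast
qed

end

theorem corollary4p5:
  fixes q :: "3 \<Rightarrow> plane" and w :: "3 list" and u :: "plane \<Rightarrow> real" and R :: real
  assumes "equilateral q"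
    and "\<And>j. u \<in> laplacian_dom q w j"
    and "0 \<le> R" and "R < lambda2 q"
    and "(\<lambda>j. SUP x \<in> cell q w. \<bar>laplacian_pow q w j u x\<bar>) \<in> O(\<lambda>j. R ^ j)"
  shows "\<exists>!v. entire_analytic q v \<and> (\<forall>x \<in> cell q w. v x = u x)"
proof -
  interpret gasket q by unfold_locales (fact assms(1))
  obtain v where v: "entire_analytic q v \<and> (\<forall>x \<in> cell q w. v x = u x)"
    using entire_extension_exists[OF assms(2-5)] ..
  show ?thesis
  proof (rule ex1I[of _ v])
    show "entire_analytic q v \<and> (\<forall>x \<in> cell q w. v x = u x)" by (rule v)
    fix v' assume "entire_analytic q v' \<and> (\<forall>x \<in> cell q w. v' x = u x)"
    then show "v' = v" using entire_unique[of v' v w] v by simp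
  qed
qed

end
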